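(* The following four assertions hold. (i) For every finite complex Borel measure $\mu$ on $\mathbb{T}^\infty$ one has $$\int_{\mathbb{T}^\infty}|\mu_\xi(e^{i\theta})|\,d\theta\le \|\mu\|_{TV}\quad\text{for all }\xi\in\mathbb{D},$$ and $\mu_r \to \mu$ in the weak-$*$ sense as $r\nearrow 1$ (that is, $\int_{\mathbb{T}^\infty} g\,\mu_r\,d\theta\to\int_{\mathbb{T}^\infty} g\,d\mu$ for every continuous $g:\mathbb{T}^\infty\to\mathbb{C}$). (ii) There is a constant $C<\infty$ such that for every finite complex Borel measure $\mu$ on $\mathbb{T}^\infty$ with Fourier spectrum supported on $\mathbb{N}^\infty_0\cup(-\mathbb{N}^\infty_0)$ and every $\lambda>0$, $$\big|\{e^{i\theta}\in\mathbb{T}^\infty: M\mu(e^{i\theta})>\lambda\}\big|\le \frac{C\|\mu\|_{TV}}{\lambda}.$$ Moreover, for every such $\mu$ the finite radial limit $\mu^*(e^{i\theta}):=\lim_{r\to1^-}\mu_r(e^{i\theta})$ exists for almost every $e^{i\theta}\in\mathbb{T}^\infty$. (iii) For every $f\in L^1(\mathbb{T}^\infty)$ with Fourier spectrum supported on $\mathbb{N}^\infty_0\cup(-\mathbb{N}^\infty_0)$ one has $f(e^{i\theta})=\lim_{r\to1^-}f_r(e^{i\theta})$ for almost every $e^{i\theta}\in\mathbb{T}^\infty$. Moreover, $\|f_r-f\|_{L^1(\mathbb{T}^\infty)}\to0$ as $r\nearrow1$. (iv) There is a constant $C<\infty$ such that for every $f\in H^1(\mathbb{T}^\infty)$, $$\|Mf\|_{L^1(\mathbb{T}^\infty)}\le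 C\|f\|_{H^1(\mathbb{T}^\infty)}.$$ Similarly, there is a constant $C<\infty$ such that for every analytic measure $\mu$ on $\mathbb{T}^\infty$, $$\|M\mu\|_{L^1(\mathbb{T}^\infty)}\le C\|\mu\|_{TV}.$$
   Context: $\mathbb{D}$ is the open unit disc, $\mathbb{T}$ the unit circle, and $\mathbb{T}^\infty=\{(z_1,z_2,\ldots):z_n\in\mathbb{T}\}$ is the compact abelian group (product topology) with normalized Haar measure $d\theta=d\theta_1\times d\theta_2\times\cdots$, each $d\theta_n$ being normalized Haar measure on $\mathbb{T}$. Points are written $e^{i\theta}=(e^{i\theta_1},e^{i\theta_2},\ldots)$; "almost every" and $|E|$ refer to $d\theta$. $\mathbb{Z}^\infty_0$ is the set of integer sequences $\nu=(\nu_1,\nu_2,\ldots)$ with only finitely many non-zero entries, and $\mathbb{N}^\infty_0$ is the subset of those with all entries $\ge0$. Write $\nu\cdot\theta=\sum_j\nu_j\theta_j$. For a finite complex Borel measure $\mu$, $\widehat\mu(\nu)=\int_{\mathbb{T}^\infty}e^{-i\nu\cdot\theta}\,d\mu$, and $\|\mu\|_{TV}$ is its total variation norm. A function $f\in L^1(\mathbb{T}^\infty)$ is identified with the measure $f\,d\theta$, and $\widehat f(\nu)$ is defined accordingly. "Fourier spectrum supported on $S$" means $\widehat\mu(\nu)=0$ for $\nu\notin S$. $H^1(\mathbb{T}^\infty)$ is the space of $f\in L^1(\mathbb{T}^\infty)$ with Fourier spectrum supported on $\mathbb{N}^\infty_0$, with $\|f\|_{H^1}=\|f\|_{L^1}$.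 A finite complex Borel measure $\mu$ is called analytic if $\widehat\mu(\nu)=0$ for all $\nu\notin\mathbb{N}^\infty_0$. For $\xi=re^{it}\in\mathbb{D}$ ($0\le r<1$) and a finite complex Borel measure $\mu$ define $$\mu_\xi(e^{i\theta})=\sum_{\nu\in\mathbb{Z}^\infty_0}\widehat\mu(\nu)\,r^{\sum_j j|\nu_j|}\,e^{it\sum_j j\nu_j}\,e^{i\nu\cdot\theta},$$ an absolutely convergent series defining a continuous function on $\mathbb{T}^\infty$; $f_\xi$ denotes the same object for the measure $f\,d\theta$. (This corresponds to the approach $(\xi e^{i\theta_1},\xi^2e^{i\theta_2},\xi^3e^{i\theta_3},\ldots)$.) The radial maximal function is $M\mu(e^{i\theta})=\sup_{r\in(0,1)}|\mu_r(e^{i\theta})|$, and similarly $Mf$. *)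

theory Defs
  imports "HOL-Probability.Probability"
begin

section \<open>Complex measures\<close>

text \<open>
  A complex measure on the \<open>\<sigma>\<close>-algebra of \<^term>\<open>M\<close> is a set function; only its values on
  \<^term>\<open>sets M\<close> are ever used, and the measure carried by \<^term>\<open>M\<close> plays no role.
  Such a set function is automatically of finite total variation.
\<close>

definition complex_measure :: "'a measure \<Rightarrow> ('a set \<Rightarrow> complex) \<Rightarrow> bool" where
  "complex_measure M \<mu> \<longleftrightarrow>
     \<mu> {} = 0 \<and>
     (\<forall>A :: nat \<Rightarrow> 'a set. range A \<subseteq> sets M \<longrightarrow> disjoint_family A \<longrightarrow>
        (\<lambda>i. \<mu> (A i)) sums \<mu> (\<Union>i. A i))"

definition total_variation :: "'a measure \<Rightarrow> ('a set \<Rightarrow> complex) \<Rightarrow> ennreal" where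
  "total_variation M \<mu> =
     (SUP A \<in> {A :: nat \<Rightarrow> 'a set. range A \<subseteq> sets M \<and> disjoint_family A \<and> (\<Union>i. A i) = space M}.
        \<Sum>i. ennreal (cmod (\<mu> (A i))))"

text \<open>
  The positive part of the Jordan decomposition of a finite signed measure \<open>\<phi>\<close> is
  \<open>\<phi>\<^sup>+(A) = sup {\<phi>(B) : B \<subseteq> A}\<close>; negative values are cut off by \<^const>\<open>ennreal\<close>, which is
  harmless because of \<open>B = {}\<close>. The negative part is the positive part of \<open>-\<phi>\<close>.
\<close>

definition pos_variation :: "'a measure \<Rightarrow> ('a set \<Rightarrow> real) \<Rightarrow> 'a measure" where
  "pos_variation M \<phi> =
     measure_of (space M) (sets M) (\<lambda>A. SUP B \<in> {B \<in> sets M. B \<subseteq> A}. ennreal (\<phi> B))"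

definition signed_integral :: "'a measure \<Rightarrow> ('a set \<Rightarrow> real) \<Rightarrow> ('a \<Rightarrow> complex) \<Rightarrow> complex" where
  "signed_integral M \<phi> g =
     (LINT x|pos_variation M \<phi>. g x) - (LINT x|pos_variation M (\<lambda>A. - \<phi> A). g x)"

definition complex_integral :: "'a measure \<Rightarrow> ('a set \<Rightarrow> complex) \<Rightarrow> ('a \<Rightarrow> complex) \<Rightarrow> complex" where
  "complex_integral M \<mu> g =
     signed_integral M (\<lambda>A. Re (\<mu> A)) g + \<i> * signed_integral M (\<lambda>A. Im (\<mu> A)) g"


section \<open>The infinite torus and its Haar measure\<close>

text \<open>
  Points are functions \<^typ>\<open>nat \<Rightarrow> complex\<close>; this type carries the product topology.
  Coordinates are numbered from 0, so \<open>z n\<close> is the coordinate usually called \<open>z\<^sub>n\<^sub>+\<^sub>1\<close>; this is why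
  the weights below are \<^term>\<open>Suc j\<close>.
\<close>

definition torus :: "(nat \<Rightarrow> complex) set" where
  "torus = {z. \<forall>n. z n \<in> sphere 0 1}"

definition haar_circle :: "complex measure" where
  "haar_circle =
     distr (uniform_measure lborel {0..<2 * pi}) (restrict_space borel (sphere 0 1)) cis"

definition haar :: "(nat \<Rightarrow> complex) measure" where
  "haar = (\<Pi>\<^sub>M n\<in>UNIV. haar_circle)"

lemma space_haar: "space haar = torus"
  by (auto simp: haar_def haar_circle_def space_PiM torus_def space_restrict_space PiE_def Pi_def)

lemma prob_space_haar_circle: "prob_space haar_circle"
proof -
  have "prob_space (uniform_measure lborel {0..<2 * pi})"
    by (rule prob_space_uniform_measure) auto
  moreover have "cis \<in> measurable borel (restrict_space borel (sphere 0 1))"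
    by (intro measurable_restrict_space2 borel_measurable_continuous_onI continuous_intros) auto
  ultimately show ?thesis
    unfolding haar_circle_def by (intro prob_space.prob_space_distr) auto
qed

lemma prob_space_haar: "prob_space haar"
  unfolding haar_def by (intro prob_space_PiM prob_space_haar_circle)

text \<open>The measurable sets of \<^const>\<open>haar\<close> are exactly the Borel sets of \<^const>\<open>torus\<close>.\<close>

lemma sets_haar: "sets haar = sets (restrict_space borel torus)"
proof (intro equalityI subsetI)
  have "(\<lambda>z. z) \<in> measurable (restrict_space borel torus) haar"
    unfolding haar_def haar_circle_def
  proof (rule measurable_PiM_single')
    fix n :: nat
    have "(\<lambda>z::nat \<Rightarrow> complex. z n) \<in> borel_measurable borel"
      by (intro borel_measurable_continuous_onI continuous_on_product_coordinates)
    then have "(\<lambda>z. z n) \<in> measurable (restrict_space borel torus) (restrict_space borel (sphere 0 1))"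
      by (intro measurable_restrict_space2 measurable_restrict_space1)
         (auto simp: space_restrict_space torus_def)
    then show "(\<lambda>z. z n) \<in> measurable (restrict_space borel torus)
        (distr (uniform_measure lborel {0..<2 * pi}) (restrict_space borel (sphere 0 1)) cis)"
      by simp
  qed (auto simp: space_restrict_space torus_def PiE_def Pi_def)
  fix A assume A: "A \<in> sets haar"
  with \<open>(\<lambda>z. z) \<in> _\<close> have "(\<lambda>z. z) -` A \<inter> space (restrict_space borel torus)
      \<in> sets (restrict_space borel torus)"
    by (rule measurable_sets)
  moreover have "A \<subseteq> torus"
    using sets.sets_into_space[OF A] by (simp add: space_haar)
  ultimately show "A \<in> sets (restrict_space borel torus)"
    by (simp add: space_restrict_space Int_absorb2)
next
  have "(\<lambda>z. z) \<in> measurable haar (\<Pi>\<^sub>M n\<in>UNIV. (borel :: complex measure))"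
  proof (rule measurable_PiM_single')
    fix n :: nat
    have "(\<lambda>z. z n) \<in> measurable haar haar_circle"
      unfolding haar_def by (rule measurable_component_singleton) simp
    moreover have "(\<lambda>x. x) \<in> borel_measurable haar_circle"
      unfolding haar_circle_def by (simp add: measurable_restrict_space1)
    ultimately show "(\<lambda>z. z n) \<in> borel_measurable haar"
      by (rule measurable_compose)
  qed (auto simp: PiE_def)
  then have "(\<lambda>z. z) \<in> measurable haar (restrict_space borel torus)"
    by (intro measurable_restrict_space2)
       (auto simp: space_haar sets_PiM_equal_borel cong: measurable_cong_sets)
  moreover fix A assume A: "A \<in> sets (restrict_space borel torus)"
  ultimately have "(\<lambda>z. z) -` A \<inter> space haar \<in> sets haar"
    by (rule measurable_sets)
  moreover have "A \<subseteq> torus"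
    using sets.sets_into_space[OF A] by (simp add: space_restrict_space)
  ultimately show "A \<in> sets haar"
    by (simp add: space_haar Int_absorb2)
qed


section \<open>Fourier coefficients\<close>

definition Z0 :: "(nat \<Rightarrow> int) set" where
  "Z0 = {\<nu>. finite {j. \<nu> j \<noteq> 0}}"

definition N0 :: "(nat \<Rightarrow> int) set" where
  "N0 = {\<nu> \<in> Z0. \<forall>j. 0 \<le> \<nu> j}"

text \<open>The character \<open>e\<^sup>i\<^sup>\<theta> \<mapsto> e\<^sup>i\<^sup>\<nu>\<^sup>\<cdot>\<^sup>\<theta>\<close>, for \<^term>\<open>\<nu> \<in> Z0\<close>.\<close>

definition torus_char :: "(nat \<Rightarrow> int) \<Rightarrow> (nat \<Rightarrow> complex) \<Rightarrow> complex" where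
  "torus_char \<nu> z = (\<Prod>j | \<nu> j \<noteq> 0. z j powi \<nu> j)"

definition fourier :: "((nat \<Rightarrow> complex) set \<Rightarrow> complex) \<Rightarrow> (nat \<Rightarrow> int) \<Rightarrow> complex" where
  "fourier \<mu> \<nu> = complex_integral haar \<mu> (torus_char (- \<nu>))"

definition spectrum_on ::
    "((nat \<Rightarrow> complex) set \<Rightarrow> complex) \<Rightarrow> (nat \<Rightarrow> int) set \<Rightarrow> bool" where
  "spectrum_on \<mu> S \<longleftrightarrow> (\<forall>\<nu>\<in>Z0. \<nu> \<notin> S \<longrightarrow> fourier \<mu> \<nu> = 0)"

definition analytic_measure :: "((nat \<Rightarrow> complex) set \<Rightarrow> complex) \<Rightarrow> bool" where
  "analytic_measure \<mu> \<longleftrightarrow> complex_measure haar \<mu> \<and> spectrum_on \<mu> N0"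

text \<open>The complex measure \<open>f d\<theta>\<close> with which \<^term>\<open>f\<close> is identified.\<close>

definition to_measure :: "((nat \<Rightarrow> complex) \<Rightarrow> complex) \<Rightarrow> (nat \<Rightarrow> complex) set \<Rightarrow> complex" where
  "to_measure f A = (LINT z:A|haar. f z)"

definition norm_L1 :: "((nat \<Rightarrow> complex) \<Rightarrow> complex) \<Rightarrow> ennreal" where
  "norm_L1 f = (\<integral>\<^sup>+ z. ennreal (cmod (f z)) \<partial>haar)"

definition H1 :: "((nat \<Rightarrow> complex) \<Rightarrow> complex) set" where
  "H1 = {f. integrable haar f \<and> spectrum_on (to_measure f) N0}"


section \<open>The extension \<open>\<mu>\<^sub>\<xi>\<close> and the radial maximal function\<close>

text \<open>
  For \<open>\<xi> = r e\<^sup>i\<^sup>t\<close> we take \<open>t\<close> to be \<^term>\<open>Arg \<xi>\<close>. Since \<open>t\<close> is multiplied by an integer, its choice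
  is immaterial; for \<open>r = 0\<close> only \<open>\<nu> = 0\<close> contributes, as \<open>0\<^sup>0 = 1\<close>.
\<close>

definition radial_ext ::
    "((nat \<Rightarrow> complex) set \<Rightarrow> complex) \<Rightarrow> complex \<Rightarrow> (nat \<Rightarrow> complex) \<Rightarrow> complex" where
  "radial_ext \<mu> \<xi> z =
     (\<Sum>\<^sub>\<infinity>\<nu>\<in>Z0. fourier \<mu> \<nu>
        * of_real (cmod \<xi> ^ (\<Sum>j | \<nu> j \<noteq> 0. Suc j * nat \<bar>\<nu> j\<bar>))
        * cis (Arg \<xi> * of_int (\<Sum>j | \<nu> j \<noteq> 0. int (Suc j) * \<nu> j))
        * torus_char \<nu> z)"

definition radial_max ::
    "((nat \<Rightarrow> complex) set \<Rightarrow> complex) \<Rightarrow> (nat \<Rightarrow> complex) \<Rightarrow> ennreal" where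
  "radial_max \<mu> z = (SUP r\<in>{0<..<1::real}. ennreal (cmod (radial_ext \<mu> (of_real r) z)))"

end

theory Submission
  imports Defs "HOL-Complex_Analysis.Complex_Analysis"
begin

text \<open>
  The maps \<open>z \<mapsto> (w z\<^sub>1, w\<^sup>2 z\<^sub>2, w\<^sup>3 z\<^sub>3, \<dots>)\<close> with \<open>\<bar>w\<bar> = 1\<close> form a flow on the torus that preserves
  Haar measure. For a fixed point \<open>z\<close>, the number \<open>\<mu>\<^sub>r\<close> at the point moved by \<open>w\<close> is a function of
  \<open>\<xi> = r w\<close> in the disc, the slice at \<open>z\<close>. A frequency \<open>\<nu>\<close> enters it with modulus
  \<open>r\<close> to the power \<open>\<Sum> j \<bar>\<nu>\<^sub>j\<bar>\<close> and rotates with speed \<open>\<Sum> j \<nu>\<^sub>j\<close>. The two numbers agree up to sign when all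
  entries of \<open>\<nu>\<close> have the same sign, so a spectrum in \<open>N0 \<union> -N0\<close> makes every slice harmonic, and a
  spectrum in \<open>N0\<close> makes it holomorphic (\<open>slice_harmonic\<close>, \<open>slice_holomorphic\<close>). The pointwise
  assertions are then theorems about the unit disc, applied to slices restricted to a smaller disc and
  averaged over the torus (\<open>nn_integral_flow_average\<close>).

  (i) \<open>\<mu>\<^sub>\<xi>\<close> is a convolution of \<open>\<mu>\<close> with a product of Poisson kernels. The product is nonnegative with
  integral 1 (\<open>torus_poisson_nonneg\<close>), which gives the contraction (\<open>kernel_contraction\<close>,
  \<open>radial_ext_L1_le\<close>). Weak-* convergence is explicit on characters and passes to continuous functions
  by the Stone-Weierstrass theorem and the contraction.

  (ii) On the circle the Poisson integral is dominated by interval means (\<open>Poisson_integral_le\<close>), and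
  Vitali's covering lemma gives a weak type bound (\<open>maximal_weak_type\<close>). For the limits, Fatou's
  lemma and (i) show that almost every slice has bounded \<open>L\<^sup>1\<close> means along a sequence of radii. Such a
  harmonic function is a difference of positive ones (\<open>h1_difference_of_positive\<close>). A positive
  harmonic function is the real part of some \<open>G\<close>, where \<open>1 / (1 + G)\<close> is bounded and holomorphic; it has radial limits
  by the weak type bound and Parseval's identity, and these vanish almost nowhere because
  \<open>ln \<bar>1 + G\<bar>\<close> has bounded means.

  (iii) Mean convergence follows from the contraction, because trigonometric polynomials are dense in
  \<open>L\<^sup>1\<close>. Along a sequence of radii it yields pointwise convergence to \<open>f\<close>, which identifies the limit
  found in (ii).

  (iv) For a holomorphic slice \<open>F\<close>, the function \<open>\<bar>F\<bar>\<^sup>1\<^sup>/\<^sup>2\<close> lies below its own Poisson integral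
  (\<open>sqrt_norm_le_Poisson\<close>). Its maximal function is therefore controlled in \<open>L\<^sup>2\<close>
  (\<open>maximal_strong_type\<close>), which controls that of \<open>F\<close> in \<open>L\<^sup>1\<close>.
\<close>

section \<open>Signed and complex measures\<close>

text \<open>
  Stated for normed spaces, so that a complex measure and its real and imaginary parts are covered
  by the same lemmas.
\<close>

definition sigma_additive :: "'a measure \<Rightarrow> ('a set \<Rightarrow> 'b::real_normed_vector) \<Rightarrow> bool" where
  "sigma_additive M \<phi> \<longleftrightarrow> \<phi> {} = 0 \<and>
     (\<forall>A :: nat \<Rightarrow> 'a set. range A \<subseteq> sets M \<longrightarrow> disjoint_family A \<longrightarrow>
        (\<lambda>i. \<phi> (A i)) sums \<phi> (\<Union>i. A i))"

lemma complex_measure_iff: "complex_measure M \<mu> \<longleftrightarrow> sigma_additive M \<mu>"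
  by (simp add: complex_measure_def sigma_additive_def)

lemma sigma_additive_empty: "sigma_additive M \<phi> \<Longrightarrow> \<phi> {} = 0"
  by (simp add: sigma_additive_def)

lemma sigma_additive_sums:
  "sigma_additive M \<phi> \<Longrightarrow> (\<And>i::nat. A i \<in> sets M) \<Longrightarrow> disjoint_family A \<Longrightarrow>
    (\<lambda>i. \<phi> (A i)) sums \<phi> (\<Union>i. A i)"
  unfolding sigma_additive_def by blast

lemma sigma_additive_bounded_linear:
  assumes "bounded_linear f" "sigma_additive M \<phi>"
  shows "sigma_additive M (\<lambda>A. f (\<phi> A))"
  using assms unfolding sigma_additive_def
  by (auto intro: bounded_linear.sums simp: bounded_linear.linear linear_0)

lemma sigma_additive_Un:
  assumes "sigma_additive M \<phi>" "A \<in> sets M" "B \<in> sets M" "A \<inter> B = {}"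
  shows "\<phi> (A \<union> B) = \<phi> A + \<phi> B"
proof -
  have "disjoint_family (binaryset A B)"
    using assms(4) by (auto simp: disjoint_family_on_def binaryset_def)
  moreover have "range (binaryset A B) \<subseteq> sets M"
    using assms by (simp add: range_binaryset_eq)
  ultimately have "(\<lambda>i. \<phi> (binaryset A B i)) sums \<phi> (A \<union> B)"
    using sigma_additive_sums[OF assms(1), of "binaryset A B"] by (auto simp: UN_binaryset_eq)
  with binaryset_sums[of \<phi> A B] sigma_additive_empty[OF assms(1)] show ?thesis
    using sums_unique2 by blast
qed

lemma sigma_additive_Diff:
  assumes "sigma_additive M \<phi>" "A \<in> sets M" "B \<in> sets M" "B \<subseteq> A"
  shows "\<phi> (A - B) = \<phi> A - \<phi> B"
proof -
  have "B \<union> (A - B) = A" using assms(4) by auto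
  with sigma_additive_Un[OF assms(1,3), of "A - B"] assms show ?thesis by auto
qed

text \<open>
  The set function that defines \<^const>\<open>pos_variation\<close>, kept apart from the measure because it has to be
  used before countable additivity is known.
\<close>

definition upper_var :: "'a measure \<Rightarrow> ('a set \<Rightarrow> real) \<Rightarrow> 'a set \<Rightarrow> ennreal" where
  "upper_var M \<phi> A = (SUP B \<in> {B \<in> sets M. B \<subseteq> A}. ennreal (\<phi> B))"

lemma upper_var_upper: "B \<in> sets M \<Longrightarrow> B \<subseteq> A \<Longrightarrow> ennreal (\<phi> B) \<le> upper_var M \<phi> A"
  unfolding upper_var_def by (rule SUP_upper) auto

lemma upper_var_mono: "A \<subseteq> A' \<Longrightarrow> upper_var M \<phi> A \<le> upper_var M \<phi> A'"
  unfolding upper_var_def by (rule SUP_subset_mono) auto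

text \<open>
  Competitors inside disjoint sets can be joined. A competitor of negative measure is replaced by
  the empty set, so cutting off at zero does no harm.
\<close>

lemma upper_var_superadd:
  assumes \<phi>: "sigma_additive M \<phi>" and "A \<inter> A' = {}"
  shows "upper_var M \<phi> A + upper_var M \<phi> A' \<le> upper_var M \<phi> (A \<union> A')"
proof -
  have le: "ennreal (\<phi> B) + ennreal (\<phi> B') \<le> upper_var M \<phi> (A \<union> A')"
    if "B \<in> sets M" "B \<subseteq> A" "B' \<in> sets M" "B' \<subseteq> A'" for B B'
  proof -
    have "B \<inter> B' = {}" using that assms by auto
    then have "\<phi> (B \<union> B') = \<phi> B + \<phi> B'" by (intro sigma_additive_Un[OF \<phi>]) (use that in auto)
    moreover have "ennreal (\<phi> (B \<union> B')) \<le> upper_var M \<phi> (A \<union> A')"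
      "ennreal (\<phi> B) \<le> upper_var M \<phi> (A \<union> A')" "ennreal (\<phi> B') \<le> upper_var M \<phi> (A \<union> A')"
      using that by (intro upper_var_upper; auto)+
    ultimately show ?thesis unfolding ennreal_plus_if by metis
  qed
  have "upper_var M \<phi> A + ennreal (\<phi> B') \<le> upper_var M \<phi> (A \<union> A')" if "B' \<in> sets M" "B' \<subseteq> A'" for B'
  proof -
    have "(SUP B\<in>{B \<in> sets M. B \<subseteq> A}. ennreal (\<phi> B)) + ennreal (\<phi> B')
      = (SUP B\<in>{B \<in> sets M. B \<subseteq> A}. ennreal (\<phi> B) + ennreal (\<phi> B'))"
      by (rule ennreal_SUP_add_left[symmetric]) (auto intro!: exI[of _ "{}"])
    also have "\<dots> \<le> upper_var M \<phi> (A \<union> A')" using le that by (intro SUP_least) auto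
    finally show ?thesis by (simp add: upper_var_def)
  qed
  moreover have "upper_var M \<phi> A + (SUP B\<in>{B \<in> sets M. B \<subseteq> A'}. ennreal (\<phi> B))
      = (SUP B\<in>{B \<in> sets M. B \<subseteq> A'}. upper_var M \<phi> A + ennreal (\<phi> B))"
    by (rule ennreal_SUP_add_right) (auto intro!: exI[of _ "{}"])
  ultimately show ?thesis
    unfolding upper_var_def[of M \<phi> A'] by (auto intro: SUP_least)
qed

lemma ennreal_sum_le: "ennreal (\<Sum>i\<in>I. f i) \<le> (\<Sum>i\<in>I. ennreal (f i))"
proof (induction I rule: infinite_finite_induct)
  case (insert i I)
  have "ennreal (f i + (\<Sum>i\<in>I. f i)) \<le> ennreal (f i) + ennreal (\<Sum>i\<in>I. f i)"
    by (auto simp: ennreal_plus_if intro!: ennreal_leI)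
  also have "\<dots> \<le> ennreal (f i) + (\<Sum>i\<in>I. ennreal (f i))"
    by (rule add_left_mono) (rule insert.IH)
  finally show ?case using insert.hyps by simp
qed auto

text \<open>
  A competitor for the union is cut along the pieces, which gives one inequality; the other one is
  superadditivity over finitely many pieces.
\<close>

lemma upper_var_countably_additive:
  assumes \<phi>: "sigma_additive M \<phi>"
  shows "countably_additive (sets M) (upper_var M \<phi>)"
proof (rule countably_additiveI)
  fix A :: "nat \<Rightarrow> 'a set"
  assume A: "range A \<subseteq> sets M" "disjoint_family A" "(\<Union>i. A i) \<in> sets M"
  have "upper_var M \<phi> (\<Union>i. A i) \<le> (\<Sum>i. upper_var M \<phi> (A i))"
    unfolding upper_var_def[of M \<phi> "\<Union>i. A i"]
  proof (intro SUP_least)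
    fix B assume "B \<in> {B \<in> sets M. B \<subseteq> \<Union> (range A)}"
    then have B: "B \<in> sets M" "(\<Union>i. B \<inter> A i) = B" "B \<inter> \<Union> (range A) = B" by auto
    have "disjoint_family (\<lambda>i. B \<inter> A i)" using A(2) by (auto simp: disjoint_family_on_def)
    then have "(\<lambda>i. \<phi> (B \<inter> A i)) sums \<phi> (\<Union>i. B \<inter> A i)"
      using A B by (intro sigma_additive_sums[OF \<phi>]) auto
    then have "(\<lambda>n. \<Sum>i<n. \<phi> (B \<inter> A i)) \<longlonglongrightarrow> \<phi> B" by (simp add: B sums_def)
    then have "(\<lambda>n. ennreal (\<Sum>i<n. \<phi> (B \<inter> A i))) \<longlonglongrightarrow> ennreal (\<phi> B)"
      by (rule tendsto_ennrealI)
    then show "ennreal (\<phi> B) \<le> (\<Sum>i. upper_var M \<phi> (A i))"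
    proof (rule LIMSEQ_le_const2, intro exI allI impI)
      fix n
      have "ennreal (\<Sum>i<n. \<phi> (B \<inter> A i)) \<le> (\<Sum>i<n. ennreal (\<phi> (B \<inter> A i)))"
        by (rule ennreal_sum_le)
      also have "\<dots> \<le> (\<Sum>i<n. upper_var M \<phi> (A i))"
        using A B by (intro sum_mono upper_var_upper) auto
      also have "\<dots> \<le> (\<Sum>i. upper_var M \<phi> (A i))" by (rule sum_le_suminf) auto
      finally show "ennreal (\<Sum>i<n. \<phi> (B \<inter> A i)) \<le> (\<Sum>i. upper_var M \<phi> (A i))" .
    qed
  qed
  moreover have "(\<Sum>i. upper_var M \<phi> (A i)) \<le> upper_var M \<phi> (\<Union>i. A i)"
  proof (rule suminf_le_const)
    fix n
    have "(\<Sum>i<n. upper_var M \<phi> (A i)) \<le> upper_var M \<phi> (\<Union>i<n. A i)"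
    proof (induction n)
      case (Suc n)
      have "A i \<inter> A n = {}" if "i < n" for i using A(2) that by (auto simp: disjoint_family_on_def)
      then have "(\<Union>i<n. A i) \<inter> A n = {}" by auto
      from upper_var_superadd[OF \<phi> this] have
        "upper_var M \<phi> (\<Union>i<n. A i) + upper_var M \<phi> (A n) \<le> upper_var M \<phi> (\<Union>i<Suc n. A i)"
        by (simp add: lessThan_Suc Un_commute)
      moreover have "(\<Sum>i<Suc n. upper_var M \<phi> (A i)) \<le> upper_var M \<phi> (\<Union>i<n. A i) + upper_var M \<phi> (A n)"
        using add_right_mono[OF Suc] by simp
      ultimately show ?case by (rule order_trans[rotated])
    qed simp
    also have "\<dots> \<le> upper_var M \<phi> (\<Union>i. A i)" by (rule upper_var_mono) auto
    finally show "(\<Sum>i<n. upper_var M \<phi> (A i)) \<le> upper_var M \<phi> (\<Union>i. A i)" .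
  qed auto
  ultimately show "(\<Sum>i. upper_var M \<phi> (A i)) = upper_var M \<phi> (\<Union>i. A i)" by (rule antisym[rotated])
qed

lemma sets_pos_variation [simp]: "sets (pos_variation M \<phi>) = sets M"
  and space_pos_variation [simp]: "space (pos_variation M \<phi>) = space M"
  by (simp_all add: pos_variation_def)

lemma emeasure_pos_variation:
  assumes \<phi>: "sigma_additive M \<phi>" and A: "A \<in> sets M"
  shows "emeasure (pos_variation M \<phi>) A = upper_var M \<phi> A"
proof -
  have "upper_var M \<phi> {} = 0"
    using sigma_additive_empty[OF \<phi>] by (simp add: upper_var_def)
  moreover have "upper_var M \<phi> = (\<lambda>A. SUP B \<in> {B \<in> sets M. B \<subseteq> A}. ennreal (\<phi> B))"
    by (simp add: fun_eq_iff upper_var_def)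
  ultimately show ?thesis
    using upper_var_countably_additive[OF \<phi>] A
    by (subst emeasure_measure_of[OF pos_variation_def])
       (auto simp: positive_def sets.space_closed)
qed

text \<open>
  If \<open>E\<close> has infinite upper variation, it contains some \<open>B\<close> with \<open>\<phi> B > \<bar>\<phi> E\<bar> + 1\<close>. Then \<open>\<phi>\<close> is at
  least 1 in modulus on both \<open>B\<close> and \<open>E - B\<close>, and one of the two again has infinite upper
  variation. Iterating splits off disjoint sets on which \<open>\<phi>\<close> stays away from 0, although the
  series of these values converges.
\<close>

lemma upper_var_finite:
  assumes \<phi>: "sigma_additive M \<phi>"
  shows "upper_var M \<phi> (space M) \<noteq> \<infinity>"
proof
  assume inf: "upper_var M \<phi> (space M) = \<infinity>"
  have split: "\<exists>E'. E' \<in> sets M \<and> upper_var M \<phi> E' = \<infinity> \<and> E' \<subseteq> E \<and> \<bar>\<phi> (E - E')\<bar> \<ge> 1"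
    if E: "E \<in> sets M" "upper_var M \<phi> E = \<infinity>" for E
  proof -
    have "ennreal (\<bar>\<phi> E\<bar> + 1) < upper_var M \<phi> E" using E by (simp add: top.not_eq_extremum)
    then obtain B where B: "B \<in> sets M" "B \<subseteq> E" "ennreal (\<bar>\<phi> E\<bar> + 1) < ennreal (\<phi> B)"
      unfolding upper_var_def less_SUP_iff by auto
    then have big: "\<phi> B > \<bar>\<phi> E\<bar> + 1" by (metis ennreal_leI not_less)
    have diff: "\<phi> (E - B) = \<phi> E - \<phi> B" using sigma_additive_Diff[OF \<phi>] E B by auto
    have "emeasure (pos_variation M \<phi>) B + emeasure (pos_variation M \<phi>) (E - B) = \<infinity>"
      using plus_emeasure[of B "pos_variation M \<phi>" "E - B"] B E
      by (simp add: emeasure_pos_variation[OF \<phi>] Un_absorb1)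
    then have "upper_var M \<phi> B = \<infinity> \<or> upper_var M \<phi> (E - B) = \<infinity>"
      using B E by (simp add: emeasure_pos_variation[OF \<phi>])
    then show ?thesis
    proof
      assume "upper_var M \<phi> B = \<infinity>"
      then show ?thesis using B big diff by (intro exI[of _ B]) auto
    next
      assume *: "upper_var M \<phi> (E - B) = \<infinity>"
      have "E - (E - B) = B" using B by auto
      then show ?thesis using B E big * by (intro exI[of _ "E - B"]) auto
    qed
  qed
  have "\<exists>E. \<forall>n. (E n \<in> sets M \<and> upper_var M \<phi> (E n) = \<infinity>) \<and>
      (E (Suc n) \<subseteq> E n \<and> \<bar>\<phi> (E n - E (Suc n))\<bar> \<ge> 1)"
    by (rule dependent_nat_choice) (use inf split in blast)+
  then obtain E where E: "\<And>n. E n \<in> sets M" "\<And>n. E (Suc n) \<subseteq> E n"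
      "\<And>n. \<bar>\<phi> (E n - E (Suc n))\<bar> \<ge> 1" by blast
  have dec: "decseq E" using E(2) by (rule decseq_SucI)
  have "disjoint_family (\<lambda>n. E n - E (Suc n))"
  unfolding disjoint_family_on_def
  proof (intro ballI impI)
    have *: "(E m - E (Suc m)) \<inter> (E n - E (Suc n)) = {}" if "m < n" for m n
      using decseqD[OF dec, of "Suc m" n] that by auto
    fix m n :: nat assume "m \<noteq> n"
    then show "(E m - E (Suc m)) \<inter> (E n - E (Suc n)) = {}"
      using *[of m n] *[of n m] by (metis Int_commute linorder_neqE_nat)
  qed
  then have "(\<lambda>n. \<phi> (E n - E (Suc n))) sums \<phi> (\<Union>n. E n - E (Suc n))"
    using E by (intro sigma_additive_sums[OF \<phi>]) auto
  then have "(\<lambda>n. \<phi> (E n - E (Suc n))) \<longlonglongrightarrow> 0" by (rule summable_LIMSEQ_zero[OF sums_summable])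
  then have "\<forall>\<^sub>F n in sequentially. \<bar>\<phi> (E n - E (Suc n))\<bar> < 1"
    by (auto dest!: tendstoD[where e = 1])
  then show False using E(3) by (auto simp: eventually_sequentially not_less[symmetric])
qed

lemma finite_measure_pos_variation:
  assumes "sigma_additive M \<phi>"
  shows "finite_measure (pos_variation M \<phi>)"
  by (rule finite_measureI)
     (use upper_var_finite[OF assms] in \<open>simp add: emeasure_pos_variation[OF assms]\<close>)

text \<open>
  Taking complements within \<open>A\<close> turns the supremum of \<open>\<phi>\<close> over subsets into the supremum of \<open>- \<phi>\<close>,
  up to the constant \<open>\<phi> A\<close>.
\<close>

lemma Jordan_decomposition:
  assumes \<phi>: "sigma_additive M \<phi>" and A: "A \<in> sets M"
  shows "\<phi> A = measure (pos_variation M \<phi>) A - measure (pos_variation M (\<lambda>A. - \<phi> A)) A"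
proof -
  have \<phi>': "sigma_additive M (\<lambda>A. - \<phi> A)"
    by (rule sigma_additive_bounded_linear[OF _ \<phi>]) (rule bounded_linear_minus[OF bounded_linear_ident])
  have dec: "measure (pos_variation M \<phi>) A \<le> \<phi> A + measure (pos_variation M (\<lambda>A. - \<phi> A)) A"
    if \<phi>: "sigma_additive M \<phi>" and \<phi>': "sigma_additive M (\<lambda>A. - \<phi> A)" for \<phi>
  proof -
    interpret P: finite_measure "pos_variation M \<phi>" by (rule finite_measure_pos_variation[OF \<phi>])
    let ?N = "pos_variation M (\<lambda>A. - \<phi> A)"
    interpret N: finite_measure ?N
      by (rule finite_measure_pos_variation[OF \<phi>'])
    have *: "\<phi> B \<le> \<phi> A + measure ?N A" if B: "B \<in> sets M" "B \<subseteq> A" for B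
    proof -
      have "ennreal (- \<phi> (A - B)) \<le> ennreal (measure ?N A)"
        using upper_var_upper[of "A - B" M A "\<lambda>A. - \<phi> A"] A B
        by (simp add: N.emeasure_eq_measure[symmetric] emeasure_pos_variation[OF \<phi>'])
      then show ?thesis
        using sigma_additive_Diff[OF \<phi> A B(1,2)] by (simp add: ennreal_le_iff)
    qed
    have "upper_var M \<phi> A \<le> ennreal (\<phi> A + measure ?N A)"
      unfolding upper_var_def by (intro SUP_least ennreal_leI) (use * in auto)
    moreover have "0 \<le> \<phi> A + measure ?N A" using *[of "{}"] sigma_additive_empty[OF \<phi>] by simp
    ultimately show ?thesis
      using A by (simp add: emeasure_pos_variation[OF \<phi>, symmetric] P.emeasure_eq_measure)
  qed
  show ?thesis using dec[OF \<phi> \<phi>'] dec[OF \<phi>'] \<phi> by simp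
qed


lemma complex_measure_Re: "complex_measure M \<mu> \<Longrightarrow> sigma_additive M (\<lambda>A. Re (\<mu> A))"
  and complex_measure_Im: "complex_measure M \<mu> \<Longrightarrow> sigma_additive M (\<lambda>A. Im (\<mu> A))"
  and complex_measure_uminus_Re: "complex_measure M \<mu> \<Longrightarrow> sigma_additive M (\<lambda>A. - Re (\<mu> A))"
  and complex_measure_uminus_Im: "complex_measure M \<mu> \<Longrightarrow> sigma_additive M (\<lambda>A. - Im (\<mu> A))"
  unfolding complex_measure_iff
  by (rule sigma_additive_bounded_linear[where f = Re] sigma_additive_bounded_linear[where f = Im]
        sigma_additive_bounded_linear[where f = "\<lambda>x. - Re x"]
        sigma_additive_bounded_linear[where f = "\<lambda>x. - Im x"],
      auto intro: bounded_linear_Re bounded_linear_Im bounded_linear_minus)+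

lemmas finite_measure_parts =
  finite_measure_pos_variation[OF complex_measure_Re]
  finite_measure_pos_variation[OF complex_measure_Im]
  finite_measure_pos_variation[OF complex_measure_uminus_Re]
  finite_measure_pos_variation[OF complex_measure_uminus_Im]

section \<open>Integration against a complex measure\<close>

definition bounded_measurable :: "'a measure \<Rightarrow> ('a \<Rightarrow> complex) \<Rightarrow> bool" where
  "bounded_measurable M g \<longleftrightarrow> g \<in> borel_measurable M \<and> (\<exists>B. \<forall>x\<in>space M. cmod (g x) \<le> B)"

lemma bounded_measurableI:
  "g \<in> borel_measurable M \<Longrightarrow> (\<And>x. x \<in> space M \<Longrightarrow> cmod (g x) \<le> B) \<Longrightarrow> bounded_measurable M g"
  by (auto simp: bounded_measurable_def)

lemma bounded_measurable_add:
  assumes "bounded_measurable M g" "bounded_measurable M h"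
  shows "bounded_measurable M (\<lambda>x. g x + h x)"
proof -
  from assms obtain B C where "\<And>x. x \<in> space M \<Longrightarrow> cmod (g x) \<le> B" "\<And>x. x \<in> space M \<Longrightarrow> cmod (h x) \<le> C"
    by (auto simp: bounded_measurable_def)
  then show ?thesis using assms
    by (intro bounded_measurableI[where B = "B + C"])
       (auto simp: bounded_measurable_def intro: norm_triangle_mono)
qed

lemma bounded_measurable_cmult:
  assumes "bounded_measurable M g"
  shows "bounded_measurable M (\<lambda>x. c * g x)"
proof -
  from assms obtain B where "\<And>x. x \<in> space M \<Longrightarrow> cmod (g x) \<le> B"
    by (auto simp: bounded_measurable_def)
  then show ?thesis using assms
    by (intro bounded_measurableI[where B = "cmod c * B"])
       (auto simp: bounded_measurable_def norm_mult intro: mult_left_mono)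
qed

lemma bounded_measurable_indicator: "A \<in> sets M \<Longrightarrow> bounded_measurable M (indicator A)"
  by (rule bounded_measurableI[where B = 1]) (auto simp: indicator_def)

lemma bounded_measurable_sum:
  "(\<And>i. i \<in> I \<Longrightarrow> bounded_measurable M (g i)) \<Longrightarrow> bounded_measurable M (\<lambda>x. \<Sum>i\<in>I. g i x)"
  by (induction I rule: infinite_finite_induct)
     (auto intro: bounded_measurable_add bounded_measurableI[where B = 0])

lemma integrable_bounded_measurable:
  assumes "finite_measure N" "sets N = sets M" "bounded_measurable M g"
  shows "integrable N g"
proof -
  have [measurable_cong]: "sets N = sets M" by fact
  have "space N = space M" using assms(2) by (rule sets_eq_imp_space_eq)
  with assms show ?thesis
    by (auto simp: bounded_measurable_def intro!: finite_measure.integrable_const_bound AE_I2)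
qed

lemma complex_integral_add:
  assumes "complex_measure M \<mu>" "bounded_measurable M g" "bounded_measurable M h"
  shows "complex_integral M \<mu> (\<lambda>x. g x + h x) = complex_integral M \<mu> g + complex_integral M \<mu> h"
  using finite_measure_parts[OF assms(1)] assms(2,3)
  by (simp add: complex_integral_def signed_integral_def integrable_bounded_measurable[of _ M] algebra_simps)

lemma complex_integral_cmult:
  "complex_integral M \<mu> (\<lambda>x. c * g x) = c * complex_integral M \<mu> g"
  by (simp add: complex_integral_def signed_integral_def algebra_simps)

lemma complex_integral_diff:
  assumes "complex_measure M \<mu>" "bounded_measurable M g" "bounded_measurable M h"
  shows "complex_integral M \<mu> (\<lambda>x. g x - h x) = complex_integral M \<mu> g - complex_integral M \<mu> h"
  using complex_integral_add[OF assms(1,2) bounded_measurable_cmult[OF assms(3)], of "-1"]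
    complex_integral_cmult[of M \<mu> "-1" h] by simp

lemma complex_integral_cong:
  "(\<And>x. x \<in> space M \<Longrightarrow> g x = h x) \<Longrightarrow> complex_integral M \<mu> g = complex_integral M \<mu> h"
  unfolding complex_integral_def signed_integral_def
  by (intro arg_cong2[where f = "(+)"] arg_cong2[where f = "(*)"] arg_cong2[where f = "(-)"]
      Bochner_Integration.integral_cong) auto

lemma complex_integral_sum:
  assumes "complex_measure M \<mu>" "\<And>i. i \<in> I \<Longrightarrow> bounded_measurable M (g i)"
  shows "complex_integral M \<mu> (\<lambda>x. \<Sum>i\<in>I. g i x) = (\<Sum>i\<in>I. complex_integral M \<mu> (g i))"
  using assms(2)
proof (induction I rule: infinite_finite_induct)
  case (insert i I)
  then show ?case
    by (simp add: complex_integral_add[OF assms(1)] bounded_measurable_sum)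
qed (simp_all add: complex_integral_def signed_integral_def)

text \<open>
  A crude bound for the integral of functions of modulus at most 1, larger than the total
  variation in general. It only enters error terms that tend to zero.
\<close>

definition variation_bound :: "'a measure \<Rightarrow> ('a set \<Rightarrow> complex) \<Rightarrow> real" where
  "variation_bound M \<mu> =
     measure (pos_variation M (\<lambda>A. Re (\<mu> A))) (space M)
   + measure (pos_variation M (\<lambda>A. Im (\<mu> A))) (space M)
   + measure (pos_variation M (\<lambda>A. - Re (\<mu> A))) (space M)
   + measure (pos_variation M (\<lambda>A. - Im (\<mu> A))) (space M)"

lemma variation_bound_nonneg: "0 \<le> variation_bound M \<mu>"
  by (simp add: variation_bound_def)

lemma norm_integral_le_measure:
  assumes "finite_measure N" "g \<in> borel_measurable N" "\<And>x. x \<in> space N \<Longrightarrow> cmod (g x) \<le> B"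
  shows "cmod (LINT x|N. g x) \<le> measure N (space N) * B"
proof -
  interpret finite_measure N by fact
  have "cmod (LINT x|N. g x) \<le> (LINT x|N. cmod (g x))" by (rule integral_norm_bound)
  also have "\<dots> \<le> (LINT x|N. B)"
    by (rule integral_mono) (use assms in \<open>auto intro!: integrable_const_bound[where B = B]\<close>)
  finally show ?thesis by simp
qed

lemma complex_integral_bound:
  assumes \<mu>: "complex_measure M \<mu>" and g: "g \<in> borel_measurable M" "\<And>x. x \<in> space M \<Longrightarrow> cmod (g x) \<le> B"
  shows "cmod (complex_integral M \<mu> g) \<le> variation_bound M \<mu> * B"
proof -
  let ?a = "LINT x|pos_variation M (\<lambda>A. Re (\<mu> A)). g x"
  let ?b = "LINT x|pos_variation M (\<lambda>A. - Re (\<mu> A)). g x"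
  let ?c = "LINT x|pos_variation M (\<lambda>A. Im (\<mu> A)). g x"
  let ?d = "LINT x|pos_variation M (\<lambda>A. - Im (\<mu> A)). g x"
  have *: "cmod (LINT x|pos_variation M \<phi>. g x) \<le> measure (pos_variation M \<phi>) (space M) * B"
    if "finite_measure (pos_variation M \<phi>)" for \<phi>
    using norm_integral_le_measure[OF that, of g B] g
    by (simp cong: measurable_cong_sets)
  have "cmod (complex_integral M \<mu> g) \<le> cmod ?a + cmod ?b + (cmod ?c + cmod ?d)"
    unfolding complex_integral_def signed_integral_def
    by (rule norm_triangle_mono, rule norm_triangle_ineq4) (simp add: norm_mult norm_triangle_ineq4)
  also have "\<dots> \<le> variation_bound M \<mu> * B"
    using finite_measure_parts[OF \<mu>, THEN *] by (simp add: variation_bound_def algebra_simps)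
  finally show ?thesis .
qed

lemma complex_integral_indicator:
  assumes \<mu>: "complex_measure M \<mu>" and A: "A \<in> sets M"
  shows "complex_integral M \<mu> (indicator A) = \<mu> A"
proof -
  have *: "(LINT x|pos_variation M \<phi>. indicator A x :: complex) = of_real (measure (pos_variation M \<phi>) A)"
    if "finite_measure (pos_variation M \<phi>)" for \<phi>
  proof -
    interpret finite_measure "pos_variation M \<phi>" by fact
    have "(LINT x|pos_variation M \<phi>. indicator A x :: complex) =
        (LINT x|pos_variation M \<phi>. of_real (indicator A x))"
      by (intro Bochner_Integration.integral_cong) (auto simp: indicator_def)
    also have "\<dots> = of_real (LINT x|pos_variation M \<phi>. indicator A x)"
      by (rule integral_complex_of_real)
    also have "(LINT x|pos_variation M \<phi>. indicator A x :: real) = measure (pos_variation M \<phi>) A"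
      using A sets.sets_into_space[OF A] by (simp add: Int_absorb2)
    finally show ?thesis .
  qed
  note dec = Jordan_decomposition[OF complex_measure_Re[OF \<mu>] A] Jordan_decomposition[OF complex_measure_Im[OF \<mu>] A]
  show ?thesis
    using finite_measure_parts[OF \<mu>, THEN *] dec
    by (simp add: complex_integral_def signed_integral_def complex_eq_iff)
qed

lemma cmod_complex_measure_le:
  assumes \<mu>: "complex_measure M \<mu>" and A: "A \<in> sets M"
  shows "cmod (\<mu> A) \<le> measure (pos_variation M (\<lambda>A. Re (\<mu> A))) A
   + measure (pos_variation M (\<lambda>A. Im (\<mu> A))) A
   + measure (pos_variation M (\<lambda>A. - Re (\<mu> A))) A
   + measure (pos_variation M (\<lambda>A. - Im (\<mu> A))) A"
proof -
  have "cmod (\<mu> A) \<le> \<bar>Re (\<mu> A)\<bar> + \<bar>Im (\<mu> A)\<bar>" by (rule cmod_le)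
  then show ?thesis
    using Jordan_decomposition[OF complex_measure_Re[OF \<mu>] A] Jordan_decomposition[OF complex_measure_Im[OF \<mu>] A]
      measure_nonneg[of "pos_variation M (\<lambda>A. Re (\<mu> A))" A] measure_nonneg[of "pos_variation M (\<lambda>A. Im (\<mu> A))" A]
      measure_nonneg[of "pos_variation M (\<lambda>A. - Re (\<mu> A))" A] measure_nonneg[of "pos_variation M (\<lambda>A. - Im (\<mu> A))" A]
    by linarith
qed

lemma total_variation_finite:
  assumes \<mu>: "complex_measure M \<mu>"
  shows "total_variation M \<mu> < \<infinity>"
proof -
  let ?P1 = "pos_variation M (\<lambda>A. Re (\<mu> A))" and ?P2 = "pos_variation M (\<lambda>A. Im (\<mu> A))"
  let ?P3 = "pos_variation M (\<lambda>A. - Re (\<mu> A))" and ?P4 = "pos_variation M (\<lambda>A. - Im (\<mu> A))"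
  note fm = finite_measure_parts[OF \<mu>]
  have "total_variation M \<mu> \<le> emeasure ?P1 (space M) + emeasure ?P2 (space M)
      + emeasure ?P3 (space M) + emeasure ?P4 (space M)"
    unfolding total_variation_def
  proof (rule SUP_least)
    fix A :: "nat \<Rightarrow> 'a set"
    assume "A \<in> {A. range A \<subseteq> sets M \<and> disjoint_family A \<and> \<Union> (range A) = space M}"
    then have A: "\<And>i. A i \<in> sets M" "disjoint_family A" "(\<Union>i. A i) = space M" by auto
    have "(\<Sum>i. ennreal (cmod (\<mu> (A i)))) \<le>
      (\<Sum>i. emeasure ?P1 (A i) + emeasure ?P2 (A i) + emeasure ?P3 (A i) + emeasure ?P4 (A i))"
    proof (rule suminf_le)
      fix i
      show "ennreal (cmod (\<mu> (A i))) \<le> emeasure ?P1 (A i) + emeasure ?P2 (A i) + emeasure ?P3 (A i) + emeasure ?P4 (A i)"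
        using cmod_complex_measure_le[OF \<mu> A(1)[of i]]
        by (simp add: fm[THEN finite_measure.emeasure_eq_measure] flip: ennreal_plus)
    qed auto
    also have "\<dots> = (\<Sum>i. emeasure ?P1 (A i)) + (\<Sum>i. emeasure ?P2 (A i)) + (\<Sum>i. emeasure ?P3 (A i)) + (\<Sum>i. emeasure ?P4 (A i))"
      by (simp flip: suminf_add)
    also have "\<dots> = emeasure ?P1 (space M) + emeasure ?P2 (space M) + emeasure ?P3 (space M) + emeasure ?P4 (space M)"
      using A by (simp add: suminf_emeasure image_subset_iff)
    finally show "(\<Sum>i. ennreal (cmod (\<mu> (A i)))) \<le> emeasure ?P1 (space M) + emeasure ?P2 (space M)
      + emeasure ?P3 (space M) + emeasure ?P4 (space M)" .
  qed
  also have "\<dots> < \<infinity>"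
    by (simp add: fm[THEN finite_measure.emeasure_eq_measure] flip: ennreal_plus)
  finally show ?thesis .
qed

lemma sum_cmod_le_total_variation:
  assumes \<mu>: "complex_measure M \<mu>" and V: "finite V" and A: "\<And>v. v \<in> V \<Longrightarrow> A v \<in> sets M"
    "disjoint_family_on A V" "(\<Union>v\<in>V. A v) = space M"
  shows "(\<Sum>v\<in>V. cmod (\<mu> (A v))) \<le> enn2real (total_variation M \<mu>)"
proof -
  obtain f where f: "bij_betw f {..<card V} V"
    using ex_bij_betw_nat_finite[OF V] by (auto simp: atLeast0LessThan)
  define B where "B = (\<lambda>i. if i < card V then A (f i) else {})"
  have fV: "f i \<in> V" if "i < card V" for i using bij_betwE[OF f] that by auto
  have "disjoint_family B"
    using A(2) fV bij_betw_imp_inj_on[OF f]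
    by (auto simp: disjoint_family_on_def B_def inj_on_def) blast
  moreover have "(\<Union>i. B i) = space M"
  proof -
    have "(\<Union>i. B i) = (\<Union>v\<in>f ` {..<card V}. A v)" by (auto simp: B_def)
    also have "f ` {..<card V} = V" using f by (simp add: bij_betw_def)
    finally show ?thesis using A(3) by simp
  qed
  moreover have "range B \<subseteq> sets M" using A(1) fV by (auto simp: B_def)
  ultimately have "(\<Sum>i. ennreal (cmod (\<mu> (B i)))) \<le> total_variation M \<mu>"
    unfolding total_variation_def by (intro SUP_upper) auto
  also have "(\<Sum>i. ennreal (cmod (\<mu> (B i)))) = (\<Sum>i<card V. ennreal (cmod (\<mu> (B i))))"
    using \<mu> by (intro suminf_finite) (auto simp: B_def complex_measure_def)
  also have "\<dots> = (\<Sum>i<card V. ennreal (cmod (\<mu> (A (f i)))))" by (simp add: B_def)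
  also have "\<dots> = (\<Sum>v\<in>V. ennreal (cmod (\<mu> (A v))))"
    by (rule sum.reindex_bij_betw[OF f])
  finally have "ennreal (\<Sum>v\<in>V. cmod (\<mu> (A v))) \<le> total_variation M \<mu>" by simp
  then show ?thesis
    using enn2real_mono[of "ennreal (\<Sum>v\<in>V. cmod (\<mu> (A v)))"] total_variation_finite[OF \<mu>]
    by (simp add: sum_nonneg)
qed

text \<open>
  Real and imaginary part are rounded down to a grid.
\<close>

lemma simple_function_approx:
  assumes "bounded_measurable M g" "0 < \<delta>"
  obtains s :: "'a \<Rightarrow> complex" where "simple_function M s" "\<And>x. x \<in> space M \<Longrightarrow> cmod (g x - s x) \<le> \<delta>"
proof -
  from assms(1) obtain B where g[measurable]: "g \<in> borel_measurable M" and B: "\<And>x. x \<in> space M \<Longrightarrow> cmod (g x) \<le> B"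
    by (auto simp: bounded_measurable_def)
  define d where "d = \<delta> / 2"
  define s where "s = (\<lambda>x. Complex (d * of_int \<lfloor>Re (g x) / d\<rfloor>) (d * of_int \<lfloor>Im (g x) / d\<rfloor>))"
  have d: "0 < d" using assms by (simp add: d_def)
  have fl: "\<bar>u - d * of_int \<lfloor>u / d\<rfloor>\<bar> \<le> d" for u
  proof -
    have "\<bar>u / d - of_int \<lfloor>u / d\<rfloor>\<bar> \<le> 1" by linarith
    then have "d * \<bar>u / d - of_int \<lfloor>u / d\<rfloor>\<bar> \<le> d * 1" using d by (intro mult_left_mono) auto
    also have "d * \<bar>u / d - of_int \<lfloor>u / d\<rfloor>\<bar> = \<bar>d * (u / d - of_int \<lfloor>u / d\<rfloor>)\<bar>" using d by (simp add: abs_mult)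
    also have "d * (u / d - of_int \<lfloor>u / d\<rfloor>) = u - d * of_int \<lfloor>u / d\<rfloor>" using d by (simp add: field_simps)
    finally show ?thesis by simp
  qed
  have err: "cmod (g x - s x) \<le> \<delta>" for x
    using cmod_le[of "g x - s x"] fl[of "Re (g x)"] fl[of "Im (g x)"] by (simp add: s_def d_def)
  have "s \<in> borel_measurable M" unfolding s_def Complex_eq by measurable
  moreover have "finite (s ` space M)"
  proof (rule finite_subset)
    show "s ` space M \<subseteq> (\<lambda>(a, b). Complex (d * of_int a) (d * of_int b)) ` ({\<lfloor>- B / d\<rfloor>..\<lfloor>B / d\<rfloor>} \<times> {\<lfloor>- B / d\<rfloor>..\<lfloor>B / d\<rfloor>})"
    proof (rule image_subsetI)
      fix x assume "x \<in> space M"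
      then have "\<bar>Re (g x)\<bar> \<le> B" "\<bar>Im (g x)\<bar> \<le> B"
        using B abs_Re_le_cmod abs_Im_le_cmod order_trans by blast+
      then have "- B / d \<le> Re (g x) / d" "Re (g x) / d \<le> B / d" "- B / d \<le> Im (g x) / d" "Im (g x) / d \<le> B / d"
        using d by (auto simp: pos_divide_le_eq pos_le_divide_eq)
      then show "s x \<in> (\<lambda>(a, b). Complex (d * of_int a) (d * of_int b)) ` ({\<lfloor>- B / d\<rfloor>..\<lfloor>B / d\<rfloor>} \<times> {\<lfloor>- B / d\<rfloor>..\<lfloor>B / d\<rfloor>})"
        by (auto simp: s_def intro!: image_eqI[where x = "(\<lfloor>Re (g x) / d\<rfloor>, \<lfloor>Im (g x) / d\<rfloor>)"] floor_mono)
    qed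
  qed auto
  ultimately have "simple_function M s" by (rule simple_function_borel_measurable)
  with err that show ?thesis by blast
qed

text \<open>
  The simple function takes values in functions on the index set, so that a single finite
  partition of the space serves the whole family.
\<close>

lemma simple_function_approx_family:
  assumes "finite F" "\<And>k. k \<in> F \<Longrightarrow> bounded_measurable M (g k)" "0 < \<delta>"
  shows "\<exists>s :: 'a \<Rightarrow> 'k \<Rightarrow> complex. simple_function M s \<and>
    (\<forall>x\<in>space M. \<forall>k\<in>F. cmod (g k x - s x k) \<le> \<delta>)"
  using assms(1,2)
proof (induction F)
    case empty
    show ?case by (intro exI[of _ "\<lambda>_ _. 0"]) auto
  next
    case (insert j F)
    then obtain s :: "'a \<Rightarrow> 'k \<Rightarrow> complex" where s: "simple_function M s"
      "\<forall>x\<in>space M. \<forall>k\<in>F. cmod (g k x - s x k) \<le> \<delta>" by auto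
    obtain t where t: "simple_function M t" "\<And>x. x \<in> space M \<Longrightarrow> cmod (g j x - t x) \<le> \<delta>"
      using simple_function_approx[of M "g j" \<delta>] insert.prems assms(3) by blast
    have "simple_function M (\<lambda>x. (\<lambda>(u, w). u(j := w)) (s x, t x))"
      by (rule simple_function_compose1) (rule simple_function_Pair[OF s(1) t(1)])
    then have "simple_function M (\<lambda>x. (s x)(j := t x))" by simp
    moreover have "\<forall>x\<in>space M. \<forall>k\<in>insert j F. cmod (g k x - ((s x)(j := t x)) k) \<le> \<delta>"
      using s t insert.hyps by auto
    ultimately show ?case by blast
qed

lemma complex_integral_simple:
  assumes \<mu>: "complex_measure M \<mu>" and s: "simple_function M s"
  shows "complex_integral M \<mu> (\<lambda>x. H (s x)) = (\<Sum>v\<in>s ` space M. H v * \<mu> (s -` {v} \<inter> space M))"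
proof -
  have fin: "finite (s ` space M)" and sets: "\<And>v. v \<in> s ` space M \<Longrightarrow> s -` {v} \<inter> space M \<in> sets M"
    using s by (auto simp: simple_function_def)
  have "complex_integral M \<mu> (\<lambda>x. H (s x)) =
      complex_integral M \<mu> (\<lambda>x. \<Sum>v\<in>s ` space M. H v * indicator (s -` {v} \<inter> space M) x)"
  proof (rule complex_integral_cong)
    fix x assume x: "x \<in> space M"
    have "(\<Sum>v\<in>s ` space M. H v * indicator (s -` {v} \<inter> space M) x) = (\<Sum>v\<in>s ` space M. if v = s x then H v else 0)"
      using x by (intro sum.cong) (auto simp: indicator_def)
    also have "\<dots> = H (s x)" using fin x by simp
    finally show "H (s x) = (\<Sum>v\<in>s ` space M. H v * indicator (s -` {v} \<inter> space M) x)" ..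
  qed
  also have "\<dots> = (\<Sum>v\<in>s ` space M. H v * \<mu> (s -` {v} \<inter> space M))"
    using sets
    by (subst complex_integral_sum[OF \<mu>])
       (auto intro!: sum.cong bounded_measurable_cmult bounded_measurable_indicator
          simp: complex_integral_cmult complex_integral_indicator[OF \<mu>])
  finally show ?thesis .
qed


text \<open>
  Replaces an integral by a finite sum over the values of \<open>\<mu>\<close> on a partition, which is the form in
  which the total variation bounds it.
\<close>

lemma complex_integral_near_simple:
  assumes \<mu>: "complex_measure M \<mu>" and g: "bounded_measurable M g" and s: "simple_function M s"
    and close: "\<And>x. x \<in> space M \<Longrightarrow> cmod (g x - H (s x)) \<le> \<delta>"
  shows "cmod (complex_integral M \<mu> g - (\<Sum>v\<in>s ` space M. H v * \<mu> (s -` {v} \<inter> space M)))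
    \<le> variation_bound M \<mu> * \<delta>"
proof -
  have Hs: "simple_function M (\<lambda>x. H (s x))" by (rule simple_function_compose1[OF s])
  have "bounded_measurable M (\<lambda>x. H (s x))"
  proof -
    have "finite ((\<lambda>x. cmod (H (s x))) ` space M)"
      using simple_functionD(1)[OF simple_function_compose1[OF Hs, of cmod]] by simp
    then obtain B where "\<forall>y\<in>(\<lambda>x. cmod (H (s x))) ` space M. y \<le> B"
      using bdd_above_finite[unfolded bdd_above_def] by blast
    then show ?thesis
      by (intro bounded_measurableI[where B = B] borel_measurable_simple_function[OF Hs]) auto
  qed
  then have "complex_integral M \<mu> g - (\<Sum>v\<in>s ` space M. H v * \<mu> (s -` {v} \<inter> space M))
      = complex_integral M \<mu> (\<lambda>x. g x - H (s x))"
    by (simp add: complex_integral_diff[OF \<mu> g] complex_integral_simple[OF \<mu> s])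
  also have "cmod \<dots> \<le> variation_bound M \<mu> * \<delta>"
    using g borel_measurable_simple_function[OF Hs] close
    by (intro complex_integral_bound[OF \<mu>]) (auto simp: bounded_measurable_def)
  finally show ?thesis .
qed

text \<open>
  Minkowski's integral inequality for a kernel of finite rank, with the exact total variation as
  constant. In the variable \<open>x\<close> the kernel is replaced by a step function on a finite partition
  into sets \<open>A v\<close>. The integral becomes a sum with weights \<open>\<mu> (A v)\<close>, whose moduli add up to at
  most the total variation. The replacement costs a multiple of the mesh \<open>\<delta>\<close>, estimated by the
  crude bound \<open>variation_bound\<close>.
\<close>

lemma kernel_contraction:
  fixes g :: "'k \<Rightarrow> 'a \<Rightarrow> complex" and a :: "'k \<Rightarrow> 'b \<Rightarrow> complex"
  assumes \<mu>: "complex_measure M \<mu>" and N: "finite_measure N" and F: "finite F"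
    and g: "\<And>k. k \<in> F \<Longrightarrow> bounded_measurable M (g k)"
    and a: "\<And>k. k \<in> F \<Longrightarrow> a k \<in> borel_measurable N"
    and c: "\<And>k z. k \<in> F \<Longrightarrow> z \<in> space N \<Longrightarrow> cmod (a k z) \<le> c k"
    and B: "0 \<le> B" "\<And>x. x \<in> space M \<Longrightarrow> (LINT z|N. cmod (\<Sum>k\<in>F. a k z * g k x)) \<le> B"
  shows "(LINT z|N. cmod (\<Sum>k\<in>F. a k z * complex_integral M \<mu> (g k)))
    \<le> B * enn2real (total_variation M \<mu>)"
proof (rule field_le_epsilon)
  fix e :: real assume e: "0 < e"
  interpret N: finite_measure N by fact
  define T where "T = enn2real (total_variation M \<mu>)"
  define K where "K = variation_bound M \<mu>"
  define C where "C = (\<Sum>k\<in>F. \<bar>c k\<bar>)"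
  define n where "n = measure N (space N)"
  have nn: "0 \<le> T" "0 \<le> K" "0 \<le> C" "0 \<le> n"
    by (auto simp: T_def K_def C_def n_def variation_bound_nonneg intro: sum_nonneg)
  define D where "D = C * n * (T + K)"
  have D: "0 \<le> D" using nn by (simp add: D_def)
  (* The total error below is delta * D; the summand 1 keeps the denominator positive. *)
  define \<delta> where "\<delta> = e / (D + 1)"
  have \<delta>: "0 < \<delta>" "\<delta> * D \<le> e"
    using e D by (auto simp: \<delta>_def field_simps intro: divide_pos_pos)
  obtain s :: "'a \<Rightarrow> 'k \<Rightarrow> complex" where s: "simple_function M s"
    and s\<delta>: "\<And>x k. x \<in> space M \<Longrightarrow> k \<in> F \<Longrightarrow> cmod (g k x - s x k) \<le> \<delta>"
    using simple_function_approx_family[of F M g \<delta>] F g \<delta>(1) by auto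
  define V where "V = s ` space M"
  define A where "A = (\<lambda>v. s -` {v} \<inter> space M)"
  define H where "H = (\<lambda>z v. \<Sum>k\<in>F. a k z * v k)"
  have V: "finite V" and A: "\<And>v. v \<in> V \<Longrightarrow> A v \<in> sets M"
    using s by (auto simp: simple_function_def V_def A_def)
  have TV: "(\<Sum>v\<in>V. cmod (\<mu> (A v))) \<le> T"
    unfolding T_def
    by (rule sum_cmod_le_total_variation[OF \<mu> V A]) (auto simp: disjoint_family_on_def A_def V_def)
  have Hm [measurable]: "H z \<in> borel_measurable (count_space UNIV)" for z by simp
  have Hmeas: "(\<lambda>z. H z v) \<in> borel_measurable N" for v
    unfolding H_def using a by (intro borel_measurable_sum borel_measurable_times) auto
  have dist_le: "cmod (\<Sum>k\<in>F. a k z * (u k - w k)) \<le> C * d"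
    if z: "z \<in> space N" and "0 \<le> d" "\<And>k. k \<in> F \<Longrightarrow> cmod (u k - w k) \<le> d" for z u w d
  proof -
    have "cmod (\<Sum>k\<in>F. a k z * (u k - w k)) \<le> (\<Sum>k\<in>F. \<bar>c k\<bar> * d)"
    proof (rule sum_norm_le)
      fix k assume k: "k \<in> F"
      have "cmod (a k z) \<le> \<bar>c k\<bar>" using c[OF k z] by linarith
      then show "cmod (a k z * (u k - w k)) \<le> \<bar>c k\<bar> * d"
        using that(3)[OF k] by (simp add: norm_mult mult_mono)
    qed
    then show ?thesis by (simp add: C_def sum_distrib_right)
  qed
  have bound: "cmod (\<Sum>k\<in>F. a k z * u k) \<le> C * (\<Sum>k\<in>F. cmod (u k))" if "z \<in> space N" for z u
    using dist_le[OF that, of "\<Sum>k\<in>F. cmod (u k)" u "\<lambda>_. 0"]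
      member_le_sum[of _ F "\<lambda>k. cmod (u k)"] F
    by (simp add: sum_nonneg)
  have int: "integrable N (\<lambda>z. cmod (\<Sum>k\<in>F. a k z * u k))" for u
    using a by (intro N.integrable_const_bound[where B = "C * (\<Sum>k\<in>F. cmod (u k))"] AE_I2)
      (auto simp: bound intro!: borel_measurable_norm borel_measurable_sum borel_measurable_times)
  have HB: "(LINT z|N. cmod (H z v)) \<le> B + C * \<delta> * n" if v: "v \<in> V" for v
  proof -
    obtain x where x: "x \<in> space M" "v = s x" using v by (auto simp: V_def)
    have "(LINT z|N. cmod (H z v)) \<le> (LINT z|N. cmod (\<Sum>k\<in>F. a k z * g k x) + C * \<delta>)"
    proof (rule integral_mono)
      show "integrable N (\<lambda>z. cmod (H z v))" unfolding H_def by (rule int)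
      show "integrable N (\<lambda>z. cmod (\<Sum>k\<in>F. a k z * g k x) + C * \<delta>)"
        by (intro Bochner_Integration.integrable_add int) simp
      fix z assume z: "z \<in> space N"
      have "cmod (H z v - (\<Sum>k\<in>F. a k z * g k x)) = cmod (\<Sum>k\<in>F. a k z * (s x k - g k x))"
        by (simp add: H_def x sum_subtractf right_diff_distrib)
      also have "\<dots> \<le> C * \<delta>"
        using s\<delta>[OF x(1)] \<delta> by (intro dist_le[OF z]) (auto simp: norm_minus_commute)
      finally show "cmod (H z v) \<le> cmod (\<Sum>k\<in>F. a k z * g k x) + C * \<delta>"
        by (smt (verit) norm_triangle_sub)
    qed
    also have "\<dots> = (LINT z|N. cmod (\<Sum>k\<in>F. a k z * g k x)) + C * \<delta> * n"
      by (subst Bochner_Integration.integral_add) (auto intro!: int simp: n_def)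
    finally show ?thesis using B(2)[OF x(1)] by simp
  qed
  have "(LINT z|N. cmod (\<Sum>k\<in>F. a k z * complex_integral M \<mu> (g k)))
      \<le> (LINT z|N. (\<Sum>v\<in>V. cmod (\<mu> (A v)) * cmod (H z v)) + C * (K * \<delta>))"
  proof (rule integral_mono)
    show "integrable N (\<lambda>z. (\<Sum>v\<in>V. cmod (\<mu> (A v)) * cmod (H z v)) + C * (K * \<delta>))"
      unfolding H_def by (intro Bochner_Integration.integrable_add Bochner_Integration.integrable_sum
          integrable_mult_right int) simp
    fix z assume z: "z \<in> space N"
    define w where "w = (\<lambda>k. \<Sum>v\<in>V. v k * \<mu> (A v))"
    have near: "cmod (complex_integral M \<mu> (g k) - w k) \<le> K * \<delta>" if "k \<in> F" for k
      unfolding w_def K_def V_def A_def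
      by (rule complex_integral_near_simple[OF \<mu> g s, of k "\<lambda>v. v k"]) (use that s\<delta> in auto)
    have "(\<Sum>k\<in>F. a k z * complex_integral M \<mu> (g k)) =
        (\<Sum>k\<in>F. a k z * w k) + (\<Sum>k\<in>F. a k z * (complex_integral M \<mu> (g k) - w k))"
      by (simp add: sum.distrib[symmetric] algebra_simps)
    also have "(\<Sum>k\<in>F. a k z * w k) = (\<Sum>v\<in>V. \<mu> (A v) * H z v)"
      unfolding w_def H_def sum_distrib_left by (subst sum.swap) (simp add: algebra_simps)
    finally have split: "(\<Sum>k\<in>F. a k z * complex_integral M \<mu> (g k)) =
        (\<Sum>v\<in>V. \<mu> (A v) * H z v) + (\<Sum>k\<in>F. a k z * (complex_integral M \<mu> (g k) - w k))" .
    have "cmod (\<Sum>k\<in>F. a k z * complex_integral M \<mu> (g k))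
        \<le> cmod (\<Sum>v\<in>V. \<mu> (A v) * H z v) + cmod (\<Sum>k\<in>F. a k z * (complex_integral M \<mu> (g k) - w k))"
      unfolding split by (rule norm_triangle_ineq)
    also have "cmod (\<Sum>v\<in>V. \<mu> (A v) * H z v) \<le> (\<Sum>v\<in>V. cmod (\<mu> (A v)) * cmod (H z v))"
      by (rule sum_norm_le) (simp add: norm_mult)
    also have "cmod (\<Sum>k\<in>F. a k z * (complex_integral M \<mu> (g k) - w k)) \<le> C * (K * \<delta>)"
      using near nn \<delta> by (intro dist_le[OF z]) auto
    finally show "cmod (\<Sum>k\<in>F. a k z * complex_integral M \<mu> (g k))
        \<le> (\<Sum>v\<in>V. cmod (\<mu> (A v)) * cmod (H z v)) + C * (K * \<delta>)" by simp
  qed (rule int)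
  also have "\<dots> = (LINT z|N. (\<Sum>v\<in>V. cmod (\<mu> (A v)) * cmod (H z v))) + (LINT z|N. C * (K * \<delta>))"
    unfolding H_def
    by (intro Bochner_Integration.integral_add Bochner_Integration.integrable_sum
        integrable_mult_right int N.integrable_const)
  also have "\<dots> = (\<Sum>v\<in>V. cmod (\<mu> (A v)) * (LINT z|N. cmod (H z v))) + C * (K * \<delta>) * n"
  proof -
    have "(LINT z|N. (\<Sum>v\<in>V. cmod (\<mu> (A v)) * cmod (H z v)))
        = (\<Sum>v\<in>V. LINT z|N. cmod (\<mu> (A v)) * cmod (H z v))"
      unfolding H_def by (intro Bochner_Integration.integral_sum integrable_mult_right int)
    also have "\<dots> = (\<Sum>v\<in>V. cmod (\<mu> (A v)) * (LINT z|N. cmod (H z v)))"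
      by (intro sum.cong refl integral_mult_right_zero)
    finally show ?thesis by (simp only: lebesgue_integral_const n_def real_scaleR_def mult.commute)
  qed
  also have "\<dots> \<le> (\<Sum>v\<in>V. cmod (\<mu> (A v)) * (B + C * \<delta> * n)) + C * (K * \<delta>) * n"
    using HB by (intro add_right_mono sum_mono mult_left_mono) auto
  also have "\<dots> = (\<Sum>v\<in>V. cmod (\<mu> (A v))) * (B + C * \<delta> * n) + C * (K * \<delta>) * n"
    by (simp add: sum_distrib_right)
  also have "\<dots> \<le> T * (B + C * \<delta> * n) + C * (K * \<delta>) * n"
    using TV B nn \<delta> by (intro add_right_mono mult_right_mono) auto
  also have "\<dots> = B * T + \<delta> * D" by (simp add: D_def algebra_simps)
  also have "\<dots> \<le> B * T + e" using \<delta> by simp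
  finally show "(LINT z|N. cmod (\<Sum>k\<in>F. a k z * complex_integral M \<mu> (g k)))
    \<le> B * enn2real (total_variation M \<mu>) + e" by (simp add: T_def)
qed

section \<open>Absolutely continuous complex measures\<close>

lemma complex_measure_density:
  fixes f :: "'a \<Rightarrow> complex"
  assumes f: "integrable M f"
  shows "complex_measure M (\<lambda>A. LINT x:A|M. f x)"
  unfolding complex_measure_def
proof (intro conjI allI impI)
  show "(LINT x:{}|M. f x) = 0" by (simp add: set_lebesgue_integral_def)
  fix A :: "nat \<Rightarrow> 'a set" assume A: "range A \<subseteq> sets M" "disjoint_family A"
  have int: "set_integrable M B f" if "B \<in> sets M" for B
    using that f by (auto simp: set_integrable_def intro!: integrable_mult_indicator)
  have "(\<lambda>n. LINT x:(\<Union>i<n. A i)|M. f x) \<longlonglongrightarrow> (LINT x:(\<Union>n. \<Union>i<n. A i)|M. f x)"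
    using A by (intro set_integral_cont_up int) (fastforce simp: incseq_def intro!: sets.countable_UN)+
  also have "(\<Union>n. \<Union>i<n. A i) = (\<Union>i. A i)" by auto
  also have "(\<lambda>n. LINT x:(\<Union>i<n. A i)|M. f x) = (\<lambda>n. \<Sum>i<n. LINT x:A i|M. f x)"
    using A by (intro ext set_integral_finite_Union int)
      (auto intro: disjoint_family_on_mono[OF subset_UNIV])
  finally show "(\<lambda>i. LINT x:A i|M. f x) sums (LINT x:(\<Union>i. A i)|M. f x)"
    by (simp add: sums_def)
qed

lemma total_variation_density:
  fixes f :: "'a \<Rightarrow> complex"
  assumes f: "integrable M f"
  shows "total_variation M (\<lambda>A. LINT x:A|M. f x) \<le> (\<integral>\<^sup>+x. cmod (f x) \<partial>M)"
  unfolding total_variation_def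
proof (rule SUP_least)
  fix A :: "nat \<Rightarrow> 'a set"
  assume "A \<in> {A. range A \<subseteq> sets M \<and> disjoint_family A \<and> \<Union> (range A) = space M}"
  then have A: "\<And>i. A i \<in> sets M" "disjoint_family A" "(\<Union>i. A i) = space M" by auto
  have "(\<Sum>i. ennreal (cmod (LINT x:A i|M. f x))) \<le> (\<Sum>i. \<integral>\<^sup>+x\<in>A i. cmod (f x) \<partial>M)"
  proof (intro suminf_le)
    fix i
    have int: "integrable M (\<lambda>x. indicator (A i) x *\<^sub>R f x)"
      using A f by (intro integrable_mult_indicator) auto
    have "ennreal (cmod (LINT x:A i|M. f x)) \<le> (\<integral>\<^sup>+x. norm (indicator (A i) x *\<^sub>R f x) \<partial>M)"
      unfolding set_lebesgue_integral_def by (rule integral_norm_bound_ennreal[OF int])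
    also have "\<dots> = (\<integral>\<^sup>+x\<in>A i. cmod (f x) \<partial>M)"
      by (intro nn_integral_cong) (auto simp: indicator_def)
    finally show "ennreal (cmod (LINT x:A i|M. f x)) \<le> (\<integral>\<^sup>+x\<in>A i. cmod (f x) \<partial>M)" .
  qed auto
  also have "\<dots> = (\<integral>\<^sup>+x\<in>(\<Union>i. A i). cmod (f x) \<partial>M)"
    using A f by (intro nn_integral_disjoint_family[symmetric]) auto
  also have "\<dots> = (\<integral>\<^sup>+x. cmod (f x) \<partial>M)"
    unfolding A by (intro nn_integral_cong) auto
  finally show "(\<Sum>i. ennreal (cmod (LINT x:A i|M. f x))) \<le> (\<integral>\<^sup>+x. cmod (f x) \<partial>M)" .
qed

text \<open>
  Both sides are linear in \<open>g\<close>, continuous for uniform convergence, and agree on indicator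
  functions.
\<close>

lemma complex_integral_density:
  fixes f :: "'a \<Rightarrow> complex"
  assumes f: "integrable M f" and g: "bounded_measurable M g"
  shows "complex_integral M (\<lambda>A. LINT x:A|M. f x) g = (LINT x|M. g x * f x)"
proof -
  let ?\<mu> = "\<lambda>A. LINT x:A|M. f x"
  define L where "L = (LINT x|M. cmod (f x))"
  define K where "K = variation_bound M ?\<mu>"
  have \<mu>: "complex_measure M ?\<mu>" by (rule complex_measure_density[OF f])
  have gm[measurable]: "g \<in> borel_measurable M" using g by (simp add: bounded_measurable_def)
  have fm[measurable]: "f \<in> borel_measurable M" using f by auto
  have nn: "0 \<le> K" "0 \<le> L" by (auto simp: K_def L_def variation_bound_nonneg)
  have gf: "integrable M (\<lambda>x. g x * f x)"
  proof -
    obtain B where B: "\<And>x. x \<in> space M \<Longrightarrow> cmod (g x) \<le> B" using g by (auto simp: bounded_measurable_def)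
    then have "cmod (g x) \<le> \<bar>B\<bar>" if "x \<in> space M" for x using that by (meson abs_ge_self order_trans)
    then show ?thesis
      by (intro Bochner_Integration.integrable_bound[OF integrable_mult_right[OF f, of "of_real B"]])
         (auto simp: norm_mult abs_mult intro!: AE_I2 mult_right_mono)
  qed
  have "cmod (complex_integral M ?\<mu> g - (LINT x|M. g x * f x)) \<le> 0 + e" if e: "0 < e" for e
  proof -
    define \<delta> where "\<delta> = e / (K + L + 1)"
    have \<delta>: "0 < \<delta>" "(K + L) * \<delta> \<le> e" using e nn by (auto simp: \<delta>_def field_simps)
    obtain s where s: "simple_function M s" "\<And>x. x \<in> space M \<Longrightarrow> cmod (g x - s x) \<le> \<delta>"
      using simple_function_approx[OF g \<delta>(1)] by blast
    have [measurable]: "s \<in> borel_measurable M" by (rule borel_measurable_simple_function[OF s(1)])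
    define S where "S = (\<Sum>v\<in>s ` space M. v * ?\<mu> (s -` {v} \<inter> space M))"
    have 1: "cmod (complex_integral M ?\<mu> g - S) \<le> K * \<delta>"
      unfolding S_def K_def by (rule complex_integral_near_simple[OF \<mu> g s(1), of "\<lambda>v. v"]) (rule s(2))
    have fin: "finite (s ` space M)" and sets: "\<And>v. s -` {v} \<inter> space M \<in> sets M"
      using s(1) by (auto simp: simple_function_def intro: measurable_sets[OF \<open>s \<in> _\<close>])
    have ints: "integrable M (\<lambda>x. v * (indicator (s -` {v} \<inter> space M) x *\<^sub>R f x))" for v
      by (intro integrable_mult_right integrable_mult_indicator sets f)
    have eq: "(\<Sum>v\<in>s ` space M. v * (indicator (s -` {v} \<inter> space M) x *\<^sub>R f x)) = s x * f x"
      if x: "x \<in> space M" for x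
    proof -
      have "(\<Sum>v\<in>s ` space M. v * (indicator (s -` {v} \<inter> space M) x *\<^sub>R f x)) =
          (\<Sum>v\<in>s ` space M. if v = s x then v * f x else 0)"
        using x by (intro sum.cong) (auto simp: indicator_def)
      then show ?thesis using fin x by simp
    qed
    have sf: "integrable M (\<lambda>x. s x * f x)"
    proof -
      have "integrable M (\<lambda>x. \<Sum>v\<in>s ` space M. v * (indicator (s -` {v} \<inter> space M) x *\<^sub>R f x))"
        by (intro Bochner_Integration.integrable_sum ints)
      then show ?thesis using eq by (simp cong: Bochner_Integration.integrable_cong)
    qed
    have "S = (\<Sum>v\<in>s ` space M. LINT x|M. v * (indicator (s -` {v} \<inter> space M) x *\<^sub>R f x))"
      by (simp only: S_def set_lebesgue_integral_def integral_mult_right_zero)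
    also have "\<dots> = (LINT x|M. (\<Sum>v\<in>s ` space M. v * (indicator (s -` {v} \<inter> space M) x *\<^sub>R f x)))"
      by (rule Bochner_Integration.integral_sum[symmetric]) (rule ints)
    also have "\<dots> = (LINT x|M. s x * f x)" by (intro Bochner_Integration.integral_cong eq) auto
    finally have "cmod (S - (LINT x|M. g x * f x)) = cmod (LINT x|M. (s x - g x) * f x)"
      using gf sf by (simp add: left_diff_distrib)
    also have "\<dots> \<le> (LINT x|M. cmod ((s x - g x) * f x))" by (rule integral_norm_bound)
    also have "\<dots> \<le> (LINT x|M. \<delta> * cmod (f x))"
    proof (rule integral_mono)
      show "integrable M (\<lambda>x. cmod ((s x - g x) * f x))"
        using gf sf by (auto simp: left_diff_distrib intro!: integrable_norm)
      show "integrable M (\<lambda>x. \<delta> * cmod (f x))" using f by auto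
    qed (use s(2) in \<open>auto simp: norm_mult norm_minus_commute intro!: mult_right_mono\<close>)
    also have "\<dots> = L * \<delta>" by (simp add: L_def)
    finally have 2: "cmod (S - (LINT x|M. g x * f x)) \<le> L * \<delta>" .
    have "cmod (complex_integral M ?\<mu> g - (LINT x|M. g x * f x)) \<le> K * \<delta> + L * \<delta>"
      using norm_triangle_mono[OF 1 2] by simp
    also have "\<dots> \<le> e" using \<delta>(2) by (simp add: algebra_simps)
    finally show ?thesis by simp
  qed
  then have "cmod (complex_integral M ?\<mu> g - (LINT x|M. g x * f x)) \<le> 0" by (rule field_le_epsilon)
  then show ?thesis by simp
qed

section \<open>The Poisson kernel of the disc\<close>

definition poisson :: "real \<Rightarrow> real \<Rightarrow> real" where
  "poisson r s = (1 - r\<^sup>2) / (1 - 2 * r * cos s + r\<^sup>2)"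

lemma poisson_denominator_pos:
  fixes r s :: real
  assumes "0 \<le> r" "r < 1" shows "0 < 1 - 2 * r * cos s + r\<^sup>2"
proof -
  have "0 < (1 - r)\<^sup>2" by (rule zero_less_power) (use assms in simp)
  also have "(1 - r)\<^sup>2 \<le> 1 - 2 * r * cos s + r\<^sup>2"
    using mult_left_mono[OF cos_le_one[of s] assms(1)] by (simp add: power2_eq_square algebra_simps)
  finally show ?thesis .
qed

lemma poisson_nonneg: "0 \<le> r \<Longrightarrow> r < 1 \<Longrightarrow> 0 \<le> poisson r s"
  using poisson_denominator_pos[of r s] by (simp add: poisson_def power_le_one)

lemma poisson_minus [simp]: "poisson r (- s) = poisson r s"
  by (simp add: poisson_def)

lemma continuous_on_poisson [continuous_intros]:
  fixes f :: "'a::t2_space \<Rightarrow> real"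
  assumes "0 \<le> r" "r < 1" "continuous_on A f"
  shows "continuous_on A (\<lambda>x. poisson r (f x))"
proof -
  have "\<forall>x\<in>A. 1 - 2 * r * cos (f x) + r\<^sup>2 \<noteq> 0"
    using poisson_denominator_pos[OF assms(1,2)] by (metis less_irrefl)
  moreover have "continuous_on A (\<lambda>x. cos (f x))" by (intro continuous_intros assms(3))
  ultimately show ?thesis unfolding poisson_def by (intro continuous_intros assms(3))
qed

lemma poisson_decreasing:
  assumes "0 \<le> r" "r < 1" "0 \<le> s" "s \<le> t" "t \<le> pi"
  shows "poisson r t \<le> poisson r s"
proof -
  have "cos t \<le> cos s" using assms by (intro cos_monotone_0_pi_le) auto
  then have "r * cos t \<le> r * cos s" using assms by (intro mult_left_mono)
  then show ?thesis
    unfolding poisson_def using poisson_denominator_pos[OF assms(1,2)] assms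
    by (intro divide_left_mono mult_pos_pos) (auto simp: power_le_one)
qed

text \<open>
  Cauchy's integral formula for \<open>H(u) (1 - r\<^sup>2) / (1 + r u)\<close> at the point \<open>-r\<close>: on the circle the
  product of \<open>1 + r u\<close> and \<open>u + r\<close> is \<open>u\<close> times the denominator of the Poisson kernel. The
  function is first rotated so that \<open>r cis t\<close> moves to \<open>-r\<close>; the usual parameter interval from 0
  to \<open>2 \<pi>\<close> then becomes the symmetric interval in which the kernel is even.
\<close>

lemma Poisson_formula:
  fixes H :: "complex \<Rightarrow> complex"
  assumes H: "H holomorphic_on cball 0 1" and r: "0 \<le> r" "r < 1"
  shows "((\<lambda>s. of_real (poisson r s) * H (cis (t + s))) has_integral
            2 * pi * H (of_real r * cis t)) {-pi..pi}"
proof -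
  have rot: "(- \<i>) * (c * \<i> * x) = c * x" for c x :: complex
    by (simp add: complex_eq_iff)
  (* The factor cis (t - pi) is the rotation that takes - r to r * cis t. *)
  define K where "K = (\<lambda>u::complex. H (u * cis (t - pi)) * (1 - complex_of_real r ^ 2) / (1 + of_real r * u))"
  have nz: "1 + of_real r * u \<noteq> 0" if "cmod u \<le> 1" for u
  proof
    assume "1 + of_real r * u = 0"
    then have "of_real r * u = - 1" by (simp add: eq_neg_iff_add_eq_0 add.commute)
    then have "r * cmod u = 1" using r by (metis norm_minus_cancel norm_mult norm_of_real norm_one abs_of_nonneg)
    moreover have "r * cmod u \<le> r" using that r by (simp add: mult_left_le)
    ultimately show False using r by simp
  qed
  have "K holomorphic_on cball 0 1"
    unfolding K_def
    by (intro holomorphic_intros holomorphic_on_compose_gen[OF _ H, unfolded o_def])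
       (auto simp: norm_mult nz)
  then have "((\<lambda>u. K u / (u - - of_real r)) has_contour_integral 2 * of_real pi * \<i> * K (- of_real r)) (circlepath 0 1)"
    by (rule Cauchy_integral_circlepath_simple) (use r in simp)
  then have "((\<lambda>v. K (cis v) / (cis v + of_real r) * \<i> * cis v) has_integral 2 * pi * \<i> * K (- of_real r)) {0..2*pi}"
    unfolding circlepath_def by (subst (asm) has_contour_integral_part_circlepath_iff) auto
  then have "((\<lambda>v. (- \<i>) * (K (cis v) / (cis v + of_real r) * \<i> * cis v)) has_integral
      (- \<i>) * (2 * pi * \<i> * K (- of_real r))) {-pi + pi..pi + pi}"
    by (intro has_integral_mult_right) simp
  then have "((\<lambda>v. (- \<i>) * (K (cis (pi + v)) / (cis (pi + v) + of_real r) * \<i> * cis (pi + v))) has_integral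
      (- \<i>) * (2 * pi * \<i> * K (- of_real r))) {-pi..pi}"
    by (subst (asm) has_integral_shift_Icc_real[symmetric]) (simp add: o_def)
  moreover have "(- \<i>) * (2 * pi * \<i> * K (- of_real r)) = 2 * pi * H (of_real r * cis t)"
  proof -
    have "1 - complex_of_real r * complex_of_real r \<noteq> 0"
      using nz[of "- of_real r"] r by simp
    moreover have "- of_real r * cis (t - pi) = of_real r * cis t"
      by (simp add: cis_divide[symmetric])
    ultimately have "K (- of_real r) = H (of_real r * cis t)"
      unfolding K_def by (simp only: power2_eq_square mult_minus_right add_uminus_conv_diff nonzero_mult_div_cancel_right simp_thms)
    then show ?thesis by (simp only: rot)
  qed
  moreover have "(- \<i>) * (K (cis (pi + v)) / (cis (pi + v) + of_real r) * \<i> * cis (pi + v))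
      = of_real (poisson r v) * H (cis (t + v))" for v
  proof -
    have c: "cis (pi + v) = - cis v" by (simp add: cis_mult[symmetric])
    have "(1 + of_real r * cis (pi + v)) * (cis (pi + v) + of_real r)
        = cis (pi + v) * ((1 - of_real r * cis v) * (1 - of_real r * cis (- v)))"
    proof -
      have "cis v * cis (- v) = 1" by (simp add: cis_mult)
      then have "- cis v + of_real r = - cis v * (1 - of_real r * cis (- v))"
        by (simp add: algebra_simps)
      then show ?thesis by (simp add: c)
    qed
    also have "(1 - of_real r * cis v) * (1 - of_real r * cis (- v)) = of_real (1 - 2 * r * cos v + r\<^sup>2)"
    proof -
      have "cis v + cis (- v) = of_real (2 * cos v)" by (simp add: complex_eq_iff)
      then have "of_real (1 - 2 * r * cos v + r\<^sup>2) = 1 - of_real r * (cis v + cis (- v)) + of_real r ^ 2 * (cis v * cis (- v))"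
        by (simp add: cis_mult)
      then show ?thesis by (simp add: algebra_simps power2_eq_square)
    qed
    finally have den: "(1 + of_real r * cis (pi + v)) * (cis (pi + v) + of_real r)
        = cis (pi + v) * of_real (1 - 2 * r * cos v + r\<^sup>2)" .
    have "(- \<i>) * (K (cis (pi + v)) / (cis (pi + v) + of_real r) * \<i> * cis (pi + v))
       = H (cis (pi + v) * cis (t - pi)) * (1 - of_real r ^ 2) * cis (pi + v) /
         ((1 + of_real r * cis (pi + v)) * (cis (pi + v) + of_real r))"
      unfolding rot by (simp add: K_def)
    also have "\<dots> = H (cis (pi + v) * cis (t - pi)) * (1 - complex_of_real r ^ 2) / of_real (1 - 2 * r * cos v + r\<^sup>2)"
      unfolding den by (simp del: of_real_add of_real_diff)
    also have "cis (pi + v) * cis (t - pi) = cis (t + v)" by (simp add: cis_mult add.commute)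
    finally show ?thesis by (simp add: poisson_def)
  qed
  ultimately show ?thesis by (simp only:)
qed

lemma poisson_has_integral:
  assumes "0 \<le> r" "r < 1"
  shows "(poisson r has_integral 2 * pi) {-pi..pi}"
proof -
  have "((\<lambda>s. complex_of_real (poisson r s)) has_integral 2 * complex_of_real pi) {-pi..pi}"
    using Poisson_formula[of "\<lambda>_. 1" r 0] assms by simp
  from has_integral_Re[OF this] show ?thesis by simp
qed

text \<open>
  The kernel is even and decreases on \<open>[0, \<pi>]\<close>, so it is a superposition of indicators of
  symmetric intervals. Instead of writing this superposition, the second mean value theorem is
  applied to the kernel and the defect \<open>g\<close>, whose integrals from 0 are nonnegative by assumption.
\<close>

lemma Poisson_integral_le:
  fixes f :: "real \<Rightarrow> real"
  assumes f: "continuous_on UNIV f" and r: "0 \<le> r" "r < 1"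
    and avg: "\<And>h. 0 < h \<Longrightarrow> h \<le> pi \<Longrightarrow> integral {t - h..t + h} f \<le> 2 * h * a"
  shows "integral {-pi..pi} (\<lambda>s. poisson r s * f (t + s)) \<le> 2 * pi * a"
proof -
  have cont: "continuous_on A (\<lambda>x. f (g x))" if "continuous_on A g" for A :: "real set" and g
    using continuous_on_compose2[OF f that] by auto
  (* Twice the bound minus the symmetrised function: its integral over [0, h] is 2 h a minus the integral of f over [t - h, t + h]. *)
  define g where "g = (\<lambda>s. 2 * a - f (t + s) - f (t - s))"
  have cg: "continuous_on A g" for A unfolding g_def by (intro continuous_intros cont)
  have g_int: "integral {0..h} g \<ge> 0" if h: "0 \<le> h" "h \<le> pi" for h
  proof -
    have 1: "((\<lambda>s. f (t + s)) has_integral integral {t..t + h} f) {0..h}"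
    proof -
      have "(f has_integral integral {t..t + h} f) {0 + t..h + t}"
        using integrable_continuous_interval[OF continuous_on_subset[OF f]]
        by (auto simp: add.commute intro: integrable_integral)
      then show ?thesis by (subst (asm) has_integral_shift_Icc_real[symmetric]) (simp add: o_def)
    qed
    have 2: "((\<lambda>s. f (t - s)) has_integral integral {t - h..t} f) {0..h}"
    proof -
      have "(f has_integral integral {t - h..t} f) {- h + t..0 + t}"
        using integrable_continuous_interval[OF continuous_on_subset[OF f]]
        by (auto simp: add.commute intro: integrable_integral)
      then have "((\<lambda>s. f (t + s)) has_integral integral {t - h..t} f) {- h..- 0}"
        by (subst (asm) has_integral_shift_Icc_real[symmetric]) (simp add: o_def)
      then show ?thesis by (subst (asm) has_integral_reflect_real[symmetric]) simp
    qed
    have "((\<lambda>s. 2 * a) has_integral 2 * a * h) {0..h}"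
      using has_integral_const_real[of "2 * a" 0 h] h by (simp add: mult.commute)
    from has_integral_diff[OF has_integral_diff[OF this 1] 2]
    have "integral {0..h} g = 2 * a * h - integral {t..t + h} f - integral {t - h..t} f"
      unfolding g_def by (rule integral_unique)
    moreover have "integral {t - h..t} f + integral {t..t + h} f = integral {t - h..t + h} f"
      using h integrable_continuous_interval[OF continuous_on_subset[OF f]]
      by (intro Henstock_Kurzweil_Integration.integral_combine) auto
    moreover have "integral {t - h..t + h} f \<le> 2 * h * a"
      using avg[of h] h by (cases "h = 0") auto
    ultimately show ?thesis by (simp add: algebra_simps)
  qed
  have "0 \<le> integral {0..pi} (\<lambda>s. poisson r s * g s)"
  proof -
    obtain c where c: "c \<in> {0..pi}" "integral {0..pi} (\<lambda>s. - poisson r s * g s) =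
        - poisson r 0 * integral {0..c} g + - poisson r pi * integral {c..pi} g"
      by (rule second_mean_value_theorem[of g 0 pi "\<lambda>s. - poisson r s"])
         (auto intro: integrable_continuous_interval cg poisson_decreasing[OF r])
    have "integral {0..c} g + integral {c..pi} g = integral {0..pi} g"
      using c(1) by (intro Henstock_Kurzweil_Integration.integral_combine)
        (auto intro: integrable_continuous_interval cg)
    then have "integral {c..pi} g = integral {0..pi} g - integral {0..c} g" by simp
    with c(2) have "integral {0..pi} (\<lambda>s. poisson r s * g s) =
        (poisson r 0 - poisson r pi) * integral {0..c} g + poisson r pi * integral {0..pi} g"
      by (simp add: algebra_simps)
    also have "\<dots> \<ge> 0"
      using g_int[of c] g_int[of pi] c(1) poisson_nonneg[OF r] poisson_decreasing[OF r, of 0 pi]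
      by (intro add_nonneg_nonneg mult_nonneg_nonneg) auto
    finally show ?thesis .
  qed
  also have "integral {0..pi} (\<lambda>s. poisson r s * g s) =
      2 * a * integral {0..pi} (poisson r) - integral {-pi..pi} (\<lambda>s. poisson r s * f (t + s))"
  proof -
    have i1: "(\<lambda>s. poisson r s * f (t + s)) integrable_on A" if "A = {u..v}" for A u v
      unfolding that by (intro integrable_continuous_interval continuous_intros cont r)
    have i2: "(\<lambda>s. poisson r s * f (t - s)) integrable_on {0..pi}"
      by (intro integrable_continuous_interval continuous_intros cont r)
    have i3: "poisson r integrable_on {0..pi}"
      by (intro integrable_continuous_interval continuous_on_poisson r continuous_on_id)
    have "integral {-pi..pi} (\<lambda>s. poisson r s * f (t + s)) =
        integral {-pi..0} (\<lambda>s. poisson r s * f (t + s)) + integral {0..pi} (\<lambda>s. poisson r s * f (t + s))"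
      by (intro Henstock_Kurzweil_Integration.integral_combine[symmetric] i1) auto
    also have "integral {-pi..0} (\<lambda>s. poisson r s * f (t + s)) = integral {0..pi} (\<lambda>s. poisson r s * f (t - s))"
      using Henstock_Kurzweil_Integration.integral_reflect_real[of pi 0 "\<lambda>s. poisson r s * f (t - s)"] by simp
    finally have split: "integral {-pi..pi} (\<lambda>s. poisson r s * f (t + s)) =
        integral {0..pi} (\<lambda>s. poisson r s * f (t - s)) + integral {0..pi} (\<lambda>s. poisson r s * f (t + s))" .
    have "((\<lambda>s. 2 * a * poisson r s - poisson r s * f (t + s) - poisson r s * f (t - s)) has_integral
        2 * a * integral {0..pi} (poisson r) - integral {0..pi} (\<lambda>s. poisson r s * f (t + s))
        - integral {0..pi} (\<lambda>s. poisson r s * f (t - s))) {0..pi}"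
      by (intro has_integral_diff has_integral_mult_right integrable_integral i1[OF refl] i2 i3)
    moreover have "(\<lambda>s. 2 * a * poisson r s - poisson r s * f (t + s) - poisson r s * f (t - s)) = (\<lambda>s. poisson r s * g s)"
      by (simp add: g_def fun_eq_iff algebra_simps)
    ultimately show ?thesis by (simp add: split integral_unique)
  qed
  also have "2 * a * integral {0..pi} (poisson r) = 2 * pi * a"
  proof -
    have i: "poisson r integrable_on {u..v}" for u v
      by (intro integrable_continuous_interval continuous_on_poisson r continuous_on_id)
    have "integral {-pi..0} (poisson r) + integral {0..pi} (poisson r) = 2 * pi"
      using poisson_has_integral[OF r] i
      by (subst Henstock_Kurzweil_Integration.integral_combine) (auto simp: integral_unique)
    moreover have "integral {-pi..0} (poisson r) = integral {0..pi} (poisson r)"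
      using Henstock_Kurzweil_Integration.integral_reflect_real[of pi 0 "poisson r"] by simp
    ultimately have "integral {0..pi} (poisson r) = pi" by simp
    then show ?thesis by simp
  qed
  finally show ?thesis by simp
qed


section \<open>The maximal function on the circle\<close>

lemma nn_integral_continuous_Icc:
  fixes f :: "real \<Rightarrow> real"
  assumes "continuous_on {a..b} f" "\<And>x. x \<in> {a..b} \<Longrightarrow> 0 \<le> f x"
  shows "(\<integral>\<^sup>+x\<in>{a..b}. ennreal (f x) \<partial>lborel) = ennreal (integral {a..b} f)"
  using assms by (intro nn_integral_has_integral_lebesgue' integrable_integral integrable_continuous_interval)

text \<open>
  Each point of \<open>E\<close> is the centre of an interval \<open>I\<close> with \<open>y \<bar>I\<bar> < \<integral>\<^sub>I f\<close>. Vitali's lemma selects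
  countably many disjoint ones whose fivefold dilations cover \<open>E\<close>. They lie within three periods,
  whence the constant \<open>15 = 5 \<cdot> 3\<close>.
\<close>

lemma maximal_weak_type:
  fixes f :: "real \<Rightarrow> real"
  assumes f: "continuous_on UNIV f" and nn: "\<And>x. 0 \<le> f x" and per: "\<And>x. f (x + 2 * pi) = f x"
    and y: "0 < y"
    and E: "\<And>t. t \<in> E \<Longrightarrow> t \<in> {0..2 * pi} \<and> (\<exists>h. 0 < h \<and> h \<le> pi \<and> 2 * h * y < integral {t - h..t + h} f)"
    and Em: "E \<in> sets lborel"
  shows "emeasure lborel E \<le> ennreal (15 / y * integral {0..2 * pi} f)"
proof -
  have fm[measurable]: "f \<in> borel_measurable borel" using f by (rule borel_measurable_continuous_onI)
  have ci: "f integrable_on {a..b}" for a b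
    by (rule integrable_continuous_interval) (rule continuous_on_subset[OF f], simp)
  obtain h where h: "\<And>t. t \<in> E \<Longrightarrow> 0 < h t \<and> h t \<le> pi \<and> 2 * h t * y < integral {t - h t..t + h t} f"
    using E by metis
  obtain C where C: "countable C" "C \<subseteq> E"
     "pairwise (\<lambda>i j. disjnt (ball i (h i)) (ball j (h j))) C"
     "E \<subseteq> (\<Union>i\<in>C. ball i (5 * h i))"
  proof (rule Vitali_covering_lemma_balls[where S = E and K = E and a = "\<lambda>t. t" and r = h and B = pi])
    show "E \<subseteq> (\<Union>i\<in>E. ball i (h i))" using h by force
  qed (use h in auto)
  define F where "F = density lborel (\<lambda>x. ennreal (f x))"
  define e where "e = to_nat_on C"
  (* C may be finite, so unused indices carry the empty set. *)
  define X where "X = (\<lambda>n. if n \<in> e ` C then (let i = from_nat_into C n in ball i (h i)) else {})"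
  define Y where "Y = (\<lambda>n. if n \<in> e ` C then (let i = from_nat_into C n in ball i (5 * h i)) else {})"
  have ei: "from_nat_into C (e i) = i" if "i \<in> C" for i using C(1) that by (simp add: e_def)
  have Xm: "X n \<in> sets borel" and Ym: "Y n \<in> sets borel" for n by (auto simp: X_def Y_def Let_def)
  have disj: "disjoint_family X"
    unfolding disjoint_family_on_def
  proof (intro ballI impI)
    fix m n :: nat assume mn: "m \<noteq> n"
    show "X m \<inter> X n = {}"
    proof (cases "m \<in> e ` C \<and> n \<in> e ` C")
      case True
      then obtain i j where ij: "i \<in> C" "j \<in> C" "m = e i" "n = e j" by auto
      then have "i \<noteq> j" using mn by auto
      then have "disjnt (ball i (h i)) (ball j (h j))" using C(3) ij by (auto simp: pairwise_def)
      then show ?thesis using ij by (simp add: X_def ei disjnt_def)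
    qed (auto simp: X_def)
  qed
  have YX: "emeasure lborel (Y n) \<le> ennreal (5 / y) * emeasure F (X n)" for n
  proof (cases "n \<in> e ` C")
    case True
    then obtain i where i: "i \<in> C" "n = e i" by auto
    then have iE: "i \<in> E" using C by auto
    have "emeasure F (X n) = (\<integral>\<^sup>+x\<in>ball i (h i). ennreal (f x) \<partial>lborel)"
      using i by (simp add: F_def X_def ei emeasure_density)
    also have "\<dots> = (\<integral>\<^sup>+x\<in>{i - h i..i + h i}. ennreal (f x) \<partial>lborel)"
    proof (rule nn_integral_cong_AE)
      have "AE x in lborel. x \<noteq> i - h i \<and> x \<noteq> i + h i"
        by (intro AE_conjI AE_lborel_singleton)
      then show "AE x in lborel. ennreal (f x) * indicator (ball i (h i)) x = ennreal (f x) * indicator {i - h i..i + h i} x"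
        by eventually_elim (auto simp: indicator_def dist_real_def)
    qed
    also have "\<dots> = ennreal (integral {i - h i..i + h i} f)"
      by (rule nn_integral_continuous_Icc) (auto intro: nn continuous_on_subset[OF f])
    finally have 1: "emeasure F (X n) = ennreal (integral {i - h i..i + h i} f)" .
    have "Y n = {i - 5 * h i<..<i + 5 * h i}" using i by (auto simp: Y_def ei dist_real_def)
    then have "emeasure lborel (Y n) = ennreal (10 * h i)" using h[OF iE] by simp
    also have "\<dots> \<le> ennreal (5 / y * integral {i - h i..i + h i} f)"
      using h[OF iE] y by (intro ennreal_leI) (simp add: field_simps)
    also have "\<dots> = ennreal (5 / y) * emeasure F (X n)"
      using y by (subst ennreal_mult') (auto simp: 1)
    finally show ?thesis .
  qed (simp add: Y_def)
  have "E \<subseteq> (\<Union>n. Y n)"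
  proof
    fix t assume "t \<in> E"
    then obtain i where "i \<in> C" "t \<in> ball i (5 * h i)" using C(4) by auto
    then have "t \<in> Y (e i)" by (simp add: Y_def ei)
    then show "t \<in> (\<Union>n. Y n)" by auto
  qed
  then have "emeasure lborel E \<le> emeasure lborel (\<Union>n. Y n)"
    using Ym by (intro emeasure_mono) auto
  also have "\<dots> \<le> (\<Sum>n. emeasure lborel (Y n))"
    using Ym by (intro emeasure_subadditive_countably) auto
  also have "\<dots> \<le> (\<Sum>n. ennreal (5 / y) * emeasure F (X n))"
    by (intro suminf_le YX) auto
  also have "\<dots> = ennreal (5 / y) * (\<Sum>n. emeasure F (X n))"
    by (rule ennreal_suminf_cmult)
  also have "(\<Sum>n. emeasure F (X n)) = emeasure F (\<Union>n. X n)"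
    using Xm by (intro suminf_emeasure disj) (auto simp: F_def)
  also have "\<dots> \<le> emeasure F {-2 * pi..4 * pi}"
  proof (rule emeasure_mono)
    show "(\<Union>n. X n) \<subseteq> {-2 * pi..4 * pi}"
    proof
      fix x assume "x \<in> (\<Union>n. X n)"
      then obtain i where i: "i \<in> C" "x \<in> ball i (h i)" by (auto simp: X_def ei split: if_splits)
      then have "i \<in> E" using C by auto
      with i h[of i] E[of i] show "x \<in> {-2 * pi..4 * pi}" by (auto simp: dist_real_def)
    qed
  qed (simp add: F_def)
  also have "\<dots> = ennreal (integral {-2 * pi..4 * pi} f)"
    unfolding F_def by (subst emeasure_density) (auto intro!: nn_integral_continuous_Icc nn continuous_on_subset[OF f])
  also have "integral {-2 * pi..4 * pi} f = 3 * integral {0..2 * pi} f"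
  proof -
    have shift: "integral {a + 2 * pi..b + 2 * pi} f = integral {a..b} f" for a b
    proof -
      have "(f has_integral integral {a + 2 * pi..b + 2 * pi} f) {a + 2 * pi..b + 2 * pi}"
        by (rule integrable_integral[OF ci])
      then have "((f \<circ> ((+) (2 * pi))) has_integral integral {a + 2 * pi..b + 2 * pi} f) {a..b}"
        by (subst has_integral_shift_Icc_real)
      moreover have "f \<circ> ((+) (2 * pi)) = f" using per by (simp add: fun_eq_iff add.commute)
      ultimately show ?thesis by (simp add: integral_unique)
    qed
    have "integral {-2 * pi..0} f + integral {0..2 * pi} f = integral {-2 * pi..2 * pi} f"
      "integral {-2 * pi..2 * pi} f + integral {2 * pi..4 * pi} f = integral {-2 * pi..4 * pi} f"
      by (auto intro!: Henstock_Kurzweil_Integration.integral_combine ci)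
    with shift[of "-2 * pi" 0] shift[of 0 "2 * pi"] show ?thesis by simp
  qed
  also have "ennreal (5 / y) * ennreal (3 * integral {0..2 * pi} f) = ennreal (15 / y * integral {0..2 * pi} f)"
    using y by (subst ennreal_mult'[symmetric]) auto
  finally show ?thesis by (simp add: mult_left_mono)
qed

text \<open>
  The square of the maximal function is handled through \<open>S\<close>, which is only assumed to be at most
  that square. If a mean of \<open>f\<close> exceeds \<open>y\<close>, then the same mean of the positive part of
  \<open>f - y / 2\<close> exceeds \<open>y / 2\<close>. The weak type bound for the latter is integrated against \<open>2 y\<close>, and
  Tonelli's theorem leaves the integral of \<open>f - y / 2\<close> over \<open>0 \<le> y \<le> 2 f\<close>, which is \<open>f\<^sup>2\<close>.
\<close>

lemma maximal_strong_type:
  fixes f :: "real \<Rightarrow> real" and S :: "real \<Rightarrow> real"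
  assumes f: "continuous_on UNIV f" and nn: "\<And>x. 0 \<le> f x" and per: "\<And>x. f (x + 2 * pi) = f x"
    and S: "S \<in> borel_measurable borel" "\<And>t. 0 \<le> S t"
    and dom: "\<And>t y. t \<in> {0..2 * pi} \<Longrightarrow> 0 < y \<Longrightarrow> y\<^sup>2 < S t \<Longrightarrow>
       (\<exists>h. 0 < h \<and> h \<le> pi \<and> 2 * h * y < integral {t - h..t + h} f)"
  shows "(\<integral>\<^sup>+t\<in>{0..2 * pi}. ennreal (S t) \<partial>lborel) \<le> ennreal (60 * integral {0..2 * pi} (\<lambda>t. (f t)\<^sup>2))"
proof -
  note [measurable] = S(1)
  have fm[measurable]: "f \<in> borel_measurable borel" using f by (rule borel_measurable_continuous_onI)
  have ci: "f integrable_on {a..b}" for a b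
    by (rule integrable_continuous_interval) (rule continuous_on_subset[OF f], simp)
  let ?P = "\<lambda>y t. max 0 (f t - y / 2)"
  have cP: "continuous_on A (?P y)" for y A
    by (intro continuous_intros continuous_on_subset[OF f]) auto
  define E where "E = (\<lambda>y. {t \<in> {0..2 * pi}. y\<^sup>2 < S t})"
  have Em[measurable]: "E y \<in> sets lborel" for y unfolding E_def by measurable
  have level: "emeasure lborel (E y) \<le> ennreal (30 / y) * (\<integral>\<^sup>+t\<in>{0..2 * pi}. ennreal (?P y t) \<partial>lborel)"
    if y: "0 < y" for y
  proof -
    have "emeasure lborel (E y) \<le> ennreal (15 / (y / 2) * integral {0..2 * pi} (?P y))"
    proof (rule maximal_weak_type)
      show "continuous_on UNIV (?P y)" by (rule cP)
      show "max 0 (f (x + 2 * pi) - y / 2) = max 0 (f x - y / 2)" for x by (simp add: per)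
      fix t assume t: "t \<in> E y"
      then obtain h where h: "0 < h" "h \<le> pi" "2 * h * y < integral {t - h..t + h} f"
        using dom[of t y] y by (auto simp: E_def)
      have "integral {t - h..t + h} f - h * y = integral {t - h..t + h} (\<lambda>t. f t - y / 2)"
        using ci h by (subst Henstock_Kurzweil_Integration.integral_diff) auto
      also have "\<dots> \<le> integral {t - h..t + h} (?P y)"
        by (intro integral_le integrable_continuous_interval cP integrable_diff ci) auto
      finally show "t \<in> {0..2 * pi} \<and> (\<exists>h>0. h \<le> pi \<and> 2 * h * (y / 2) < integral {t - h..t + h} (?P y))"
        using t h by (intro conjI exI[of _ h]) (auto simp: E_def)
    qed (use y Em in auto)
    also have "\<dots> = ennreal (30 / y) * ennreal (integral {0..2 * pi} (?P y))"
      using y by (subst ennreal_mult'[symmetric]) auto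
    also have "ennreal (integral {0..2 * pi} (?P y)) = (\<integral>\<^sup>+t\<in>{0..2 * pi}. ennreal (?P y t) \<partial>lborel)"
      by (intro nn_integral_continuous_Icc[symmetric] cP) auto
    finally show ?thesis .
  qed
  (* The layer cake formula for the square of sqrt s. *)
  have layer: "ennreal s = (\<integral>\<^sup>+y. ennreal (2 * y) * indicator {y. 0 < y \<and> y\<^sup>2 < s} y \<partial>lborel)" if "0 \<le> s" for s :: real
  proof -
    have "((\<lambda>y. 2 * y) has_integral (sqrt s)\<^sup>2 - 0\<^sup>2) {0..sqrt s}"
      by (rule fundamental_theorem_of_calculus)
         (auto simp: that has_real_derivative_iff_has_vector_derivative[symmetric] intro!: derivative_eq_intros)
    then have "(\<integral>\<^sup>+y\<in>{0..sqrt s}. ennreal (2 * y) \<partial>lborel) = ennreal ((sqrt s)\<^sup>2 - 0\<^sup>2)"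
      by (intro nn_integral_has_integral_lebesgue') auto
    then have "ennreal s = (\<integral>\<^sup>+y\<in>{0..sqrt s}. ennreal (2 * y) \<partial>lborel)" using that by simp
    also have "\<dots> = (\<integral>\<^sup>+y. ennreal (2 * y) * indicator {y. 0 < y \<and> y\<^sup>2 < s} y \<partial>lborel)"
    proof (rule nn_integral_cong_AE)
      have "AE y in lborel. y \<noteq> 0 \<and> y \<noteq> sqrt s" by (intro AE_conjI AE_lborel_singleton)
      then show "AE y in lborel. ennreal (2 * y) * indicator {0..sqrt s} y = ennreal (2 * y) * indicator {y. 0 < y \<and> y\<^sup>2 < s} y"
      proof eventually_elim
        case (elim y)
        have "y \<le> sqrt s \<longleftrightarrow> y\<^sup>2 < s" if "0 < y"
          using elim that real_less_rsqrt[of y s] \<open>0 \<le> s\<close>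
          by (metis less_eq_real_def real_less_lsqrt real_sqrt_less_iff real_sqrt_unique order_less_imp_le)
        with elim show ?case by (auto simp: indicator_def)
      qed
    qed
    finally show ?thesis .
  qed
  have "(\<integral>\<^sup>+t\<in>{0..2 * pi}. ennreal (S t) \<partial>lborel)
      = (\<integral>\<^sup>+t. (\<integral>\<^sup>+y. ennreal (2 * y) * indicator {0<..} y * indicator (E y) t \<partial>lborel) \<partial>lborel)"
  proof (rule nn_integral_cong)
    fix t
    have "ennreal (S t) * indicator {0..2 * pi} t
       = (\<integral>\<^sup>+y. ennreal (2 * y) * indicator {y. 0 < y \<and> y\<^sup>2 < S t} y * indicator {0..2 * pi} t \<partial>lborel)"
      by (subst layer[OF S(2)]) (rule nn_integral_multc[symmetric], measurable)
    also have "\<dots> = (\<integral>\<^sup>+y. ennreal (2 * y) * indicator {0<..} y * indicator (E y) t \<partial>lborel)"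
      by (intro nn_integral_cong) (auto simp: indicator_def E_def)
    finally show "ennreal (S t) * indicator {0..2 * pi} t = \<dots>" .
  qed
  also have "\<dots> = (\<integral>\<^sup>+y. (\<integral>\<^sup>+t. ennreal (2 * y) * indicator {0<..} y * indicator (E y) t \<partial>lborel) \<partial>lborel)"
    unfolding E_def by (rule lborel_pair.Fubini'[symmetric]) measurable
  also have "\<dots> = (\<integral>\<^sup>+y. ennreal (2 * y) * indicator {0<..} y * emeasure lborel (E y) \<partial>lborel)"
    by (intro nn_integral_cong) (subst nn_integral_cmult_indicator, use Em in auto)
  also have "\<dots> \<le> (\<integral>\<^sup>+y. 60 * (indicator {0<..} y * (\<integral>\<^sup>+t\<in>{0..2 * pi}. ennreal (?P y t) \<partial>lborel)) \<partial>lborel)"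
  proof (intro nn_integral_mono)
    fix y :: real
    show "ennreal (2 * y) * indicator {0<..} y * emeasure lborel (E y)
        \<le> 60 * (indicator {0<..} y * (\<integral>\<^sup>+t\<in>{0..2 * pi}. ennreal (?P y t) \<partial>lborel))"
    proof (cases "0 < y")
      case True
      have "ennreal (2 * y) * emeasure lborel (E y) \<le>
          ennreal (2 * y) * (ennreal (30 / y) * (\<integral>\<^sup>+t\<in>{0..2 * pi}. ennreal (?P y t) \<partial>lborel))"
        by (intro mult_left_mono level True) auto
      also have "\<dots> = 60 * (\<integral>\<^sup>+t\<in>{0..2 * pi}. ennreal (?P y t) \<partial>lborel)"
      proof -
        have "ennreal (2 * y) * ennreal (30 / y) = ennreal 60"
          using True by (subst ennreal_mult'[symmetric]) auto
        then show ?thesis by (simp add: mult.assoc[symmetric])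
      qed
      finally show ?thesis using True by simp
    qed simp
  qed
  also have "\<dots> = 60 * (\<integral>\<^sup>+y. (\<integral>\<^sup>+t. indicator {0<..} y * (ennreal (?P y t) * indicator {0..2 * pi} t) \<partial>lborel) \<partial>lborel)"
    by (subst nn_integral_cmult[symmetric], measurable) (simp add: nn_integral_cmult)
  also have "(\<integral>\<^sup>+y. (\<integral>\<^sup>+t. indicator {0<..} y * (ennreal (?P y t) * indicator {0..2 * pi} t) \<partial>lborel) \<partial>lborel)
     = (\<integral>\<^sup>+t. (\<integral>\<^sup>+y. indicator {0<..} y * (ennreal (?P y t) * indicator {0..2 * pi} t) \<partial>lborel) \<partial>lborel)"
    by (rule lborel_pair.Fubini') measurable
  also have "\<dots> = (\<integral>\<^sup>+t\<in>{0..2 * pi}. ennreal ((f t)\<^sup>2) \<partial>lborel)"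
  proof (rule nn_integral_cong)
    fix t
    have "((\<lambda>y. f t - y / 2) has_integral (f t * (2 * f t) - (2 * f t)\<^sup>2 / 4) - (f t * 0 - 0\<^sup>2 / 4)) {0..2 * f t}"
      by (rule fundamental_theorem_of_calculus)
         (auto simp: nn has_real_derivative_iff_has_vector_derivative[symmetric] intro!: derivative_eq_intros)
    then have "(\<integral>\<^sup>+y\<in>{0..2 * f t}. ennreal (f t - y / 2) \<partial>lborel)
        = ennreal ((f t * (2 * f t) - (2 * f t)\<^sup>2 / 4) - (f t * 0 - 0\<^sup>2 / 4))"
      by (intro nn_integral_has_integral_lebesgue') auto
    also have "(f t * (2 * f t) - (2 * f t)\<^sup>2 / 4) - (f t * 0 - 0\<^sup>2 / 4) = (f t)\<^sup>2"
      by (simp add: power2_eq_square)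
    also have "(\<integral>\<^sup>+y\<in>{0..2 * f t}. ennreal (f t - y / 2) \<partial>lborel) = (\<integral>\<^sup>+y. indicator {0<..} y * ennreal (?P y t) \<partial>lborel)"
    proof (rule nn_integral_cong_AE)
      have "AE y in lborel. y \<noteq> (0::real)" by (rule AE_lborel_singleton)
      then show "AE y in lborel. ennreal (f t - y / 2) * indicator {0..2 * f t} y = indicator {0<..} y * ennreal (?P y t)"
        by eventually_elim (auto simp: indicator_def max_def ennreal_neg)
    qed
    finally have "(\<integral>\<^sup>+y. indicator {0<..} y * ennreal (?P y t) \<partial>lborel) = ennreal ((f t)\<^sup>2)" .
    then show "(\<integral>\<^sup>+y. indicator {0<..} y * (ennreal (?P y t) * indicator {0..2 * pi} t) \<partial>lborel)
        = ennreal ((f t)\<^sup>2) * indicator {0..2 * pi} t"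
      by (simp add: mult.assoc[symmetric] nn_integral_multc)
  qed
  also have "\<dots> = ennreal (integral {0..2 * pi} (\<lambda>t. (f t)\<^sup>2))"
    by (intro nn_integral_continuous_Icc continuous_intros continuous_on_subset[OF f]) auto
  also have "60 * ennreal (integral {0..2 * pi} (\<lambda>t. (f t)\<^sup>2)) = ennreal (60 * integral {0..2 * pi} (\<lambda>t. (f t)\<^sup>2))"
    by (simp add: ennreal_mult')
  finally show ?thesis .
qed

lemma mult_less_one:
  fixes a x :: real
  assumes "0 \<le> a" "a < 1" "x \<le> 1" shows "a * x < 1"
  using mult_left_mono[OF assms(3,1)] assms(2) by simp

section \<open>Boundary values on the circle\<close>

text \<open>
  On the circle \<open>cnj z\<close> is the inverse of \<open>z\<close>, so a real polynomial in real and imaginary part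
  becomes a Laurent polynomial; multiplication by a power of \<open>z\<close> clears the denominators.
\<close>

lemma real_polynomial_on_circle:
  assumes "real_polynomial_function (g :: complex \<Rightarrow> real)"
  shows "\<exists>n p. \<forall>z\<in>sphere 0 1. of_real (g z) * z ^ n = poly p z"
  using assms
proof induction
  case (linear f)
  have f: "f z = Re z * f 1 + Im z * f \<i>" for z
  proof -
    interpret bounded_linear f by fact
    have "z = Re z *\<^sub>R 1 + Im z *\<^sub>R \<i>" by (simp add: complex_eq_iff)
    then have "f z = f (Re z *\<^sub>R 1 + Im z *\<^sub>R \<i>)" by simp
    then show ?thesis by (simp add: add scaleR)
  qed
  (* A real linear functional of z is c * z + cnj (c * z). *)
  define c where "c = Complex (f 1 / 2) (- f \<i> / 2)"
  have "of_real (f z) * z ^ 1 = poly [:cnj c, 0, c:] z" if "z \<in> sphere 0 1" for z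
  proof -
    have "z * cnj z = 1" using that by (simp add: complex_norm_square[symmetric])
    moreover have "of_real (f z) = c * z + cnj c * cnj z"
      by (simp add: f[of z] c_def complex_eq_iff algebra_simps)
    ultimately show ?thesis by (simp add: algebra_simps)
  qed
  then show ?case by blast
next
  case (const c)
  show ?case by (intro exI[of _ 0] exI[of _ "[:of_real c:]"]) simp
next
  case (add f g)
  then obtain m p n q where *: "\<forall>z\<in>sphere 0 1. of_real (f z) * z ^ m = poly p z"
      "\<forall>z\<in>sphere 0 1. of_real (g z) * z ^ n = poly q z" by blast
  have "of_real (f z + g z) * z ^ (m + n) = poly (p * monom 1 n + q * monom 1 m) z" if "z \<in> sphere 0 1" for z
  proof -
    have "of_real (f z + g z) * z ^ (m + n) = (of_real (f z) * z ^ m) * z ^ n + (of_real (g z) * z ^ n) * z ^ m"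
      by (simp add: algebra_simps power_add)
    also have "\<dots> = poly p z * z ^ n + poly q z * z ^ m" using * that by metis
    finally show ?thesis by (simp add: poly_monom)
  qed
  then show ?case by blast
next
  case (mult f g)
  then obtain m p n q where *: "\<forall>z\<in>sphere 0 1. of_real (f z) * z ^ m = poly p z"
      "\<forall>z\<in>sphere 0 1. of_real (g z) * z ^ n = poly q z" by blast
  have "of_real (f z * g z) * z ^ (m + n) = poly (p * q) z" if "z \<in> sphere 0 1" for z
  proof -
    have "of_real (f z * g z) * z ^ (m + n) = (of_real (f z) * z ^ m) * (of_real (g z) * z ^ n)"
      by (simp add: algebra_simps power_add)
    also have "\<dots> = poly p z * poly q z" using * that by metis
    finally show ?thesis by simp
  qed
  then show ?case by blast
qed

text \<open>
  Replaces the solution of a Dirichlet problem: the Stone-Weierstrass theorem gives a real Laurent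
  polynomial near \<open>\<phi>\<close>, and its negative powers are reflected, because \<open>c z\<^sup>-\<^sup>m\<close> and \<open>cnj c z\<^sup>m\<close>
  have the same real part on the circle.
\<close>

lemma circle_approx_Re_holomorphic:
  fixes \<phi> :: "complex \<Rightarrow> real"
  assumes "continuous_on (sphere 0 1) \<phi>" "0 < e"
  obtains G where "G holomorphic_on UNIV" "\<And>z. z \<in> sphere 0 1 \<Longrightarrow> \<bar>Re (G z) - \<phi> z\<bar> \<le> e"
proof -
  obtain g where g: "real_polynomial_function g" "\<And>x. x \<in> sphere 0 1 \<Longrightarrow> \<bar>\<phi> x - g x\<bar> < e"
    using Stone_Weierstrass_real_polynomial_function[OF compact_sphere assms] by blast
  obtain n p where np: "\<forall>z\<in>sphere 0 1. of_real (g z) * z ^ n = poly p z"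
    using real_polynomial_on_circle[OF g(1)] by blast
  define G where "G = (\<lambda>z. \<Sum>i\<le>degree p. if n \<le> i then coeff p i * z ^ (i - n) else cnj (coeff p i) * z ^ (n - i))"
  have "G holomorphic_on UNIV"
    unfolding G_def
  proof (rule holomorphic_on_sum)
    fix i
    show "(\<lambda>z. if n \<le> i then coeff p i * z ^ (i - n) else cnj (coeff p i) * z ^ (n - i)) holomorphic_on UNIV"
      by (cases "n \<le> i") (auto intro!: holomorphic_intros)
  qed
  moreover have "Re (G z) = g z" if z: "z \<in> sphere 0 1" for z
  proof -
    have zz: "z * cnj z = 1" using z by (simp add: complex_norm_square[symmetric])
    then have zzn: "z ^ k * cnj z ^ k = 1" for k by (simp add: power_mult_distrib[symmetric])
    have "of_real (g z) = of_real (g z) * z ^ n * cnj z ^ n" by (simp add: zzn mult.assoc)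
    also have "\<dots> = (\<Sum>i\<le>degree p. coeff p i * z ^ i * cnj z ^ n)"
      using np z by (simp add: poly_altdef sum_distrib_right)
    finally have "g z = (\<Sum>i\<le>degree p. Re (coeff p i * z ^ i * cnj z ^ n))"
      by (metis Re_complex_of_real Re_sum)
    also have "\<dots> = Re (G z)"
      unfolding G_def Re_sum
    proof (intro sum.cong refl)
      fix i
      show "Re (coeff p i * z ^ i * cnj z ^ n) =
          Re (if n \<le> i then coeff p i * z ^ (i - n) else cnj (coeff p i) * z ^ (n - i))"
      proof (cases "n \<le> i")
        case True
        then have "z ^ i = z ^ (i - n) * z ^ n" by (simp add: power_add[symmetric])
        then have "z ^ i * cnj z ^ n = z ^ (i - n)" by (simp add: zzn mult.assoc)
        then show ?thesis using True by (simp add: mult.assoc)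
      next
        case False
        then have "cnj z ^ n = cnj z ^ i * cnj z ^ (n - i)" by (simp add: power_add[symmetric])
        then have "z ^ i * cnj z ^ n = cnj z ^ (n - i)" by (simp add: zzn mult.assoc[symmetric])
        then have "coeff p i * z ^ i * cnj z ^ n = cnj (cnj (coeff p i) * z ^ (n - i))"
          by (simp add: mult.assoc)
        then show ?thesis using False by (simp only: if_False cnj.sel)
      qed
    qed
    finally show ?thesis ..
  qed
  ultimately show ?thesis using g(2) that[of G] by (metis abs_minus_commute less_imp_le)
qed

lemma Poisson_formula_Re:
  assumes "G holomorphic_on cball 0 1" "0 \<le> r" "r < 1"
  shows "((\<lambda>s. poisson r s * Re (G (cis (t + s)))) has_integral 2 * pi * Re (G (of_real r * cis t))) {-pi..pi}"
  using has_integral_Re[OF Poisson_formula[OF assms, of t]] by simp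

text \<open>
  Let \<open>Re G\<close> lie slightly above \<open>ln (\<bar>F\<bar> + e)\<close> on the circle. By the maximum principle
  \<open>F exp (- G)\<close> has modulus at most 1, so \<open>\<bar>F\<bar>\<^sup>1\<^sup>/\<^sup>2 \<le> exp (Re G / 2)\<close> in the disc. There
  \<open>Re G / 2\<close> is the Poisson integral of its boundary values, and Jensen's inequality moves the
  exponential inside. Finally \<open>e\<close>, which keeps the logarithm finite at the zeros of \<open>F\<close>, tends to
  0.
\<close>

lemma sqrt_norm_le_Poisson:
  assumes F: "F holomorphic_on cball 0 1" and r: "0 \<le> r" "r < 1"
  shows "2 * pi * sqrt (cmod (F (of_real r * cis t)))
    \<le> integral {-pi..pi} (\<lambda>s. poisson r s * sqrt (cmod (F (cis (t + s)))))"
proof -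
  let ?I = "integral {-pi..pi} (\<lambda>s. poisson r s * sqrt (cmod (F (cis (t + s)))))"
  define z where "z = of_real r * cis t"
  have contF: "continuous_on (cball 0 1) F" by (rule holomorphic_on_imp_continuous_on[OF F])
  have contFc: "continuous_on A (\<lambda>s. F (cis (t + s)))" for A :: "real set"
    by (rule continuous_on_compose2[OF contF]) (auto intro!: continuous_intros)
  have hasI: "((\<lambda>s. poisson r s * sqrt (cmod (F (cis (t + s))))) has_integral ?I) {-pi..pi}"
    by (intro integrable_integral integrable_continuous_interval continuous_intros contFc r)
  have key: "2 * pi * sqrt (cmod (F z)) \<le> exp e * (?I + 2 * pi * sqrt e)" if e: "0 < e" for e
  proof -
    define \<phi> where "\<phi> = (\<lambda>w. ln (cmod (F w) + e))"
    have pos: "0 < cmod (F w) + e" for w using e by (simp add: add_nonneg_pos)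
    have "continuous_on (sphere 0 1) \<phi>"
      unfolding \<phi>_def using pos
      by (intro continuous_intros continuous_on_subset[OF contF]) (auto simp: less_imp_neq[symmetric] simp del: less_imp_neq)
    then obtain G0 where G0: "G0 holomorphic_on UNIV" "\<And>w. w \<in> sphere 0 1 \<Longrightarrow> \<bar>Re (G0 w) - \<phi> w\<bar> \<le> e"
      using circle_approx_Re_holomorphic e by metis
    define G where "G = (\<lambda>w. G0 w + of_real e)"
    have G: "G holomorphic_on A" for A
      unfolding G_def by (intro holomorphic_intros holomorphic_on_subset[OF G0(1)]) auto
    have ge: "\<phi> w \<le> Re (G w)" and le: "Re (G w) \<le> \<phi> w + 2 * e" if "w \<in> sphere 0 1" for w
      using G0(2)[OF that] by (auto simp: G_def)
    have "cmod (F z * exp (- G z)) \<le> 1"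
    proof (rule maximum_modulus_frontier[where f = "\<lambda>z. F z * exp (- G z)" and S = "cball 0 1"])
      show "(\<lambda>z. F z * exp (- G z)) holomorphic_on interior (cball 0 1)"
        by (intro holomorphic_intros holomorphic_on_subset[OF F] G) auto
      show "continuous_on (closure (cball 0 1)) (\<lambda>z. F z * exp (- G z))"
        by (intro continuous_intros) (auto intro: contF holomorphic_on_imp_continuous_on[OF G])
      fix w :: complex assume "w \<in> frontier (cball 0 1)"
      then have w: "w \<in> sphere 0 1" by simp
      have "cmod (F w * exp (- G w)) = cmod (F w) * exp (- Re (G w))" by (simp add: norm_mult)
      also have "\<dots> \<le> cmod (F w) * exp (- \<phi> w)" using ge[OF w] by (intro mult_left_mono) auto
      also have "\<dots> = cmod (F w) / (cmod (F w) + e)" using pos[of w] by (simp add: \<phi>_def exp_minus divide_inverse)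
      also have "\<dots> \<le> 1" using pos[of w] e by simp
      finally show "cmod (F w * exp (- G w)) \<le> 1" .
    qed (use r in \<open>auto simp: z_def norm_mult\<close>)
    moreover have "cmod (F z * exp (- G z)) = cmod (F z) * exp (- Re (G z))" by (simp add: norm_mult)
    ultimately have Fz: "cmod (F z) \<le> exp (Re (G z))"
      by (simp only: exp_minus) (simp add: field_simps)
    define a where "a = Re (G z) / 2"
    define x where "x = (\<lambda>s. Re (G (cis (t + s))) / 2)"
    have contx: "continuous_on A x" for A
      unfolding x_def by (intro continuous_intros continuous_on_compose2[OF holomorphic_on_imp_continuous_on[OF G[of UNIV]]]) auto
    have "((\<lambda>s. poisson r s * Re (G (cis (t + s))) / 2) has_integral 2 * pi * Re (G z) / 2) {-pi..pi}"
      unfolding z_def by (intro has_integral_divide Poisson_formula_Re G r)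
    then have intx: "((\<lambda>s. poisson r s * x s) has_integral 2 * pi * a) {-pi..pi}"
      by (simp add: x_def a_def)
    have "((\<lambda>s. exp a * (poisson r s * (1 - a) + poisson r s * x s)) has_integral
        exp a * (2 * pi * (1 - a) + 2 * pi * a)) {-pi..pi}"
      by (intro has_integral_mult_right has_integral_add has_integral_mult_left intx poisson_has_integral r)
    moreover have "((\<lambda>s. exp e * (poisson r s * sqrt (cmod (F (cis (t + s)))) + poisson r s * sqrt e)) has_integral
        exp e * (?I + 2 * pi * sqrt e)) {-pi..pi}"
      by (intro has_integral_mult_right has_integral_add has_integral_mult_left hasI poisson_has_integral r)
    ultimately have "exp a * (2 * pi * (1 - a) + 2 * pi * a) \<le> exp e * (?I + 2 * pi * sqrt e)"
    proof (rule has_integral_le)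
      fix s :: real
      have w: "cis (t + s) \<in> sphere 0 1" by simp
      (* Jensen: the exponential lies above its tangent at the mean value a. *)
      have "exp a * (1 - a + x s) \<le> exp a * exp (x s - a)"
        using exp_ge_add_one_self[of "x s - a"] by (intro mult_left_mono) (linarith, simp)
      also have "\<dots> = exp (x s)" by (simp add: exp_add[symmetric])
      also have "\<dots> \<le> exp (\<phi> (cis (t + s)) / 2 + e)" using le[OF w] by (simp add: x_def)
      also have "\<dots> = exp e * sqrt (cmod (F (cis (t + s))) + e)"
      proof -
        have "exp (\<phi> (cis (t + s)) / 2) ^ 2 = exp (\<phi> (cis (t + s)))" by (simp add: exp_double[symmetric])
        also have "\<dots> = cmod (F (cis (t + s))) + e" using pos by (simp add: \<phi>_def)
        finally have "exp (\<phi> (cis (t + s)) / 2) = sqrt (cmod (F (cis (t + s))) + e)"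
          by (metis exp_ge_zero real_sqrt_unique)
        then show ?thesis by (simp add: exp_add)
      qed
      also have "\<dots> \<le> exp e * (sqrt (cmod (F (cis (t + s)))) + sqrt e)"
        using e by (intro mult_left_mono sqrt_add_le_add_sqrt) auto
      finally have "poisson r s * (exp a * (1 - a + x s)) \<le> poisson r s * (exp e * (sqrt (cmod (F (cis (t + s)))) + sqrt e))"
        by (rule mult_left_mono[OF _ poisson_nonneg[OF r]])
      then show "exp a * (poisson r s * (1 - a) + poisson r s * x s)
          \<le> exp e * (poisson r s * sqrt (cmod (F (cis (t + s)))) + poisson r s * sqrt e)"
        by (simp add: algebra_simps)
    qed
    then have "2 * pi * exp a \<le> exp e * (?I + 2 * pi * sqrt e)" by (simp add: algebra_simps)
    moreover have "sqrt (cmod (F z)) \<le> exp a"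
    proof (rule real_le_lsqrt)
      have "(exp a)\<^sup>2 = exp (Re (G z))" by (simp add: a_def exp_double[symmetric])
      then show "cmod (F z) \<le> (exp a)\<^sup>2" using Fz by simp
    qed auto
    ultimately show ?thesis by (meson mult_left_mono order_trans pi_ge_zero zero_le_mult_iff zero_le_numeral)
  qed
  have "((\<lambda>e. exp e * (?I + 2 * pi * sqrt e)) \<longlongrightarrow> exp 0 * (?I + 2 * pi * sqrt 0)) (at_right 0)"
    by (intro tendsto_intros)
  then have "2 * pi * sqrt (cmod (F z)) \<le> exp 0 * (?I + 2 * pi * sqrt 0)"
    by (rule tendsto_lowerbound) (auto simp: eventually_at_right_less intro!: eventually_at_rightI[of 0 1] key)
  then show ?thesis by (simp add: z_def)
qed

text \<open>
  Reduces suprema over an interval of radii to countable ones, for the sake of measurability.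
\<close>

lemma ex_gt_iff_ex_rat:
  fixes g :: "real \<Rightarrow> real"
  assumes "continuous_on {a<..<b} g"
  shows "(\<exists>r\<in>{a<..<b}. y < g r) \<longleftrightarrow> (\<exists>r\<in>{a<..<b} \<inter> \<rat>. y < g r)"
proof
  assume "\<exists>r\<in>{a<..<b}. y < g r"
  then obtain r where r: "r \<in> {a<..<b}" "y < g r" by auto
  have "open {r \<in> {a<..<b}. y < g r}"
    using continuous_open_preimage[OF assms open_greaterThanLessThan open_greaterThan[of y]]
    by (simp add: vimage_def Int_def)
  then obtain e where e: "0 < e" "\<And>s. dist s r < e \<Longrightarrow> s \<in> {r \<in> {a<..<b}. y < g r}"
    using r unfolding open_dist by blast
  obtain q where "q \<in> \<rat>" "r < q" "q < r + e" using Rats_dense_in_real[of r "r + e"] e by auto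
  then show "\<exists>r\<in>{a<..<b} \<inter> \<rat>. y < g r" using e(2)[of q] by (auto simp: dist_real_def)
qed auto

lemma SUP_eq_SUP_rat:
  fixes g :: "real \<Rightarrow> real"
  assumes "continuous_on {a<..<b} g" "\<And>r. 0 \<le> g r"
  shows "(SUP r\<in>{a<..<b}. ennreal (g r)) = (SUP r\<in>{a<..<b} \<inter> \<rat>. ennreal (g r))"
proof (rule antisym)
  show "(SUP r\<in>{a<..<b}. ennreal (g r)) \<le> (SUP r\<in>{a<..<b} \<inter> \<rat>. ennreal (g r))"
  proof (rule SUP_least)
    fix r assume r: "r \<in> {a<..<b}"
    show "ennreal (g r) \<le> (SUP r\<in>{a<..<b} \<inter> \<rat>. ennreal (g r))"
      unfolding le_SUP_iff
    proof (intro allI impI)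
      fix y assume y: "y < ennreal (g r)"
      then obtain u where u: "y = ennreal u" "0 \<le> u" by (cases y) auto
      then have "u < g r" using y by (simp add: ennreal_less_iff)
      then obtain q where "q \<in> {a<..<b} \<inter> \<rat>" "u < g q" using ex_gt_iff_ex_rat[OF assms(1), of u] r by blast
      then show "\<exists>i\<in>{a<..<b} \<inter> \<rat>. y < ennreal (g i)" using u by (auto simp: ennreal_less_iff)
    qed
  qed
qed (rule SUP_subset_mono, auto)

section \<open>Harmonic functions on the disc\<close>

text \<open>
  Complex harmonic functions, encoded by holomorphic functions whose real parts are the real and
  the imaginary part; the lemmas below are derived from holomorphic ones in this form.
\<close>

definition harmonic_disc :: "(complex \<Rightarrow> complex) \<Rightarrow> bool" where
  "harmonic_disc F \<longleftrightarrow> (\<exists>H1 H2. H1 holomorphic_on ball 0 1 \<and> H2 holomorphic_on ball 0 1 \<and>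
     (\<forall>z\<in>ball 0 1. F z = Complex (Re (H1 z)) (Re (H2 z))))"

lemma harmonic_disc_holomorphic:
  assumes "F holomorphic_on ball 0 1"
  shows "harmonic_disc F"
  unfolding harmonic_disc_def
  by (rule exI[of _ F], rule exI[of _ "\<lambda>z. - \<i> * F z"]) (auto intro!: holomorphic_intros assms simp: complex_eq_iff)

lemma continuous_on_harmonic_disc:
  assumes "harmonic_disc F" shows "continuous_on (ball 0 1) F"
proof -
  obtain H1 H2 where H: "H1 holomorphic_on ball 0 1" "H2 holomorphic_on ball 0 1"
     "\<And>z. z \<in> ball 0 1 \<Longrightarrow> F z = Complex (Re (H1 z)) (Re (H2 z))"
    using assms unfolding harmonic_disc_def by blast
  have "continuous_on (ball 0 1) (\<lambda>z. Complex (Re (H1 z)) (Re (H2 z)))"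
    unfolding Complex_eq
    by (intro continuous_intros holomorphic_on_imp_continuous_on[OF H(1)] holomorphic_on_imp_continuous_on[OF H(2)])
  then show ?thesis by (rule continuous_on_eq) (simp add: H(3))
qed

lemma continuous_on_harmonic_circle:
  assumes "harmonic_disc F" "0 \<le> \<rho>" "\<rho> < 1" "continuous_on A g"
  shows "continuous_on A (\<lambda>s. F (of_real \<rho> * cis (g s)))"
  by (rule continuous_on_compose2[OF continuous_on_harmonic_disc[OF assms(1)]])
     (use assms in \<open>auto intro!: continuous_intros simp: norm_mult\<close>)

lemma continuous_on_harmonic_radius:
  assumes "harmonic_disc F" "\<rho> \<le> 1"
  shows "continuous_on {0<..<\<rho>} (\<lambda>r. F (of_real r * cis t))"
  by (rule continuous_on_compose2[OF continuous_on_harmonic_disc[OF assms(1)]])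
     (use assms in \<open>auto intro!: continuous_intros simp: norm_mult\<close>)

lemma harmonic_disc_le_Poisson:
  assumes F: "harmonic_disc F" and r: "0 \<le> r" "r < \<rho>" "\<rho> < 1"
  shows "2 * pi * cmod (F (of_real r * cis t))
    \<le> integral {-pi..pi} (\<lambda>s. poisson (r / \<rho>) s * cmod (F (of_real \<rho> * cis (t + s))))"
proof -
  obtain H1 H2 where H: "H1 holomorphic_on ball 0 1" "H2 holomorphic_on ball 0 1"
     "\<And>z. z \<in> ball 0 1 \<Longrightarrow> F z = Complex (Re (H1 z)) (Re (H2 z))"
    using F unfolding harmonic_disc_def by blast
  have q: "0 \<le> r / \<rho>" "r / \<rho> < 1" using r by auto
  have *: "(\<lambda>z. H (of_real \<rho> * z)) holomorphic_on cball 0 1" if "H holomorphic_on ball 0 1" for H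
    by (rule holomorphic_on_compose_gen[OF _ that, unfolded o_def])
       (use r in \<open>auto intro!: holomorphic_intros simp: norm_mult mult_less_one\<close>)
  have rr: "of_real \<rho> * (of_real (r / \<rho>) * cis t) = of_real r * cis t" using r by simp
  have bound: "of_real r * cis t \<in> ball 0 1" "of_real \<rho> * cis s \<in> ball 0 1" for s
    using r by (auto simp: norm_mult)
  have "((\<lambda>s. of_real (poisson (r / \<rho>) s * Re (H1 (of_real \<rho> * cis (t + s)))) +
           \<i> * of_real (poisson (r / \<rho>) s * Re (H2 (of_real \<rho> * cis (t + s)))))
       has_integral of_real (2 * pi * Re (H1 (of_real r * cis t))) + \<i> * of_real (2 * pi * Re (H2 (of_real r * cis t)))) {-pi..pi}"
    using Poisson_formula_Re[OF *[OF H(1)] q, of t] Poisson_formula_Re[OF *[OF H(2)] q, of t]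
    unfolding rr by (intro has_integral_add has_integral_mult_right has_integral_of_real)
  then have int: "((\<lambda>s. of_real (poisson (r / \<rho>) s) * F (of_real \<rho> * cis (t + s)))
       has_integral of_real (2 * pi) * F (of_real r * cis t)) {-pi..pi}"
    unfolding H(3)[OF bound(1)] H(3)[OF bound(2)] Complex_eq by (simp add: algebra_simps)
  have "cmod (integral {-pi..pi} (\<lambda>s. of_real (poisson (r / \<rho>) s) * F (of_real \<rho> * cis (t + s))))
     \<le> integral {-pi..pi} (\<lambda>s. poisson (r / \<rho>) s * cmod (F (of_real \<rho> * cis (t + s))))"
  proof (rule integral_norm_bound_integral)
    show "(\<lambda>s. poisson (r / \<rho>) s * cmod (F (of_real \<rho> * cis (t + s)))) integrable_on {- pi..pi}"
      using r by (intro integrable_continuous_interval continuous_intros continuous_on_harmonic_circle[OF F] q) auto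
  qed (use int poisson_nonneg[OF q] in \<open>auto simp: norm_mult has_integral_integrable\<close>)
  then show ?thesis using integral_unique[OF int] by (simp add: norm_mult)
qed

text \<open>
  The contrapositive of \<open>Poisson_integral_le\<close>: a large Poisson integral forces a large interval
  mean, which is what the covering argument needs.
\<close>

lemma average_gt_of_le_Poisson:
  fixes f :: "real \<Rightarrow> real"
  assumes "continuous_on UNIV f" "0 \<le> r" "r < 1"
    and "2 * pi * u \<le> integral {-pi..pi} (\<lambda>s. poisson r s * f (t + s))" "y < u"
  shows "\<exists>h. 0 < h \<and> h \<le> pi \<and> 2 * h * y < integral {t - h..t + h} f"
proof (rule ccontr)
  assume "\<not> ?thesis"
  then have "integral {-pi..pi} (\<lambda>s. poisson r s * f (t + s)) \<le> 2 * pi * y"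
    by (intro Poisson_integral_le[OF assms(1-3)]) (auto simp: not_less)
  with assms(4) have "2 * pi * u \<le> 2 * pi * y" by linarith
  with assms(5) show False by simp
qed

lemma radial_superlevel_measurable:
  assumes F: "harmonic_disc F" and \<rho>: "\<rho> \<le> 1"
  shows "{t \<in> {a..b}. \<exists>r\<in>{0<..<\<rho>}. y < cmod (F (of_real r * cis t))} \<in> sets lborel"
proof -
  have "{t \<in> {a..b}. \<exists>r\<in>{0<..<\<rho>}. y < cmod (F (of_real r * cis t))}
      = (\<Union>r\<in>{0<..<\<rho>} \<inter> \<rat>. {t \<in> {a..b}. y < cmod (F (of_real r * cis t))})"
    using ex_gt_iff_ex_rat[of 0 \<rho> "\<lambda>r. cmod (F (of_real r * cis _))" y]
    by (auto simp: continuous_on_norm[OF continuous_on_harmonic_radius[OF F \<rho>]])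
  also have "\<dots> \<in> sets lborel"
  proof (rule sets.countable_UN'')
    show "countable ({0<..<\<rho>} \<inter> \<rat>)" by (intro countable_Int2 countable_rat)
    fix r assume "r \<in> {0<..<\<rho>} \<inter> \<rat>"
    then have "(\<lambda>t. cmod (F (of_real r * cis t))) \<in> borel_measurable borel"
      using \<rho> by (intro borel_measurable_continuous_onI continuous_intros continuous_on_harmonic_circle[OF F]) auto
    then show "{t \<in> {a..b}. y < cmod (F (of_real r * cis t))} \<in> sets lborel" by measurable
  qed
  finally show ?thesis .
qed

text \<open>
  On a smaller disc the function is dominated by the Poisson integral of its modulus on the
  boundary circle, and a Poisson integral by interval means.
\<close>

lemma harmonic_weak_type:
  assumes F: "harmonic_disc F" and \<rho>: "0 < \<rho>" "\<rho> < 1" and y: "0 < y"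
  shows "emeasure lborel {t \<in> {0..2 * pi}. \<exists>r\<in>{0<..<\<rho>}. y < cmod (F (of_real r * cis t))}
    \<le> ennreal (15 / y * integral {0..2 * pi} (\<lambda>t. cmod (F (of_real \<rho> * cis t))))"
proof (rule maximal_weak_type[OF _ _ _ y])
  show cont: "continuous_on UNIV (\<lambda>t. cmod (F (of_real \<rho> * cis t)))"
    using \<rho> by (intro continuous_intros continuous_on_harmonic_circle[OF F]) auto
  show "cmod (F (of_real \<rho> * cis (x + 2 * pi))) = cmod (F (of_real \<rho> * cis x))" for x
    by (simp add: cis_mult[symmetric])
  show "{t \<in> {0..2 * pi}. \<exists>r\<in>{0<..<\<rho>}. y < cmod (F (of_real r * cis t))} \<in> sets lborel"
    using \<rho> by (intro radial_superlevel_measurable[OF F]) auto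
  fix t assume "t \<in> {t \<in> {0..2 * pi}. \<exists>r\<in>{0<..<\<rho>}. y < cmod (F (of_real r * cis t))}"
  then obtain r where t: "t \<in> {0..2 * pi}" and r: "0 < r" "r < \<rho>" "y < cmod (F (of_real r * cis t))" by auto
  have "\<exists>h>0. h \<le> pi \<and> 2 * h * y < integral {t - h..t + h} (\<lambda>t. cmod (F (of_real \<rho> * cis t)))"
    using average_gt_of_le_Poisson[OF cont _ _ harmonic_disc_le_Poisson[OF F _ r(2) \<rho>(2)] r(3)] r \<rho> by simp
  with t show "t \<in> {0..2 * pi} \<and> (\<exists>h>0. h \<le> pi \<and> 2 * h * y < integral {t - h..t + h} (\<lambda>t. cmod (F (of_real \<rho> * cis t))))"
    by blast
qed simp

text \<open>
  The strong type bound is applied to \<open>\<bar>F\<bar>\<^sup>1\<^sup>/\<^sup>2\<close> on the circle of radius \<open>\<rho>\<close>, whose square is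
  \<open>\<bar>F\<bar>\<close>.
\<close>

lemma H1_maximal_disc:
  assumes F: "F holomorphic_on ball 0 1" and \<rho>: "0 < \<rho>" "\<rho> < 1"
  shows "(\<integral>\<^sup>+t\<in>{0..2 * pi}. (SUP r\<in>{0<..<\<rho>}. ennreal (cmod (F (of_real r * cis t)))) \<partial>lborel)
    \<le> ennreal (60 * integral {0..2 * pi} (\<lambda>t. cmod (F (of_real \<rho> * cis t))))"
proof -
  note hF = harmonic_disc_holomorphic[OF F]
  let ?f = "\<lambda>t. sqrt (cmod (F (of_real \<rho> * cis t)))"
  define S where "S = (\<lambda>t. SUP r\<in>{0<..<\<rho>}. ennreal (cmod (F (of_real r * cis t))))"
  have "compact (F ` cball 0 \<rho>)"
    using \<rho> by (intro compact_continuous_image continuous_on_subset[OF continuous_on_harmonic_disc[OF hF]]) auto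
  then obtain B where B: "\<And>z. z \<in> cball 0 \<rho> \<Longrightarrow> cmod (F z) \<le> B"
    by (meson bounded_iff compact_imp_bounded image_eqI)
  have "S t \<le> ennreal B" for t unfolding S_def
    by (intro SUP_least ennreal_leI B) (auto simp: norm_mult)
  then have fin: "ennreal (enn2real (S t)) = S t" for t
    by (intro ennreal_enn2real) (use ennreal_less_top le_less_trans in blast)
  have "S = (\<lambda>t. SUP r\<in>{0<..<\<rho>} \<inter> \<rat>. ennreal (cmod (F (of_real r * cis t))))"
    unfolding S_def using \<rho>
    by (intro ext SUP_eq_SUP_rat continuous_on_norm continuous_on_harmonic_radius[OF hF]) auto
  also have "\<dots> \<in> borel_measurable borel"
  proof (rule borel_measurable_SUP)
    show "countable ({0<..<\<rho>} \<inter> \<rat>)" by (intro countable_Int2 countable_rat)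
    fix r assume "r \<in> {0<..<\<rho>} \<inter> \<rat>"
    then have "(\<lambda>t. cmod (F (of_real r * cis t))) \<in> borel_measurable borel"
      using \<rho> by (intro borel_measurable_continuous_onI continuous_intros continuous_on_harmonic_circle[OF hF]) auto
    then show "(\<lambda>t. ennreal (cmod (F (of_real r * cis t)))) \<in> borel_measurable borel" by measurable
  qed
  finally have Sm: "S \<in> borel_measurable borel" .
  have cont: "continuous_on UNIV ?f"
    using \<rho> by (intro continuous_intros continuous_on_harmonic_circle[OF hF]) auto
  have "(\<integral>\<^sup>+t\<in>{0..2 * pi}. ennreal (enn2real (S t)) \<partial>lborel) \<le> ennreal (60 * integral {0..2 * pi} (\<lambda>t. (?f t)\<^sup>2))"
  proof (rule maximal_strong_type[OF cont])
    show "sqrt (cmod (F (of_real \<rho> * cis (x + 2 * pi)))) = sqrt (cmod (F (of_real \<rho> * cis x)))" for x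
      by (simp add: cis_mult[symmetric])
    show "(\<lambda>t. enn2real (S t)) \<in> borel_measurable borel" using Sm by measurable
    fix t y :: real assume t: "t \<in> {0..2 * pi}" and y: "0 < y" "y\<^sup>2 < enn2real (S t)"
    then have "ennreal (y\<^sup>2) < S t" by (subst fin[symmetric]) (simp add: ennreal_less_iff)
    then obtain r where r: "r \<in> {0<..<\<rho>}" "ennreal (y\<^sup>2) < ennreal (cmod (F (of_real r * cis t)))"
      unfolding S_def less_SUP_iff by auto
    then have "y < sqrt (cmod (F (of_real r * cis t)))"
      using y by (simp add: ennreal_less_iff real_less_rsqrt)
    moreover have "(\<lambda>z. F (of_real \<rho> * z)) holomorphic_on cball 0 1"
      by (rule holomorphic_on_compose_gen[OF _ F, unfolded o_def])
         (use \<rho> in \<open>auto intro!: holomorphic_intros simp: norm_mult mult_less_one\<close>)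
    from sqrt_norm_le_Poisson[OF this, of "r / \<rho>" t] r \<rho>
    have "2 * pi * sqrt (cmod (F (of_real r * cis t))) \<le> integral {-pi..pi} (\<lambda>s. poisson (r / \<rho>) s * ?f (t + s))"
      by simp
    ultimately show "\<exists>h>0. h \<le> pi \<and> 2 * h * y < integral {t - h..t + h} ?f"
      using average_gt_of_le_Poisson[OF cont, of "r / \<rho>"] r \<rho> by simp
  qed auto
  then show ?thesis unfolding fin by (simp add: S_def)
qed

section \<open>Fatou's theorem\<close>

text \<open>
  Expresses convergence without naming the limit and with countably many quantifiers over bounds,
  so that the set of points of convergence can be shown to be measurable.
\<close>

lemma at_left_limit_iff_Cauchy:
  fixes g :: "real \<Rightarrow> 'a::complete_space"
  shows "(\<exists>L. (g \<longlongrightarrow> L) (at_left 1)) \<longleftrightarrow>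
    (\<forall>n::nat. \<exists>m::nat. \<forall>r\<in>{1 - 1 / Suc m<..<1}. \<forall>s\<in>{1 - 1 / Suc m<..<1}. dist (g r) (g s) \<le> 1 / Suc n)"
proof
  assume "\<exists>L. (g \<longlongrightarrow> L) (at_left 1)"
  then obtain L where L: "(g \<longlongrightarrow> L) (at_left 1)" by blast
  show "\<forall>n::nat. \<exists>m::nat. \<forall>r\<in>{1 - 1 / Suc m<..<1}. \<forall>s\<in>{1 - 1 / Suc m<..<1}. dist (g r) (g s) \<le> 1 / Suc n"
  proof
    fix n :: nat
    have "eventually (\<lambda>r. dist (g r) L < 1 / Suc n / 2) (at_left 1)" by (rule tendstoD[OF L]) simp
    then obtain b where b: "b < 1" "\<And>r. b < r \<Longrightarrow> r < 1 \<Longrightarrow> dist (g r) L < 1 / Suc n / 2"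
      unfolding eventually_at_left_field by blast
    obtain m where m: "inverse (real (Suc m)) < 1 - b" using reals_Archimedean[of "1 - b"] b by auto
    have "dist (g r) (g s) \<le> 1 / Suc n" if "r \<in> {1 - 1 / Suc m<..<1}" "s \<in> {1 - 1 / Suc m<..<1}" for r s
    proof -
      have "b < r" "r < 1" "b < s" "s < 1" using that m by (auto simp: inverse_eq_divide)
      then have "dist (g r) L < 1 / Suc n / 2" "dist (g s) L < 1 / Suc n / 2" by (simp_all only: b(2))
      then show ?thesis using dist_triangle2[of "g r" "g s" L] by linarith
    qed
    then show "\<exists>m::nat. \<forall>r\<in>{1 - 1 / Suc m<..<1}. \<forall>s\<in>{1 - 1 / Suc m<..<1}. dist (g r) (g s) \<le> 1 / Suc n" by blast
  qed
next
  assume C: "\<forall>n::nat. \<exists>m::nat. \<forall>r\<in>{1 - 1 / Suc m<..<1}. \<forall>s\<in>{1 - 1 / Suc m<..<1}. dist (g r) (g s) \<le> 1 / Suc n"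
  define x where "x = (\<lambda>k. 1 - 1 / real (Suc (Suc k)))"
  have xin: "x k \<in> {1 - 1 / real (Suc m)<..<1}" if "m \<le> k" for k m
    using that by (auto simp: x_def frac_less2)
  have small: "\<exists>m. \<forall>r\<in>{1 - 1 / Suc m<..<1}. \<forall>s\<in>{1 - 1 / Suc m<..<1}. dist (g r) (g s) < e" if e: "0 < e" for e
  proof -
    obtain n where n: "inverse (real (Suc n)) < e" using reals_Archimedean[OF e] by auto
    obtain m where m: "\<forall>r\<in>{1 - 1 / Suc m<..<1}. \<forall>s\<in>{1 - 1 / Suc m<..<1}. dist (g r) (g s) \<le> 1 / Suc n"
      using C by blast
    have "dist (g r) (g s) < e" if "r\<in>{1 - 1 / Suc m<..<1}" "s\<in>{1 - 1 / Suc m<..<1}" for r s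
    proof -
      have "dist (g r) (g s) \<le> 1 / Suc n" using m that by blast
      also have "\<dots> < e" using n by (simp add: inverse_eq_divide)
      finally show ?thesis .
    qed
    then show ?thesis by blast
  qed
  have "Cauchy (\<lambda>k. g (x k))"
  proof (rule metric_CauchyI)
    fix e :: real assume "0 < e"
    then obtain m where m: "\<And>r s. r\<in>{1 - 1 / Suc m<..<1} \<Longrightarrow> s\<in>{1 - 1 / Suc m<..<1} \<Longrightarrow> dist (g r) (g s) < e"
      using small by blast
    show "\<exists>M. \<forall>i\<ge>M. \<forall>j\<ge>M. dist (g (x i)) (g (x j)) < e"
      using m xin by blast
  qed
  then obtain L where L: "(\<lambda>k. g (x k)) \<longlonglongrightarrow> L" using Cauchy_convergent convergent_def by blast
  have "(g \<longlongrightarrow> L) (at_left 1)"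
  proof (rule tendstoI)
    fix e :: real assume e: "0 < e"
    then have "0 < e / 2" by simp
    from small[OF this] obtain m where m: "\<And>r s. r\<in>{1 - 1 / Suc m<..<1} \<Longrightarrow> s\<in>{1 - 1 / Suc m<..<1} \<Longrightarrow> dist (g r) (g s) < e / 2"
      by blast
    have "dist (g r) L < e" if r: "r \<in> {1 - 1 / Suc m<..<1}" for r
    proof -
      have "dist (g r) L \<le> e / 2"
        by (rule LIMSEQ_le_const2[OF tendsto_dist[OF tendsto_const L]])
           (use m[OF r] xin in \<open>auto intro!: exI[of _ m] less_imp_le\<close>)
      then show ?thesis using e by linarith
    qed
    then show "eventually (\<lambda>r. dist (g r) L < e) (at_left 1)"
      unfolding eventually_at_left_field by (intro exI[of _ "1 - 1 / Suc m"]) auto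
  qed
  then show "\<exists>L. (g \<longlongrightarrow> L) (at_left 1)" by blast
qed

definition radii :: "nat \<Rightarrow> real" where
  "radii n = 1 - 1 / real (Suc (Suc n))"

lemma radii_bounds: "0 < radii n" "radii n < 1"
  by (auto simp: radii_def)

lemma radii_incseq: "incseq radii"
  by (rule incseq_SucI) (simp add: radii_def frac_le)

lemma radii_tendsto: "radii \<longlonglongrightarrow> 1"
proof -
  have "(\<lambda>n. 1 - inverse (real (Suc (Suc n)))) \<longlonglongrightarrow> 1 - 0"
    by (intro tendsto_diff tendsto_const LIMSEQ_Suc[OF LIMSEQ_inverse_real_of_nat])
  then show ?thesis by (simp add: radii_def[abs_def] inverse_eq_divide)
qed

lemma radii_at_left: "filterlim radii (at_left 1) sequentially"
proof -
  have "radii n \<noteq> 1" for n using radii_bounds(2)[of n] by simp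
  then show ?thesis using radii_tendsto radii_bounds by (auto simp: filterlim_at intro!: always_eventually)
qed

lemma ex_radii_gt: "r < 1 \<Longrightarrow> \<exists>n. r < radii n"
  using order_tendstoD(1)[OF radii_tendsto] by (auto simp: eventually_sequentially)

lemma cis_has_integral:
  "((\<lambda>t. cis (of_int j * t)) has_integral (if j = 0 then 2 * pi else 0)) {0..2 * pi}"
proof (cases "j = 0")
  case True
  then show ?thesis using has_integral_const_real[of "1::complex" 0 "2 * pi"] by (simp add: scaleR_conv_of_real)
next
  case False
  define F where "F = (\<lambda>t::real. cis (of_int j * t) / (\<i> * of_int j))"
  have "((\<lambda>t. cis (of_int j * t)) has_integral F (2 * pi) - F 0) {0..2 * pi}"
  proof (rule fundamental_theorem_of_calculus)
    fix t assume "t \<in> {0..2 * pi}"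
    have "((\<lambda>t. exp (\<i> * of_int j * of_real t)) has_vector_derivative (exp (\<i> * of_int j * of_real t) * (\<i> * of_int j))) (at t within {0..2 * pi})"
      by (rule has_vector_derivative_real_field) (auto intro!: derivative_eq_intros)
    then have "((\<lambda>t. exp (\<i> * of_int j * of_real t) / (\<i> * of_int j)) has_vector_derivative (exp (\<i> * of_int j * of_real t) * (\<i> * of_int j)) / (\<i> * of_int j)) (at t within {0..2 * pi})"
      by (rule has_vector_derivative_divide)
    then show "(F has_vector_derivative cis (of_int j * t)) (at t within {0..2 * pi})"
      using False by (simp add: F_def cis_conv_exp mult.assoc)
  qed simp
  moreover have "cis (of_int j * (2 * pi)) = 1"
  proof -
    have "of_int j * (2 * pi) = 2 * pi * of_int j" by simp
    then show ?thesis by (metis cis_multiple_2pi Ints_of_int)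
  qed
  ultimately show ?thesis using False by (simp add: F_def)
qed

text \<open>
  The series converges uniformly, hence may be integrated term by term.
\<close>

lemma Fourier_series_integral_sums:
  fixes c :: "nat \<Rightarrow> complex"
  assumes c: "summable (\<lambda>k. cmod (c k))" and h: "continuous_on {0..2 * pi} h"
  shows "(\<lambda>k. c k * integral {0..2 * pi} (\<lambda>t. cis (real k * t) * h t)) sums
      integral {0..2 * pi} (\<lambda>t. (\<Sum>k. c k * cis (real k * t)) * h t)"
    and "continuous_on A (\<lambda>t. \<Sum>k. c k * cis (real k * t))"
proof -
  show "continuous_on A (\<lambda>t. \<Sum>k. c k * cis (real k * t))"
    by (rule uniform_limit_theorem[OF _ Weierstrass_m_test[OF _ c]])
       (auto intro!: always_eventually continuous_intros simp: norm_mult)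
  have "bounded (h ` {0..2 * pi})" by (intro compact_imp_bounded compact_continuous_image h compact_Icc)
  then obtain B where B: "\<And>t. t \<in> {0..2 * pi} \<Longrightarrow> cmod (h t) \<le> B" unfolding bounded_iff by blast
  have "uniform_limit {0..2 * pi} (\<lambda>n t. \<Sum>k<n. c k * cis (real k * t) * h t) (\<lambda>t. \<Sum>k. c k * cis (real k * t) * h t) sequentially"
    using B by (intro Weierstrass_m_test[OF _ summable_mult2[OF c, of B]]) (auto simp: norm_mult intro: mult_left_mono)
  moreover have "(\<Sum>k. c k * cis (real k * t) * h t) = (\<Sum>k. c k * cis (real k * t)) * h t" for t
    by (rule suminf_mult2[symmetric], rule summable_norm_cancel) (use c in \<open>simp add: norm_mult\<close>)
  ultimately have ul: "uniform_limit {0..2 * pi} (\<lambda>n t. \<Sum>k<n. c k * cis (real k * t) * h t) (\<lambda>t. (\<Sum>k. c k * cis (real k * t)) * h t) sequentially"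
    by simp
  obtain I J where IJ: "\<And>n. ((\<lambda>t. \<Sum>k<n. c k * cis (real k * t) * h t) has_integral I n) {0..2 * pi}"
    "((\<lambda>t. (\<Sum>k. c k * cis (real k * t)) * h t) has_integral J) {0..2 * pi}" "I \<longlonglongrightarrow> J"
    by (rule uniform_limit_integral[OF ul]) (auto intro!: continuous_intros h)
  have "I = (\<lambda>n. \<Sum>k<n. c k * integral {0..2 * pi} (\<lambda>t. cis (real k * t) * h t))"
  proof (rule ext, rule has_integral_unique[OF IJ(1)])
    fix n
    have "((\<lambda>t. \<Sum>k<n. c k * (cis (real k * t) * h t)) has_integral
        (\<Sum>k<n. c k * integral {0..2 * pi} (\<lambda>t. cis (real k * t) * h t))) {0..2 * pi}"
      by (intro has_integral_sum has_integral_mult_right integrable_integral integrable_continuous_interval continuous_intros h) auto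
    then show "((\<lambda>t. \<Sum>k<n. c k * cis (real k * t) * h t) has_integral
        (\<Sum>k<n. c k * integral {0..2 * pi} (\<lambda>t. cis (real k * t) * h t))) {0..2 * pi}"
      by (simp add: mult.assoc)
  qed
  then show "(\<lambda>k. c k * integral {0..2 * pi} (\<lambda>t. cis (real k * t) * h t)) sums
      integral {0..2 * pi} (\<lambda>t. (\<Sum>k. c k * cis (real k * t)) * h t)"
    using IJ(3) by (simp only: sums_def integral_unique[OF IJ(2)] )
qed

text \<open>
  Termwise integration is used twice: against characters to recover the coefficients, and then
  against the conjugate of the sum itself.
\<close>

lemma Parseval_circle:
  fixes c :: "nat \<Rightarrow> complex"
  assumes c: "summable (\<lambda>k. cmod (c k))"
  shows "(\<lambda>k. 2 * pi * (cmod (c k))\<^sup>2) sums integral {0..2 * pi} (\<lambda>t. (cmod (\<Sum>k. c k * cis (real k * t)))\<^sup>2)"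
proof -
  define g where "g = (\<lambda>t::real. \<Sum>k. c k * cis (real k * t))"
  have cg: "continuous_on A g" for A unfolding g_def by (rule Fourier_series_integral_sums(2)[OF c, of "\<lambda>_. 0"]) auto
  have coeff: "integral {0..2 * pi} (\<lambda>t. g t * cis (- real j * t)) = 2 * pi * c j" for j
  proof -
    have "cis (real k * t) * cis (- real j * t) = cis (of_int (int k - int j) * t)" for k t
      by (simp add: cis_mult algebra_simps)
    then have "integral {0..2 * pi} (\<lambda>t. cis (real k * t) * cis (- real j * t)) = (if k = j then 2 * pi else 0)" for k
      using integral_unique[OF cis_has_integral[of "int k - int j"]] by simp
    then have "(\<lambda>k. c k * (if k = j then 2 * pi else 0)) sums integral {0..2 * pi} (\<lambda>t. g t * cis (- real j * t))"
      using Fourier_series_integral_sums(1)[OF c, of "\<lambda>t. cis (- real j * t)"] by (simp add: g_def continuous_intros)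
    moreover have "(\<lambda>k. c k * complex_of_real (if k = j then 2 * pi else 0)) = (\<lambda>k. if k = j then 2 * pi * c j else 0)"
      by (auto simp: fun_eq_iff)
    ultimately show ?thesis using sums_single[of j "\<lambda>_. 2 * pi * c j"] by (metis (no_types, lifting) sums_unique2)
  qed
  have cc: "integral {0..2 * pi} (\<lambda>t. cis (real k * t) * cnj (g t)) = 2 * pi * cnj (c k)" for k
  proof -
    have "(\<lambda>t. cis (real k * t) * cnj (g t)) = (\<lambda>t. cnj (g t * cis (- real k * t)))"
      by (simp add: fun_eq_iff cis_cnj)
    then have "integral {0..2 * pi} (\<lambda>t. cis (real k * t) * cnj (g t)) = cnj (integral {0..2 * pi} (\<lambda>t. g t * cis (- real k * t)))"
      by (simp only: integral_cnj)
    then show ?thesis by (simp only: coeff) simp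
  qed
  have gt: "(\<Sum>k. c k * cis (real k * t)) = g t" for t by (simp add: g_def)
  have "(\<lambda>k. c k * (2 * pi * cnj (c k))) sums integral {0..2 * pi} (\<lambda>t. g t * cnj (g t))"
    using Fourier_series_integral_sums(1)[OF c continuous_on_cnj[OF cg]] by (simp only: cc gt)
  then have "(\<lambda>k. Re (c k * (2 * pi * cnj (c k)))) sums Re (integral {0..2 * pi} (\<lambda>t. g t * cnj (g t)))"
    by (rule sums_Re)
  moreover have "Re (c k * (2 * pi * cnj (c k))) = 2 * pi * (cmod (c k))\<^sup>2" for k
    by (simp add: cmod_power2) (simp add: power2_eq_square algebra_simps)
  moreover have "Re (integral {0..2 * pi} (\<lambda>t. g t * cnj (g t))) = integral {0..2 * pi} (\<lambda>t. (cmod (g t))\<^sup>2)"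
  proof -
    have "(\<lambda>t. g t * cnj (g t)) integrable_on {0..2 * pi}"
      by (intro integrable_continuous_interval continuous_intros cg)
    from has_integral_Re[OF integrable_integral[OF this]]
    have "((\<lambda>t. (cmod (g t))\<^sup>2) has_integral Re (integral {0..2 * pi} (\<lambda>t. g t * cnj (g t)))) {0..2 * pi}"
      by (simp add: complex_norm_square[symmetric] cmod_power2 power2_eq_square)
    then show ?thesis by (simp add: integral_unique)
  qed
  ultimately show ?thesis by (simp add: g_def)
qed

text \<open>
  Let \<open>D n z = B z - B (\<rho> z)\<close> with \<open>\<rho>\<close> near 1. By Parseval its means on circles are small,
  uniformly in the radius, so by the weak type bound \<open>\<bar>D n\<bar>\<close> exceeds a given \<open>y\<close> on a radius only
  for few directions. On all other radii \<open>B\<close> is within \<open>y\<close> of the function \<open>B (\<rho> z)\<close>, which is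
  continuous up to the boundary, so \<open>B\<close> oscillates by at most \<open>3 y\<close> near the end of the radius.
\<close>

lemma bounded_holomorphic_radial_limits:
  assumes B: "B holomorphic_on ball 0 1" and bd: "\<And>z. z \<in> ball 0 1 \<Longrightarrow> cmod (B z) \<le> 1"
  shows "AE t in lborel. t \<in> {0..2 * pi} \<longrightarrow> (\<exists>L. ((\<lambda>r. B (of_real r * cis t)) \<longlongrightarrow> L) (at_left 1))"
proof -
  define b where "b = (\<lambda>k. (deriv ^^ k) B 0 / fact k)"
  have series: "(\<lambda>k. b k * z ^ k) sums B z" if "z \<in> ball 0 1" for z
    using holomorphic_power_series[OF B that] by (simp add: b_def)
  have abs_sum: "summable (\<lambda>k. cmod (b k) * \<sigma> ^ k)" if \<sigma>: "0 \<le> \<sigma>" "\<sigma> < 1" for \<sigma>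
  proof -
    have "summable (\<lambda>k. b k * of_real ((\<sigma> + 1) / 2) ^ k)"
      using series[of "of_real ((\<sigma> + 1) / 2)"] \<sigma> by (intro sums_summable) auto
    then have "summable (\<lambda>k. norm (b k * of_real \<sigma> ^ k))"
      by (rule powser_insidea) (use \<sigma> in \<open>simp add: abs_le_iff\<close>)
    then show ?thesis using \<sigma> by (simp add: norm_mult norm_power)
  qed
  have Bcis: "(\<lambda>k. b k * of_real \<sigma> ^ k * cis (real k * t)) sums B (of_real \<sigma> * cis t)" if "0 \<le> \<sigma>" "\<sigma> < 1" for \<sigma> t
    using series[of "of_real \<sigma> * cis t"] that by (simp add: norm_mult power_mult_distrib Complex.DeMoivre mult.assoc)
  (* The energies on circles are at most 2 pi, which bounds the partial sums by Parseval. *)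
  have bsum: "summable (\<lambda>k. (cmod (b k))\<^sup>2)"
  proof (rule summableI_nonneg_bounded)
    fix N
    have le: "(\<Sum>k<N. (cmod (b k))\<^sup>2 * \<sigma> ^ (2 * k)) \<le> 1" if \<sigma>: "0 \<le> \<sigma>" "\<sigma> < 1" for \<sigma>
    proof -
      have s: "summable (\<lambda>k. cmod (b k * of_real \<sigma> ^ k))"
        using abs_sum[OF \<sigma>] \<sigma> by (simp add: norm_mult norm_power)
      have eq: "(\<Sum>k. b k * of_real \<sigma> ^ k * cis (real k * t)) = B (of_real \<sigma> * cis t)" for t
        using Bcis[OF \<sigma>, of t] by (simp add: sums_iff)
      have P: "(\<lambda>k. 2 * pi * (cmod (b k * of_real \<sigma> ^ k))\<^sup>2) sums integral {0..2 * pi} (\<lambda>t. (cmod (B (of_real \<sigma> * cis t)))\<^sup>2)"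
        using Parseval_circle[OF s] by (simp only: eq)
      have "(\<Sum>k<N. 2 * pi * (cmod (b k * of_real \<sigma> ^ k))\<^sup>2) \<le> integral {0..2 * pi} (\<lambda>t. (cmod (B (of_real \<sigma> * cis t)))\<^sup>2)"
        using sum_le_suminf[OF sums_summable[OF P], of "{..<N}"] sums_unique[OF P] by simp
      also have "\<dots> \<le> integral {0..2 * pi} (\<lambda>t. 1)"
      proof (rule integral_le)
        show "(\<lambda>t. (cmod (B (of_real \<sigma> * cis t)))\<^sup>2) integrable_on {0..2 * pi}"
          using \<sigma> by (intro integrable_continuous_interval continuous_intros
              continuous_on_harmonic_circle[OF harmonic_disc_holomorphic[OF B]]) auto
      qed (use bd \<sigma> in \<open>auto simp: power_le_one norm_mult\<close>)
      also have "\<dots> = 2 * pi" by simp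
      finally have "2 * pi * (\<Sum>k<N. (cmod (b k * of_real \<sigma> ^ k))\<^sup>2) \<le> 2 * pi * 1" by (simp add: sum_distrib_left)
      then have "(\<Sum>k<N. (cmod (b k * of_real \<sigma> ^ k))\<^sup>2) \<le> 1" by (subst (asm) mult_le_cancel_left_pos) auto
      moreover have "(cmod (b k * of_real \<sigma> ^ k))\<^sup>2 = (cmod (b k))\<^sup>2 * \<sigma> ^ (2 * k)" for k
        using \<sigma> by (simp add: norm_mult norm_power power_mult_distrib power_even_eq)
      ultimately show ?thesis by simp
    qed
    have "((\<lambda>\<sigma>. \<Sum>k<N. (cmod (b k))\<^sup>2 * \<sigma> ^ (2 * k)) \<longlongrightarrow> (\<Sum>k<N. (cmod (b k))\<^sup>2 * 1 ^ (2 * k))) (at_left (1::real))"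
      by (intro tendsto_intros)
    then have "(\<Sum>k<N. (cmod (b k))\<^sup>2 * 1 ^ (2 * k)) \<le> 1"
      by (rule tendsto_upperbound) (auto intro!: eventually_at_leftI[of 0 1] le)
    then show "(\<Sum>k<N. (cmod (b k))\<^sup>2) \<le> 1" by simp
  qed auto
  define V where "V = (\<lambda>\<rho>::real. \<Sum>k. (cmod (b k))\<^sup>2 * (1 - \<rho> ^ k)\<^sup>2)"
  have Vsum: "summable (\<lambda>k. (cmod (b k))\<^sup>2 * (1 - \<rho> ^ k)\<^sup>2)" if "0 \<le> \<rho>" "\<rho> \<le> 1" for \<rho>
    using that by (intro summable_comparison_test'[OF bsum, of 0])
      (auto simp: abs_mult power_le_one intro!: mult_left_le)
  define \<rho> where "\<rho> = radii"
  note \<rho> = radii_bounds[folded \<rho>_def] and \<rho>lim = radii_tendsto[folded \<rho>_def]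
  have V0: "(\<lambda>n. V (\<rho> n)) \<longlonglongrightarrow> 0"
  proof -
    have "(\<lambda>n. \<Sum>k. (cmod (b k))\<^sup>2 * (1 - \<rho> n ^ k)\<^sup>2) \<longlonglongrightarrow> (\<Sum>k. 0 :: real)"
    proof (rule tannerys_theorem[THEN conjunct2, THEN conjunct2])
      show "(\<lambda>n. (cmod (b k))\<^sup>2 * (1 - \<rho> n ^ k)\<^sup>2) \<longlonglongrightarrow> 0" for k
      proof -
        have "(\<lambda>n. (cmod (b k))\<^sup>2 * (1 - \<rho> n ^ k)\<^sup>2) \<longlonglongrightarrow> (cmod (b k))\<^sup>2 * (1 - 1 ^ k)\<^sup>2"
          by (intro tendsto_intros \<rho>lim)
        then show ?thesis by simp
      qed
      have "norm ((cmod (b k))\<^sup>2 * (1 - \<rho> n ^ k)\<^sup>2) \<le> (cmod (b k))\<^sup>2" for k n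
        using \<rho>[of n] by (auto simp: abs_mult power_le_one intro!: mult_left_le)
      then show "\<forall>\<^sub>F (k, n) in sequentially \<times>\<^sub>F sequentially. norm ((cmod (b k))\<^sup>2 * (1 - \<rho> n ^ k)\<^sup>2) \<le> (cmod (b k))\<^sup>2"
        by (intro always_eventually) auto
    qed (use bsum in auto)
    then show ?thesis by (simp add: V_def)
  qed
  define D where "D = (\<lambda>n z. B z - B (of_real (\<rho> n) * z))"
  have D: "D n holomorphic_on ball 0 1" for n
    unfolding D_def
    by (intro holomorphic_intros B holomorphic_on_compose_gen[OF _ B, unfolded o_def])
       (use \<rho>[of n] in \<open>auto simp: norm_mult intro!: mult_less_one\<close>)
  note hD = harmonic_disc_holomorphic[OF D]
  have energy: "integral {0..2 * pi} (\<lambda>t. (cmod (D n (of_real \<sigma> * cis t)))\<^sup>2) \<le> 2 * pi * V (\<rho> n)"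
    if \<sigma>: "0 \<le> \<sigma>" "\<sigma> < 1" for n \<sigma>
  proof -
    define c where "c = (\<lambda>k. b k * of_real \<sigma> ^ k * (1 - of_real (\<rho> n) ^ k))"
    have nc: "cmod (c k) = cmod (b k) * \<sigma> ^ k * (1 - \<rho> n ^ k)" for k
    proof -
      have "cmod (1 - of_real (\<rho> n) ^ k) = \<bar>1 - \<rho> n ^ k\<bar>"
        by (metis norm_of_real of_real_1 of_real_diff of_real_power)
      then show ?thesis using \<sigma> \<rho>[of n] by (simp add: c_def norm_mult norm_power power_le_one)
    qed
    have s: "summable (\<lambda>k. cmod (c k))"
      using \<rho>[of n] \<sigma> by (intro summable_comparison_test'[OF abs_sum[OF \<sigma>], of 0])
        (auto simp: nc abs_mult power_le_one intro!: mult_left_le)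
    have sn: "0 \<le> \<rho> n * \<sigma>" "\<rho> n * \<sigma> < 1" using \<rho>[of n] \<sigma> by (auto intro!: mult_less_one)
    have "(\<lambda>k. b k * of_real \<sigma> ^ k * cis (real k * t) - b k * of_real (\<rho> n * \<sigma>) ^ k * cis (real k * t)) sums
       (B (of_real \<sigma> * cis t) - B (of_real (\<rho> n * \<sigma>) * cis t))" for t
      by (intro sums_diff Bcis \<sigma> sn)
    then have "(\<lambda>k. c k * cis (real k * t)) sums D n (of_real \<sigma> * cis t)" for t
      by (simp add: D_def c_def algebra_simps power_mult_distrib)
    then have eq: "(\<Sum>k. c k * cis (real k * t)) = D n (of_real \<sigma> * cis t)" for t
      by (simp add: sums_iff)
    have P: "(\<lambda>k. 2 * pi * (cmod (c k))\<^sup>2) sums integral {0..2 * pi} (\<lambda>t. (cmod (D n (of_real \<sigma> * cis t)))\<^sup>2)"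
      using Parseval_circle[OF s] by (simp only: eq)
    have "2 * pi * (cmod (c k))\<^sup>2 \<le> 2 * pi * ((cmod (b k))\<^sup>2 * (1 - \<rho> n ^ k)\<^sup>2)" for k
    proof -
      have "(\<sigma> ^ k)\<^sup>2 \<le> 1" using \<sigma> by (intro power_le_one) auto
      then have "((cmod (b k))\<^sup>2 * (1 - \<rho> n ^ k)\<^sup>2) * (\<sigma> ^ k)\<^sup>2 \<le> ((cmod (b k))\<^sup>2 * (1 - \<rho> n ^ k)\<^sup>2) * 1"
        by (intro mult_left_mono) auto
      then show ?thesis by (simp add: nc power_mult_distrib mult_ac)
    qed
    then have "(\<Sum>k. 2 * pi * (cmod (c k))\<^sup>2) \<le> (\<Sum>k. 2 * pi * ((cmod (b k))\<^sup>2 * (1 - \<rho> n ^ k)\<^sup>2))"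
      using \<rho>[of n] by (intro suminf_le sums_summable[OF P] summable_mult Vsum) auto
    also have "\<dots> = 2 * pi * V (\<rho> n)" unfolding V_def using \<rho>[of n] by (intro suminf_mult Vsum) auto
    finally show ?thesis using sums_unique[OF P] by simp
  qed
  (* x \<le> \<delta> + x\<^sup>2 / \<delta> pointwise, with a free \<delta>, in place of the Cauchy-Schwarz inequality. *)
  have L1: "integral {0..2 * pi} (\<lambda>t. cmod (D n (of_real \<sigma> * cis t))) \<le> 2 * pi * (\<delta> + V (\<rho> n) / \<delta>)"
    if \<sigma>: "0 \<le> \<sigma>" "\<sigma> < 1" and \<delta>: "0 < \<delta>" for n \<sigma> \<delta>
  proof -
    have cont: "continuous_on {0..2 * pi} (\<lambda>t. cmod (D n (of_real \<sigma> * cis t)))"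
      by (intro continuous_intros continuous_on_harmonic_circle[OF hD] \<sigma>)
    have "integral {0..2 * pi} (\<lambda>t. cmod (D n (of_real \<sigma> * cis t))) \<le>
        integral {0..2 * pi} (\<lambda>t. \<delta> + (cmod (D n (of_real \<sigma> * cis t)))\<^sup>2 / \<delta>)"
    proof (rule integral_le)
      fix t
      let ?x = "cmod (D n (of_real \<sigma> * cis t))"
      show "?x \<le> \<delta> + ?x\<^sup>2 / \<delta>"
      proof (cases "?x \<le> \<delta>")
        case False
        then have "?x * \<delta> \<le> ?x\<^sup>2" by (simp add: power2_eq_square mult_left_mono)
        then have "?x \<le> ?x\<^sup>2 / \<delta>" using \<delta> by (simp add: pos_le_divide_eq)
        then show ?thesis using \<delta> by linarith
      qed (use \<delta> in \<open>simp add: add_increasing2\<close>)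
    qed (use \<delta> in \<open>auto intro!: integrable_continuous_interval continuous_intros cont\<close>)
    also have "\<dots> = 2 * pi * \<delta> + integral {0..2 * pi} (\<lambda>t. (cmod (D n (of_real \<sigma> * cis t)))\<^sup>2) / \<delta>"
    proof -
      have "((\<lambda>t. \<delta> + (cmod (D n (of_real \<sigma> * cis t)))\<^sup>2 / \<delta>) has_integral
          (2 * pi - 0) *\<^sub>R \<delta> + integral {0..2 * pi} (\<lambda>t. (cmod (D n (of_real \<sigma> * cis t)))\<^sup>2) / \<delta>) {0..2 * pi}"
        by (intro has_integral_add has_integral_divide integrable_integral
            integrable_continuous_interval continuous_intros cont) (use has_integral_const_real[of \<delta> 0 "2 * pi"] in simp)
      then show ?thesis by (simp add: integral_unique)
    qed
    also have "\<dots> \<le> 2 * pi * \<delta> + 2 * pi * V (\<rho> n) / \<delta>"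
      using energy[OF \<sigma>, of n] \<delta> by (intro add_left_mono divide_right_mono) auto
    finally show ?thesis by (simp add: algebra_simps)
  qed
  define E where "E = (\<lambda>n y. {t \<in> {0..2 * pi}. \<exists>r\<in>{0<..<1}. y < cmod (D n (of_real r * cis t))})"
  have Em: "E n y \<in> sets lborel" for n y
    unfolding E_def by (rule radial_superlevel_measurable[OF hD]) simp
  have Ebound: "emeasure lborel (E n y) \<le> ennreal (15 / y * (2 * pi * (\<delta> + V (\<rho> n) / \<delta>)))" if y: "0 < y" and \<delta>: "0 < \<delta>" for n y \<delta>
  proof -
    define Ek where "Ek = (\<lambda>k. {t \<in> {0..2 * pi}. \<exists>r\<in>{0<..<\<rho> k}. y < cmod (D n (of_real r * cis t))})"
    have inc: "incseq Ek"
    proof (rule incseq_SucI)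
      fix k
      have "\<rho> k \<le> \<rho> (Suc k)" by (simp add: \<rho>_def radii_def frac_le)
      then show "Ek k \<le> Ek (Suc k)" by (fastforce simp: Ek_def)
    qed
    have U: "E n y = (\<Union>k. Ek k)"
    proof
      show "E n y \<subseteq> (\<Union>k. Ek k)"
      proof
        fix t assume "t \<in> E n y"
        then obtain r where r: "t \<in> {0..2 * pi}" "0 < r" "r < 1" "y < cmod (D n (of_real r * cis t))" by (auto simp: E_def)
        have "eventually (\<lambda>k. r < \<rho> k) sequentially" using order_tendstoD(1)[OF \<rho>lim r(3)] .
        then obtain k where "r < \<rho> k" by (auto simp: eventually_sequentially)
        then have "t \<in> Ek k" using r by (auto simp: Ek_def)
        then show "t \<in> (\<Union>k. Ek k)" by blast
      qed
      show "(\<Union>k. Ek k) \<subseteq> E n y" using \<rho>(2) by (fastforce simp: Ek_def E_def intro: less_trans)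
    qed
    have "Ek k \<in> sets lborel" for k
      unfolding Ek_def by (rule radial_superlevel_measurable[OF hD less_imp_le[OF \<rho>(2)]])
    then have S: "(SUP k. emeasure lborel (Ek k)) = emeasure lborel (\<Union>k. Ek k)"
      using inc by (intro SUP_emeasure_incseq image_subsetI)
    have "emeasure lborel (Ek k) \<le> ennreal (15 / y * (2 * pi * (\<delta> + V (\<rho> n) / \<delta>)))" for k
    proof -
      have "emeasure lborel (Ek k) \<le> ennreal (15 / y * integral {0..2 * pi} (\<lambda>t. cmod (D n (of_real (\<rho> k) * cis t))))"
        unfolding Ek_def by (rule harmonic_weak_type[OF hD \<rho> y])
      also have "\<dots> \<le> ennreal (15 / y * (2 * pi * (\<delta> + V (\<rho> n) / \<delta>)))"
        using y by (intro ennreal_leI mult_left_mono L1 \<delta>) (use \<rho>[of k] in auto)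
      finally show ?thesis .
    qed
    then have "(SUP k. emeasure lborel (Ek k)) \<le> ennreal (15 / y * (2 * pi * (\<delta> + V (\<rho> n) / \<delta>)))"
      by (intro SUP_least)
    then show ?thesis by (simp only: U S)
  qed
  have null: "(\<Inter>n. E n y) \<in> null_sets lborel" if y: "0 < y" for y
  proof -
    have small: "emeasure lborel (\<Inter>n. E n y) \<le> 0 + ennreal e" if e: "0 < e" for e :: real
    proof -
      (* 60 pi = 15 * 2 pi * 2: both summands of Ebound are made at most \<delta>. *)
      define \<delta> where "\<delta> = e * y / (60 * pi)"
      have \<delta>: "0 < \<delta>" using e y by (simp add: \<delta>_def)
      have "eventually (\<lambda>n. V (\<rho> n) < \<delta>\<^sup>2) sequentially" using order_tendstoD(2)[OF V0] \<delta> by simp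
      then obtain n where n: "V (\<rho> n) < \<delta>\<^sup>2" by (auto simp: eventually_sequentially)
      then have "V (\<rho> n) / \<delta> \<le> \<delta>" using \<delta> by (simp add: pos_divide_le_eq power2_eq_square)
      have "emeasure lborel (\<Inter>n. E n y) \<le> emeasure lborel (E n y)" by (rule emeasure_mono[OF _ Em]) auto
      also have "\<dots> \<le> ennreal (15 / y * (2 * pi * (\<delta> + V (\<rho> n) / \<delta>)))" by (rule Ebound[OF y \<delta>])
      also have "\<dots> \<le> ennreal (15 / y * (2 * pi * (\<delta> + \<delta>)))"
        using \<open>V (\<rho> n) / \<delta> \<le> \<delta>\<close> y by (intro ennreal_leI mult_left_mono) auto
      also have "15 / y * (2 * pi * (\<delta> + \<delta>)) = e" using y by (simp add: \<delta>_def)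
      finally show ?thesis by simp
    qed
    have "emeasure lborel (\<Inter>n. E n y) \<le> 0" by (rule ennreal_le_epsilon) (rule small)
    moreover have "(\<Inter>n. E n y) \<in> sets lborel" using Em by (intro sets.countable_INT) auto
    ultimately show ?thesis by (simp add: null_sets_def)
  qed
  have "AE t in lborel. t \<notin> (\<Inter>n. E n (1 / (3 * real (Suc j))))" for j :: nat
    by (intro AE_not_in null) simp
  then have "AE t in lborel. \<forall>j::nat. t \<notin> (\<Inter>n. E n (1 / (3 * real (Suc j))))"
    by (simp only: AE_all_countable) blast
  then show ?thesis
  proof eventually_elim
    case (elim t)
    show ?case
    proof
      assume t: "t \<in> {0..2 * pi}"
      show "\<exists>L. ((\<lambda>r. B (of_real r * cis t)) \<longlongrightarrow> L) (at_left 1)"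
        unfolding at_left_limit_iff_Cauchy
      proof
        fix j :: nat
        (* Three estimates by y: one at each of two points of the radius and one between them for the dilated function. *)
        define y where "y = 1 / (3 * real (Suc j))"
        have y: "0 < y" by (simp add: y_def)
        obtain n where "t \<notin> E n y" using elim unfolding y_def by blast
        then have n: "\<And>r. 0 < r \<Longrightarrow> r < 1 \<Longrightarrow> cmod (D n (of_real r * cis t)) \<le> y"
          using t by (auto simp: E_def not_less)
        have "((\<lambda>r. B (of_real (\<rho> n) * (of_real r * cis t))) \<longlongrightarrow> B (of_real (\<rho> n) * (of_real 1 * cis t))) (at_left 1)"
        proof -
          have "continuous_on {0..1} (\<lambda>r. B (of_real (\<rho> n) * (of_real r * cis t)))"
            by (rule continuous_on_compose2[OF holomorphic_on_imp_continuous_on[OF B]])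
               (use \<rho>[of n] in \<open>auto intro!: continuous_intros mult_less_one simp: norm_mult\<close>)
          then have "continuous (at 1 within {0..1}) (\<lambda>r. B (of_real (\<rho> n) * (of_real r * cis t)))"
            by (simp add: continuous_on_eq_continuous_within)
          then have "((\<lambda>r. B (of_real (\<rho> n) * (of_real r * cis t))) \<longlongrightarrow> B (of_real (\<rho> n) * (of_real 1 * cis t))) (at 1 within {0..1})"
            by (simp add: continuous_within)
          moreover have "at_left (1::real) = at 1 within {0..1}" by (rule at_within_Icc_at_left[symmetric]) simp
          ultimately show ?thesis by simp
        qed
        from tendstoD[OF this, of "y / 2"] y
        have "eventually (\<lambda>r. dist (B (of_real (\<rho> n) * (of_real r * cis t))) (B (of_real (\<rho> n) * (of_real 1 * cis t))) < y / 2) (at_left 1)" by simp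
        then obtain a where a: "a < 1" "\<And>r. a < r \<Longrightarrow> r < 1 \<Longrightarrow> dist (B (of_real (\<rho> n) * (of_real r * cis t))) (B (of_real (\<rho> n) * (of_real 1 * cis t))) < y / 2"
          unfolding eventually_at_left_field by blast
        obtain m where m: "inverse (real (Suc m)) < 1 - max a 0" using reals_Archimedean[of "1 - max a 0"] a by auto
        have tri: "dist u v \<le> dist u u' + dist u' w + (dist v v' + dist v' w)" for u v u' w v' :: complex
          using dist_triangle[of u v w] dist_triangle[of u w u'] dist_triangle[of v w v']
          by (simp add: dist_commute)
        have "dist (B (of_real r * cis t)) (B (of_real s * cis t)) \<le> 1 / Suc j"
          if "r \<in> {1 - 1 / Suc m<..<1}" "s \<in> {1 - 1 / Suc m<..<1}" for r s
        proof -
          have r: "0 < r" "a < r" "r < 1" and s: "0 < s" "a < s" "s < 1"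
            using that m by (auto simp: inverse_eq_divide)
          have "cmod (D n (of_real r * cis t)) \<le> y" "cmod (D n (of_real s * cis t)) \<le> y" using n r s by auto
          then have "dist (B (of_real r * cis t)) (B (of_real (\<rho> n) * (of_real r * cis t))) \<le> y"
            "dist (B (of_real s * cis t)) (B (of_real (\<rho> n) * (of_real s * cis t))) \<le> y"
            by (auto simp: D_def dist_norm)
          with a(2)[OF r(2,3)] a(2)[OF s(2,3)]
          have "dist (B (of_real r * cis t)) (B (of_real s * cis t)) \<le> 3 * y"
            using tri[of "B (of_real r * cis t)" "B (of_real s * cis t)" "B (of_real (\<rho> n) * (of_real r * cis t))"
              "B (of_real (\<rho> n) * (of_real 1 * cis t))" "B (of_real (\<rho> n) * (of_real s * cis t))"]
            by linarith
          also have "3 * y = 1 / Suc j" by (simp add: y_def del: of_nat_Suc)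
          finally show ?thesis .
        qed
        then show "\<exists>m::nat. \<forall>r\<in>{1 - 1 / Suc m<..<1}. \<forall>s\<in>{1 - 1 / Suc m<..<1}.
            dist (B (of_real r * cis t)) (B (of_real s * cis t)) \<le> 1 / Suc j" by blast
      qed
    qed
  qed
qed


lemma circle_mean_value_Re:
  assumes "G holomorphic_on cball 0 1"
  shows "((\<lambda>t. Re (G (cis t))) has_integral 2 * pi * Re (G 0)) {0..2 * pi}"
proof -
  have "((\<lambda>s. Re (G (cis (pi + s)))) has_integral 2 * pi * Re (G 0)) {-pi..pi}"
    using Poisson_formula_Re[OF assms, of 0 pi] by (simp add: poisson_def)
  then show ?thesis
    using has_integral_shift_Icc_real[of "\<lambda>t. Re (G (cis t))" pi "2 * pi * Re (G 0)" "-pi" pi]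
    by (simp add: o_def)
qed

lemma holomorphic_dilation:
  assumes "G holomorphic_on ball 0 1" "0 \<le> \<rho>" "\<rho> < 1"
  shows "(\<lambda>z. G (of_real \<rho> * z)) holomorphic_on cball 0 1"
  by (rule holomorphic_on_compose_gen[OF _ assms(1), unfolded o_def])
     (use assms in \<open>auto intro!: holomorphic_intros simp: norm_mult mult_less_one\<close>)

text \<open>
  \<open>Q = 1 / (1 + G)\<close> is bounded by 1 and therefore has radial limits. If such a limit were 0, then
  \<open>ln \<bar>1 + G\<bar>\<close> would tend to infinity along the radius. This function is nonnegative and harmonic,
  being the real part of \<open>Ln (1 + G)\<close>, so its means do not depend on the radius, and Fatou's lemma
  forbids an infinite limit on a set of positive measure.
\<close>

lemma positive_real_part_radial_limits:
  assumes G: "G holomorphic_on ball 0 1" and pos: "\<And>z. z \<in> ball 0 1 \<Longrightarrow> 0 \<le> Re (G z)"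
  shows "AE t in lborel. t \<in> {0..2 * pi} \<longrightarrow> (\<exists>L. ((\<lambda>r. G (of_real r * cis t)) \<longlongrightarrow> L) (at_left 1))"
proof -
  have ge1: "1 \<le> cmod (1 + G z)" if "z \<in> ball 0 1" for z
    using pos[OF that] complex_Re_le_cmod[of "1 + G z"] by simp
  then have nz: "1 + G z \<noteq> 0" if "z \<in> ball 0 1" for z using that by force
  define Q where "Q = (\<lambda>z. 1 / (1 + G z))"
  have Qlim: "AE t in lborel. t \<in> {0..2 * pi} \<longrightarrow> (\<exists>L. ((\<lambda>r. Q (of_real r * cis t)) \<longlongrightarrow> L) (at_left 1))"
  proof (rule bounded_holomorphic_radial_limits)
    show "Q holomorphic_on ball 0 1" unfolding Q_def by (intro holomorphic_intros G nz)
    show "cmod (Q z) \<le> 1" if "z \<in> ball 0 1" for z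
      using ge1[OF that] frac_le[of 1 1 1 "cmod (1 + G z)"] by (simp add: Q_def norm_divide)
  qed
  define \<rho> where "\<rho> = radii"
  note \<rho> = radii_bounds[folded \<rho>_def] and \<rho>lim = radii_tendsto[folded \<rho>_def]
  note \<rho>left = radii_at_left[folded \<rho>_def]
  define u where "u = (\<lambda>n t. ln (cmod (1 + G (of_real (\<rho> n) * cis t))))"
  have in_ball: "of_real (\<rho> n) * cis t \<in> ball 0 1" for n t using \<rho>[of n] by (simp add: norm_mult)
  have u_nn: "0 \<le> u n t" for n t using ge1[OF in_ball[of n t]] by (simp add: u_def)
  have u_int: "(\<integral>\<^sup>+t\<in>{0..2 * pi}. ennreal (u n t) \<partial>lborel) = ennreal (2 * pi * ln (cmod (1 + G 0)))" for n
  proof (rule nn_integral_has_integral_lebesgue')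
    have not_neg: "1 + G z \<notin> \<real>\<^sub>\<le>\<^sub>0" if "z \<in> ball 0 1" for z
      using pos[OF that] by (auto simp: complex_nonpos_Reals_iff)
    have "(\<lambda>z. Ln (1 + G z)) holomorphic_on ball 0 1"
      by (intro holomorphic_intros G not_neg)
    from circle_mean_value_Re[OF holomorphic_dilation[OF this, of "\<rho> n"]] \<rho>[of n]
    have "((\<lambda>t. Re (Ln (1 + G (of_real (\<rho> n) * cis t)))) has_integral 2 * pi * Re (Ln (1 + G 0))) {0..2 * pi}" by simp
    then show "(u n has_integral 2 * pi * ln (cmod (1 + G 0))) {0..2 * pi}"
      using nz[OF in_ball] nz[of 0] by (simp add: u_def[abs_def] Re_Ln)
  qed (rule u_nn)
  have um: "(\<lambda>t. ennreal (u n t) * indicator {0..2 * pi} t) \<in> borel_measurable lborel" for n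
  proof -
    have "(\<lambda>t. G (of_real (\<rho> n) * cis t)) \<in> borel_measurable borel"
      using \<rho>[of n] by (intro borel_measurable_continuous_onI continuous_on_harmonic_circle[OF harmonic_disc_holomorphic[OF G]]) auto
    then have "u n \<in> borel_measurable borel" unfolding u_def by measurable
    then show ?thesis by measurable
  qed
  have "(\<integral>\<^sup>+t. liminf (\<lambda>n. ennreal (u n t) * indicator {0..2 * pi} t) \<partial>lborel)
      \<le> liminf (\<lambda>n. \<integral>\<^sup>+t\<in>{0..2 * pi}. ennreal (u n t) \<partial>lborel)"
    by (rule nn_integral_liminf) (rule um)
  also have "\<dots> < \<infinity>" unfolding u_int by (simp add: Liminf_const)
  finally have "AE t in lborel. liminf (\<lambda>n. ennreal (u n t) * indicator {0..2 * pi} t) \<noteq> \<infinity>"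
    by (intro nn_integral_noteq_infinite borel_measurable_liminf um) auto
  with Qlim show ?thesis
  proof eventually_elim
    case (elim t)
    show ?case
    proof
      assume t: "t \<in> {0..2 * pi}"
      then obtain L where L: "((\<lambda>r. Q (of_real r * cis t)) \<longlongrightarrow> L) (at_left 1)" using elim by auto
      have "L \<noteq> 0"
      proof
        assume "L = 0"
        then have "(\<lambda>n. Q (of_real (\<rho> n) * cis t)) \<longlonglongrightarrow> 0"
          using filterlim_compose[OF L \<rho>left] by simp
        moreover have "eventually (\<lambda>n. Q (of_real (\<rho> n) * cis t) \<noteq> 0) sequentially"
          using nz[OF in_ball] by (auto simp: Q_def)
        ultimately have "filterlim (\<lambda>n. inverse (Q (of_real (\<rho> n) * cis t))) at_infinity sequentially"
          by (intro filterlim_compose[OF filterlim_inverse_at_infinity]) (auto simp: filterlim_at)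
        then have "filterlim (\<lambda>n. cmod (1 + G (of_real (\<rho> n) * cis t))) at_top sequentially"
          by (simp add: Q_def filterlim_at_infinity_imp_norm_at_top)
        then have top: "filterlim (\<lambda>n. u n t) at_top sequentially"
          unfolding u_def by (rule filterlim_compose[OF ln_at_top])
        have "(\<lambda>n. ennreal (u n t)) \<longlonglongrightarrow> \<infinity>"
          using top by (simp add: ennreal_tendsto_top_eq_at_top)
        then have "liminf (\<lambda>n. ennreal (u n t)) = \<infinity>"
          by (intro lim_imp_Liminf) auto
        with elim t show False by simp
      qed
      then have "((\<lambda>r. 1 / Q (of_real r * cis t) - 1) \<longlongrightarrow> 1 / L - 1) (at_left 1)"
        by (intro tendsto_intros L)
      moreover have "eventually (\<lambda>r. 1 / Q (of_real r * cis t) - 1 = G (of_real r * cis t)) (at_left 1)"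
        by (rule eventually_at_leftI[of 0]) (auto simp: Q_def)
      ultimately have "((\<lambda>r. G (of_real r * cis t)) \<longlongrightarrow> 1 / L - 1) (at_left 1)"
        by (simp add: filterlim_cong)
      then show "\<exists>L. ((\<lambda>r. G (of_real r * cis t)) \<longlongrightarrow> L) (at_left 1)" by blast
    qed
  qed
qed

text \<open>
  The real part of \<open>G\<close> approximates, from above, the positive part of \<open>Re H\<close> on the circle of
  radius \<open>\<rho>\<close>; the inequalities extend to the disc because the Poisson kernel is nonnegative.
\<close>

lemma positive_majorant_on_disc:
  assumes H: "H holomorphic_on ball 0 1" and \<rho>: "0 < \<rho>" "\<rho> < 1" and e: "0 < e"
  obtains G where "G holomorphic_on ball 0 1" "\<And>z. z \<in> ball 0 1 \<Longrightarrow> 0 \<le> Re (G z)"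
    "\<And>z. z \<in> ball 0 1 \<Longrightarrow> Re (H (of_real \<rho> * z)) \<le> Re (G z)" "Im (G 0) = 0"
    "2 * pi * Re (G 0) \<le> integral {0..2 * pi} (\<lambda>t. \<bar>Re (H (of_real \<rho> * cis t))\<bar>) + 4 * pi * e"
proof -
  define \<phi> where "\<phi> = (\<lambda>z. max 0 (Re (H (of_real \<rho> * z))) + e)"
  have Hd: "(\<lambda>z. H (of_real \<rho> * z)) holomorphic_on cball 0 1" using \<rho> by (intro holomorphic_dilation H) auto
  have cHd: "continuous_on A (\<lambda>z. H (of_real \<rho> * z))" if "A \<subseteq> cball 0 1" for A
    by (rule continuous_on_subset[OF holomorphic_on_imp_continuous_on[OF Hd] that])
  have "continuous_on (sphere 0 1) \<phi>" unfolding \<phi>_def by (intro continuous_intros cHd) auto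
  then obtain G0 where G0: "G0 holomorphic_on UNIV" "\<And>z. z \<in> sphere 0 1 \<Longrightarrow> \<bar>Re (G0 z) - \<phi> z\<bar> \<le> e"
    using circle_approx_Re_holomorphic e by metis
  define G where "G = (\<lambda>z. G0 z - \<i> * of_real (Im (G0 0)))"
  have G: "G holomorphic_on A" for A
    unfolding G_def by (intro holomorphic_intros holomorphic_on_subset[OF G0(1)]) auto
  have ReG: "Re (G z) = Re (G0 z)" for z by (simp add: G_def)
  have nn: "0 \<le> Re (K z)" if "K holomorphic_on cball 0 1" "\<And>z. z \<in> sphere 0 1 \<Longrightarrow> 0 \<le> Re (K z)" "z \<in> ball 0 1" for K z
  proof -
    have z: "z = of_real (cmod z) * cis (Arg z)" by (metis rcis_cmod_Arg rcis_def)
    have r: "0 \<le> cmod z" "cmod z < 1" using that(3) by auto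
    have "0 \<le> 2 * pi * Re (K (of_real (cmod z) * cis (Arg z)))"
      by (rule has_integral_nonneg[OF Poisson_formula_Re[OF that(1) r]])
         (auto intro!: mult_nonneg_nonneg poisson_nonneg r that(2))
    then have "0 \<le> Re (K (of_real (cmod z) * cis (Arg z)))" using pi_gt_zero by (auto simp: zero_le_mult_iff)
    then show ?thesis using z by simp
  qed
  show ?thesis
  proof (rule that)
    show "G holomorphic_on ball 0 1" by (rule G)
    show "Im (G 0) = 0" by (simp add: G_def)
    show "0 \<le> Re (G z)" if "z \<in> ball 0 1" for z
    proof (rule nn[OF G _ that])
      fix w :: complex assume "w \<in> sphere 0 1"
      from G0(2)[OF this] show "0 \<le> Re (G w)" by (simp add: ReG \<phi>_def)
    qed
    show "Re (H (of_real \<rho> * z)) \<le> Re (G z)" if "z \<in> ball 0 1" for z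
    proof -
      have "0 \<le> Re (G z - H (of_real \<rho> * z))"
      proof (rule nn[OF _ _ that])
        show "(\<lambda>z. G z - H (of_real \<rho> * z)) holomorphic_on cball 0 1" by (intro holomorphic_intros G Hd)
        fix w :: complex assume "w \<in> sphere 0 1"
        from G0(2)[OF this] show "0 \<le> Re (G w - H (of_real \<rho> * w))" by (simp add: ReG \<phi>_def)
      qed
      then show ?thesis by simp
    qed
    have "((\<lambda>t. \<bar>Re (H (of_real \<rho> * cis t))\<bar> + 2 * e) has_integral
        integral {0..2 * pi} (\<lambda>t. \<bar>Re (H (of_real \<rho> * cis t))\<bar>) + (2 * pi - 0) *\<^sub>R (2 * e)) {0..2 * pi}"
    proof (intro has_integral_add integrable_integral integrable_continuous_interval continuous_intros)
      show "continuous_on {0..2 * pi} (\<lambda>x. H (of_real \<rho> * cis x))"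
        using \<rho> by (intro continuous_on_harmonic_circle[OF harmonic_disc_holomorphic[OF H]] continuous_intros) auto
    qed (use has_integral_const_real[of "2 * e" 0 "2 * pi"] in simp)
    then have "2 * pi * Re (G 0) \<le> integral {0..2 * pi} (\<lambda>t. \<bar>Re (H (of_real \<rho> * cis t))\<bar>) + (2 * pi - 0) *\<^sub>R (2 * e)"
    proof (rule has_integral_le[OF circle_mean_value_Re[OF G]])
      fix t :: real
      have "cis t \<in> sphere 0 1" by simp
      from G0(2)[OF this] show "Re (G (cis t)) \<le> \<bar>Re (H (of_real \<rho> * cis t))\<bar> + 2 * e" by (simp add: ReG \<phi>_def)
    qed
    then show "2 * pi * Re (G 0) \<le> integral {0..2 * pi} (\<lambda>t. \<bar>Re (H (of_real \<rho> * cis t))\<bar>) + 4 * pi * e" by simp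
  qed
qed

text \<open>
  The majorants on discs of radius \<open>\<rho> n\<close> have bounded values at 0, but need not be locally bounded
  a priori. Montel's theorem is applied to \<open>1 / (1 + G n)\<close>, which are bounded by 1. Their limit is
  nonzero at 0 and by Hurwitz's theorem nowhere zero, so the \<open>G n\<close> converge as well.
\<close>

lemma h1_difference_of_positive:
  assumes H: "H holomorphic_on ball 0 1" and \<rho>: "\<And>n. 0 < \<rho> n" "\<And>n. \<rho> n < 1" "\<rho> \<longlonglongrightarrow> 1"
    and K: "\<And>n::nat. integral {0..2 * pi} (\<lambda>t. \<bar>Re (H (of_real (\<rho> n) * cis t))\<bar>) \<le> K"
  obtains G where "G holomorphic_on ball 0 1" "\<And>z. z \<in> ball 0 1 \<Longrightarrow> 0 \<le> Re (G z)"
    "\<And>z. z \<in> ball 0 1 \<Longrightarrow> Re (H z) \<le> Re (G z)"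
proof -
  (* The summand 2 is the error of the majorant for approximation parameter 1, divided by 2 pi. *)
  have "\<exists>G. G holomorphic_on ball 0 1 \<and> (\<forall>z\<in>ball 0 1. 0 \<le> Re (G z)) \<and>
      (\<forall>z\<in>ball 0 1. Re (H (of_real (\<rho> n) * z)) \<le> Re (G z)) \<and> Im (G 0) = 0 \<and> Re (G 0) \<le> K / (2 * pi) + 2" for n
  proof -
    obtain G where G: "G holomorphic_on ball 0 1" "\<And>z. z \<in> ball 0 1 \<Longrightarrow> 0 \<le> Re (G z)"
      "\<And>z. z \<in> ball 0 1 \<Longrightarrow> Re (H (of_real (\<rho> n) * z)) \<le> Re (G z)" "Im (G 0) = 0"
      "2 * pi * Re (G 0) \<le> integral {0..2 * pi} (\<lambda>t. \<bar>Re (H (of_real (\<rho> n) * cis t))\<bar>) + 4 * pi * 1"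
      using positive_majorant_on_disc[OF H \<rho>(1,2), of 1 n] by (metis zero_less_one)
    have "2 * pi * Re (G 0) \<le> K + 4 * pi" using G(5) K[of n] by simp
    then have "Re (G 0) \<le> K / (2 * pi) + 2" by (simp add: field_simps)
    with G show ?thesis by blast
  qed
  then obtain G where G: "\<And>n. G n holomorphic_on ball 0 1" "\<And>n z. z \<in> ball 0 1 \<Longrightarrow> 0 \<le> Re (G n z)"
      "\<And>n z. z \<in> ball 0 1 \<Longrightarrow> Re (H (of_real (\<rho> n) * z)) \<le> Re (G n z)" "\<And>n. Im (G n 0) = 0"
      "\<And>n. Re (G n 0) \<le> K / (2 * pi) + 2" by metis
  have nz: "1 + G n z \<noteq> 0" and ge1: "1 \<le> cmod (1 + G n z)" if "z \<in> ball 0 1" for n z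
    using G(2)[OF that, of n] complex_Re_le_cmod[of "1 + G n z"] by auto
  define Q where "Q = (\<lambda>n z. 1 / (1 + G n z))"
  have Qh: "Q n holomorphic_on ball 0 1" for n unfolding Q_def by (intro holomorphic_intros G nz)
  have Qb: "cmod (Q n z) \<le> 1" if "z \<in> ball 0 1" for n z
    using ge1[OF that, of n] frac_le[of 1 1 1 "cmod (1 + G n z)"] by (simp add: Q_def norm_divide)
  obtain q s where q: "q holomorphic_on ball 0 1" "strict_mono s"
    "\<And>z. z \<in> ball 0 1 \<Longrightarrow> (\<lambda>n. Q (s n) z) \<longlonglongrightarrow> q z"
    "\<And>A. compact A \<Longrightarrow> A \<subseteq> ball 0 1 \<Longrightarrow> uniform_limit A (Q \<circ> s) q sequentially"
  proof (rule Montel[of "ball 0 1" "range Q" Q])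
    show "\<exists>B. \<forall>h\<in>range Q. \<forall>z\<in>A. cmod (h z) \<le> B" if "A \<subseteq> ball 0 1" for A
      using Qb that by (intro exI[of _ 1]) auto
  qed (use Qh in auto)
  have q0: "q 0 \<noteq> 0"
  proof -
    have "1 / (3 + \<bar>K\<bar> / (2 * pi)) \<le> cmod (q 0)"
    proof (rule LIMSEQ_le_const[OF tendsto_norm[OF q(3)[of 0]]])
      have "1 / (3 + \<bar>K\<bar> / (2 * pi)) \<le> cmod (Q (s n) 0)" for n
      proof -
        have "1 + G (s n) 0 = of_real (1 + Re (G (s n) 0))" using G(4) by (simp add: complex_eq_iff)
        then have "cmod (1 + G (s n) 0) = 1 + Re (G (s n) 0)"
          using G(2)[of 0 "s n"] by (simp only: norm_of_real) simp
        also have "\<dots> \<le> 3 + \<bar>K\<bar> / (2 * pi)"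
          using G(5)[of "s n"] divide_right_mono[OF abs_ge_self[of K], of "2 * pi"] by simp
        finally show ?thesis
          using ge1[of 0 "s n"] nz[of 0 "s n"] frac_le[of 1 1 "cmod (1 + G (s n) 0)" "3 + \<bar>K\<bar> / (2 * pi)"]
          by (simp add: Q_def norm_divide)
      qed
      then show "\<exists>N. \<forall>n\<ge>N. 1 / (3 + \<bar>K\<bar> / (2 * pi)) \<le> cmod (Q (s n) 0)" by blast
    qed simp
    moreover have "0 < 1 / (3 + \<bar>K\<bar> / (2 * pi))" by (simp add: add_pos_nonneg)
    ultimately show ?thesis by force
  qed
  have qnz: "q z \<noteq> 0" if z: "z \<in> ball 0 1" for z
  (* Hurwitz's theorem says nothing about constant limits; these are covered by the value at 0. *)
  proof (cases "q constant_on ball 0 1")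
    case True
    then have "q z = q 0" using z unfolding constant_on_def by force
    then show ?thesis using q0 by simp
  next
    case False
    have "Q n w \<noteq> 0" if "w \<in> ball 0 1" for n w using nz[OF that] by (simp add: Q_def)
    then show ?thesis
      using Hurwitz_no_zeros[of "ball 0 1" "Q \<circ> s" q z] Qh q False z by (simp add: convex_connected)
  qed
  define g where "g = (\<lambda>z. 1 / q z - 1)"
  have lim: "(\<lambda>n. G (s n) z) \<longlonglongrightarrow> g z" if z: "z \<in> ball 0 1" for z
  proof -
    have "(\<lambda>n. 1 / Q (s n) z - 1) \<longlonglongrightarrow> g z"
      unfolding g_def by (intro tendsto_intros q(3) z qnz)
    then show ?thesis by (simp add: Q_def)
  qed
  show ?thesis
  proof (rule that[of g])
    show "g holomorphic_on ball 0 1" unfolding g_def by (intro holomorphic_intros q(1) qnz)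
    fix z :: complex assume z: "z \<in> ball 0 1"
    show "0 \<le> Re (g z)"
      by (rule LIMSEQ_le_const[OF tendsto_Re[OF lim[OF z]]]) (use G(2)[OF z] in auto)
    have "(\<lambda>n. of_real (\<rho> (s n)) * z) \<longlonglongrightarrow> of_real 1 * z"
      using LIMSEQ_subseq_LIMSEQ[OF \<rho>(3) q(2)] by (intro tendsto_intros) (simp add: o_def)
    then have "(\<lambda>n. H (of_real (\<rho> (s n)) * z)) \<longlonglongrightarrow> H z"
      using holomorphic_on_imp_continuous_on[OF H] z
      by (intro isCont_tendsto_compose[of z H]) (auto simp: continuous_on_eq_continuous_at)
    then show "Re (H z) \<le> Re (g z)"
      by (intro LIMSEQ_le[OF tendsto_Re tendsto_Re[OF lim[OF z]]]) (use G(3)[OF z] in auto)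
  qed
qed

lemma Fatou_Re:
  assumes H: "H holomorphic_on ball 0 1" and \<rho>: "\<And>n. 0 < \<rho> n" "\<And>n. \<rho> n < 1" "\<rho> \<longlonglongrightarrow> 1"
    and K: "\<And>n::nat. integral {0..2 * pi} (\<lambda>t. \<bar>Re (H (of_real (\<rho> n) * cis t))\<bar>) \<le> K"
  shows "AE t in lborel. t \<in> {0..2 * pi} \<longrightarrow> (\<exists>L. ((\<lambda>r. H (of_real r * cis t)) \<longlongrightarrow> L) (at_left 1))"
proof -
  obtain G where G: "G holomorphic_on ball 0 1" "\<And>z. z \<in> ball 0 1 \<Longrightarrow> 0 \<le> Re (G z)"
    "\<And>z. z \<in> ball 0 1 \<Longrightarrow> Re (H z) \<le> Re (G z)"
    using h1_difference_of_positive[OF assms] by metis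
  have "AE t in lborel. t \<in> {0..2 * pi} \<longrightarrow> (\<exists>L. ((\<lambda>r. G (of_real r * cis t) - H (of_real r * cis t)) \<longlongrightarrow> L) (at_left 1))"
    using G by (intro positive_real_part_radial_limits holomorphic_intros H) auto
  moreover have "AE t in lborel. t \<in> {0..2 * pi} \<longrightarrow> (\<exists>L. ((\<lambda>r. G (of_real r * cis t)) \<longlongrightarrow> L) (at_left 1))"
    using G by (intro positive_real_part_radial_limits) auto
  ultimately show ?thesis
  proof eventually_elim
    case (elim t)
    show ?case
    proof
      assume "t \<in> {0..2 * pi}"
      then obtain L L' where "((\<lambda>r. G (of_real r * cis t)) \<longlongrightarrow> L) (at_left 1)"
        "((\<lambda>r. G (of_real r * cis t) - H (of_real r * cis t)) \<longlongrightarrow> L') (at_left 1)" using elim by blast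
      from tendsto_diff[OF this] show "\<exists>L. ((\<lambda>r. H (of_real r * cis t)) \<longlongrightarrow> L) (at_left 1)" by auto
    qed
  qed
qed

lemma Fatou_harmonic:
  assumes F: "harmonic_disc F" and \<rho>: "\<And>n. 0 < \<rho> n" "\<And>n. \<rho> n < 1" "\<rho> \<longlonglongrightarrow> 1"
    and K: "\<And>n::nat. integral {0..2 * pi} (\<lambda>t. cmod (F (of_real (\<rho> n) * cis t))) \<le> K"
  shows "AE t in lborel. t \<in> {0..2 * pi} \<longrightarrow> (\<exists>L. ((\<lambda>r. F (of_real r * cis t)) \<longlongrightarrow> L) (at_left 1))"
proof -
  obtain H1 H2 where H: "H1 holomorphic_on ball 0 1" "H2 holomorphic_on ball 0 1"
     "\<And>z. z \<in> ball 0 1 \<Longrightarrow> F z = Complex (Re (H1 z)) (Re (H2 z))"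
    using F unfolding harmonic_disc_def by blast
  have le: "integral {0..2 * pi} (\<lambda>t. \<bar>Re (H (of_real (\<rho> n) * cis t))\<bar>) \<le> K"
    if hol: "H holomorphic_on ball 0 1" and H: "\<And>z. z \<in> ball 0 1 \<Longrightarrow> \<bar>Re (H z)\<bar> \<le> cmod (F z)" for H n
  proof -
    have "integral {0..2 * pi} (\<lambda>t. \<bar>Re (H (of_real (\<rho> n) * cis t))\<bar>) \<le> integral {0..2 * pi} (\<lambda>t. cmod (F (of_real (\<rho> n) * cis t)))"
      using \<rho>(1)[of n] \<rho>(2)[of n]
      by (intro integral_le integrable_continuous_interval continuous_intros continuous_on_harmonic_circle[OF F]
          continuous_on_harmonic_circle[OF harmonic_disc_holomorphic[OF hol]] H) (auto simp: norm_mult)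
    then show ?thesis using K[of n] by linarith
  qed
  have bd: "\<bar>Re (H1 z)\<bar> \<le> cmod (F z)" "\<bar>Re (H2 z)\<bar> \<le> cmod (F z)" if "z \<in> ball 0 1" for z
    using abs_Re_le_cmod[of "F z"] abs_Im_le_cmod[of "F z"] H(3)[OF that] by auto
  have "AE t in lborel. t \<in> {0..2 * pi} \<longrightarrow> (\<exists>L. ((\<lambda>r. H1 (of_real r * cis t)) \<longlongrightarrow> L) (at_left 1))"
    by (rule Fatou_Re[OF H(1) \<rho>]) (rule le[OF H(1) bd(1)])
  moreover have "AE t in lborel. t \<in> {0..2 * pi} \<longrightarrow> (\<exists>L. ((\<lambda>r. H2 (of_real r * cis t)) \<longlongrightarrow> L) (at_left 1))"
    by (rule Fatou_Re[OF H(2) \<rho>]) (rule le[OF H(2) bd(2)])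
  ultimately show ?thesis
  proof eventually_elim
    case (elim t)
    show ?case
    proof
      assume "t \<in> {0..2 * pi}"
      then obtain L1 L2 where "((\<lambda>r. H1 (of_real r * cis t)) \<longlongrightarrow> L1) (at_left 1)" "((\<lambda>r. H2 (of_real r * cis t)) \<longlongrightarrow> L2) (at_left 1)"
        using elim by blast
      then have "((\<lambda>r. Complex (Re (H1 (of_real r * cis t))) (Re (H2 (of_real r * cis t)))) \<longlongrightarrow> Complex (Re L1) (Re L2)) (at_left 1)"
        by (intro tendsto_Complex tendsto_Re)
      moreover have "eventually (\<lambda>r. Complex (Re (H1 (of_real r * cis t))) (Re (H2 (of_real r * cis t))) = F (of_real r * cis t)) (at_left 1)"
        by (rule eventually_at_leftI[of 0]) (auto simp: H(3) norm_mult)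
      ultimately have "((\<lambda>r. F (of_real r * cis t)) \<longlongrightarrow> Complex (Re L1) (Re L2)) (at_left 1)"
        by (rule Lim_transform_eventually)
      then show "\<exists>L. ((\<lambda>r. F (of_real r * cis t)) \<longlongrightarrow> L) (at_left 1)" by blast
    qed
  qed
qed

section \<open>Invariance of the Haar measure\<close>

lemma space_haar_circle [simp]: "space haar_circle = sphere 0 1"
  by (simp add: haar_circle_def space_restrict_space)

lemma sets_haar_circle: "sets haar_circle = sets (restrict_space borel (sphere 0 1))"
  by (simp add: haar_circle_def)

lemma measurable_haar_circleI:
  assumes "f \<in> borel_measurable M" "\<And>x. x \<in> space M \<Longrightarrow> f x \<in> sphere 0 1"
  shows "f \<in> measurable M haar_circle"
  using assms measurable_restrict_space2[of f M "sphere 0 1" borel] sets_haar_circle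
  by (auto cong: measurable_cong_sets)

lemma measurable_haarI:
  assumes "\<And>n. (\<lambda>x. f x n) \<in> borel_measurable M" "\<And>x n. x \<in> space M \<Longrightarrow> cmod (f x n) = 1"
  shows "f \<in> measurable M haar"
  unfolding haar_def
  by (rule measurable_PiM_single') (auto intro!: measurable_haar_circleI assms simp: PiE_def extensional_def assms)

lemma measurable_haar_component [measurable]: "(\<lambda>z. z n) \<in> borel_measurable haar"
proof -
  have "(\<lambda>z. z n) \<in> measurable haar haar_circle"
    unfolding haar_def by (rule measurable_component_singleton) simp
  moreover have "(\<lambda>x. x) \<in> borel_measurable haar_circle"
    unfolding haar_circle_def by (simp add: measurable_restrict_space1)
  ultimately show ?thesis by (rule measurable_compose)
qed

lemma emeasure_haar_circle:
  assumes "A \<in> sets haar_circle"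
  shows "emeasure haar_circle A = (\<integral>\<^sup>+t\<in>{0..<2 * pi}. indicator A (cis t) \<partial>lborel) / ennreal (2 * pi)"
proof -
  have m: "cis \<in> measurable lborel (restrict_space borel (sphere 0 1))"
    by (intro measurable_restrict_space2) (auto intro!: borel_measurable_continuous_onI continuous_intros simp: measurable_lborel1)
  have A: "A \<in> sets (restrict_space borel (sphere 0 1))" using assms sets_haar_circle by simp
  have pre: "cis -` A \<in> sets lborel" using measurable_sets[OF m A] by simp
  have m': "cis \<in> measurable (uniform_measure lborel {0..<2 * pi}) (restrict_space borel (sphere 0 1))"
    using m by simp
  have "emeasure haar_circle A = emeasure (uniform_measure lborel {0..<2 * pi}) (cis -` A)"
    unfolding haar_circle_def using A by (subst emeasure_distr[OF m']) simp_all
  also have "\<dots> = emeasure lborel ({0..<2 * pi} \<inter> cis -` A) / ennreal (2 * pi)"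
    using pre by (subst emeasure_uniform_measure) simp_all
  also have "emeasure lborel ({0..<2 * pi} \<inter> cis -` A) = (\<integral>\<^sup>+t. indicator ({0..<2 * pi} \<inter> cis -` A) t \<partial>lborel)"
    using pre by simp
  also have "\<dots> = (\<integral>\<^sup>+t\<in>{0..<2 * pi}. indicator A (cis t) \<partial>lborel)"
    by (intro nn_integral_cong) (auto simp: indicator_def)
  finally show ?thesis .
qed

lemma nn_integral_periodic_shift:
  fixes g :: "real \<Rightarrow> ennreal"
  assumes g[measurable]: "g \<in> borel_measurable borel" and per: "\<And>t. g (t + 2 * pi) = g t"
    and s: "0 \<le> s" "s \<le> 2 * pi"
  shows "(\<integral>\<^sup>+t\<in>{0..<2 * pi}. g (s + t) \<partial>lborel) = (\<integral>\<^sup>+t\<in>{0..<2 * pi}. g t \<partial>lborel)"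
proof -
  have "(\<integral>\<^sup>+t\<in>{0..<2 * pi}. g t \<partial>lborel) =
      (\<integral>\<^sup>+t. g t * indicator {s..<2 * pi} t + g t * indicator {0..<s} t \<partial>lborel)"
    using s by (intro nn_integral_cong) (auto simp: indicator_def)
  also have "\<dots> = (\<integral>\<^sup>+t. g t * indicator {s..<2 * pi} t \<partial>lborel) + (\<integral>\<^sup>+t. g t * indicator {0..<s} t \<partial>lborel)"
    by (rule nn_integral_add) auto
  also have "(\<integral>\<^sup>+t. g t * indicator {s..<2 * pi} t \<partial>lborel) =
      (\<integral>\<^sup>+t. g (s + t) * indicator {s..<2 * pi} (s + t) \<partial>lborel)"
    by (subst nn_integral_real_affine[of _ 1 s]) auto
  also have "(\<integral>\<^sup>+t. g t * indicator {0..<s} t \<partial>lborel) =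
      (\<integral>\<^sup>+t. g (s - 2 * pi + t) * indicator {0..<s} (s - 2 * pi + t) \<partial>lborel)"
    by (subst nn_integral_real_affine[of _ 1 "s - 2 * pi"]) auto
  also have "(\<integral>\<^sup>+t. g (s + t) * indicator {s..<2 * pi} (s + t) \<partial>lborel) +
      (\<integral>\<^sup>+t. g (s - 2 * pi + t) * indicator {0..<s} (s - 2 * pi + t) \<partial>lborel) =
      (\<integral>\<^sup>+t. g (s + t) * indicator {s..<2 * pi} (s + t) + g (s - 2 * pi + t) * indicator {0..<s} (s - 2 * pi + t) \<partial>lborel)"
    by (rule nn_integral_add[symmetric]) auto
  also have "\<dots> = (\<integral>\<^sup>+t\<in>{0..<2 * pi}. g (s + t) \<partial>lborel)"
  proof (rule nn_integral_cong)
    fix t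
    have "g (s - 2 * pi + t) = g (s + t)" using per[of "s - 2 * pi + t"] by simp
    then show "g (s + t) * indicator {s..<2 * pi} (s + t) + g (s - 2 * pi + t) * indicator {0..<s} (s - 2 * pi + t)
        = g (s + t) * indicator {0..<2 * pi} t"
      using s by (auto simp: indicator_def)
  qed
  finally show ?thesis ..
qed

lemma haar_circle_rotate:
  assumes a: "cmod a = 1"
  shows "distr haar_circle haar_circle (\<lambda>w. a * w) = haar_circle"
proof (rule measure_eqI)
  have m: "(\<lambda>w. a * w) \<in> measurable haar_circle haar_circle"
    by (rule measurable_haar_circleI)
       (use a in \<open>auto simp: norm_mult sets_haar_circle cong: measurable_cong_sets
          intro!: measurable_restrict_space1\<close>)
  fix A assume "A \<in> sets (distr haar_circle haar_circle (\<lambda>w. a * w))"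
  then have A: "A \<in> sets haar_circle" by simp
  obtain s where s: "0 \<le> s" "s < 2 * pi" "a = cis s"
    using a by (metis Arg2pi_ge_0 Arg2pi_lt_2pi Arg2pi_eq cis_conv_exp norm_one mult_1 of_real_1)
  have A': "(\<lambda>w. a * w) -` A \<inter> space haar_circle \<in> sets haar_circle"
    by (rule measurable_sets[OF m A])
  define g where "g = (\<lambda>t. indicator A (cis t) :: ennreal)"
  have gm: "g \<in> borel_measurable borel"
  proof -
    have "cis \<in> measurable borel (restrict_space borel (sphere 0 1))"
      by (intro measurable_restrict_space2 borel_measurable_continuous_onI continuous_intros) auto
    then have "cis -` A \<in> sets borel" using measurable_sets[of cis borel _ A] A sets_haar_circle by simp
    then have "indicator (cis -` A) \<in> borel_measurable borel" by (rule borel_measurable_indicator)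
    moreover have "g = indicator (cis -` A)" by (auto simp: g_def indicator_def fun_eq_iff)
    ultimately show ?thesis by simp
  qed
  have "emeasure (distr haar_circle haar_circle (\<lambda>w. a * w)) A = emeasure haar_circle ((\<lambda>w. a * w) -` A \<inter> space haar_circle)"
    by (rule emeasure_distr[OF m A])
  also have "\<dots> = (\<integral>\<^sup>+t\<in>{0..<2 * pi}. g (s + t) \<partial>lborel) / ennreal (2 * pi)"
    unfolding emeasure_haar_circle[OF A']
    by (intro arg_cong2[where f = "(/)"] nn_integral_cong refl) (auto simp: g_def s(3) cis_mult indicator_def)
  also have "(\<integral>\<^sup>+t\<in>{0..<2 * pi}. g (s + t) \<partial>lborel) = (\<integral>\<^sup>+t\<in>{0..<2 * pi}. g t \<partial>lborel)"
    by (rule nn_integral_periodic_shift[OF gm]) (use s in \<open>auto simp: g_def cis_mult[symmetric]\<close>)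
  finally show "emeasure (distr haar_circle haar_circle (\<lambda>w. a * w)) A = emeasure haar_circle A"
    by (simp add: emeasure_haar_circle[OF A] g_def)
qed simp

text \<open>
  Rotation invariance in each coordinate determines the image measure on cylinder sets.
\<close>

lemma haar_translate:
  assumes a: "a \<in> torus"
  shows "distr haar haar (\<lambda>z n. a n * z n) = haar"
proof -
  interpret product_prob_space "\<lambda>n::nat. haar_circle" UNIV
    by (rule product_prob_spaceI) (rule prob_space_haar_circle)
  have a1: "cmod (a n) = 1" for n using a by (auto simp: torus_def)
  have m: "(\<lambda>z n. a n * z n) \<in> measurable haar haar"
    by (rule measurable_haarI) (auto simp: space_haar torus_def norm_mult a1)
  have mc: "(\<lambda>w. a n * w) \<in> measurable haar_circle haar_circle" for n
    by (rule measurable_haar_circleI)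
       (auto simp: norm_mult a1 sets_haar_circle cong: measurable_cong_sets intro!: measurable_restrict_space1)
  show ?thesis
    unfolding haar_def
  proof (rule measure_eqI_PiM_infinite)
    show "finite_measure (distr (Pi\<^sub>M UNIV (\<lambda>n. haar_circle)) (Pi\<^sub>M UNIV (\<lambda>n. haar_circle)) (\<lambda>z n. a n * z n))"
      using m unfolding haar_def by (intro prob_space.finite_measure prob_space_distr)
    fix A :: "nat \<Rightarrow> complex set" and J :: "nat set"
    assume J: "finite J" and A: "\<And>i. i \<in> J \<Longrightarrow> A i \<in> sets haar_circle"
    define A' where "A' = (\<lambda>n. (\<lambda>w. a n * w) -` A n \<inter> space haar_circle)"
    have A': "A' n \<in> sets haar_circle" if "n \<in> J" for n
      unfolding A'_def by (rule measurable_sets[OF mc A[OF that]])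
    have AA': "emeasure haar_circle (A' n) = emeasure haar_circle (A n)" if "n \<in> J" for n
      using emeasure_distr[OF mc[of n] A[OF that]] unfolding haar_circle_rotate[OF a1] A'_def by (rule sym)
    have sub: "A n \<subseteq> sphere 0 1" if "n \<in> J" for n using sets.sets_into_space[OF A[OF that]] by simp
    have "emeasure (distr (Pi\<^sub>M UNIV (\<lambda>n. haar_circle)) (Pi\<^sub>M UNIV (\<lambda>n. haar_circle)) (\<lambda>z n. a n * z n))
        (prod_emb UNIV (\<lambda>n. haar_circle) J (Pi\<^sub>E J A)) =
       emeasure (Pi\<^sub>M UNIV (\<lambda>n. haar_circle)) ((\<lambda>z n. a n * z n) -` prod_emb UNIV (\<lambda>n. haar_circle) J (Pi\<^sub>E J A) \<inter> space (Pi\<^sub>M UNIV (\<lambda>n. haar_circle)))"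
      using J A m unfolding haar_def by (intro emeasure_distr sets_PiM_I) auto
    also have "(\<lambda>z n. a n * z n) -` prod_emb UNIV (\<lambda>n. haar_circle) J (Pi\<^sub>E J A) \<inter> space (Pi\<^sub>M UNIV (\<lambda>n. haar_circle))
        = prod_emb UNIV (\<lambda>n. haar_circle) J (Pi\<^sub>E J A')"
      using a1 by (auto simp: prod_emb_def space_PiM PiE_iff A'_def norm_mult)
    also have "emeasure (Pi\<^sub>M UNIV (\<lambda>n. haar_circle)) (prod_emb UNIV (\<lambda>n. haar_circle) J (Pi\<^sub>E J A'))
        = (\<Prod>i\<in>J. emeasure haar_circle (A' i))"
      using J A' by (intro emeasure_PiM_emb) auto
    also have "\<dots> = (\<Prod>i\<in>J. emeasure haar_circle (A i))" by (intro prod.cong refl AA')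
    also have "\<dots> = emeasure (Pi\<^sub>M UNIV (\<lambda>n. haar_circle)) (prod_emb UNIV (\<lambda>n. haar_circle) J (Pi\<^sub>E J A))"
      using J A by (intro emeasure_PiM_emb[symmetric]) auto
    finally show "emeasure (distr (Pi\<^sub>M UNIV (\<lambda>n. haar_circle)) (Pi\<^sub>M UNIV (\<lambda>n. haar_circle)) (\<lambda>z n. a n * z n))
        (prod_emb UNIV (\<lambda>n. haar_circle) J (Pi\<^sub>E J A)) = \<dots>" .
  qed simp_all
qed

definition flow :: "complex \<Rightarrow> (nat \<Rightarrow> complex) \<Rightarrow> nat \<Rightarrow> complex" where
  "flow w z n = w ^ Suc n * z n"

lemma flow_torus: "cmod w = 1 \<Longrightarrow> z \<in> torus \<Longrightarrow> flow w z \<in> torus"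
  by (simp add: flow_def torus_def norm_mult norm_power)

lemma measurable_translate: "a \<in> torus \<Longrightarrow> (\<lambda>z n. a n * z n) \<in> measurable haar haar"
  by (rule measurable_haarI) (auto simp: space_haar torus_def norm_mult)

lemma flow_eq_translate: "flow w = (\<lambda>z n. (w ^ Suc n) * z n)"
  by (simp add: fun_eq_iff flow_def)

lemma nn_integral_flow:
  assumes "g \<in> borel_measurable haar" "cmod w = 1"
  shows "(\<integral>\<^sup>+z. g (flow w z) \<partial>haar) = (\<integral>\<^sup>+z. g z \<partial>haar)"
proof -
  have a: "(\<lambda>n. w ^ Suc n) \<in> torus" using assms by (simp add: torus_def norm_mult norm_power)
  have "(\<integral>\<^sup>+z. g z \<partial>haar) = (\<integral>\<^sup>+z. g z \<partial>distr haar haar (flow w))"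
    using haar_translate[OF a] by (simp add: flow_eq_translate)
  also have "\<dots> = (\<integral>\<^sup>+z. g (flow w z) \<partial>haar)"
    using assms measurable_translate[OF a] by (intro nn_integral_distr) (auto simp: flow_eq_translate)
  finally show ?thesis ..
qed

lemma measurable_flow_pair: "(\<lambda>(z, t). flow (cis t) z) \<in> measurable (haar \<Otimes>\<^sub>M lborel) haar"
proof (rule measurable_haarI)
  fix n
  have [measurable]: "cis \<in> borel_measurable borel"
    by (intro borel_measurable_continuous_onI continuous_intros)
  show "(\<lambda>x. (case x of (z, t) \<Rightarrow> flow (cis t) z) n) \<in> borel_measurable (haar \<Otimes>\<^sub>M lborel)"
    unfolding flow_def split_beta by measurable
qed (auto simp: flow_def space_pair_measure space_haar torus_def norm_mult norm_power)

text \<open>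
  Transfers inequalities on slices to the torus: by Tonelli's theorem and invariance, integrating
  over an orbit first does not change the integral, up to the length of the parameter interval.
\<close>

lemma nn_integral_flow_average:
  assumes g[measurable]: "g \<in> borel_measurable haar"
  shows "(\<integral>\<^sup>+z. (\<integral>\<^sup>+t\<in>{0..2 * pi}. g (flow (cis t) z) \<partial>lborel) \<partial>haar) = ennreal (2 * pi) * (\<integral>\<^sup>+z. g z \<partial>haar)"
proof -
  interpret H: prob_space haar by (rule prob_space_haar)
  interpret pair_sigma_finite haar lborel ..
  have [measurable]: "(\<lambda>x. g (flow (cis (snd x)) (fst x))) \<in> borel_measurable (haar \<Otimes>\<^sub>M lborel)"
    using measurable_compose[OF measurable_flow_pair g] by (simp add: split_beta)
  have "(\<integral>\<^sup>+z. (\<integral>\<^sup>+t\<in>{0..2 * pi}. g (flow (cis t) z) \<partial>lborel) \<partial>haar) =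
      (\<integral>\<^sup>+t. (\<integral>\<^sup>+z. g (flow (cis t) z) * indicator {0..2 * pi} t \<partial>haar) \<partial>lborel)"
    using Fubini'[of "\<lambda>z t. g (flow (cis t) z) * indicator {0..2 * pi} t"]
    by (simp add: split_beta)
  also have "\<dots> = (\<integral>\<^sup>+t. (\<integral>\<^sup>+z. g z \<partial>haar) * indicator {0..2 * pi} t \<partial>lborel)"
  proof (rule nn_integral_cong)
    fix t :: real
    have "(\<lambda>z. g (flow (cis t) z)) \<in> borel_measurable haar"
      using measurable_translate[of "\<lambda>n. cis t ^ Suc n"]
      by (intro measurable_compose[OF _ g]) (simp add: flow_eq_translate torus_def norm_mult norm_power)
    then show "(\<integral>\<^sup>+z. g (flow (cis t) z) * indicator {0..2 * pi} t \<partial>haar) = (\<integral>\<^sup>+z. g z \<partial>haar) * indicator {0..2 * pi} t"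
      by (simp add: nn_integral_multc nn_integral_flow)
  qed
  also have "\<dots> = ennreal (2 * pi) * (\<integral>\<^sup>+z. g z \<partial>haar)"
    by (simp add: nn_integral_cmult_indicator mult.commute)
  finally show ?thesis .
qed

section \<open>Characters\<close>

lemma torus_norm: "z \<in> torus \<Longrightarrow> cmod (z j) = 1"
  by (simp add: torus_def)

lemma torus_nonzero: "z \<in> torus \<Longrightarrow> z j \<noteq> 0"
  by (metis norm_zero torus_norm zero_neq_one)

lemma torus_char_superset:
  assumes "finite J" "{j. \<nu> j \<noteq> 0} \<subseteq> J"
  shows "torus_char \<nu> z = (\<Prod>j\<in>J. z j powi \<nu> j)"
  unfolding torus_char_def using assms by (intro prod.mono_neutral_left) auto

lemma norm_torus_char: "z \<in> torus \<Longrightarrow> cmod (torus_char \<nu> z) = 1"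
  by (simp add: torus_char_def prod_norm[symmetric] norm_power_int torus_norm)

lemma torus_char_add:
  assumes "\<nu> \<in> Z0" "\<nu>' \<in> Z0" "z \<in> torus"
  shows "torus_char (\<lambda>j. \<nu> j + \<nu>' j) z = torus_char \<nu> z * torus_char \<nu>' z"
proof -
  define J where "J = {j. \<nu> j \<noteq> 0} \<union> {j. \<nu>' j \<noteq> 0}"
  have J: "finite J" using assms by (simp add: J_def Z0_def)
  have "torus_char (\<lambda>j. \<nu> j + \<nu>' j) z = (\<Prod>j\<in>J. z j powi (\<nu> j + \<nu>' j))"
    by (rule torus_char_superset[OF J]) (auto simp: J_def)
  also have "\<dots> = (\<Prod>j\<in>J. z j powi \<nu> j) * (\<Prod>j\<in>J. z j powi \<nu>' j)"
    using torus_nonzero[OF assms(3)] by (simp add: power_int_add prod.distrib)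
  also have "(\<Prod>j\<in>J. z j powi \<nu> j) = torus_char \<nu> z"
    by (rule torus_char_superset[OF J, symmetric]) (auto simp: J_def)
  also have "(\<Prod>j\<in>J. z j powi \<nu>' j) = torus_char \<nu>' z"
    by (rule torus_char_superset[OF J, symmetric]) (auto simp: J_def)
  finally show ?thesis .
qed

lemma torus_char_0 [simp]: "torus_char (\<lambda>_. 0) z = 1"
  by (simp add: torus_char_def)

lemma torus_char_uminus:
  assumes "z \<in> torus" shows "torus_char (- \<nu>) z = cnj (torus_char \<nu> z)"
proof -
  have *: "cnj w powi k = w powi (- k)" if "cmod w = 1" for w :: complex and k
  proof -
    have "cnj w = inverse w" using that by (metis divide_conv_cnj inverse_eq_divide mult_1)
    then show ?thesis by (simp add: power_int_minus power_int_inverse)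
  qed
  show ?thesis
    unfolding torus_char_def by (simp add: * torus_norm[OF assms])
qed

lemma torus_char_mult:
  "torus_char \<nu> (\<lambda>n. a n * z n) = torus_char \<nu> a * torus_char \<nu> z"
  by (simp add: torus_char_def power_int_mult_distrib prod.distrib)

lemma Z0_add: "\<nu> \<in> Z0 \<Longrightarrow> \<nu>' \<in> Z0 \<Longrightarrow> (\<lambda>j. \<nu> j + \<nu>' j) \<in> Z0"
  unfolding Z0_def by (auto intro: finite_subset[of _ "{j. \<nu> j \<noteq> 0} \<union> {j. \<nu>' j \<noteq> 0}"])

lemma Z0_uminus [simp]: "- \<nu> \<in> Z0 \<longleftrightarrow> \<nu> \<in> Z0"
  by (simp add: Z0_def)

lemma Z0_0 [simp]: "(\<lambda>_. 0) \<in> Z0"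
  by (simp add: Z0_def)

lemma continuous_on_torus_char: "continuous_on torus (torus_char \<nu>)"
  unfolding torus_char_def
  by (intro continuous_intros continuous_on_subset[OF continuous_on_product_coordinates])
     (auto simp: torus_nonzero)

lemma borel_measurable_haar_continuous:
  fixes g :: "(nat \<Rightarrow> complex) \<Rightarrow> 'a::topological_space"
  assumes "continuous_on torus g" shows "g \<in> borel_measurable haar"
  using borel_measurable_continuous_on_restrict[OF assms] measurable_cong_sets[OF sets_haar refl] by blast

lemma measurable_torus_char [measurable]: "torus_char \<nu> \<in> borel_measurable haar"
  by (rule borel_measurable_haar_continuous[OF continuous_on_torus_char])

lemma bounded_measurable_torus_char: "bounded_measurable haar (torus_char \<nu>)"
  by (rule bounded_measurableI[where B = 1]) (auto simp: space_haar norm_torus_char)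

text \<open>
  Translation by a point at which the character is \<open>-1\<close> changes the sign of the integral.
\<close>

lemma integral_torus_char:
  assumes "\<nu> \<in> Z0"
  shows "(LINT z|haar. torus_char \<nu> z) = (if \<nu> = (\<lambda>_. 0) then 1 else 0)"
proof (cases "\<nu> = (\<lambda>_. 0)")
  case True
  interpret prob_space haar by (rule prob_space_haar)
  show ?thesis using True by (simp add: prob_space)
next
  case False
  then obtain k where k: "\<nu> k \<noteq> 0" by (auto simp: fun_eq_iff)
  define a where "a = (\<lambda>n. if n = k then cis (pi / of_int (\<nu> k)) else 1 :: complex)"
  have a: "a \<in> torus" by (simp add: a_def torus_def)
  have "torus_char \<nu> a = (\<Prod>j | \<nu> j \<noteq> 0. if j = k then cis pi else 1)"
    unfolding torus_char_def using k by (intro prod.cong) (auto simp: a_def cis_power_int)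
  also have "\<dots> = -1" using assms k by (simp add: Z0_def prod.delta)
  finally have ca: "torus_char \<nu> a = -1" .
  have "(LINT z|haar. torus_char \<nu> z) = (LINT z|distr haar haar (\<lambda>z n. a n * z n). torus_char \<nu> z)"
    by (simp add: haar_translate[OF a])
  also have "\<dots> = (LINT z|haar. torus_char \<nu> (\<lambda>n. a n * z n))"
    by (rule integral_distr[OF measurable_translate[OF a]]) simp
  also have "\<dots> = - (LINT z|haar. torus_char \<nu> z)" by (simp add: torus_char_mult ca)
  finally show ?thesis using False by simp
qed


section \<open>The Poisson kernel of the infinite torus\<close>

definition weight :: "(nat \<Rightarrow> int) \<Rightarrow> nat" where
  "weight \<nu> = (\<Sum>j | \<nu> j \<noteq> 0. Suc j * nat \<bar>\<nu> j\<bar>)"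

definition signed_weight :: "(nat \<Rightarrow> int) \<Rightarrow> int" where
  "signed_weight \<nu> = (\<Sum>j | \<nu> j \<noteq> 0. int (Suc j) * \<nu> j)"

definition torus_poisson :: "real \<Rightarrow> (nat \<Rightarrow> complex) \<Rightarrow> complex" where
  "torus_poisson r z = (\<Sum>\<^sub>\<infinity>\<nu>\<in>Z0. of_real (r ^ weight \<nu>) * torus_char \<nu> z)"

lemma infsum_truncate:
  fixes f :: "'a \<Rightarrow> 'b::banach"
  assumes f: "(\<lambda>x. norm (f x)) summable_on A" and e: "0 < e"
  obtains F where "finite F" "F \<subseteq> A" "\<And>B. F \<subseteq> B \<Longrightarrow> B \<subseteq> A \<Longrightarrow> norm (infsum f A - infsum f B) \<le> e"
proof -
  let ?g = "\<lambda>x. norm (f x)"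
  have "(sum ?g \<longlongrightarrow> infsum ?g A) (finite_subsets_at_top A)"
    using has_sum_infsum[OF f] by (simp add: has_sum_def)
  then have "eventually (\<lambda>F. dist (sum ?g F) (infsum ?g A) < e) (finite_subsets_at_top A)"
    using e by (rule tendstoD)
  then obtain F where F: "finite F" "F \<subseteq> A" "dist (sum ?g F) (infsum ?g A) < e"
    unfolding eventually_finite_subsets_at_top by blast
  have tail: "infsum ?g (A - F) \<le> e"
    using F infsum_Diff[OF f summable_on_subset_banach[OF f F(2)] F(2)] by (simp add: dist_real_def)
  have "norm (infsum f A - infsum f B) \<le> e" if B: "F \<subseteq> B" "B \<subseteq> A" for B
  proof -
    have "infsum f A - infsum f B = infsum f (A - B)"
      using abs_summable_summable[OF f] B
      by (intro infsum_Diff[symmetric]) (auto intro: summable_on_subset_banach)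
    also have "norm \<dots> \<le> infsum ?g (A - B)"
      using f by (intro norm_infsum_bound) (auto intro: summable_on_subset_banach)
    also have "\<dots> \<le> infsum ?g (A - F)"
      using B f by (intro infsum_mono_neutral) (auto intro: summable_on_subset_banach)
    finally show ?thesis using tail by simp
  qed
  with F tail that show ?thesis by blast
qed

text \<open>
  The Fourier expansion of the Poisson kernel, evaluated in closed form.
\<close>

lemma has_sum_int_geometric:
  fixes w :: complex
  assumes q: "0 \<le> q" "q < 1" and w: "cmod w = 1"
  shows "((\<lambda>k::int. of_real (q ^ nat \<bar>k\<bar>) * w powi k) has_sum of_real ((1 - q\<^sup>2) / (cmod (1 - of_real q * w))\<^sup>2)) UNIV"
proof -
  define u where "u = of_real q * w"
  have nu: "cmod u < 1" using q w by (simp add: u_def norm_mult)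
  have cw: "w powi (- int n) = cnj w ^ n" for n
  proof -
    have "cnj w = inverse w" using w by (metis divide_conv_cnj inverse_eq_divide mult_1)
    then show ?thesis by (simp add: power_int_minus power_inverse)
  qed
  have geo: "((\<lambda>n. v ^ n) has_sum 1 / (1 - v)) UNIV" if "cmod v < 1" for v :: complex
    by (rule norm_summable_imp_has_sum) (use that geometric_sums[OF that] in \<open>auto simp: norm_power summable_geometric\<close>)
  have 1: "((\<lambda>k::int. of_real (q ^ nat \<bar>k\<bar>) * w powi k) has_sum 1 / (1 - u)) (range int)"
    using geo[OF nu] by (subst has_sum_reindex) (auto simp: o_def u_def power_mult_distrib)
  have 2: "((\<lambda>k::int. of_real (q ^ nat \<bar>k\<bar>) * w powi k) has_sum cnj u * (1 / (1 - cnj u))) (range (\<lambda>n. - int (Suc n)))"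
  proof (subst has_sum_reindex)
    have "(\<lambda>k::int. of_real (q ^ nat \<bar>k\<bar>) * w powi k) \<circ> (\<lambda>n. - int (Suc n)) = (\<lambda>n. cnj u * cnj u ^ n)"
    proof
      fix n
      have "((\<lambda>k::int. of_real (q ^ nat \<bar>k\<bar>) * w powi k) \<circ> (\<lambda>n. - int (Suc n))) n = of_real (q ^ Suc n) * cnj w ^ Suc n"
        by (simp only: o_def cw abs_minus_cancel abs_of_nat nat_int)
      also have "\<dots> = cnj u ^ Suc n" by (simp add: u_def power_mult_distrib)
      finally show "((\<lambda>k::int. of_real (q ^ nat \<bar>k\<bar>) * w powi k) \<circ> (\<lambda>n. - int (Suc n))) n = cnj u * cnj u ^ n" by simp
    qed
    moreover have "((\<lambda>n. cnj u * cnj u ^ n) has_sum cnj u * (1 / (1 - cnj u))) UNIV"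
      using nu by (intro has_sum_cmult_right geo) simp
    ultimately show "((\<lambda>k::int. of_real (q ^ nat \<bar>k\<bar>) * w powi k) \<circ> (\<lambda>n. - int (Suc n)) has_sum cnj u * (1 / (1 - cnj u))) UNIV"
      by simp
  qed (auto simp: inj_on_def)
  have "range int \<union> range (\<lambda>n. - int (Suc n)) = UNIV"
  proof -
    have "k \<in> range int \<union> range (\<lambda>n. - int (Suc n))" for k by (cases k) (auto simp del: of_nat_Suc)
    then show ?thesis by blast
  qed
  moreover have "range int \<inter> range (\<lambda>n. - int (Suc n)) = {}" by (auto simp del: of_nat_Suc)
  ultimately have "((\<lambda>k::int. of_real (q ^ nat \<bar>k\<bar>) * w powi k) has_sum 1 / (1 - u) + cnj u * (1 / (1 - cnj u))) UNIV"
    using has_sum_Un_disjoint[OF 1 2] by simp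
  moreover have "1 / (1 - u) + cnj u * (1 / (1 - cnj u)) = of_real ((1 - q\<^sup>2) / (cmod (1 - u))\<^sup>2)"
  proof -
    have nz: "1 - u \<noteq> 0" "1 - cnj u \<noteq> 0" using nu by (auto simp: eq_iff_diff_eq_0[symmetric] dest: arg_cong[where f = cmod])
    have "w * cnj w = 1" using w by (simp add: complex_norm_square[symmetric])
    moreover have "u * cnj u = of_real q * of_real q * (w * cnj w)" by (simp add: u_def)
    ultimately have "u * cnj u = of_real (q\<^sup>2)" by (simp add: power2_eq_square)
    moreover have "of_real ((cmod (1 - u))\<^sup>2) = (1 - u) * (1 - cnj u)"
      by (subst complex_norm_square) simp
    ultimately show ?thesis using nz by (simp add: field_simps)
  qed
  ultimately show ?thesis by (simp add: u_def)
qed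

lemma has_sum_int_power:
  fixes q :: real
  assumes "0 \<le> q" "q < 1"
  shows "((\<lambda>k::int. q ^ nat \<bar>k\<bar>) has_sum (1 + q) / (1 - q)) UNIV"
proof -
  have "((\<lambda>k::int. Re (of_real (q ^ nat \<bar>k\<bar>) * 1 powi k)) has_sum Re (of_real ((1 - q\<^sup>2) / (cmod (1 - of_real q * 1))\<^sup>2))) UNIV"
    by (intro has_sum_Re has_sum_int_geometric assms) simp
  moreover have "(1 - q\<^sup>2) / (cmod (1 - of_real q * 1))\<^sup>2 = (1 + q) / (1 - q)"
  proof -
    have c: "cmod (1 - of_real q * 1) = 1 - q" using assms by (metis abs_of_nonneg diff_ge_0_iff_ge less_imp_le mult.right_neutral norm_of_real of_real_1 of_real_diff)
    have "1 - q\<^sup>2 = (1 - q) * (1 + q)" by (simp add: power2_eq_square algebra_simps)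
    then show ?thesis unfolding c power2_eq_square using assms by simp
  qed
  ultimately show ?thesis by simp
qed

text \<open>
  Functions on the first \<open>n\<close> indices are \<open>undefined\<close> elsewhere when products of sets are formed;
  here they are turned into integer sequences.
\<close>

definition extend0 :: "nat \<Rightarrow> (nat \<Rightarrow> int) \<Rightarrow> nat \<Rightarrow> int" where
  "extend0 n g = (\<lambda>j. if j < n then g j else 0)"

lemma weight_superset:
  assumes "finite J" "{j. \<nu> j \<noteq> 0} \<subseteq> J"
  shows "weight \<nu> = (\<Sum>j\<in>J. Suc j * nat \<bar>\<nu> j\<bar>)"
  unfolding weight_def using assms by (intro sum.mono_neutral_left) auto

lemma power_weight_extend0: "r ^ weight (extend0 n g) = (\<Prod>j<n. (r ^ Suc j) ^ nat \<bar>g j\<bar>)"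
  for r :: "'a::comm_semiring_1"
proof -
  have "weight (extend0 n g) = (\<Sum>j<n. Suc j * nat \<bar>extend0 n g j\<bar>)"
    by (rule weight_superset) (auto simp: extend0_def split: if_splits)
  then have "r ^ weight (extend0 n g) = (\<Prod>j<n. r ^ (Suc j * nat \<bar>extend0 n g j\<bar>))"
    by (simp only: power_sum)
  also have "\<dots> = (\<Prod>j<n. (r ^ Suc j) ^ nat \<bar>g j\<bar>)"
    by (intro prod.cong) (auto simp: extend0_def power_mult[symmetric] simp del: power_Suc mult_Suc)
  finally show ?thesis .
qed

lemma torus_char_extend0: "torus_char (extend0 n g) z = (\<Prod>j<n. z j powi g j)"
  by (subst torus_char_superset[of "{..<n}"]) (auto simp: extend0_def split: if_splits)

lemma bij_betw_extend0:
  "bij_betw (extend0 n) (Pi\<^sub>E {..<n} (\<lambda>_. UNIV)) {\<nu>. \<forall>j\<ge>n. \<nu> j = 0}"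
  by (rule bij_betw_byWitness[where f' = "\<lambda>\<nu>. restrict \<nu> {..<n}"])
     (auto simp: extend0_def fun_eq_iff restrict_def PiE_def extensional_def)

lemma Z0_eq_UN: "Z0 = (\<Union>n. {\<nu>. \<forall>j\<ge>n. \<nu> j = 0})"
proof (intro equalityI subsetI)
  fix \<nu> :: "nat \<Rightarrow> int" assume "\<nu> \<in> Z0"
  then obtain n where "\<And>j. \<nu> j \<noteq> 0 \<Longrightarrow> j < n" by (auto simp: Z0_def finite_nat_set_iff_bounded)
  then show "\<nu> \<in> (\<Union>n. {\<nu>. \<forall>j\<ge>n. \<nu> j = 0})" by (auto simp: not_less[symmetric])
next
  fix \<nu> :: "nat \<Rightarrow> int" assume "\<nu> \<in> (\<Union>n. {\<nu>. \<forall>j\<ge>n. \<nu> j = 0})"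
  then obtain n where "\<forall>j\<ge>n. \<nu> j = 0" by auto
  then have "{j. \<nu> j \<noteq> 0} \<subseteq> {..<n}" by (auto simp: not_le[symmetric])
  then show "\<nu> \<in> Z0" by (auto simp: Z0_def intro: finite_subset)
qed

lemma finite_Z0_subset_bounded:
  assumes "finite F" "F \<subseteq> Z0"
  obtains n where "F \<subseteq> {\<nu>. \<forall>j\<ge>n. \<nu> j = 0}"
proof -
  have "\<forall>\<nu>\<in>F. \<exists>n. \<forall>j\<ge>n. \<nu> j = 0" using assms(2) unfolding Z0_eq_UN by blast
  then obtain N where N: "\<And>\<nu>. \<nu> \<in> F \<Longrightarrow> \<forall>j\<ge>N \<nu>. \<nu> j = 0" by metis
  have "\<forall>j\<ge>Max (N ` F). \<nu> j = 0" if "\<nu> \<in> F" for \<nu>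
    using N[OF that] that assms(1) Max_ge[of "N ` F" "N \<nu>"] by (meson finite_imageI imageI order_trans)
  then show ?thesis using that by blast
qed

text \<open>
  A finite set of frequencies lies in a box. The sum over a box is a product of sums over the
  coordinates, of which the \<open>j\<close>-th is at most \<open>(1 + r\<^sup>j) / (1 - r\<^sup>j) \<le> exp (2 r\<^sup>j / (1 - r))\<close>;
  since \<open>\<Sum> r\<^sup>j\<close> converges, the bound is uniform in the box.
\<close>

lemma summable_weight:
  fixes r :: real
  assumes r: "0 \<le> r" "r < 1"
  shows "(\<lambda>\<nu>. r ^ weight \<nu>) summable_on Z0"
proof (rule nonneg_bdd_above_summable_on)
  show "bdd_above (sum (\<lambda>\<nu>. r ^ weight \<nu>) ` {F. F \<subseteq> Z0 \<and> finite F})"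
  proof (rule bdd_aboveI2)
    fix F assume "F \<in> {F. F \<subseteq> Z0 \<and> finite F}"
    then have F: "F \<subseteq> Z0" "finite F" by auto
    obtain n where n: "F \<subseteq> {\<nu>. \<forall>j\<ge>n. \<nu> j = 0}"
      by (rule finite_Z0_subset_bounded[OF F(2,1)])
    define N where "N = Max (insert 0 ((\<lambda>(\<nu>, j). \<bar>\<nu> j\<bar>) ` (F \<times> {..<n})))"
    have N: "\<bar>\<nu> j\<bar> \<le> N" if "\<nu> \<in> F" "j < n" for \<nu> j
      unfolding N_def using F that by (intro Max_ge) force+
    define B where "B = Pi\<^sub>E {..<n} (\<lambda>_. {-N..N})"
    have finB: "finite B" unfolding B_def by (intro finite_PiE) auto
    have q: "0 \<le> r ^ Suc j" "r ^ Suc j < 1" for j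
      using r mult_less_one[OF r power_le_one[OF r(1), of j]] by simp_all
    have "F \<subseteq> extend0 n ` B"
    proof
      fix \<nu> assume \<nu>: "\<nu> \<in> F"
      then have "\<nu> = extend0 n (restrict \<nu> {..<n})" using n by (auto simp: extend0_def fun_eq_iff)
      moreover have "restrict \<nu> {..<n} \<in> B" using N[OF \<nu>] by (force simp: B_def)
      ultimately show "\<nu> \<in> extend0 n ` B" by blast
    qed
    then have "(\<Sum>\<nu>\<in>F. r ^ weight \<nu>) \<le> (\<Sum>\<nu>\<in>extend0 n ` B. r ^ weight \<nu>)"
      using r finB by (intro sum_mono2) auto
    also have "\<dots> = (\<Sum>g\<in>B. r ^ weight (extend0 n g))"
    proof (rule sum.reindex_cong[OF _ refl refl])
      have "B \<subseteq> Pi\<^sub>E {..<n} (\<lambda>_. UNIV)" by (auto simp: B_def)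
      then show "inj_on (extend0 n) B"
        using bij_betw_imp_inj_on[OF bij_betw_extend0] inj_on_subset by blast
    qed
    also have "\<dots> = (\<Sum>g\<in>B. \<Prod>j<n. (r ^ Suc j) ^ nat \<bar>g j\<bar>)" by (simp only: power_weight_extend0)
    also have "\<dots> = (\<Prod>j<n. \<Sum>k\<in>{-N..N}. (r ^ Suc j) ^ nat \<bar>k\<bar>)"
      unfolding B_def by (rule prod_sum_PiE[symmetric]) auto
    also have "\<dots> \<le> (\<Prod>j<n. exp (2 / (1 - r) * r ^ Suc j))"
    proof (rule prod_mono, intro conjI)
      fix j
      show "0 \<le> (\<Sum>k\<in>{-N..N}. (r ^ Suc j) ^ nat \<bar>k\<bar>)" using q by (intro sum_nonneg) simp
      have "(\<Sum>k\<in>{-N..N}. (r ^ Suc j) ^ nat \<bar>k\<bar>) \<le> (1 + r ^ Suc j) / (1 - r ^ Suc j)"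
        using q[of j] by (intro has_sum_mono_neutral[OF has_sum_finite has_sum_int_power[OF q[of j]]]) auto
      also have "\<dots> = 1 + 2 * (r ^ Suc j / (1 - r ^ Suc j))" using q[of j] by (simp add: field_simps)
      also have "\<dots> \<le> 1 + 2 * (r ^ Suc j / (1 - r))"
      proof -
        have "r ^ Suc j \<le> r" using r power_decreasing[of 1 "Suc j" r] by simp
        then have "r ^ Suc j / (1 - r ^ Suc j) \<le> r ^ Suc j / (1 - r)" using r q[of j] by (intro divide_left_mono) auto
        then show ?thesis by simp
      qed
      also have "\<dots> = 1 + 2 / (1 - r) * r ^ Suc j" by simp
      also have "\<dots> \<le> exp (2 / (1 - r) * r ^ Suc j)" by (rule exp_ge_add_one_self)
      finally show "(\<Sum>k\<in>{-N..N}. (r ^ Suc j) ^ nat \<bar>k\<bar>) \<le> exp (2 / (1 - r) * r ^ Suc j)" .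
    qed
    also have "\<dots> = exp (2 / (1 - r) * (\<Sum>j<n. r ^ Suc j))"
      by (simp add: exp_sum sum_distrib_left del: power_Suc)
    also have "\<dots> \<le> exp (2 / (1 - r) * (1 / (1 - r)))"
    proof -
      have "(\<Sum>j<n. r ^ Suc j) \<le> (\<Sum>j<n. r ^ j)" using r by (intro sum_mono power_decreasing) auto
      also have "\<dots> \<le> 1 / (1 - r)"
        using r sum_le_suminf[of "\<lambda>j. r ^ j" "{..<n}"] suminf_geometric[of r] by (simp add: summable_geometric)
      finally have "2 / (1 - r) * (\<Sum>j<n. r ^ Suc j) \<le> 2 / (1 - r) * (1 / (1 - r))"
        using r by (intro mult_left_mono) simp_all
      then show ?thesis by (simp only: exp_le_cancel_iff)
    qed
    finally show "(\<Sum>\<nu>\<in>F. r ^ weight \<nu>) \<le> exp (2 / (1 - r) * (1 / (1 - r)))" .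
  qed
qed (use r in auto)

lemma abs_summable_weight_char:
  assumes r: "0 \<le> r" "r < 1" and z: "z \<in> torus" and c: "\<And>\<nu>. cmod (c \<nu>) \<le> K" and S: "S \<subseteq> Z0"
  shows "(\<lambda>\<nu>. cmod (c \<nu> * of_real (r ^ weight \<nu>) * torus_char \<nu> z)) summable_on S"
proof -
  have "(\<lambda>\<nu>. K * r ^ weight \<nu>) summable_on S"
    by (intro summable_on_cmult_right summable_on_subset_banach[OF summable_weight[OF r] S])
  then have "(\<lambda>\<nu>. norm (K * r ^ weight \<nu>)) summable_on S"
    by (rule summable_on_iff_abs_summable_on_real[THEN iffD1])
  then show ?thesis
  proof (rule Infinite_Sum.abs_summable_on_comparison_test)
    fix \<nu>
    have "cmod (c \<nu> * of_real (r ^ weight \<nu>) * torus_char \<nu> z) = cmod (c \<nu>) * r ^ weight \<nu>"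
      using r by (simp add: norm_mult norm_torus_char[OF z] norm_power)
    also have "\<dots> \<le> K * r ^ weight \<nu>" using c r by (intro mult_right_mono) auto
    finally show "norm (c \<nu> * of_real (r ^ weight \<nu>) * torus_char \<nu> z) \<le> norm (K * r ^ weight \<nu>)" by simp
  qed
qed

text \<open>
  Restricted to frequencies living on the first \<open>n\<close> coordinates, the kernel is a product of
  Poisson kernels of the disc; the full kernel is a limit of these.
\<close>

lemma torus_poisson_nonneg:
  assumes r: "0 \<le> r" "r < 1" and z: "z \<in> torus"
  shows "torus_poisson r z = of_real (cmod (torus_poisson r z))"
proof -
  let ?f = "\<lambda>\<nu>. of_real (r ^ weight \<nu>) * torus_char \<nu> z"
  have sum: "(\<lambda>\<nu>. cmod (?f \<nu>)) summable_on Z0"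
    using abs_summable_weight_char[OF r z, of "\<lambda>_. 1" 1 Z0] by simp
  have fin: "infsum ?f {\<nu>. \<forall>j\<ge>n. \<nu> j = 0} \<in> \<real>\<^sub>\<ge>\<^sub>0" for n
  proof -
    have q: "0 \<le> r ^ Suc j" "r ^ Suc j < 1" for j
      using r mult_less_one[OF r power_le_one[OF r(1), of j]] by simp_all
    have geo: "((\<lambda>k::int. of_real ((r ^ Suc j) ^ nat \<bar>k\<bar>) * z j powi k) has_sum
        of_real ((1 - (r ^ Suc j)\<^sup>2) / (cmod (1 - of_real (r ^ Suc j) * z j))\<^sup>2)) UNIV" for j
      by (intro has_sum_int_geometric q torus_norm z)
    have "infsum ?f {\<nu>. \<forall>j\<ge>n. \<nu> j = 0} = (\<Sum>\<^sub>\<infinity>g\<in>Pi\<^sub>E {..<n} (\<lambda>_. UNIV). ?f (extend0 n g))"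
      by (rule infsum_reindex_bij_betw[OF bij_betw_extend0, symmetric])
    also have "\<dots> = (\<Sum>\<^sub>\<infinity>g\<in>Pi\<^sub>E {..<n} (\<lambda>_. UNIV). \<Prod>j<n. of_real ((r ^ Suc j) ^ nat \<bar>g j\<bar>) * z j powi g j)"
      by (simp only: power_weight_extend0 torus_char_extend0 of_real_prod prod.distrib)
    also have "\<dots> = (\<Prod>j<n. \<Sum>\<^sub>\<infinity>k. of_real ((r ^ Suc j) ^ nat \<bar>k\<bar>) * z j powi k)"
    proof (rule infsum_prod_PiE_abs)
      fix j
      show "(\<lambda>k. cmod (of_real ((r ^ Suc j) ^ nat \<bar>k\<bar>) * z j powi k)) summable_on UNIV"
        by (rule summable_on_iff_abs_summable_on_complex[THEN iffD1]) (rule has_sum_imp_summable[OF geo[of j]])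
    qed simp
    also have "\<dots> = of_real (\<Prod>j<n. (1 - (r ^ Suc j)\<^sup>2) / (cmod (1 - of_real (r ^ Suc j) * z j))\<^sup>2)"
      by (simp only: infsumI[OF geo] of_real_prod)
    also have "\<dots> \<in> \<real>\<^sub>\<ge>\<^sub>0"
    proof -
      have "0 \<le> (\<Prod>j<n. (1 - (r ^ Suc j)\<^sup>2) / (cmod (1 - of_real (r ^ Suc j) * z j))\<^sup>2)"
      proof (intro prod_nonneg ballI divide_nonneg_nonneg zero_le_power2)
        fix j show "0 \<le> 1 - (r ^ Suc j)\<^sup>2" using q[of j] by (simp add: power_le_one del: power_Suc)
      qed
      then show ?thesis by (simp only: nonneg_Reals_of_real_iff)
    qed
    finally show ?thesis .
  qed
  have "torus_poisson r z \<in> closure \<real>\<^sub>\<ge>\<^sub>0"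
    unfolding closure_approachable
  proof (intro allI impI)
    fix e :: real assume e: "0 < e"
    then have e2: "0 < e / 2" by simp
    obtain F where F: "finite F" "F \<subseteq> Z0" "\<And>B. F \<subseteq> B \<Longrightarrow> B \<subseteq> Z0 \<Longrightarrow> norm (infsum ?f Z0 - infsum ?f B) \<le> e / 2"
      by (rule infsum_truncate[OF sum e2], rule that, assumption+)
    obtain n where "F \<subseteq> {\<nu>. \<forall>j\<ge>n. \<nu> j = 0}"
      by (rule finite_Z0_subset_bounded[OF F(1,2)])
    then have "norm (infsum ?f Z0 - infsum ?f {\<nu>. \<forall>j\<ge>n. \<nu> j = 0}) \<le> e / 2"
      by (rule F(3)) (auto simp: Z0_eq_UN)
    then have "dist (infsum ?f {\<nu>. \<forall>j\<ge>n. \<nu> j = 0}) (torus_poisson r z) < e"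
      using e by (simp add: torus_poisson_def dist_norm norm_minus_commute)
    then show "\<exists>y\<in>\<real>\<^sub>\<ge>\<^sub>0. dist y (torus_poisson r z) < e" using fin by blast
  qed
  then have "torus_poisson r z \<in> \<real>\<^sub>\<ge>\<^sub>0" by simp
  then show ?thesis by (auto simp: nonneg_Reals_def)
qed

section \<open>Poisson extensions contract the total variation\<close>

lemma norm_fourier_le:
  assumes "complex_measure haar \<mu>"
  shows "cmod (fourier \<mu> \<nu>) \<le> variation_bound haar \<mu>"
  using complex_integral_bound[OF assms, of "torus_char (- \<nu>)" 1]
  by (simp add: fourier_def space_haar norm_torus_char)

lemma prod_cis: "(\<Prod>j\<in>J. cis (f j)) = cis (\<Sum>j\<in>J. f j)"
  by (induction J rule: infinite_finite_induct) (auto simp: cis_mult)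

lemma torus_char_flow:
  "torus_char \<nu> (flow (cis t) z) = cis (t * of_int (signed_weight \<nu>)) * torus_char \<nu> z"
proof -
  have "torus_char \<nu> (flow (cis t) z) = torus_char \<nu> (\<lambda>n. cis t ^ Suc n) * torus_char \<nu> z"
    unfolding flow_eq_translate by (rule torus_char_mult)
  also have "torus_char \<nu> (\<lambda>n. cis t ^ Suc n) = (\<Prod>j | \<nu> j \<noteq> 0. cis (t * of_int (int (Suc j) * \<nu> j)))"
    unfolding torus_char_def
    by (intro prod.cong refl) (simp only: Complex.DeMoivre cis_power_int, simp add: algebra_simps)
  also have "\<dots> = cis (t * of_int (signed_weight \<nu>))"
    by (simp only: prod_cis signed_weight_def of_int_sum sum_distrib_left)
  finally show ?thesis .
qed

lemma radial_ext_polar: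
  assumes "0 \<le> r"
  shows "radial_ext \<mu> (of_real r) (flow (cis t) z) =
    (\<Sum>\<^sub>\<infinity>\<nu>\<in>Z0. fourier \<mu> \<nu> * of_real (r ^ weight \<nu>) * cis (t * of_int (signed_weight \<nu>)) * torus_char \<nu> z)"
proof -
  have "Arg (of_real r) = 0" using assms by (cases "r = 0") (auto simp: Arg_zero)
  then show ?thesis
    using assms unfolding radial_ext_def weight_def[symmetric] by (simp add: torus_char_flow mult.assoc)
qed

lemma flow_1 [simp]: "flow 1 z = z"
  by (simp add: flow_def fun_eq_iff)

lemma radial_ext_real:
  assumes "0 \<le> r"
  shows "radial_ext \<mu> (of_real r) z = (\<Sum>\<^sub>\<infinity>\<nu>\<in>Z0. fourier \<mu> \<nu> * of_real (r ^ weight \<nu>) * torus_char \<nu> z)"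
  using radial_ext_polar[OF assms, of \<mu> 0 z] by simp

text \<open>
  The phase of \<open>\<xi>\<close> acts as a translation, so only real radii need to be studied.
\<close>

lemma radial_ext_flow: "radial_ext \<mu> \<xi> z = radial_ext \<mu> (of_real (cmod \<xi>)) (flow (cis (Arg \<xi>)) z)"
  unfolding radial_ext_polar[OF norm_ge_zero]
  by (simp add: radial_ext_def weight_def signed_weight_def)

lemma weight_uminus [simp]: "weight (- \<nu>) = weight \<nu>"
  by (simp add: weight_def)

lemma weight_0 [simp]: "weight (\<lambda>_. 0) = 0"
  by (simp add: weight_def)

text \<open>
  The error does not depend on the point, so the series can be truncated uniformly on the torus.
\<close>

lemma char_series_tail:
  fixes r :: real
  assumes r: "0 \<le> r" "r < 1" and z: "z \<in> torus" and c: "\<And>\<nu>. cmod (c \<nu>) \<le> K"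
    and F: "finite F" "F \<subseteq> Z0"
  shows "cmod ((\<Sum>\<^sub>\<infinity>\<nu>\<in>Z0. c \<nu> * of_real (r ^ weight \<nu>) * torus_char \<nu> z) - (\<Sum>\<nu>\<in>F. c \<nu> * of_real (r ^ weight \<nu>) * torus_char \<nu> z))
    \<le> K * (\<Sum>\<^sub>\<infinity>\<nu>\<in>Z0 - F. r ^ weight \<nu>)"
proof -
  let ?f = "\<lambda>\<nu>. c \<nu> * of_real (r ^ weight \<nu>) * torus_char \<nu> z"
  have abs: "(\<lambda>\<nu>. cmod (?f \<nu>)) summable_on S" if "S \<subseteq> Z0" for S
    by (rule abs_summable_weight_char[OF r z c that])
  have w: "(\<lambda>\<nu>. r ^ weight \<nu>) summable_on (Z0 - F)"
    by (rule summable_on_subset_banach[OF summable_weight[OF r]]) auto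
  have "infsum ?f Z0 - sum ?f F = infsum ?f (Z0 - F)"
    using infsum_Diff[OF abs_summable_summable[OF abs[OF order_refl]] abs_summable_summable[OF abs[OF F(2)]] F(2)] F by simp
  also have "cmod \<dots> \<le> (\<Sum>\<^sub>\<infinity>\<nu>\<in>Z0 - F. cmod (?f \<nu>))" by (rule norm_infsum_bound[OF abs]) auto
  also have "\<dots> \<le> (\<Sum>\<^sub>\<infinity>\<nu>\<in>Z0 - F. K * r ^ weight \<nu>)"
  proof (rule infsum_mono[OF abs])
    fix \<nu>
    have "cmod (?f \<nu>) = cmod (c \<nu>) * r ^ weight \<nu>"
      using r by (simp add: norm_mult norm_torus_char[OF z] norm_power)
    also have "\<dots> \<le> K * r ^ weight \<nu>" using c r by (intro mult_right_mono) auto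
    finally show "cmod (?f \<nu>) \<le> K * r ^ weight \<nu>" .
  qed (use w in \<open>auto intro: summable_on_cmult_right\<close>)
  also have "\<dots> = K * (\<Sum>\<^sub>\<infinity>\<nu>\<in>Z0 - F. r ^ weight \<nu>)" by (rule infsum_cmult_right) (use w in simp)
  finally show ?thesis .
qed

lemma weight_tail:
  fixes r :: real
  assumes r: "0 \<le> r" "r < 1" and e: "0 < e" and G: "finite G" "G \<subseteq> Z0"
  obtains F where "finite F" "F \<subseteq> Z0" "G \<subseteq> F" "(\<Sum>\<^sub>\<infinity>\<nu>\<in>Z0 - F. r ^ weight \<nu>) \<le> e"
proof -
  have w: "(\<lambda>\<nu>. r ^ weight \<nu>) summable_on S" if "S \<subseteq> Z0" for S
    by (rule summable_on_subset_banach[OF summable_weight[OF r] that])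
  have wn: "(\<lambda>\<nu>. norm (r ^ weight \<nu>)) summable_on Z0" using summable_weight[OF r] r by simp
  obtain F where F: "finite F" "F \<subseteq> Z0"
    "\<And>B. F \<subseteq> B \<Longrightarrow> B \<subseteq> Z0 \<Longrightarrow> norm ((\<Sum>\<^sub>\<infinity>\<nu>\<in>Z0. r ^ weight \<nu>) - (\<Sum>\<^sub>\<infinity>\<nu>\<in>B. r ^ weight \<nu>)) \<le> e"
    by (rule infsum_truncate[OF wn e], rule that, assumption+)
  have FG: "F \<union> G \<subseteq> Z0" using F G by auto
  show ?thesis
  proof (rule that[of "F \<union> G"])
    show "(\<Sum>\<^sub>\<infinity>\<nu>\<in>Z0 - (F \<union> G). r ^ weight \<nu>) \<le> e"
      unfolding infsum_Diff[OF w[OF order_refl] w[OF FG] FG] using F(3)[OF Un_upper1 FG] by simp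
  qed (use F G in auto)
qed

lemma continuous_on_radial_ext:
  assumes \<mu>: "complex_measure haar \<mu>" and r: "0 \<le> r" "r < 1"
  shows "continuous_on torus (radial_ext \<mu> (of_real r))"
proof -
  let ?K = "variation_bound haar \<mu>"
  have "uniform_limit torus (\<lambda>F z. \<Sum>\<nu>\<in>F. fourier \<mu> \<nu> * of_real (r ^ weight \<nu>) * torus_char \<nu> z)
      (\<lambda>z. \<Sum>\<^sub>\<infinity>\<nu>\<in>Z0. fourier \<mu> \<nu> * of_real (r ^ weight \<nu>) * torus_char \<nu> z) (finite_subsets_at_top Z0)"
  proof (rule Weierstrass_m_test_general)
    show "(\<lambda>\<nu>. ?K * r ^ weight \<nu>) summable_on Z0" by (intro summable_on_cmult_right summable_weight r)
    fix \<nu> z assume "z \<in> torus"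
    then show "cmod (fourier \<mu> \<nu> * of_real (r ^ weight \<nu>) * torus_char \<nu> z) \<le> ?K * r ^ weight \<nu>"
      using norm_fourier_le[OF \<mu>, of \<nu>] r by (simp add: norm_mult norm_torus_char norm_power mult_right_mono)
  qed
  then have "continuous_on torus (\<lambda>z. \<Sum>\<^sub>\<infinity>\<nu>\<in>Z0. fourier \<mu> \<nu> * of_real (r ^ weight \<nu>) * torus_char \<nu> z)"
    by (rule uniform_limit_theorem[rotated])
       (auto intro!: always_eventually continuous_intros continuous_on_torus_char)
  then show ?thesis unfolding radial_ext_real[OF r(1), abs_def] .
qed

lemma compact_torus: "compact torus"
proof -
  have "compactin (product_topology (\<lambda>i::nat. euclidean :: complex topology) UNIV) (PiE UNIV (\<lambda>_. sphere 0 1))"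
    by (subst compactin_PiE) auto
  moreover have "torus = PiE UNIV (\<lambda>_. sphere 0 1)" by (auto simp: torus_def)
  ultimately show ?thesis by (simp add: euclidean_product_topology)
qed

lemma bounded_measurable_continuous:
  assumes "continuous_on torus g" shows "bounded_measurable haar g"
proof -
  have "bounded (g ` torus)" by (intro compact_imp_bounded compact_continuous_image assms compact_torus)
  then obtain B where "\<forall>z\<in>torus. cmod (g z) \<le> B" unfolding bounded_iff by blast
  then show ?thesis
    by (intro bounded_measurableI borel_measurable_haar_continuous assms) (auto simp: space_haar)
qed

lemma integrable_haar_bounded: "bounded_measurable haar g \<Longrightarrow> integrable haar g"
  by (rule integrable_bounded_measurable[of haar haar])
     (auto intro: prob_space.finite_measure prob_space_haar)

lemmas integrable_radial_ext =
  integrable_haar_bounded[OF bounded_measurable_continuous[OF continuous_on_radial_ext]]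

lemma torus_char_cnj: "torus_char \<nu> (\<lambda>n. cnj (z n)) = cnj (torus_char \<nu> z)"
  by (simp add: torus_char_def)

text \<open>
  The truncation differs by at most \<open>e\<close> from a nonnegative function, so its modulus exceeds its
  real part by at most \<open>2 e\<close>, and the integral of the truncation is 0 or 1 by orthogonality.
\<close>

lemma truncated_kernel_norm:
  fixes r :: real
  assumes r: "0 \<le> r" "r < 1" and F: "finite F" "F \<subseteq> Z0" and tail: "(\<Sum>\<^sub>\<infinity>\<nu>\<in>Z0 - F. r ^ weight \<nu>) \<le> e"
    and \<phi>: "\<phi> \<in> torus"
  shows "(LINT z|haar. cmod (\<Sum>\<nu>\<in>F. (of_real (r ^ weight \<nu>) * torus_char \<nu> z) * torus_char (- \<nu>) \<phi>)) \<le> 1 + 2 * e"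
proof -
  interpret prob_space haar by (rule prob_space_haar)
  define u where "u = (\<lambda>(z :: nat \<Rightarrow> complex) n. cnj (\<phi> n) * z n)"
  define S where "S = (\<lambda>z. \<Sum>\<nu>\<in>F. (of_real (r ^ weight \<nu>) * torus_char \<nu> z) * torus_char (- \<nu>) \<phi>)"
  have "torus_char \<nu> (u z) = cnj (torus_char \<nu> \<phi>) * torus_char \<nu> z" for \<nu> z
    unfolding u_def torus_char_mult torus_char_cnj ..
  then have S: "S z = (\<Sum>\<nu>\<in>F. of_real (r ^ weight \<nu>) * torus_char \<nu> (u z))" for z
    by (simp add: S_def torus_char_uminus[OF \<phi>] mult_ac)
  have intS: "integrable haar S"
    unfolding S_def
    by (intro Bochner_Integration.integrable_sum integrable_mult_left integrable_mult_right
        integrable_haar_bounded bounded_measurable_torus_char)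
  have pw: "cmod (S z) \<le> Re (S z) + 2 * e" if z: "z \<in> torus" for z
  proof -
    have uz: "u z \<in> torus" using z \<phi> by (simp add: u_def torus_def norm_mult)
    have "cmod (torus_poisson r (u z) - S z) \<le> e"
      using char_series_tail[OF r uz, of "\<lambda>_. 1" 1, OF _ F] tail by (simp add: torus_poisson_def S)
    moreover have "cmod (S z) \<le> cmod (torus_poisson r (u z)) + cmod (torus_poisson r (u z) - S z)"
      by (metis norm_minus_commute norm_triangle_sub)
    moreover have "cmod (torus_poisson r (u z)) = Re (torus_poisson r (u z))"
      by (subst (2) torus_poisson_nonneg[OF r uz]) simp
    moreover have "Re (torus_poisson r (u z)) \<le> Re (S z) + cmod (torus_poisson r (u z) - S z)"
      using complex_Re_le_cmod[of "torus_poisson r (u z) - S z"] by simp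
    ultimately show ?thesis by linarith
  qed
  have "(LINT z|haar. cmod (S z)) \<le> (LINT z|haar. Re (S z) + 2 * e)"
    using intS pw by (intro integral_mono) (auto simp: space_haar intro!: integrable_norm integrable_Re)
  also have "\<dots> = Re (LINT z|haar. S z) + 2 * e"
    using intS by (simp add: integral_Re prob_space)
  also have "(LINT z|haar. S z) = (\<Sum>\<nu>\<in>F. (of_real (r ^ weight \<nu>) * (LINT z|haar. torus_char \<nu> z)) * torus_char (- \<nu>) \<phi>)"
  proof -
    have "(LINT z|haar. S z) = (\<Sum>\<nu>\<in>F. LINT z|haar. (of_real (r ^ weight \<nu>) * torus_char \<nu> z) * torus_char (- \<nu>) \<phi>)"
      unfolding S_def
      by (intro Bochner_Integration.integral_sum integrable_mult_left integrable_mult_right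
          integrable_haar_bounded bounded_measurable_torus_char)
    then show ?thesis by simp
  qed
  also have "\<dots> = (\<Sum>\<nu>\<in>F. if \<nu> = (\<lambda>_. 0) then 1 else 0)"
    using F by (intro sum.cong) (auto simp: integral_torus_char torus_char_uminus[OF \<phi>] prob_space)
  also have "Re \<dots> \<le> 1" using F by simp
  finally show ?thesis by (simp add: S_def)
qed

text \<open>
  \<open>kernel_contraction\<close> applied to truncations of the Poisson kernel; all errors are proportional
  to the tail \<open>d\<close> of the series of weights.
\<close>

lemma radial_ext_L1_le:
  assumes \<mu>: "complex_measure haar \<mu>" and r: "0 \<le> r" "r < 1"
  shows "(LINT z|haar. cmod (radial_ext \<mu> (of_real r) z)) \<le> enn2real (total_variation haar \<mu>)"
proof (rule field_le_epsilon)
  fix e :: real assume e: "0 < e"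
  interpret prob_space haar by (rule prob_space_haar)
  define T where "T = enn2real (total_variation haar \<mu>)"
  define K where "K = variation_bound haar \<mu>"
  have nn: "0 \<le> T" "0 \<le> K" by (auto simp: T_def K_def variation_bound_nonneg)
  define d where "d = e / (2 * T + K + 1)"
  have d: "0 < d" "d * (2 * T + K) \<le> e" using e nn by (auto simp: d_def field_simps)
  obtain F where F: "finite F" "F \<subseteq> Z0" and tail: "(\<Sum>\<^sub>\<infinity>\<nu>\<in>Z0 - F. r ^ weight \<nu>) \<le> d"
    by (rule weight_tail[OF r d(1) finite.emptyI empty_subsetI], rule that, assumption+)
  let ?S = "\<lambda>z. \<Sum>\<nu>\<in>F. (of_real (r ^ weight \<nu>) * torus_char \<nu> z) * complex_integral haar \<mu> (torus_char (- \<nu>))"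
  have intS: "integrable haar ?S"
    by (intro Bochner_Integration.integrable_sum integrable_mult_left integrable_mult_right
        integrable_haar_bounded bounded_measurable_torus_char)
  have "(LINT z|haar. cmod (radial_ext \<mu> (of_real r) z)) \<le> (LINT z|haar. cmod (?S z) + K * d)"
  proof (rule integral_mono)
    show "integrable haar (\<lambda>z. cmod (radial_ext \<mu> (of_real r) z))"
      by (intro integrable_norm integrable_radial_ext \<mu> r)
    show "integrable haar (\<lambda>z. cmod (?S z) + K * d)"
      by (intro Bochner_Integration.integrable_add integrable_norm intS) simp
    fix z assume "z \<in> space haar"
    then have z: "z \<in> torus" by (simp add: space_haar)
    have eq: "?S z = (\<Sum>\<nu>\<in>F. fourier \<mu> \<nu> * of_real (r ^ weight \<nu>) * torus_char \<nu> z)"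
      by (intro sum.cong) (auto simp: fourier_def)
    have "cmod (radial_ext \<mu> (of_real r) z - ?S z) \<le> K * (\<Sum>\<^sub>\<infinity>\<nu>\<in>Z0 - F. r ^ weight \<nu>)"
      unfolding radial_ext_real[OF r(1)] eq K_def by (rule char_series_tail[OF r z norm_fourier_le[OF \<mu>] F])
    also have "\<dots> \<le> K * d" using tail nn by (intro mult_left_mono)
    finally show "cmod (radial_ext \<mu> (of_real r) z) \<le> cmod (?S z) + K * d"
      by (smt (verit) norm_triangle_sub)
  qed
  also have "\<dots> = (LINT z|haar. cmod (?S z)) + K * d"
    using intS by (simp add: prob_space)
  also have "(LINT z|haar. cmod (?S z)) \<le> (1 + 2 * d) * T"
    unfolding T_def
  proof (rule kernel_contraction[OF \<mu> finite_measure_axioms F(1)])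
    fix \<nu> assume "\<nu> \<in> F"
    show "bounded_measurable haar (torus_char (- \<nu>))" by (rule bounded_measurable_torus_char)
    show "(\<lambda>z. of_real (r ^ weight \<nu>) * torus_char \<nu> z) \<in> borel_measurable haar" by measurable
    show "cmod (of_real (r ^ weight \<nu>) * torus_char \<nu> z) \<le> r ^ weight \<nu>" if "z \<in> space haar" for z
      using that r by (simp add: space_haar norm_mult norm_torus_char norm_power)
  next
    show "0 \<le> 1 + 2 * d" using d by simp
    show "(LINT z|haar. cmod (\<Sum>\<nu>\<in>F. (of_real (r ^ weight \<nu>) * torus_char \<nu> z) * torus_char (- \<nu>) \<phi>)) \<le> 1 + 2 * d"
      if "\<phi> \<in> space haar" for \<phi>
      using truncated_kernel_norm[OF r F tail] that by (simp add: space_haar)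
  qed
  also have "(1 + 2 * d) * T + K * d = T + d * (2 * T + K)" by (simp add: algebra_simps)
  also have "\<dots> \<le> T + e" using d by simp
  finally show "(LINT z|haar. cmod (radial_ext \<mu> (of_real r) z)) \<le> enn2real (total_variation haar \<mu>) + e"
    by (simp add: T_def)
qed

lemma norm_L1_radial_ext_eq:
  assumes \<mu>: "complex_measure haar \<mu>" and r: "0 \<le> r" "r < 1"
  shows "norm_L1 (radial_ext \<mu> (of_real r)) = ennreal (LINT z|haar. cmod (radial_ext \<mu> (of_real r) z))"
  unfolding norm_L1_def
  by (intro nn_integral_eq_integral integrable_norm integrable_radial_ext \<mu> r) auto

lemma norm_L1_radial_ext_le:
  assumes \<mu>: "complex_measure haar \<mu>" and \<xi>: "cmod \<xi> < 1"
  shows "norm_L1 (radial_ext \<mu> \<xi>) \<le> total_variation haar \<mu>"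
proof -
  have "norm_L1 (radial_ext \<mu> \<xi>) = norm_L1 (radial_ext \<mu> (of_real (cmod \<xi>)))"
    unfolding norm_L1_def
    by (subst radial_ext_flow, rule nn_integral_flow)
       (auto intro!: measurable_compose[OF borel_measurable_haar_continuous[OF continuous_on_radial_ext[OF \<mu> _ \<xi>]]])
  also have "\<dots> \<le> ennreal (enn2real (total_variation haar \<mu>))"
    using norm_L1_radial_ext_eq[OF \<mu> _ \<xi>] radial_ext_L1_le[OF \<mu> _ \<xi>] by (simp add: ennreal_leI)
  also have "\<dots> = total_variation haar \<mu>"
    using total_variation_finite[OF \<mu>] by (simp add: ennreal_enn2real)
  finally show ?thesis .
qed

section \<open>Trigonometric polynomials\<close>

text \<open>
  The last rule is needed because the product of two characters is given by adding the frequencies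
  only where no coordinate vanishes, in particular on the torus.
\<close>

inductive trig_poly :: "((nat \<Rightarrow> complex) \<Rightarrow> complex) \<Rightarrow> bool" where
  trig_char: "\<nu> \<in> Z0 \<Longrightarrow> trig_poly (\<lambda>z. c * torus_char \<nu> z)"
| trig_add: "trig_poly p \<Longrightarrow> trig_poly q \<Longrightarrow> trig_poly (\<lambda>z. p z + q z)"
| trig_cong: "trig_poly p \<Longrightarrow> (\<And>z. z \<in> torus \<Longrightarrow> q z = p z) \<Longrightarrow> trig_poly q"

lemma trig_poly_continuous: "trig_poly p \<Longrightarrow> continuous_on torus p"
proof (induction rule: trig_poly.induct)
  case (trig_cong p q)
  then show ?case by (metis continuous_on_cong)
qed (auto intro!: continuous_intros continuous_on_torus_char)

lemma trig_poly_const: "trig_poly (\<lambda>_. c)"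
  using trig_char[OF Z0_0, of c] by simp

lemma trig_poly_char_mult:
  assumes "trig_poly p" "\<nu> \<in> Z0" shows "trig_poly (\<lambda>z. c * torus_char \<nu> z * p z)"
  using assms(1)
proof (induction rule: trig_poly.induct)
  case (trig_char \<nu>' c')
  show ?case
    by (rule trig_cong[OF trig_poly.trig_char[OF Z0_add[OF assms(2) trig_char], of "c * c'"]])
       (simp add: torus_char_add[OF assms(2) trig_char])
next
  case (trig_add p q)
  show ?case by (rule trig_cong[OF trig_poly.trig_add[OF trig_add.IH]]) (simp add: algebra_simps)
next
  case (trig_cong p q)
  show ?case by (rule trig_poly.trig_cong[OF trig_cong.IH]) (simp add: trig_cong.hyps)
qed

lemma trig_poly_mult:
  assumes "trig_poly p" "trig_poly q" shows "trig_poly (\<lambda>z. p z * q z)"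
  using assms(1)
proof (induction rule: trig_poly.induct)
  case (trig_char \<nu> c)
  show ?case by (rule trig_poly_char_mult[OF assms(2) trig_char])
next
  case (trig_add p p')
  show ?case by (rule trig_cong[OF trig_poly.trig_add[OF trig_add.IH]]) (simp add: algebra_simps)
next
  case (trig_cong p p')
  show ?case by (rule trig_poly.trig_cong[OF trig_cong.IH]) (simp add: trig_cong.hyps)
qed

lemma trig_poly_cmult: "trig_poly p \<Longrightarrow> trig_poly (\<lambda>z. c * p z)"
  using trig_poly_mult[OF trig_poly_const] .

lemma trig_poly_coordinate: "trig_poly (\<lambda>z. z n)" "trig_poly (\<lambda>z. cnj (z n))"
proof -
  let ?e = "\<lambda>j. if j = n then 1 else 0 :: int"
  have Z: "?e \<in> Z0" by (simp add: Z0_def)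
  have eq: "torus_char ?e z = z n" for z
    by (subst torus_char_superset[of "{n}"]) auto
  show "trig_poly (\<lambda>z. z n)" using trig_char[OF Z, of 1] by (simp add: eq)
  show "trig_poly (\<lambda>z. cnj (z n))"
    by (rule trig_cong[OF trig_char[OF Z0_uminus[THEN iffD2, OF Z], of 1]])
       (simp only: torus_char_uminus eq mult_1)
qed

lemma trig_poly_Re_coordinate:
  "trig_poly (\<lambda>z. of_real (Re (z n)))" "trig_poly (\<lambda>z. of_real (Im (z n)))"
proof -
  have "trig_poly (\<lambda>z. 1 / 2 * (z n + cnj (z n)))"
    by (intro trig_poly_cmult trig_add trig_poly_coordinate)
  then show "trig_poly (\<lambda>z. of_real (Re (z n)))" by (rule trig_cong) (simp add: complex_eq_iff)
  have "trig_poly (\<lambda>z. - \<i> / 2 * (z n + (- 1) * cnj (z n)))"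
    by (intro trig_poly_cmult trig_add trig_poly_coordinate)
  then show "trig_poly (\<lambda>z. of_real (Im (z n)))" by (rule trig_cong) (simp add: complex_eq_iff)
qed

text \<open>
  The real trigonometric polynomials form an algebra that separates points through the real and
  imaginary parts of coordinates.
\<close>

lemma trig_poly_uniform_dense:
  fixes g :: "(nat \<Rightarrow> complex) \<Rightarrow> complex"
  assumes g: "continuous_on torus g" and e: "0 < e"
  obtains p where "trig_poly p" "\<And>z. z \<in> torus \<Longrightarrow> cmod (g z - p z) \<le> e"
proof -
  let ?R = "{f :: (nat \<Rightarrow> complex) \<Rightarrow> real. trig_poly (\<lambda>z. of_real (f z))}"
  interpret function_ring_on ?R torus
  proof
    show "compact torus" by (rule compact_torus)
    show "continuous_on torus f" if "f \<in> ?R" for f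
      using continuous_on_Re[OF trig_poly_continuous[of "\<lambda>z. of_real (f z)"]] that by simp
    show "(\<lambda>x. f x + g x) \<in> ?R" if "f \<in> ?R" "g \<in> ?R" for f g using trig_add that by simp
    show "(\<lambda>x. f x * g x) \<in> ?R" if "f \<in> ?R" "g \<in> ?R" for f g using trig_poly_mult that by simp
    show "(\<lambda>_. c) \<in> ?R" for c by (simp add: trig_poly_const)
    fix x y :: "nat \<Rightarrow> complex" assume "x \<noteq> y"
    then obtain n where "x n \<noteq> y n" by (auto simp: fun_eq_iff)
    then have "Re (x n) \<noteq> Re (y n) \<or> Im (x n) \<noteq> Im (y n)" by (simp add: complex_eq_iff)
    then show "\<exists>f\<in>?R. f x \<noteq> f y"
    proof
      assume "Re (x n) \<noteq> Re (y n)"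
      then show ?thesis using trig_poly_Re_coordinate(1)[of n] by (intro bexI[of _ "\<lambda>z. Re (z n)"]) auto
    next
      assume "Im (x n) \<noteq> Im (y n)"
      then show ?thesis using trig_poly_Re_coordinate(2)[of n] by (intro bexI[of _ "\<lambda>z. Im (z n)"]) auto
    qed
  qed
  from e have e2: "0 < e / 2" by simp
  obtain p1 where p1: "trig_poly (\<lambda>z. of_real (p1 z))" "\<And>z. z \<in> torus \<Longrightarrow> \<bar>Re (g z) - p1 z\<bar> < e / 2"
    using Stone_Weierstrass_basic[OF continuous_on_Re[OF g] e2] by blast
  obtain p2 where p2: "trig_poly (\<lambda>z. of_real (p2 z))" "\<And>z. z \<in> torus \<Longrightarrow> \<bar>Im (g z) - p2 z\<bar> < e / 2"
    using Stone_Weierstrass_basic[OF continuous_on_Im[OF g] e2] by blast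
  have "cmod (g z - (of_real (p1 z) + \<i> * of_real (p2 z))) \<le> e" if "z \<in> torus" for z
    using cmod_le[of "g z - (of_real (p1 z) + \<i> * of_real (p2 z))"] p1(2)[OF that] p2(2)[OF that] by simp
  moreover have "trig_poly (\<lambda>z. of_real (p1 z) + \<i> * of_real (p2 z))"
    by (intro trig_add trig_poly_cmult p1 p2)
  ultimately show ?thesis using that by blast
qed


section \<open>Convergence of the Poisson extensions\<close>

text \<open>
  Orthogonality of characters, with the series truncated to a finite set that contains \<open>- \<nu>\<close>.
\<close>

lemma integral_char_radial_ext:
  assumes \<mu>: "complex_measure haar \<mu>" and r: "0 \<le> r" "r < 1" and \<nu>: "\<nu> \<in> Z0"
  shows "(LINT z|haar. torus_char \<nu> z * radial_ext \<mu> (of_real r) z) = of_real (r ^ weight \<nu>) * complex_integral haar \<mu> (torus_char \<nu>)"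
    (is "?L = ?R")
proof -
  interpret prob_space haar by (rule prob_space_haar)
  define K where "K = variation_bound haar \<mu>"
  have K: "0 \<le> K" by (simp add: K_def variation_bound_nonneg)
  have "cmod (?L - ?R) \<le> 0 + e" if e: "0 < e" for e
  proof -
    define d where "d = e / (K + 1)"
    have d: "0 < d" "K * d \<le> e" using e K by (auto simp: d_def field_simps)
    have G: "finite {- \<nu>}" "{- \<nu>} \<subseteq> Z0" using \<nu> by simp_all
    obtain F where F: "finite F" "F \<subseteq> Z0" "{- \<nu>} \<subseteq> F" and tail: "(\<Sum>\<^sub>\<infinity>\<nu>\<in>Z0 - F. r ^ weight \<nu>) \<le> d"
      by (rule weight_tail[OF r d(1) G], rule that, assumption+)
    define S where "S = (\<lambda>z. \<Sum>\<nu>'\<in>F. fourier \<mu> \<nu>' * of_real (r ^ weight \<nu>') * torus_char \<nu>' z)"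
    have contS: "continuous_on torus S" unfolding S_def by (intro continuous_intros continuous_on_torus_char)
    have cont: "continuous_on torus (radial_ext \<mu> (of_real r))" by (rule continuous_on_radial_ext[OF \<mu> r])
    note int = integrable_haar_bounded[OF bounded_measurable_continuous]
    have int\<nu>: "integrable haar (torus_char \<nu>')" for \<nu>' by (rule int[OF continuous_on_torus_char])
    have close: "cmod (radial_ext \<mu> (of_real r) z - S z) \<le> K * d" if z: "z \<in> torus" for z
    proof -
      have "cmod (radial_ext \<mu> (of_real r) z - S z) \<le> K * (\<Sum>\<^sub>\<infinity>\<nu>\<in>Z0 - F. r ^ weight \<nu>)"
        unfolding radial_ext_real[OF r(1)] S_def K_def by (rule char_series_tail[OF r z norm_fourier_le[OF \<mu>] F(1,2)])
      also have "\<dots> \<le> K * d" using tail K by (intro mult_left_mono)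
      finally show ?thesis .
    qed
    have "(LINT z|haar. torus_char \<nu> z * S z) = (LINT z|haar. (\<Sum>\<nu>'\<in>F. fourier \<mu> \<nu>' * of_real (r ^ weight \<nu>') * torus_char (\<lambda>j. \<nu> j + \<nu>' j) z))"
    proof (rule Bochner_Integration.integral_cong[OF refl])
      fix z assume "z \<in> space haar"
      then have z: "z \<in> torus" by (simp add: space_haar)
      show "torus_char \<nu> z * S z = (\<Sum>\<nu>'\<in>F. fourier \<mu> \<nu>' * of_real (r ^ weight \<nu>') * torus_char (\<lambda>j. \<nu> j + \<nu>' j) z)"
        unfolding S_def sum_distrib_left
      proof (rule sum.cong[OF refl])
        fix \<nu>' assume "\<nu>' \<in> F"
        then have "\<nu>' \<in> Z0" using F by auto
        then show "torus_char \<nu> z * (fourier \<mu> \<nu>' * of_real (r ^ weight \<nu>') * torus_char \<nu>' z) =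
            fourier \<mu> \<nu>' * of_real (r ^ weight \<nu>') * torus_char (\<lambda>j. \<nu> j + \<nu>' j) z"
          by (simp add: torus_char_add[OF \<nu> _ z])
      qed
    qed
    also have "\<dots> = (\<Sum>\<nu>'\<in>F. fourier \<mu> \<nu>' * of_real (r ^ weight \<nu>') * (LINT z|haar. torus_char (\<lambda>j. \<nu> j + \<nu>' j) z))"
      by (simp add: Bochner_Integration.integral_sum int\<nu>)
    also have "\<dots> = (\<Sum>\<nu>'\<in>F. if \<nu>' = - \<nu> then fourier \<mu> \<nu>' * of_real (r ^ weight \<nu>') else 0)"
    proof (rule sum.cong[OF refl])
      fix \<nu>' assume "\<nu>' \<in> F"
      then have "(\<lambda>j. \<nu> j + \<nu>' j) \<in> Z0" using F \<nu> by (auto intro: Z0_add)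
      moreover have "(\<lambda>j. \<nu> j + \<nu>' j) = (\<lambda>_. 0) \<longleftrightarrow> \<nu>' = - \<nu>"
        by (auto simp: fun_eq_iff add_eq_0_iff)
      ultimately show "fourier \<mu> \<nu>' * of_real (r ^ weight \<nu>') * (LINT z|haar. torus_char (\<lambda>j. \<nu> j + \<nu>' j) z)
          = (if \<nu>' = - \<nu> then fourier \<mu> \<nu>' * of_real (r ^ weight \<nu>') else 0)"
        by (simp add: integral_torus_char)
    qed
    also have "\<dots> = ?R"
    proof -
      have "- (- \<nu>) = \<nu>" by (simp add: fun_eq_iff)
      then show ?thesis using F by (simp add: fourier_def)
    qed
    finally have SR: "(LINT z|haar. torus_char \<nu> z * S z) = ?R" .
    have "?L - ?R = (LINT z|haar. torus_char \<nu> z * radial_ext \<mu> (of_real r) z - torus_char \<nu> z * S z)"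
      unfolding SR[symmetric]
      by (intro Bochner_Integration.integral_diff[symmetric] int continuous_on_mult continuous_on_torus_char contS cont)
    also have "cmod \<dots> \<le> measure haar (space haar) * (K * d)"
    proof (rule norm_integral_le_measure[OF finite_measure_axioms])
      show "(\<lambda>z. torus_char \<nu> z * radial_ext \<mu> (of_real r) z - torus_char \<nu> z * S z) \<in> borel_measurable haar"
        by (intro borel_measurable_haar_continuous continuous_intros continuous_on_torus_char contS cont)
      fix z assume "z \<in> space haar"
      then have z: "z \<in> torus" by (simp add: space_haar)
      have "cmod (torus_char \<nu> z * radial_ext \<mu> (of_real r) z - torus_char \<nu> z * S z)
          = cmod (torus_char \<nu> z) * cmod (radial_ext \<mu> (of_real r) z - S z)"
        by (simp add: right_diff_distrib[symmetric] norm_mult)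
      then show "cmod (torus_char \<nu> z * radial_ext \<mu> (of_real r) z - torus_char \<nu> z * S z) \<le> K * d"
        using close[OF z] by (simp add: norm_torus_char[OF z])
    qed
    also have "\<dots> \<le> 0 + e" using d by (simp add: prob_space)
    finally show ?thesis .
  qed
  then have "cmod (?L - ?R) \<le> 0" by (rule field_le_epsilon)
  then show ?thesis by simp
qed

lemma eventually_at_left_1: "eventually (\<lambda>r::real. 0 \<le> r \<and> r < 1) (at_left 1)"
  by (rule eventually_at_leftI[of 0]) auto

lemma weak_star_trig_poly:
  assumes \<mu>: "complex_measure haar \<mu>" and p: "trig_poly p"
  shows "((\<lambda>r. LINT z|haar. p z * radial_ext \<mu> (of_real r) z) \<longlongrightarrow> complex_integral haar \<mu> p) (at_left 1)"
  using p
proof (induction rule: trig_poly.induct)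
  case (trig_char \<nu> c)
  have "((\<lambda>r. c * (of_real (r ^ weight \<nu>) * complex_integral haar \<mu> (torus_char \<nu>))) \<longlongrightarrow>
      c * (of_real (1 ^ weight \<nu>) * complex_integral haar \<mu> (torus_char \<nu>))) (at_left 1)"
    by (intro tendsto_intros)
  moreover have "eventually (\<lambda>r. c * (of_real (r ^ weight \<nu>) * complex_integral haar \<mu> (torus_char \<nu>)) =
      (LINT z|haar. c * torus_char \<nu> z * radial_ext \<mu> (of_real r) z)) (at_left 1)"
    using eventually_at_left_1
    by eventually_elim (simp add: mult.assoc integral_char_radial_ext[OF \<mu> _ _ trig_char])
  ultimately show ?case
    by (simp add: complex_integral_cmult Lim_transform_eventually)
next
  case (trig_add p q)
  have "eventually (\<lambda>r. (LINT z|haar. p z * radial_ext \<mu> (of_real r) z) + (LINT z|haar. q z * radial_ext \<mu> (of_real r) z) =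
      (LINT z|haar. (p z + q z) * radial_ext \<mu> (of_real r) z)) (at_left 1)"
    using eventually_at_left_1
  proof eventually_elim
    case (elim r)
    then have "integrable haar (\<lambda>z. u z * radial_ext \<mu> (of_real r) z)" if "trig_poly u" for u
      by (intro integrable_haar_bounded bounded_measurable_continuous continuous_on_mult trig_poly_continuous that
          continuous_on_radial_ext[OF \<mu>]) auto
    then show ?case using trig_add.hyps by (simp add: distrib_right)
  qed
  then show ?case
    using tendsto_add[OF trig_add.IH]
    by (simp add: complex_integral_add[OF \<mu>] bounded_measurable_continuous trig_poly_continuous trig_add.hyps Lim_transform_eventually)
next
  case (trig_cong p q)
  have "(LINT z|haar. q z * radial_ext \<mu> (of_real r) z) = (LINT z|haar. p z * radial_ext \<mu> (of_real r) z)" for r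
    by (intro Bochner_Integration.integral_cong) (auto simp: space_haar trig_cong.hyps)
  moreover have "complex_integral haar \<mu> q = complex_integral haar \<mu> p"
    by (rule complex_integral_cong) (simp add: space_haar trig_cong.hyps)
  ultimately show ?case using trig_cong.IH by simp
qed

text \<open>
  Approximation of \<open>g\<close> by trigonometric polynomials; the \<open>L\<^sup>1\<close> contraction makes the error uniform
  in \<open>r\<close>.
\<close>

lemma weak_star_convergence:
  assumes \<mu>: "complex_measure haar \<mu>" and g: "continuous_on torus g"
  shows "((\<lambda>r. LINT z|haar. g z * radial_ext \<mu> (of_real r) z) \<longlongrightarrow> complex_integral haar \<mu> g) (at_left 1)"
proof (rule tendstoI)
  fix e :: real assume e: "0 < e"
  define T where "T = enn2real (total_variation haar \<mu>)"
  define K where "K = variation_bound haar \<mu>"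
  have nn: "0 \<le> T" "0 \<le> K" by (auto simp: T_def K_def variation_bound_nonneg)
  define d where "d = e / (2 * (T + K + 1))"
  have d: "0 < d" using e nn by (auto simp: d_def)
  have "d * (2 * (T + K + 1)) = e" using nn by (simp add: d_def)
  then have dTK: "d * T + d * K < e / 2" using d by (simp add: algebra_simps)
  obtain p where p: "trig_poly p" "\<And>z. z \<in> torus \<Longrightarrow> cmod (g z - p z) \<le> d"
    using trig_poly_uniform_dense[OF g d] by blast
  have cp: "continuous_on torus p" by (rule trig_poly_continuous[OF p(1)])
  have CI: "cmod (complex_integral haar \<mu> p - complex_integral haar \<mu> g) \<le> K * d"
  proof -
    have "complex_integral haar \<mu> p - complex_integral haar \<mu> g = complex_integral haar \<mu> (\<lambda>z. p z - g z)"
      by (rule complex_integral_diff[OF \<mu> bounded_measurable_continuous[OF cp] bounded_measurable_continuous[OF g], symmetric])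
    also have "cmod \<dots> \<le> K * d"
      unfolding K_def using p(2) cp g
      by (intro complex_integral_bound[OF \<mu>] borel_measurable_haar_continuous continuous_intros)
         (auto simp: space_haar norm_minus_commute)
    finally show ?thesis .
  qed
  have "eventually (\<lambda>r. dist (LINT z|haar. p z * radial_ext \<mu> (of_real r) z) (complex_integral haar \<mu> p) < e / 2) (at_left 1)"
    using weak_star_trig_poly[OF \<mu> p(1)] e by (intro tendstoD) auto
  with eventually_at_left_1
  show "eventually (\<lambda>r. dist (LINT z|haar. g z * radial_ext \<mu> (of_real r) z) (complex_integral haar \<mu> g) < e) (at_left 1)"
  proof eventually_elim
    case (elim r)
    then have r: "0 \<le> r" "r < 1" by auto
    have cr: "continuous_on torus (radial_ext \<mu> (of_real r))" by (rule continuous_on_radial_ext[OF \<mu> r])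
    note int = integrable_haar_bounded[OF bounded_measurable_continuous]
    have "cmod ((LINT z|haar. g z * radial_ext \<mu> (of_real r) z) - (LINT z|haar. p z * radial_ext \<mu> (of_real r) z))
        = cmod (LINT z|haar. (g z - p z) * radial_ext \<mu> (of_real r) z)"
      unfolding left_diff_distrib
      by (subst Bochner_Integration.integral_diff) (auto intro!: int continuous_on_mult g cp cr)
    also have "\<dots> \<le> (LINT z|haar. cmod ((g z - p z) * radial_ext \<mu> (of_real r) z))"
      by (rule integral_norm_bound)
    also have "\<dots> \<le> (LINT z|haar. d * cmod (radial_ext \<mu> (of_real r) z))"
    proof (rule integral_mono)
      show "integrable haar (\<lambda>z. cmod ((g z - p z) * radial_ext \<mu> (of_real r) z))"
        by (intro integrable_norm int continuous_intros g cp cr)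
      show "integrable haar (\<lambda>z. d * cmod (radial_ext \<mu> (of_real r) z))"
        by (intro integrable_mult_right integrable_norm int cr)
    qed (use p(2) in \<open>auto simp: space_haar norm_mult intro!: mult_right_mono\<close>)
    also have "\<dots> = d * (LINT z|haar. cmod (radial_ext \<mu> (of_real r) z))" by simp
    also have "\<dots> \<le> d * T" unfolding T_def using d radial_ext_L1_le[OF \<mu> r] by (intro mult_left_mono) auto
    finally have "dist (LINT z|haar. g z * radial_ext \<mu> (of_real r) z) (LINT z|haar. p z * radial_ext \<mu> (of_real r) z) \<le> d * T"
      by (simp add: dist_norm)
    moreover have "dist (complex_integral haar \<mu> p) (complex_integral haar \<mu> g) \<le> d * K"
      using CI by (simp add: dist_norm mult.commute)
    ultimately show ?case
      using elim(2) dTK dist_triangle[of "LINT z|haar. g z * radial_ext \<mu> (of_real r) z" "complex_integral haar \<mu> g" "LINT z|haar. p z * radial_ext \<mu> (of_real r) z"]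
        dist_triangle[of "LINT z|haar. p z * radial_ext \<mu> (of_real r) z" "complex_integral haar \<mu> g" "complex_integral haar \<mu> p"]
      by linarith
  qed
qed

subsection \<open>Density of trigonometric polynomials\<close>

definition L1_approximable :: "((nat \<Rightarrow> complex) \<Rightarrow> complex) \<Rightarrow> bool" where
  "L1_approximable f \<longleftrightarrow> integrable haar f \<and>
     (\<forall>e>0. \<exists>p. trig_poly p \<and> (LINT z|haar. cmod (f z - p z)) < e)"

lemma integral_norm_diff_triangle:
  fixes a b c :: "'a \<Rightarrow> complex"
  assumes "integrable M a" "integrable M b" "integrable M c"
  shows "(LINT x|M. cmod (a x - c x)) \<le> (LINT x|M. cmod (a x - b x)) + (LINT x|M. cmod (b x - c x))"
proof -
  have "(LINT x|M. cmod (a x - c x)) \<le> (LINT x|M. cmod (a x - b x) + cmod (b x - c x))"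
    using assms norm_triangle_ineq[of "a x - b x" "b x - c x" for x] by (intro integral_mono) auto
  then show ?thesis using assms by simp
qed

lemma integrable_trig_poly: "trig_poly p \<Longrightarrow> integrable haar p"
  by (intro integrable_haar_bounded bounded_measurable_continuous trig_poly_continuous)

lemma L1_approximable_limit:
  assumes f: "integrable haar f" and g: "\<And>e. 0 < e \<Longrightarrow> \<exists>g. L1_approximable g \<and> (LINT z|haar. cmod (f z - g z)) < e"
  shows "L1_approximable f"
  unfolding L1_approximable_def
proof (intro conjI allI impI f)
  fix e :: real assume "0 < e"
  then have e2: "0 < e / 2" by simp
  obtain g where g': "L1_approximable g" "(LINT z|haar. cmod (f z - g z)) < e / 2" using g[OF e2] by blast
  then obtain p where p: "trig_poly p" "(LINT z|haar. cmod (g z - p z)) < e / 2"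
    using e2 unfolding L1_approximable_def by blast
  have "(LINT z|haar. cmod (f z - p z)) < e"
    using integral_norm_diff_triangle[OF f _ integrable_trig_poly[OF p(1)], of g] g' p by (simp add: L1_approximable_def)
  with p show "\<exists>p. trig_poly p \<and> (LINT z|haar. cmod (f z - p z)) < e" by blast
qed

lemma L1_approximable_dominated:
  assumes g: "\<And>n::nat. L1_approximable (g n)" and lim: "\<And>z. z \<in> torus \<Longrightarrow> (\<lambda>n. g n z) \<longlonglongrightarrow> f z"
    and w: "integrable haar w" and le: "\<And>n z. z \<in> torus \<Longrightarrow> cmod (g n z) \<le> w z"
  shows "L1_approximable f"
proof (rule L1_approximable_limit)
  have gm: "g n \<in> borel_measurable haar" for n using g[of n] unfolding L1_approximable_def by auto
  have fm: "f \<in> borel_measurable haar"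
    by (rule borel_measurable_LIMSEQ_metric[where f = g, OF gm]) (simp add: space_haar lim)
  show f: "integrable haar f"
    by (rule integrable_dominated_convergence[where s = g and w = w])
       (use fm gm w lim le in \<open>auto simp: space_haar intro!: AE_I2\<close>)
  have wf: "cmod (f z) \<le> w z" if "z \<in> torus" for z
    by (rule LIMSEQ_le_const2[OF tendsto_norm[OF lim[OF that]]]) (use le[OF that] in auto)
  have "(\<lambda>n. LINT z|haar. cmod (f z - g n z)) \<longlonglongrightarrow> (LINT z|haar. 0)"
  proof (rule integral_dominated_convergence[where w = "\<lambda>z. 2 * w z"])
    show "AE z in haar. (\<lambda>n. cmod (f z - g n z)) \<longlonglongrightarrow> 0"
    proof (rule AE_I2)
      fix z assume "z \<in> space haar"
      then have "(\<lambda>n. cmod (f z - g n z)) \<longlonglongrightarrow> cmod (f z - f z)"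
        by (intro tendsto_intros lim) (simp add: space_haar)
      then show "(\<lambda>n. cmod (f z - g n z)) \<longlonglongrightarrow> 0" by simp
    qed
    show "AE z in haar. norm (cmod (f z - g n z)) \<le> 2 * w z" for n
    proof (rule AE_I2)
      fix z assume "z \<in> space haar"
      then have "z \<in> torus" by (simp add: space_haar)
      then show "norm (cmod (f z - g n z)) \<le> 2 * w z"
        using norm_triangle_ineq4[of "f z" "g n z"] wf[of z] le[of z n] by simp
    qed
  qed (use fm gm w in auto)
  then have lim0: "(\<lambda>n. LINT z|haar. cmod (f z - g n z)) \<longlonglongrightarrow> 0" by simp
  fix e :: real assume "0 < e"
  from order_tendstoD(2)[OF lim0 this] obtain n where "(LINT z|haar. cmod (f z - g n z)) < e"
    by (auto simp: eventually_sequentially)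
  with g show "\<exists>g. L1_approximable g \<and> (LINT z|haar. cmod (f z - g z)) < e" by blast
qed

lemma L1_approximable_continuous:
  assumes "continuous_on torus f" shows "L1_approximable f"
  unfolding L1_approximable_def
proof (intro conjI allI impI)
  interpret prob_space haar by (rule prob_space_haar)
  show f: "integrable haar f" by (intro integrable_haar_bounded bounded_measurable_continuous assms)
  fix e :: real assume e: "0 < e"
  then obtain p where p: "trig_poly p" "\<And>z. z \<in> torus \<Longrightarrow> cmod (f z - p z) \<le> e / 2"
    using trig_poly_uniform_dense[OF assms, of "e / 2"] by (metis half_gt_zero)
  have "(LINT z|haar. cmod (f z - p z)) \<le> (LINT z|haar. e / 2)"
    using f integrable_trig_poly[OF p(1)] p(2) by (intro integral_mono) (auto simp: space_haar)
  also have "\<dots> < e" using e by (simp add: prob_space)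
  finally show "\<exists>p. trig_poly p \<and> (LINT z|haar. cmod (f z - p z)) < e" using p(1) by blast
qed

lemma L1_approximable_add:
  assumes f: "L1_approximable f" and g: "L1_approximable g"
  shows "L1_approximable (\<lambda>z. f z + g z)"
  unfolding L1_approximable_def
proof (intro conjI allI impI)
  show "integrable haar (\<lambda>z. f z + g z)" using f g by (simp add: L1_approximable_def)
  fix e :: real assume "0 < e"
  then have e2: "0 < e / 2" by simp
  obtain p where p: "trig_poly p" "(LINT z|haar. cmod (f z - p z)) < e / 2" using f e2 unfolding L1_approximable_def by blast
  obtain q where q: "trig_poly q" "(LINT z|haar. cmod (g z - q z)) < e / 2" using g e2 unfolding L1_approximable_def by blast
  have int: "integrable haar (\<lambda>z. f z - p z)" "integrable haar (\<lambda>z. g z - q z)"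
    using f g integrable_trig_poly[OF p(1)] integrable_trig_poly[OF q(1)] by (auto simp: L1_approximable_def)
  have "(LINT z|haar. cmod (f z + g z - (p z + q z))) \<le> (LINT z|haar. cmod (f z - p z) + cmod (g z - q z))"
  proof (rule integral_mono)
    show "integrable haar (\<lambda>z. cmod (f z + g z - (p z + q z)))"
      using Bochner_Integration.integrable_add[OF int] by (simp add: algebra_simps)
    show "cmod (f z + g z - (p z + q z)) \<le> cmod (f z - p z) + cmod (g z - q z)" for z
      using norm_triangle_ineq[of "f z - p z" "g z - q z"] by (simp add: algebra_simps)
  qed (use int in auto)
  also have "\<dots> = (LINT z|haar. cmod (f z - p z)) + (LINT z|haar. cmod (g z - q z))"
    by (rule Bochner_Integration.integral_add) (use int in auto)
  finally show "\<exists>p. trig_poly p \<and> (LINT z|haar. cmod (f z + g z - p z)) < e"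
    using p q by (intro exI[of _ "\<lambda>z. p z + q z"] conjI trig_add) auto
qed

lemma L1_approximable_cmult:
  assumes f: "L1_approximable f" shows "L1_approximable (\<lambda>z. c * f z)"
  unfolding L1_approximable_def
proof (intro conjI allI impI)
  show "integrable haar (\<lambda>z. c * f z)" using f by (simp add: L1_approximable_def)
  fix e :: real assume e: "0 < e"
  then have "0 < e / (cmod c + 1)" by (simp add: add_nonneg_pos)
  then obtain p where p: "trig_poly p" "(LINT z|haar. cmod (f z - p z)) < e / (cmod c + 1)"
    using f unfolding L1_approximable_def by blast
  have "(LINT z|haar. cmod (c * f z - c * p z)) = cmod c * (LINT z|haar. cmod (f z - p z))"
    by (simp add: right_diff_distrib[symmetric] norm_mult)
  also have "\<dots> \<le> cmod c * (e / (cmod c + 1))" using p by (intro mult_left_mono) auto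
  also have "\<dots> < e"
  proof -
    have "cmod c * e < e * (cmod c + 1)" using e by (simp add: algebra_simps)
    then show ?thesis by (simp add: pos_divide_less_eq add_nonneg_pos)
  qed
  finally show "\<exists>p. trig_poly p \<and> (LINT z|haar. cmod (c * f z - p z)) < e"
    using trig_poly_cmult[OF p(1)] by blast
qed

text \<open>
  The indicator of a closed set is the pointwise limit of continuous functions of the distance to
  the set.
\<close>

lemma L1_approximable_indicator_closed:
  assumes "closed C" shows "L1_approximable (indicator C)"
proof (cases "C = {}")
  case True
  then show ?thesis by (simp add: L1_approximable_continuous)
next
  case False
  define g where "g = (\<lambda>n z. of_real (max 0 (1 - real n * infdist z C)) :: complex)"
  interpret prob_space haar by (rule prob_space_haar)
  show ?thesis
  proof (rule L1_approximable_dominated[where g = g and w = "\<lambda>_. 1"])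
    show "L1_approximable (g n)" for n
      unfolding g_def by (intro L1_approximable_continuous continuous_intros)
    fix z :: "nat \<Rightarrow> complex"
    show "(\<lambda>n. g n z) \<longlonglongrightarrow> indicator C z"
    proof (cases "z \<in> C")
      case True
      then show ?thesis by (simp add: g_def)
    next
      case zC: False
      then have pos: "0 < infdist z C"
        using in_closed_iff_infdist_zero[OF assms False] infdist_nonneg[of z C] by (simp add: less_le)
      obtain N where N: "1 / infdist z C < real N" using reals_Archimedean2 by blast
      have "g n z = 0" if "N \<le> n" for n
      proof -
        have "1 / infdist z C \<le> real n" using N that by linarith
        then have "1 \<le> real n * infdist z C" using pos by (simp add: pos_divide_le_eq)
        then show ?thesis by (simp add: g_def)
      qed
      then have "(\<lambda>n. g n z) \<longlonglongrightarrow> 0"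
        by (intro tendsto_eventually eventually_sequentiallyI[of N]) auto
      then show ?thesis using zC by simp
    qed
    show "cmod (g n z) \<le> 1" for n by (simp add: g_def infdist_nonneg)
  qed simp
qed

text \<open>
  The closed sets form a generator of the Borel sets that is stable under intersection, so it
  suffices to pass to complements and disjoint unions.
\<close>

lemma L1_approximable_indicator:
  assumes "B \<in> sets (borel :: (nat \<Rightarrow> complex) measure)" shows "L1_approximable (indicator B)"
proof -
  have "B \<in> sigma_sets UNIV (Collect closed)" using assms by (simp add: borel_eq_closed)
  then show ?thesis
  proof (rule sigma_sets_induct_disjoint[rotated 2])
    show "Int_stable (Collect closed :: (nat \<Rightarrow> complex) set set)" by (auto simp: Int_stable_def)
    show "L1_approximable (indicator A)" if "A \<in> Collect closed" for A
      using that by (intro L1_approximable_indicator_closed) auto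
    show "L1_approximable (indicator {})" by (intro L1_approximable_indicator_closed) auto
    show "L1_approximable (indicator (UNIV - A))" if "L1_approximable (indicator A)" for A
    proof -
      have "indicator (UNIV - A) = (\<lambda>z. 1 + (- 1) * indicator A z :: complex)"
        by (auto simp: fun_eq_iff indicator_def)
      then show ?thesis
        using L1_approximable_add[OF L1_approximable_continuous[of "\<lambda>_. 1"] L1_approximable_cmult[OF that, of "- 1"]] by simp
    qed
    fix A :: "nat \<Rightarrow> (nat \<Rightarrow> complex) set"
    assume disj: "disjoint_family A" and A: "\<And>i. L1_approximable (indicator (A i))"
    show "L1_approximable (indicator (\<Union>i. A i))"
    proof (rule L1_approximable_dominated[where g = "\<lambda>n z. \<Sum>i<n. indicator (A i) z" and w = "\<lambda>_. 1"])
      interpret prob_space haar by (rule prob_space_haar)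
      show "integrable haar (\<lambda>_. 1 :: real)" by simp
      show "L1_approximable (\<lambda>z. \<Sum>i<n. indicator (A i) z)" for n
        by (induction n) (auto intro: L1_approximable_add A L1_approximable_continuous)
      fix z :: "nat \<Rightarrow> complex"
      show "(\<lambda>n. \<Sum>i<n. indicator (A i) z :: complex) \<longlonglongrightarrow> indicator (\<Union>i. A i) z"
      proof -
        have "(\<lambda>i. indicator (A i) z *\<^sub>R (1::complex)) sums (indicator (\<Union>i. A i) z *\<^sub>R 1)"
          by (intro sums_scaleR_left indicator_sums) (use disj in \<open>auto simp: disjoint_family_on_def\<close>)
        moreover have "indicator X z *\<^sub>R (1::complex) = indicator X z" for X by (simp add: indicator_def)
        ultimately show ?thesis by (simp add: sums_def)
      qed
      show "cmod (\<Sum>i<n. indicator (A i) z :: complex) \<le> 1" for n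
      proof -
        have "(\<Sum>i<n. indicator (A i) z :: complex) = indicator (\<Union>i<n. A i) z"
          by (rule indicator_UN_disjoint[symmetric]) (use disj in \<open>auto simp: disjoint_family_on_def\<close>)
        then show ?thesis by (simp add: indicator_def)
      qed
    qed
  qed auto
qed

lemma L1_approximable_integrable:
  assumes "integrable haar f" shows "L1_approximable f"
  using assms
proof (induction rule: integrable_induct)
  case (base A c)
  have "A \<in> sets (restrict_space borel torus)" using base(1) by (simp add: sets_haar)
  then obtain B where B: "B \<in> sets borel" "A = torus \<inter> B" by (auto simp: sets_restrict_space)
  show ?case
  proof (rule L1_approximable_limit)
    show "integrable haar (\<lambda>x. indicator A x *\<^sub>R c)"
      using base by simp
    fix e :: real assume e: "0 < e"
    have "(LINT z|haar. cmod (indicator A z *\<^sub>R c - c * indicator B z)) = (LINT z|haar. 0)"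
      by (intro Bochner_Integration.integral_cong) (auto simp: B(2) space_haar indicator_def)
    then show "\<exists>g. L1_approximable g \<and> (LINT z|haar. cmod (indicator A z *\<^sub>R c - g z)) < e"
      using L1_approximable_cmult[OF L1_approximable_indicator[OF B(1)], of c] e by (intro exI[of _ "\<lambda>z. c * indicator B z"]) auto
  qed
next
  case (add f g)
  then show ?case by (intro L1_approximable_add)
next
  case (lim f s)
  show ?case
    by (rule L1_approximable_dominated[where g = s and w = "\<lambda>z. 2 * cmod (f z)"])
       (use lim in \<open>auto simp: space_haar\<close>)
qed

section \<open>Convergence in mean\<close>

lemma to_measure_eq: "to_measure f = (\<lambda>A. LINT z:A|haar. f z)"
  by (simp add: to_measure_def fun_eq_iff)

lemma complex_measure_to_measure: "integrable haar f \<Longrightarrow> complex_measure haar (to_measure f)"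
  unfolding to_measure_eq by (rule complex_measure_density)

lemma total_variation_to_measure: "integrable haar f \<Longrightarrow> total_variation haar (to_measure f) \<le> norm_L1 f"
  unfolding to_measure_eq norm_L1_def by (rule total_variation_density)

lemma fourier_to_measure:
  "integrable haar f \<Longrightarrow> fourier (to_measure f) \<nu> = (LINT z|haar. torus_char (- \<nu>) z * f z)"
  unfolding to_measure_eq fourier_def by (rule complex_integral_density[OF _ bounded_measurable_torus_char])

lemma integrable_char_mult:
  assumes "integrable haar f" shows "integrable haar (\<lambda>z. torus_char \<nu> z * f z)"
proof (rule Bochner_Integration.integrable_bound[OF assms])
  show "(\<lambda>z. torus_char \<nu> z * f z) \<in> borel_measurable haar" using assms by measurable
  show "AE z in haar. cmod (torus_char \<nu> z * f z) \<le> cmod (f z)"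
    by (rule AE_I2) (simp add: space_haar norm_mult norm_torus_char)
qed

lemma radial_ext_L1_le_norm:
  assumes f: "integrable haar f" and r: "0 \<le> r" "r < 1"
  shows "(LINT z|haar. cmod (radial_ext (to_measure f) (of_real r) z)) \<le> (LINT z|haar. cmod (f z))"
proof -
  have "total_variation haar (to_measure f) \<le> ennreal (LINT z|haar. cmod (f z))"
    using total_variation_to_measure[OF f] f
    by (simp add: norm_L1_def nn_integral_eq_integral)
  then have "enn2real (total_variation haar (to_measure f)) \<le> (LINT z|haar. cmod (f z))"
    by (rule enn2real_leI[rotated]) simp
  then show ?thesis using radial_ext_L1_le[OF complex_measure_to_measure[OF f] r] by linarith
qed

lemma summable_radial_ext:
  assumes \<mu>: "complex_measure haar \<mu>" and r: "0 \<le> r" "r < 1" and z: "z \<in> torus"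
  shows "(\<lambda>\<nu>. fourier \<mu> \<nu> * of_real (r ^ weight \<nu>) * torus_char \<nu> z) summable_on Z0"
  by (rule abs_summable_summable[OF abs_summable_weight_char[OF r z norm_fourier_le[OF \<mu>] order_refl]])

lemma radial_ext_add:
  assumes f: "integrable haar f" and g: "integrable haar g" and r: "0 \<le> r" "r < 1" and z: "z \<in> torus"
  shows "radial_ext (to_measure (\<lambda>z. f z + g z)) (of_real r) z =
      radial_ext (to_measure f) (of_real r) z + radial_ext (to_measure g) (of_real r) z"
proof -
  note sf = summable_radial_ext[OF complex_measure_to_measure[OF f] r z]
  note sg = summable_radial_ext[OF complex_measure_to_measure[OF g] r z]
  have "fourier (to_measure (\<lambda>z. f z + g z)) \<nu> = fourier (to_measure f) \<nu> + fourier (to_measure g) \<nu>" for \<nu>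
    using f g by (simp add: fourier_to_measure distrib_left integrable_char_mult)
  then show ?thesis
    unfolding radial_ext_real[OF r(1)] infsum_add[OF sf sg, symmetric] by (simp add: algebra_simps)
qed

lemma radial_ext_diff:
  assumes f: "integrable haar f" and g: "integrable haar g" and r: "0 \<le> r" "r < 1" and z: "z \<in> torus"
  shows "radial_ext (to_measure (\<lambda>z. f z - g z)) (of_real r) z =
      radial_ext (to_measure f) (of_real r) z - radial_ext (to_measure g) (of_real r) z"
  using radial_ext_add[OF Bochner_Integration.integrable_diff[OF f g] g r z] by simp

lemma radial_ext_cong:
  assumes "\<And>z. z \<in> torus \<Longrightarrow> f z = g z"
  shows "radial_ext (to_measure f) = radial_ext (to_measure g)"
proof -
  have "to_measure f = to_measure g"
    unfolding to_measure_eq set_lebesgue_integral_def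
    by (intro ext Bochner_Integration.integral_cong) (auto simp: space_haar assms)
  then show ?thesis by simp
qed

text \<open>
  The Fourier series has a single term.
\<close>

lemma radial_ext_char:
  assumes \<nu>: "\<nu> \<in> Z0" and r: "0 \<le> r" and z: "z \<in> torus"
  shows "radial_ext (to_measure (\<lambda>z. c * torus_char \<nu> z)) (of_real r) z = c * of_real (r ^ weight \<nu>) * torus_char \<nu> z"
proof -
  have int: "integrable haar (\<lambda>z. c * torus_char \<nu> z)"
    by (intro integrable_trig_poly trig_char \<nu>)
  have four: "fourier (to_measure (\<lambda>z. c * torus_char \<nu> z)) \<nu>' = (if \<nu>' = \<nu> then c else 0)" if \<nu>': "\<nu>' \<in> Z0" for \<nu>'
  proof -
    have Z1: "- \<nu>' \<in> Z0" using \<nu>' by simp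
    note Z = Z1 Z0_add[OF Z1 \<nu>]
    have "fourier (to_measure (\<lambda>z. c * torus_char \<nu> z)) \<nu>' = (LINT z|haar. c * torus_char (\<lambda>j. (- \<nu>') j + \<nu> j) z)"
      unfolding fourier_to_measure[OF int]
    proof (rule Bochner_Integration.integral_cong[OF refl])
      fix z assume "z \<in> space haar"
      then have z: "z \<in> torus" by (simp add: space_haar)
      show "torus_char (- \<nu>') z * (c * torus_char \<nu> z) = c * torus_char (\<lambda>j. (- \<nu>') j + \<nu> j) z"
        unfolding torus_char_add[OF Z(1) \<nu> z] by simp
    qed
    also have "\<dots> = c * (if (\<lambda>j. (- \<nu>') j + \<nu> j) = (\<lambda>_. 0) then 1 else 0)"
      using integral_torus_char[OF Z(2)] by simp
    also have "(\<lambda>j. (- \<nu>') j + \<nu> j) = (\<lambda>_. 0) \<longleftrightarrow> \<nu>' = \<nu>"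
      by (auto simp: fun_eq_iff)
    finally show ?thesis by simp
  qed
  have "radial_ext (to_measure (\<lambda>z. c * torus_char \<nu> z)) (of_real r) z =
      (\<Sum>\<^sub>\<infinity>\<nu>'\<in>{\<nu>}. c * of_real (r ^ weight \<nu>') * torus_char \<nu>' z)"
    unfolding radial_ext_real[OF r] by (rule infsum_cong_neutral) (use \<nu> in \<open>auto simp: four\<close>)
  then show ?thesis by simp
qed

lemma L1_convergence_trig_poly:
  assumes "trig_poly p"
  shows "((\<lambda>r. LINT z|haar. cmod (radial_ext (to_measure p) (of_real r) z - p z)) \<longlongrightarrow> 0) (at_left 1)"
  using assms
proof (induction rule: trig_poly.induct)
  case (trig_char \<nu> c)
  interpret prob_space haar by (rule prob_space_haar)
  have "((\<lambda>r. cmod (c * of_real (r ^ weight \<nu>) - c)) \<longlongrightarrow> cmod (c * of_real (1 ^ weight \<nu>) - c)) (at_left (1::real))"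
    by (intro tendsto_intros)
  moreover have "eventually (\<lambda>r. cmod (c * of_real (r ^ weight \<nu>) - c) =
      (LINT z|haar. cmod (radial_ext (to_measure (\<lambda>z. c * torus_char \<nu> z)) (of_real r) z - c * torus_char \<nu> z))) (at_left 1)"
    using eventually_at_left_1
  proof eventually_elim
    case (elim r)
    have "(LINT z|haar. cmod (radial_ext (to_measure (\<lambda>z. c * torus_char \<nu> z)) (of_real r) z - c * torus_char \<nu> z))
        = (LINT z|haar. cmod (c * of_real (r ^ weight \<nu>) - c))"
    proof (rule Bochner_Integration.integral_cong[OF refl])
      fix z assume "z \<in> space haar"
      then have z: "z \<in> torus" by (simp add: space_haar)
      have "radial_ext (to_measure (\<lambda>z. c * torus_char \<nu> z)) (of_real r) z - c * torus_char \<nu> z = (c * of_real (r ^ weight \<nu>) - c) * torus_char \<nu> z"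
        using elim by (simp only: radial_ext_char[OF trig_char _ z] left_diff_distrib)
      then show "cmod (radial_ext (to_measure (\<lambda>z. c * torus_char \<nu> z)) (of_real r) z - c * torus_char \<nu> z) = cmod (c * of_real (r ^ weight \<nu>) - c)"
        by (simp add: norm_mult norm_torus_char[OF z])
    qed
    then show ?case by (simp add: prob_space)
  qed
  ultimately show ?case by (simp add: Lim_transform_eventually)
next
  case (trig_add p q)
  show ?case
  proof (rule tendsto_sandwich[OF _ _ tendsto_const])
    show "((\<lambda>r. (LINT z|haar. cmod (radial_ext (to_measure p) (of_real r) z - p z)) +
        (LINT z|haar. cmod (radial_ext (to_measure q) (of_real r) z - q z))) \<longlongrightarrow> 0) (at_left 1)"
      using tendsto_add[OF trig_add.IH] by simp
    show "eventually (\<lambda>r. 0 \<le> (LINT z|haar. cmod (radial_ext (to_measure (\<lambda>z. p z + q z)) (of_real r) z - (p z + q z)))) (at_left 1)"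
      by simp
    show "eventually (\<lambda>r. (LINT z|haar. cmod (radial_ext (to_measure (\<lambda>z. p z + q z)) (of_real r) z - (p z + q z))) \<le>
        (LINT z|haar. cmod (radial_ext (to_measure p) (of_real r) z - p z)) +
        (LINT z|haar. cmod (radial_ext (to_measure q) (of_real r) z - q z))) (at_left 1)"
      using eventually_at_left_1
    proof eventually_elim
      case (elim r)
      then have r: "0 \<le> r" "r < 1" by auto
      note int = integrable_trig_poly[OF trig_add.hyps(1)] integrable_trig_poly[OF trig_add.hyps(2)]
      note intr = integrable_radial_ext[OF complex_measure_to_measure[OF int(1)] r]
        integrable_radial_ext[OF complex_measure_to_measure[OF int(2)] r]
      have "(LINT z|haar. cmod (radial_ext (to_measure (\<lambda>z. p z + q z)) (of_real r) z - (p z + q z))) \<le>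
        (LINT z|haar. cmod (radial_ext (to_measure p) (of_real r) z - p z) + cmod (radial_ext (to_measure q) (of_real r) z - q z))"
      proof (rule integral_mono)
        show "integrable haar (\<lambda>z. cmod (radial_ext (to_measure (\<lambda>z. p z + q z)) (of_real r) z - (p z + q z)))"
          using int by (intro integrable_norm Bochner_Integration.integrable_diff integrable_radial_ext complex_measure_to_measure r) auto
        show "integrable haar (\<lambda>z. cmod (radial_ext (to_measure p) (of_real r) z - p z) + cmod (radial_ext (to_measure q) (of_real r) z - q z))"
          using int intr by auto
        fix z assume "z \<in> space haar"
        then have "z \<in> torus" by (simp add: space_haar)
        then show "cmod (radial_ext (to_measure (\<lambda>z. p z + q z)) (of_real r) z - (p z + q z)) \<le>
            cmod (radial_ext (to_measure p) (of_real r) z - p z) + cmod (radial_ext (to_measure q) (of_real r) z - q z)"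
          using norm_triangle_ineq[of "radial_ext (to_measure p) (of_real r) z - p z" "radial_ext (to_measure q) (of_real r) z - q z"]
          by (simp add: radial_ext_add[OF int r] algebra_simps)
      qed
      also have "\<dots> = (LINT z|haar. cmod (radial_ext (to_measure p) (of_real r) z - p z)) +
          (LINT z|haar. cmod (radial_ext (to_measure q) (of_real r) z - q z))"
        by (rule Bochner_Integration.integral_add) (use int intr in auto)
      finally show ?case .
    qed
  qed
next
  case (trig_cong p q)
  have "(LINT z|haar. cmod (radial_ext (to_measure q) (of_real r) z - q z)) =
      (LINT z|haar. cmod (radial_ext (to_measure p) (of_real r) z - p z))" for r
    using radial_ext_cong[of q p] by (intro Bochner_Integration.integral_cong) (auto simp: space_haar trig_cong.hyps)
  then show ?case using trig_cong.IH by simp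
qed

text \<open>
  Approximation by a trigonometric polynomial, whose extensions converge explicitly; the error is
  not enlarged by the extension.
\<close>

lemma L1_convergence:
  assumes f: "integrable haar f"
  shows "((\<lambda>r. LINT z|haar. cmod (radial_ext (to_measure f) (of_real r) z - f z)) \<longlongrightarrow> 0) (at_left 1)"
proof (rule tendstoI)
  fix e :: real assume e: "0 < e"
  then have "0 < e / 3" by simp
  then obtain p where p: "trig_poly p" "(LINT z|haar. cmod (f z - p z)) < e / 3"
    using L1_approximable_integrable[OF f] unfolding L1_approximable_def by blast
  have ip: "integrable haar p" by (rule integrable_trig_poly[OF p(1)])
  have "eventually (\<lambda>r. dist (LINT z|haar. cmod (radial_ext (to_measure p) (of_real r) z - p z)) 0 < e / 3) (at_left 1)"
    using e by (intro tendstoD[OF L1_convergence_trig_poly[OF p(1)]]) simp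
  with eventually_at_left_1
  show "eventually (\<lambda>r. dist (LINT z|haar. cmod (radial_ext (to_measure f) (of_real r) z - f z)) 0 < e) (at_left 1)"
  proof eventually_elim
    case (elim r)
    then have r: "0 \<le> r" "r < 1" by auto
    let ?f = "radial_ext (to_measure f) (of_real r)" and ?p = "radial_ext (to_measure p) (of_real r)"
    have if': "integrable haar ?f" and ip': "integrable haar ?p"
      by (intro integrable_radial_ext complex_measure_to_measure f ip r)+
    have "(LINT z|haar. cmod (?f z - ?p z)) = (LINT z|haar. cmod (radial_ext (to_measure (\<lambda>z. f z - p z)) (of_real r) z))"
      by (intro Bochner_Integration.integral_cong refl) (simp add: space_haar radial_ext_diff[OF f ip r])
    also have "\<dots> \<le> (LINT z|haar. cmod (f z - p z))"
      using f ip by (intro radial_ext_L1_le_norm r) auto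
    finally have 1: "(LINT z|haar. cmod (?f z - ?p z)) < e / 3" using p(2) by linarith
    have 2: "(LINT z|haar. cmod (p z - f z)) < e / 3" using p(2) by (simp add: norm_minus_commute)
    have 3: "(LINT z|haar. cmod (?p z - p z)) < e / 3" using elim(2) by (simp add: abs_less_iff)
    have "(LINT z|haar. cmod (?f z - f z)) < e"
      using integral_norm_diff_triangle[OF if' ip' f] integral_norm_diff_triangle[OF ip' ip f] 1 2 3 by linarith
    then show ?case by simp
  qed
qed

section \<open>Slices\<close>

text \<open>
  On a disc of radius \<open>r < 1\<close> the finite partial sums converge uniformly by \<open>summable_weight\<close>.
\<close>

lemma weight_series_holomorphic:
  assumes S: "S \<subseteq> Z0" and d: "\<And>\<nu>. cmod (d \<nu>) \<le> K"
  shows "(\<lambda>\<xi>. \<Sum>\<^sub>\<infinity>\<nu>\<in>S. d \<nu> * \<xi> ^ weight \<nu>) holomorphic_on ball 0 1" (is "?g holomorphic_on _")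
proof -
  have hol: "?g holomorphic_on ball 0 r" if r: "0 < r" "r < 1" for r
  proof (rule holomorphic_uniform_limit)
    show "eventually (\<lambda>F. continuous_on (cball 0 r) (\<lambda>\<xi>. \<Sum>\<nu>\<in>F. d \<nu> * \<xi> ^ weight \<nu>) \<and>
        (\<lambda>\<xi>. \<Sum>\<nu>\<in>F. d \<nu> * \<xi> ^ weight \<nu>) holomorphic_on ball 0 r) (finite_subsets_at_top S)"
      by (intro always_eventually allI conjI continuous_intros holomorphic_intros)
    show "uniform_limit (cball 0 r) (\<lambda>F \<xi>. \<Sum>\<nu>\<in>F. d \<nu> * \<xi> ^ weight \<nu>) ?g (finite_subsets_at_top S)"
    proof (rule Weierstrass_m_test_general)
      show "(\<lambda>\<nu>. K * r ^ weight \<nu>) summable_on S"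
        using r by (intro summable_on_cmult_right summable_on_subset_banach[OF summable_weight S]) auto
      fix \<nu> and \<xi> :: complex assume "\<xi> \<in> cball 0 r"
      then have "cmod \<xi> ^ weight \<nu> \<le> r ^ weight \<nu>" by (intro power_mono) auto
      moreover have "0 \<le> K" using d[of \<nu>] norm_ge_zero order_trans by blast
      ultimately show "cmod (d \<nu> * \<xi> ^ weight \<nu>) \<le> K * r ^ weight \<nu>"
        using d[of \<nu>] by (simp add: norm_mult norm_power mult_mono)
    qed
    show "finite_subsets_at_top S \<noteq> bot" by simp
  qed
  have "?g field_differentiable (at \<xi>)" if \<xi>: "\<xi> \<in> ball 0 1" for \<xi>
  proof -
    define r where "r = (cmod \<xi> + 1) / 2"
    have r: "0 < r" "r < 1" "cmod \<xi> < r" using \<xi> norm_ge_zero[of \<xi>] by (auto simp: r_def simp del: norm_ge_zero)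
    then show ?thesis
      using hol[of r] by (intro holomorphic_on_imp_differentiable_at[of _ "ball 0 r"]) auto
  qed
  then show ?thesis by (auto simp: holomorphic_on_def intro: field_differentiable_at_within)
qed

lemma signed_weight_N0:
  assumes "\<nu> \<in> N0" shows "signed_weight \<nu> = int (weight \<nu>)"
proof -
  have "\<nu> j \<ge> 0" for j using assms by (simp add: N0_def)
  then show ?thesis unfolding signed_weight_def weight_def of_nat_sum of_nat_mult
    by (intro sum.cong) auto
qed

lemma signed_weight_uminus: "signed_weight (- \<nu>) = - signed_weight \<nu>"
  by (simp add: signed_weight_def sum_negf[symmetric])

lemma cis_power_weight:
  "of_real (r ^ n) * cis (t * of_int (int n)) = (of_real r * cis t) ^ n"
  by (simp add: power_mult_distrib Complex.DeMoivre mult.commute)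

lemma slice_holomorphic:
  assumes \<mu>: "complex_measure haar \<mu>" and spec: "spectrum_on \<mu> N0" and z: "z \<in> torus"
  obtains F where "F holomorphic_on ball 0 1"
    "\<And>r t. 0 \<le> r \<Longrightarrow> r < 1 \<Longrightarrow> radial_ext \<mu> (of_real r) (flow (cis t) z) = F (of_real r * cis t)"
proof
  show "(\<lambda>\<xi>. \<Sum>\<^sub>\<infinity>\<nu>\<in>N0. (fourier \<mu> \<nu> * torus_char \<nu> z) * \<xi> ^ weight \<nu>) holomorphic_on ball 0 1"
    by (rule weight_series_holomorphic[where K = "variation_bound haar \<mu>"])
       (auto simp: N0_def norm_mult norm_torus_char[OF z] norm_fourier_le[OF \<mu>])
  fix r t :: real assume r: "0 \<le> r" "r < 1"
  show "radial_ext \<mu> (of_real r) (flow (cis t) z) = (\<Sum>\<^sub>\<infinity>\<nu>\<in>N0. (fourier \<mu> \<nu> * torus_char \<nu> z) * (of_real r * cis t) ^ weight \<nu>)"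
    unfolding radial_ext_polar[OF r(1)]
  proof (rule infsum_cong_neutral)
    fix \<nu> assume "\<nu> \<in> Z0 \<inter> N0"
    then show "fourier \<mu> \<nu> * of_real (r ^ weight \<nu>) * cis (t * of_int (signed_weight \<nu>)) * torus_char \<nu> z =
        (fourier \<mu> \<nu> * torus_char \<nu> z) * (of_real r * cis t) ^ weight \<nu>"
      unfolding cis_power_weight[symmetric] using signed_weight_N0[of \<nu>] by (simp only: Int_iff mult_ac)
  qed (use spec in \<open>auto simp: spectrum_on_def N0_def\<close>)
qed

text \<open>
  Frequencies in \<open>N0\<close> contribute powers of \<open>\<xi>\<close>, those in \<open>- N0\<close> powers of its conjugate. The zero
  frequency lies in both sets and is counted with the former.
\<close>

lemma slice_harmonic:
  assumes \<mu>: "complex_measure haar \<mu>" and spec: "spectrum_on \<mu> (N0 \<union> uminus ` N0)" and z: "z \<in> torus"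
  obtains F where "harmonic_disc F"
    "\<And>r t. 0 \<le> r \<Longrightarrow> r < 1 \<Longrightarrow> radial_ext \<mu> (of_real r) (flow (cis t) z) = F (of_real r * cis t)"
proof
  let ?M = "uminus ` N0 - N0"
  define A where "A = (\<lambda>\<xi>. \<Sum>\<^sub>\<infinity>\<nu>\<in>N0. (fourier \<mu> \<nu> * torus_char \<nu> z) * \<xi> ^ weight \<nu>)"
  define B where "B = (\<lambda>\<xi>. \<Sum>\<^sub>\<infinity>\<nu>\<in>?M. cnj (fourier \<mu> \<nu> * torus_char \<nu> z) * \<xi> ^ weight \<nu>)"
  have sub: "N0 \<subseteq> Z0" "?M \<subseteq> Z0" by (auto simp: N0_def)
  have AB: "A holomorphic_on ball 0 1" "B holomorphic_on ball 0 1"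
    unfolding A_def B_def
    by (rule weight_series_holomorphic[OF sub(1), where K = "variation_bound haar \<mu>"]
          weight_series_holomorphic[OF sub(2), where K = "variation_bound haar \<mu>"],
        simp add: norm_mult norm_torus_char[OF z] norm_fourier_le[OF \<mu>])+
  show "harmonic_disc (\<lambda>\<xi>. A \<xi> + cnj (B \<xi>))"
    unfolding harmonic_disc_def
    by (rule exI[of _ "\<lambda>\<xi>. A \<xi> + B \<xi>"], rule exI[of _ "\<lambda>\<xi>. - \<i> * (A \<xi> - B \<xi>)"])
       (auto intro!: holomorphic_intros AB simp: complex_eq_iff)
  fix r t :: real assume r: "0 \<le> r" "r < 1"
  let ?f = "\<lambda>\<nu>. fourier \<mu> \<nu> * of_real (r ^ weight \<nu>) * cis (t * of_int (signed_weight \<nu>)) * torus_char \<nu> z"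
  have summ: "?f summable_on S" if "S \<subseteq> Z0" for S
  proof -
    have "flow (cis t) z \<in> torus" by (rule flow_torus[OF _ z]) simp
    then have "(\<lambda>\<nu>. fourier \<mu> \<nu> * of_real (r ^ weight \<nu>) * torus_char \<nu> (flow (cis t) z)) summable_on Z0"
      by (rule summable_radial_ext[OF \<mu> r])
    then have "?f summable_on Z0" by (simp only: torus_char_flow mult.assoc)
    then show ?thesis using that by (rule summable_on_subset_banach)
  qed
  have "radial_ext \<mu> (of_real r) (flow (cis t) z) = infsum ?f (N0 \<union> ?M)"
    unfolding radial_ext_polar[OF r(1)]
    by (rule infsum_cong_neutral) (use spec sub in \<open>auto simp: spectrum_on_def\<close>)
  also have "\<dots> = infsum ?f N0 + infsum ?f ?M"
    by (rule infsum_Un_disjoint) (use summ sub in auto)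
  also have "infsum ?f N0 = A (of_real r * cis t)"
    unfolding A_def
  proof (rule infsum_cong)
    fix \<nu> assume "\<nu> \<in> N0"
    then show "?f \<nu> = (fourier \<mu> \<nu> * torus_char \<nu> z) * (of_real r * cis t) ^ weight \<nu>"
      unfolding cis_power_weight[symmetric] using signed_weight_N0[of \<nu>] by (simp only: mult_ac)
  qed
  also have "infsum ?f ?M = cnj (B (of_real r * cis t))"
    unfolding B_def infsum_cnj[symmetric]
  proof (rule infsum_cong)
    fix \<nu> assume "\<nu> \<in> ?M"
    then obtain \<nu>' where \<nu>': "\<nu>' \<in> N0" "\<nu> = - \<nu>'" by auto
    have "cnj ((of_real r * cis t) ^ weight \<nu>) = of_real (r ^ weight \<nu>) * cis (t * of_int (signed_weight \<nu>))"
      unfolding cis_power_weight[symmetric] \<nu>'(2) weight_uminus signed_weight_uminus signed_weight_N0[OF \<nu>'(1)]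
      by (simp add: cis_cnj)
    then show "?f \<nu> = cnj (cnj (fourier \<mu> \<nu> * torus_char \<nu> z) * (of_real r * cis t) ^ weight \<nu>)"
      by (simp only: complex_cnj_mult complex_cnj_cnj mult_ac)
  qed
  finally show "radial_ext \<mu> (of_real r) (flow (cis t) z) = A (of_real r * cis t) + cnj (B (of_real r * cis t))" .
qed


section \<open>Maximal inequalities and radial limits on the torus\<close>

lemma measurable_radial_ext:
  "complex_measure haar \<mu> \<Longrightarrow> 0 \<le> r \<Longrightarrow> r < 1 \<Longrightarrow> radial_ext \<mu> (of_real r) \<in> borel_measurable haar"
  by (intro borel_measurable_haar_continuous continuous_on_radial_ext)

lemma continuous_on_radius:
  assumes \<mu>: "complex_measure haar \<mu>" and spec: "spectrum_on \<mu> (N0 \<union> uminus ` N0)" and z: "z \<in> torus" and \<rho>: "\<rho> \<le> 1"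
  shows "continuous_on {0<..<\<rho>} (\<lambda>r. radial_ext \<mu> (of_real r) z)"
proof -
  obtain F where F: "harmonic_disc F"
    "\<And>r t. 0 \<le> r \<Longrightarrow> r < 1 \<Longrightarrow> radial_ext \<mu> (of_real r) (flow (cis t) z) = F (of_real r * cis t)"
    by (rule slice_harmonic[OF \<mu> spec z], rule that, assumption+)
  have "radial_ext \<mu> (of_real r) z = F (of_real r * cis 0)" if "r \<in> {0<..<\<rho>}" for r
    using F(2)[of r 0] that \<rho> by simp
  then show ?thesis
    using continuous_on_harmonic_radius[OF F(1) \<rho>, of 0] continuous_on_cong by (metis (no_types, lifting))
qed

text \<open>
  The set where the maximal function over radii below \<open>\<rho>\<close> exceeds \<open>y\<close>. The bound on the radius
  keeps slices away from the boundary of the disc, where they need not be continuous.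
\<close>

definition superlevel :: "((nat \<Rightarrow> complex) set \<Rightarrow> complex) \<Rightarrow> real \<Rightarrow> real \<Rightarrow> (nat \<Rightarrow> complex) set" where
  "superlevel \<mu> \<rho> y = {z \<in> torus. \<exists>r\<in>{0<..<\<rho>}. y < cmod (radial_ext \<mu> (of_real r) z)}"

lemma superlevel_sets:
  assumes \<mu>: "complex_measure haar \<mu>" and spec: "spectrum_on \<mu> (N0 \<union> uminus ` N0)" and \<rho>: "\<rho> \<le> 1"
  shows "superlevel \<mu> \<rho> y \<in> sets haar"
proof -
  have "superlevel \<mu> \<rho> y = (\<Union>r\<in>{0<..<\<rho>} \<inter> \<rat>. {z \<in> space haar. y < cmod (radial_ext \<mu> (of_real r) z)})"
    unfolding superlevel_def space_haar
    using ex_gt_iff_ex_rat[OF continuous_on_norm[OF continuous_on_radius[OF \<mu> spec _ \<rho>]], of _ y] by blast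
  also have "\<dots> \<in> sets haar"
  proof (rule sets.countable_UN'')
    show "countable ({0<..<\<rho>} \<inter> \<rat>)" by (intro countable_Int2 countable_rat)
    fix r assume "r \<in> {0<..<\<rho>} \<inter> \<rat>"
    then have [measurable]: "radial_ext \<mu> (of_real r) \<in> borel_measurable haar"
      using \<rho> by (intro measurable_radial_ext \<mu>) auto
    show "{z \<in> space haar. y < cmod (radial_ext \<mu> (of_real r) z)} \<in> sets haar" by measurable
  qed
  finally show ?thesis .
qed

lemma slice_integral:
  assumes F: "harmonic_disc F" and \<rho>: "0 \<le> \<rho>" "\<rho> < 1"
    and sl: "\<And>r t. 0 \<le> r \<Longrightarrow> r < 1 \<Longrightarrow> radial_ext \<mu> (of_real r) (flow (cis t) z) = F (of_real r * cis t)"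
  shows "(\<integral>\<^sup>+t\<in>{0..2 * pi}. ennreal (cmod (radial_ext \<mu> (of_real \<rho>) (flow (cis t) z))) \<partial>lborel) =
    ennreal (integral {0..2 * pi} (\<lambda>t. cmod (F (of_real \<rho> * cis t))))"
  unfolding sl[OF \<rho>]
  by (intro nn_integral_continuous_Icc continuous_intros continuous_on_harmonic_circle[OF F] \<rho>) auto

lemma average_norm_radial_ext:
  assumes \<mu>: "complex_measure haar \<mu>" and \<rho>: "0 \<le> \<rho>" "\<rho> < 1"
  shows "(\<integral>\<^sup>+z. (\<integral>\<^sup>+t\<in>{0..2 * pi}. ennreal (cmod (radial_ext \<mu> (of_real \<rho>) (flow (cis t) z))) \<partial>lborel) \<partial>haar)
    \<le> ennreal (2 * pi) * total_variation haar \<mu>"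
proof -
  have "(\<integral>\<^sup>+z. (\<integral>\<^sup>+t\<in>{0..2 * pi}. ennreal (cmod (radial_ext \<mu> (of_real \<rho>) (flow (cis t) z))) \<partial>lborel) \<partial>haar)
      = ennreal (2 * pi) * norm_L1 (radial_ext \<mu> (of_real \<rho>))"
  proof -
    have [measurable]: "radial_ext \<mu> (of_real \<rho>) \<in> borel_measurable haar" by (rule measurable_radial_ext[OF \<mu> \<rho>])
    have "(\<lambda>z. ennreal (cmod (radial_ext \<mu> (of_real \<rho>) z))) \<in> borel_measurable haar" by measurable
    then show ?thesis unfolding norm_L1_def by (rule nn_integral_flow_average)
  qed
  also have "\<dots> \<le> ennreal (2 * pi) * total_variation haar \<mu>"
    using \<rho> by (intro mult_left_mono norm_L1_radial_ext_le \<mu>) auto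
  finally show ?thesis .
qed

lemma measurable_flow_integral:
  assumes g: "g \<in> borel_measurable haar"
  shows "(\<lambda>z. \<integral>\<^sup>+t\<in>{0..2 * pi}. ennreal (cmod (g (flow (cis t) z))) \<partial>lborel) \<in> borel_measurable haar"
proof (rule lborel.borel_measurable_nn_integral)
  have [measurable]: "(\<lambda>x. g (flow (cis (snd x)) (fst x))) \<in> borel_measurable (haar \<Otimes>\<^sub>M lborel)"
    using measurable_compose[OF measurable_flow_pair g] by (simp add: split_beta)
  show "(\<lambda>(z, t). ennreal (cmod (g (flow (cis t) z))) * indicator {0..2 * pi} t) \<in> borel_measurable (haar \<Otimes>\<^sub>M lborel)"
    unfolding split_beta by measurable
qed

lemma cancel_2pi: "ennreal (2 * pi) * a \<le> ennreal (2 * pi) * b \<Longrightarrow> a \<le> b"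
  by (subst (asm) ennreal_mult_le_mult_iff) auto

text \<open>
  The weak type bound on each slice is integrated over the torus; the factor \<open>2 \<pi>\<close> from averaging
  over orbits appears on both sides.
\<close>

lemma superlevel_emeasure_le:
  assumes \<mu>: "complex_measure haar \<mu>" and spec: "spectrum_on \<mu> (N0 \<union> uminus ` N0)"
    and \<rho>: "0 < \<rho>" "\<rho> < 1" and y: "0 < y"
  shows "emeasure haar (superlevel \<mu> \<rho> y) \<le> ennreal (15 / y) * total_variation haar \<mu>"
proof (rule cancel_2pi)
  have L: "superlevel \<mu> \<rho> y \<in> sets haar" using \<rho> by (intro superlevel_sets \<mu> spec) auto
  have "ennreal (2 * pi) * emeasure haar (superlevel \<mu> \<rho> y) =
      (\<integral>\<^sup>+z. (\<integral>\<^sup>+t\<in>{0..2 * pi}. indicator (superlevel \<mu> \<rho> y) (flow (cis t) z) \<partial>lborel) \<partial>haar)"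
    using L nn_integral_flow_average[of "indicator (superlevel \<mu> \<rho> y)"] by simp
  also have "\<dots> \<le> (\<integral>\<^sup>+z. ennreal (15 / y) * (\<integral>\<^sup>+t\<in>{0..2 * pi}. ennreal (cmod (radial_ext \<mu> (of_real \<rho>) (flow (cis t) z))) \<partial>lborel) \<partial>haar)"
  proof (rule nn_integral_mono)
    fix z assume "z \<in> space haar"
    then have z: "z \<in> torus" by (simp add: space_haar)
    obtain F where F: "harmonic_disc F"
      "\<And>r t. 0 \<le> r \<Longrightarrow> r < 1 \<Longrightarrow> radial_ext \<mu> (of_real r) (flow (cis t) z) = F (of_real r * cis t)"
      by (rule slice_harmonic[OF \<mu> spec z], rule that, assumption+)
    let ?E = "{t \<in> {0..2 * pi}. \<exists>r\<in>{0<..<\<rho>}. y < cmod (F (of_real r * cis t))}"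
    have "flow (cis t) z \<in> superlevel \<mu> \<rho> y \<longleftrightarrow> (\<exists>r\<in>{0<..<\<rho>}. y < cmod (F (of_real r * cis t)))" for t
      using flow_torus[OF _ z, of "cis t"] F(2)[of _ t] \<rho> by (auto simp: superlevel_def)
    then have "(\<integral>\<^sup>+t\<in>{0..2 * pi}. indicator (superlevel \<mu> \<rho> y) (flow (cis t) z) \<partial>lborel) = (\<integral>\<^sup>+t. indicator ?E t \<partial>lborel)"
      by (intro nn_integral_cong) (auto simp: indicator_def)
    also have "\<dots> = emeasure lborel ?E"
      using \<rho> radial_superlevel_measurable[OF F(1), of \<rho>] by (intro nn_integral_indicator) auto
    also have "\<dots> \<le> ennreal (15 / y * integral {0..2 * pi} (\<lambda>t. cmod (F (of_real \<rho> * cis t))))"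
      by (rule harmonic_weak_type[OF F(1) \<rho> y])
    also have "\<dots> = ennreal (15 / y) * ennreal (integral {0..2 * pi} (\<lambda>t. cmod (F (of_real \<rho> * cis t))))"
      using y by (intro ennreal_mult') auto
    also have "ennreal (integral {0..2 * pi} (\<lambda>t. cmod (F (of_real \<rho> * cis t)))) =
        (\<integral>\<^sup>+t\<in>{0..2 * pi}. ennreal (cmod (radial_ext \<mu> (of_real \<rho>) (flow (cis t) z))) \<partial>lborel)"
      using \<rho> by (intro slice_integral[OF F(1) _ _ F(2), symmetric]) auto
    finally show "(\<integral>\<^sup>+t\<in>{0..2 * pi}. indicator (superlevel \<mu> \<rho> y) (flow (cis t) z) \<partial>lborel) \<le>
        ennreal (15 / y) * (\<integral>\<^sup>+t\<in>{0..2 * pi}. ennreal (cmod (radial_ext \<mu> (of_real \<rho>) (flow (cis t) z))) \<partial>lborel)" .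
  qed
  also have "\<dots> = ennreal (15 / y) * (\<integral>\<^sup>+z. (\<integral>\<^sup>+t\<in>{0..2 * pi}. ennreal (cmod (radial_ext \<mu> (of_real \<rho>) (flow (cis t) z))) \<partial>lborel) \<partial>haar)"
    using \<rho> by (intro nn_integral_cmult measurable_flow_integral measurable_radial_ext[OF \<mu>]) auto
  also have "\<dots> \<le> ennreal (15 / y) * (ennreal (2 * pi) * total_variation haar \<mu>)"
    using \<rho> by (intro mult_left_mono average_norm_radial_ext \<mu>) auto
  finally show "ennreal (2 * pi) * emeasure haar (superlevel \<mu> \<rho> y) \<le> ennreal (2 * pi) * (ennreal (15 / y) * total_variation haar \<mu>)"
    by (simp only: mult_ac)
qed

theorem radial_max_weak_type:
  assumes \<mu>: "complex_measure haar \<mu>" and spec: "spectrum_on \<mu> (N0 \<union> uminus ` N0)" and y: "0 < y"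
  shows "emeasure haar {z \<in> torus. radial_max \<mu> z > ennreal y} \<le> ennreal 15 * total_variation haar \<mu> / ennreal y"
proof -
  have "{z \<in> torus. radial_max \<mu> z > ennreal y} = superlevel \<mu> 1 y"
    using y by (auto simp: radial_max_def superlevel_def less_SUP_iff ennreal_less_iff)
  also have "\<dots> = (\<Union>n. superlevel \<mu> (radii n) y)"
  proof
    show "superlevel \<mu> 1 y \<subseteq> (\<Union>n. superlevel \<mu> (radii n) y)"
    proof
      fix z assume "z \<in> superlevel \<mu> 1 y"
      then obtain r where r: "z \<in> torus" "0 < r" "r < 1" "y < cmod (radial_ext \<mu> (of_real r) z)"
        by (auto simp: superlevel_def)
      obtain n where "r < radii n" using ex_radii_gt[OF r(3)] by blast
      then have "z \<in> superlevel \<mu> (radii n) y" using r by (auto simp: superlevel_def)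
      then show "z \<in> (\<Union>n. superlevel \<mu> (radii n) y)" by blast
    qed
    show "(\<Union>n. superlevel \<mu> (radii n) y) \<subseteq> superlevel \<mu> 1 y"
      using radii_bounds(2) by (fastforce simp: superlevel_def intro: less_trans)
  qed
  finally have "emeasure haar {z \<in> torus. radial_max \<mu> z > ennreal y} = (SUP n. emeasure haar (superlevel \<mu> (radii n) y))"
  proof (subst SUP_emeasure_incseq)
    show "range (\<lambda>n. superlevel \<mu> (radii n) y) \<subseteq> sets haar"
      by (intro image_subsetI superlevel_sets[OF \<mu> spec less_imp_le[OF radii_bounds(2)]])
    show "incseq (\<lambda>n. superlevel \<mu> (radii n) y)"
    proof (rule incseq_SucI)
      fix n
      have "radii n \<le> radii (Suc n)" using radii_incseq by (simp add: incseq_SucD)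
      then show "superlevel \<mu> (radii n) y \<le> superlevel \<mu> (radii (Suc n)) y" by (fastforce simp: superlevel_def)
    qed
  qed simp
  also have "\<dots> \<le> ennreal (15 / y) * total_variation haar \<mu>"
    by (intro SUP_least superlevel_emeasure_le \<mu> spec radii_bounds y)
  also have "\<dots> = ennreal 15 * total_variation haar \<mu> / ennreal y"
  proof -
    have "ennreal (15 / y) = ennreal 15 * inverse (ennreal y)"
      using y by (simp only: inverse_ennreal divide_inverse) (rule ennreal_mult', simp)
    then show ?thesis by (simp only: divide_ennreal_def mult_ac)
  qed
  finally show ?thesis .
qed

text \<open>
  As for the weak type bound, the estimate is obtained on slices for radii below \<open>\<rho>\<close>, and then \<open>\<rho>\<close>
  tends to 1 by monotone convergence.
\<close>

theorem radial_max_L1: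
  assumes \<mu>: "complex_measure haar \<mu>" and spec: "spectrum_on \<mu> N0"
  shows "(\<integral>\<^sup>+z. radial_max \<mu> z \<partial>haar) \<le> ennreal 60 * total_variation haar \<mu>"
proof -
  have spec': "spectrum_on \<mu> (N0 \<union> uminus ` N0)" using spec by (auto simp: spectrum_on_def)
  define R where "R = (\<lambda>\<rho> z. SUP r\<in>{0<..<\<rho>}. ennreal (cmod (radial_ext \<mu> (of_real r) z)))"
  have Rm: "R \<rho> \<in> borel_measurable haar" if \<rho>: "\<rho> \<le> 1" for \<rho>
  proof -
    have "(\<lambda>z. SUP r\<in>{0<..<\<rho>} \<inter> \<rat>. ennreal (cmod (radial_ext \<mu> (of_real r) z))) \<in> borel_measurable haar"
    proof (rule borel_measurable_SUP)
      show "countable ({0<..<\<rho>} \<inter> \<rat>)" by (intro countable_Int2 countable_rat)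
      fix r assume "r \<in> {0<..<\<rho>} \<inter> \<rat>"
      then have [measurable]: "radial_ext \<mu> (of_real r) \<in> borel_measurable haar"
        using \<rho> by (intro measurable_radial_ext \<mu>) auto
      show "(\<lambda>z. ennreal (cmod (radial_ext \<mu> (of_real r) z))) \<in> borel_measurable haar" by measurable
    qed
    moreover have "R \<rho> z = (SUP r\<in>{0<..<\<rho>} \<inter> \<rat>. ennreal (cmod (radial_ext \<mu> (of_real r) z)))" if "z \<in> space haar" for z
      unfolding R_def using that
      by (intro SUP_eq_SUP_rat continuous_on_norm continuous_on_radius[OF \<mu> spec' _ \<rho>]) (auto simp: space_haar)
    ultimately show ?thesis by (simp cong: measurable_cong)
  qed
  have bound: "(\<integral>\<^sup>+z. R \<rho> z \<partial>haar) \<le> ennreal 60 * total_variation haar \<mu>" if \<rho>: "0 < \<rho>" "\<rho> < 1" for \<rho>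
  proof (rule cancel_2pi)
    have "ennreal (2 * pi) * (\<integral>\<^sup>+z. R \<rho> z \<partial>haar) = (\<integral>\<^sup>+z. (\<integral>\<^sup>+t\<in>{0..2 * pi}. R \<rho> (flow (cis t) z) \<partial>lborel) \<partial>haar)"
      using \<rho> by (intro nn_integral_flow_average[symmetric] Rm) auto
    also have "\<dots> \<le> (\<integral>\<^sup>+z. ennreal 60 * (\<integral>\<^sup>+t\<in>{0..2 * pi}. ennreal (cmod (radial_ext \<mu> (of_real \<rho>) (flow (cis t) z))) \<partial>lborel) \<partial>haar)"
    proof (rule nn_integral_mono)
      fix z assume "z \<in> space haar"
      then have z: "z \<in> torus" by (simp add: space_haar)
      obtain F where F: "F holomorphic_on ball 0 1"
        "\<And>r t. 0 \<le> r \<Longrightarrow> r < 1 \<Longrightarrow> radial_ext \<mu> (of_real r) (flow (cis t) z) = F (of_real r * cis t)"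
        by (rule slice_holomorphic[OF \<mu> spec z], rule that, assumption+)
      have "R \<rho> (flow (cis t) z) = (SUP r\<in>{0<..<\<rho>}. ennreal (cmod (F (of_real r * cis t))))" for t
        unfolding R_def using \<rho> F(2) by (intro SUP_cong) auto
      then have "(\<integral>\<^sup>+t\<in>{0..2 * pi}. R \<rho> (flow (cis t) z) \<partial>lborel) \<le> ennreal (60 * integral {0..2 * pi} (\<lambda>t. cmod (F (of_real \<rho> * cis t))))"
        using H1_maximal_disc[OF F(1) \<rho>] by simp
      also have "\<dots> = ennreal 60 * ennreal (integral {0..2 * pi} (\<lambda>t. cmod (F (of_real \<rho> * cis t))))"
        by (intro ennreal_mult') auto
      also have "ennreal (integral {0..2 * pi} (\<lambda>t. cmod (F (of_real \<rho> * cis t)))) =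
          (\<integral>\<^sup>+t\<in>{0..2 * pi}. ennreal (cmod (radial_ext \<mu> (of_real \<rho>) (flow (cis t) z))) \<partial>lborel)"
        using \<rho> by (intro slice_integral[OF harmonic_disc_holomorphic[OF F(1)] _ _ F(2), symmetric]) auto
      finally show "(\<integral>\<^sup>+t\<in>{0..2 * pi}. R \<rho> (flow (cis t) z) \<partial>lborel) \<le>
          ennreal 60 * (\<integral>\<^sup>+t\<in>{0..2 * pi}. ennreal (cmod (radial_ext \<mu> (of_real \<rho>) (flow (cis t) z))) \<partial>lborel)" .
    qed
    also have "\<dots> = ennreal 60 * (\<integral>\<^sup>+z. (\<integral>\<^sup>+t\<in>{0..2 * pi}. ennreal (cmod (radial_ext \<mu> (of_real \<rho>) (flow (cis t) z))) \<partial>lborel) \<partial>haar)"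
      using \<rho> by (intro nn_integral_cmult measurable_flow_integral measurable_radial_ext[OF \<mu>]) auto
    also have "\<dots> \<le> ennreal 60 * (ennreal (2 * pi) * total_variation haar \<mu>)"
      using \<rho> by (intro mult_left_mono average_norm_radial_ext \<mu>) auto
    finally show "ennreal (2 * pi) * (\<integral>\<^sup>+z. R \<rho> z \<partial>haar) \<le> ennreal (2 * pi) * (ennreal 60 * total_variation haar \<mu>)"
      by (simp only: mult_ac)
  qed
  have "radial_max \<mu> z = (SUP n. R (radii n) z)" for z
    unfolding radial_max_def R_def
  proof (rule antisym)
    show "(SUP r\<in>{0<..<1}. ennreal (cmod (radial_ext \<mu> (of_real r) z))) \<le> (SUP n. SUP r\<in>{0<..<radii n}. ennreal (cmod (radial_ext \<mu> (of_real r) z)))"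
    proof (rule SUP_least)
      fix r :: real assume r: "r \<in> {0<..<1}"
      then obtain n where "r < radii n" using ex_radii_gt by auto
      with r show "ennreal (cmod (radial_ext \<mu> (of_real r) z)) \<le> (SUP n. SUP r\<in>{0<..<radii n}. ennreal (cmod (radial_ext \<mu> (of_real r) z)))"
        by (intro SUP_upper2[of n] SUP_upper2[of r]) auto
    qed
    show "(SUP n. SUP r\<in>{0<..<radii n}. ennreal (cmod (radial_ext \<mu> (of_real r) z))) \<le> (SUP r\<in>{0<..<1}. ennreal (cmod (radial_ext \<mu> (of_real r) z)))"
      using radii_bounds(2) by (intro SUP_least SUP_subset_mono) (fastforce intro: less_trans)+
  qed
  then have "(\<integral>\<^sup>+z. radial_max \<mu> z \<partial>haar) = (SUP n. \<integral>\<^sup>+z. R (radii n) z \<partial>haar)"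
  proof (simp, intro nn_integral_monotone_convergence_SUP Rm)
    show "radii n \<le> 1" for n using radii_bounds(2)[of n] by simp
    show "incseq (\<lambda>n. R (radii n))"
    proof (rule incseq_SucI, rule le_funI)
      fix n z
      have "radii n \<le> radii (Suc n)" using radii_incseq by (simp add: incseq_SucD)
      then show "R (radii n) z \<le> R (radii (Suc n)) z" unfolding R_def by (intro SUP_subset_mono) auto
    qed
  qed
  also have "\<dots> \<le> ennreal 60 * total_variation haar \<mu>" by (intro SUP_least bound radii_bounds)
  finally show ?thesis .
qed

text \<open>
  The Cauchy criterion may be tested on rational radii, because \<open>\<mu>\<^sub>r\<close> depends continuously on \<open>r\<close>.
\<close>

lemma radial_convergence_set:
  assumes \<mu>: "complex_measure haar \<mu>" and spec: "spectrum_on \<mu> (N0 \<union> uminus ` N0)"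
  shows "{z \<in> space haar. \<exists>L. ((\<lambda>r. radial_ext \<mu> (of_real r) z) \<longlongrightarrow> L) (at_left 1)} \<in> sets haar"
proof -
  define Q where "Q = (\<lambda>m::nat. {1 - 1 / Suc m<..<1::real} \<inter> \<rat>)"
  have Q: "countable (Q m)" for m unfolding Q_def by (intro countable_Int2 countable_rat)
  have rat: "(\<forall>r\<in>{1 - 1 / Suc m<..<1}. \<forall>s\<in>{1 - 1 / Suc m<..<1}. dist (g r) (g s) \<le> c) \<longleftrightarrow>
      (\<forall>r\<in>Q m. \<forall>s\<in>Q m. dist (g r) (g s) \<le> c)"
    if "continuous_on {0<..<1} g" for g :: "real \<Rightarrow> complex" and c and m :: nat
  proof -
    have cont: "continuous_on {1 - 1 / Suc m<..<1} g"
    proof (rule continuous_on_subset[OF that])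
      have "1 / real (Suc m) \<le> 1" by simp
      then have "0 < r" if "1 - 1 / real (Suc m) < r" for r using that by linarith
      then show "{1 - 1 / Suc m<..<1::real} \<subseteq> {0<..<1}" by (auto simp del: of_nat_Suc)
    qed
    have 1: "(\<forall>r\<in>{1 - 1 / Suc m<..<1}. dist (g r) w \<le> c) \<longleftrightarrow> (\<forall>r\<in>Q m. dist (g r) w \<le> c)" for w
      using ex_gt_iff_ex_rat[of "1 - 1 / Suc m" 1 "\<lambda>r. dist (g r) w" c, OF continuous_on_dist[OF cont continuous_on_const]]
      unfolding Q_def by (meson not_less)
    have 2: "(\<forall>s\<in>{1 - 1 / Suc m<..<1}. dist w (g s) \<le> c) \<longleftrightarrow> (\<forall>s\<in>Q m. dist w (g s) \<le> c)" for w
      using 1[of w] by (simp only: dist_commute)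
    show ?thesis using 1 2 by blast
  qed
  have "{z \<in> space haar. \<exists>L. ((\<lambda>r. radial_ext \<mu> (of_real r) z) \<longlongrightarrow> L) (at_left 1)} =
      {z \<in> space haar. \<forall>n::nat. \<exists>m::nat. \<forall>r\<in>Q m. \<forall>s\<in>Q m.
         dist (radial_ext \<mu> (of_real r) z) (radial_ext \<mu> (of_real s) z) \<le> 1 / Suc n}"
    unfolding at_left_limit_iff_Cauchy
    using rat[OF continuous_on_radius[OF \<mu> spec _ order_refl]] by (auto simp: space_haar)
  also have "\<dots> \<in> sets haar"
  proof (intro sets.sets_Collect_countable_All sets.sets_Collect_countable_Ex sets.sets_Collect_countable_All' Q)
    fix n m :: nat and r s :: real assume "r \<in> Q m" "s \<in> Q m"
    then have "1 - 1 / real (Suc m) < r" "r < 1" "1 - 1 / real (Suc m) < s" "s < 1" by (auto simp: Q_def)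
    moreover have "1 / real (Suc m) \<le> 1" by simp
    ultimately have "0 \<le> r" "r < 1" "0 \<le> s" "s < 1" by linarith+
    then have [measurable]: "radial_ext \<mu> (of_real r) \<in> borel_measurable haar" "radial_ext \<mu> (of_real s) \<in> borel_measurable haar"
      by (auto intro!: measurable_radial_ext \<mu>)
    show "{z \<in> space haar. dist (radial_ext \<mu> (of_real r) z) (radial_ext \<mu> (of_real s) z) \<le> 1 / Suc n} \<in> sets haar"
      by measurable
  qed
  finally show ?thesis .
qed

lemma finite_liminf_subsequence:
  fixes a :: "nat \<Rightarrow> real"
  assumes "liminf (\<lambda>n. ennreal (a n)) \<noteq> \<infinity>"
  shows "\<exists>(s :: nat \<Rightarrow> nat) K. strict_mono s \<and> (\<forall>n. a (s n) \<le> K)"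
proof -
  obtain K where K: "0 \<le> K" "liminf (\<lambda>n. ennreal (a n)) = ennreal K"
    using assms by (cases "liminf (\<lambda>n. ennreal (a n))") auto
  then have "\<not> ennreal (K + 1) \<le> liminf (\<lambda>n. ennreal (a n))" by (simp add: ennreal_le_iff)
  then obtain y where y: "y < ennreal (K + 1)" "\<not> eventually (\<lambda>n. y < ennreal (a n)) sequentially"
    unfolding le_Liminf_iff by blast
  have "infinite {n. a n \<le> K + 1}"
    unfolding infinite_nat_iff_unbounded_le
  proof
    fix m
    obtain n where n: "m \<le> n" "\<not> y < ennreal (a n)" using y(2) unfolding eventually_sequentially by blast
    then have "ennreal (a n) < ennreal (K + 1)" using y(1) by (simp add: not_less)
    then have "a n \<le> K + 1" by (metis ennreal_leI leD linear)
    with n show "\<exists>n\<ge>m. n \<in> {n. a n \<le> K + 1}" by auto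
  qed
  from infinite_enumerate[OF this] obtain s :: "nat \<Rightarrow> nat" where s: "strict_mono s" "\<forall>n. s n \<in> {n. a n \<le> K + 1}"
    by blast
  then show ?thesis by (intro exI[of _ s] exI[of _ "K + 1"]) simp
qed

text \<open>
  By the contraction, the means of \<open>\<bar>\<mu>\<^sub>r\<bar>\<close> over orbits have bounded integrals over the torus, so
  by Fatou's lemma they stay bounded along a sequence of radii for almost every orbit. Fatou's
  theorem gives limits at almost every point of such an orbit. As the exceptional set is
  measurable, averaging over orbits shows that it is null.
\<close>

theorem radial_limits_AE:
  assumes \<mu>: "complex_measure haar \<mu>" and spec: "spectrum_on \<mu> (N0 \<union> uminus ` N0)"
  shows "AE z in haar. \<exists>L. ((\<lambda>r. radial_ext \<mu> (of_real r) z) \<longlongrightarrow> L) (at_left 1)"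
proof -
  let ?P = "\<lambda>z. \<exists>L. ((\<lambda>r. radial_ext \<mu> (of_real r) z) \<longlongrightarrow> L) (at_left 1)"
  let ?I = "\<lambda>n z. (\<integral>\<^sup>+t\<in>{0..2 * pi}. ennreal (cmod (radial_ext \<mu> (of_real (radii n)) (flow (cis t) z))) \<partial>lborel)"
  define N where "N = {z \<in> space haar. \<not> ?P z}"
  have Nm: "N \<in> sets haar"
  proof -
    have "N = space haar - {z \<in> space haar. ?P z}" by (auto simp: N_def)
    then show ?thesis using radial_convergence_set[OF \<mu> spec] by auto
  qed
  have Im: "?I n \<in> borel_measurable haar" for n
    using radii_bounds[of n] by (intro measurable_flow_integral measurable_radial_ext[OF \<mu>]) auto
  have "(\<integral>\<^sup>+z. liminf (\<lambda>n. ?I n z) \<partial>haar) \<le> liminf (\<lambda>n. \<integral>\<^sup>+z. ?I n z \<partial>haar)"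
    by (rule nn_integral_liminf) (rule Im)
  also have "\<dots> \<le> liminf (\<lambda>n::nat. ennreal (2 * pi) * total_variation haar \<mu>)"
    using radii_bounds by (intro Liminf_mono always_eventually allI average_norm_radial_ext \<mu>) (auto intro: less_imp_le)
  also have "\<dots> < \<infinity>"
    using total_variation_finite[OF \<mu>] by (simp add: Liminf_const ennreal_mult_less_top)
  finally have "AE z in haar. liminf (\<lambda>n. ?I n z) \<noteq> \<infinity>"
    by (intro nn_integral_noteq_infinite borel_measurable_liminf Im) auto
  then have "AE z in haar. (\<integral>\<^sup>+t\<in>{0..2 * pi}. indicator N (flow (cis t) z) \<partial>lborel) = 0"
  proof (rule AE_mp, intro AE_I2 impI)
    fix z assume "z \<in> space haar" and fin: "liminf (\<lambda>n. ?I n z) \<noteq> \<infinity>"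
    then have z: "z \<in> torus" by (simp add: space_haar)
    obtain F where F: "harmonic_disc F"
      "\<And>r t. 0 \<le> r \<Longrightarrow> r < 1 \<Longrightarrow> radial_ext \<mu> (of_real r) (flow (cis t) z) = F (of_real r * cis t)"
      by (rule slice_harmonic[OF \<mu> spec z], rule that, assumption+)
    have I: "?I n z = ennreal (integral {0..2 * pi} (\<lambda>t. cmod (F (of_real (radii n) * cis t))))" for n
      using radii_bounds[of n] by (intro slice_integral[OF F(1) _ _ F(2)]) auto
    obtain s :: "nat \<Rightarrow> nat" and K where s: "strict_mono s" "\<forall>n. integral {0..2 * pi} (\<lambda>t. cmod (F (of_real (radii (s n)) * cis t))) \<le> K"
      using finite_liminf_subsequence[OF fin[unfolded I]] by blast
    have "AE t in lborel. t \<in> {0..2 * pi} \<longrightarrow> (\<exists>L. ((\<lambda>r. F (of_real r * cis t)) \<longlongrightarrow> L) (at_left 1))"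
    proof (rule Fatou_harmonic[OF F(1)])
      show "(\<lambda>n. radii (s n)) \<longlonglongrightarrow> 1"
        using LIMSEQ_subseq_LIMSEQ[OF radii_tendsto s(1)] by (simp add: o_def)
    qed (use radii_bounds s(2) in auto)
    then have "AE t in lborel. indicator N (flow (cis t) z) * indicator {0..2 * pi} t = (0 :: ennreal)"
    proof eventually_elim
      case (elim t)
      have "flow (cis t) z \<notin> N" if t: "t \<in> {0..2 * pi}"
      proof -
        obtain L where L: "((\<lambda>r. F (of_real r * cis t)) \<longlongrightarrow> L) (at_left 1)" using elim t by blast
        have "eventually (\<lambda>r. F (of_real r * cis t) = radial_ext \<mu> (of_real r) (flow (cis t) z)) (at_left 1)"
          using eventually_at_left_1 by eventually_elim (simp add: F(2))
        with L have "((\<lambda>r. radial_ext \<mu> (of_real r) (flow (cis t) z)) \<longlongrightarrow> L) (at_left 1)"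
          by (rule Lim_transform_eventually)
        then show ?thesis by (auto simp: N_def)
      qed
      then show ?case by (auto simp: indicator_def)
    qed
    then have "(\<integral>\<^sup>+t\<in>{0..2 * pi}. indicator N (flow (cis t) z) \<partial>lborel) = (\<integral>\<^sup>+t. 0 \<partial>(lborel :: real measure))"
      by (rule nn_integral_cong_AE)
    then show "(\<integral>\<^sup>+t\<in>{0..2 * pi}. indicator N (flow (cis t) z) \<partial>lborel) = 0" by simp
  qed
  then have "(\<integral>\<^sup>+z. (\<integral>\<^sup>+t\<in>{0..2 * pi}. indicator N (flow (cis t) z) \<partial>lborel) \<partial>haar) = (\<integral>\<^sup>+z. 0 \<partial>haar)"
    by (rule nn_integral_cong_AE)
  then have "(\<integral>\<^sup>+z. (\<integral>\<^sup>+t\<in>{0..2 * pi}. indicator N (flow (cis t) z) \<partial>lborel) \<partial>haar) = 0" by simp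
  then have "ennreal (2 * pi) * emeasure haar N = 0"
    using nn_integral_flow_average[of "indicator N"] Nm by simp
  then have "emeasure haar N = 0" by simp
  then have "N \<in> null_sets haar" using Nm by (simp add: null_sets_def)
  then show ?thesis by (rule AE_I') (auto simp: N_def)
qed

text \<open>
  Mean convergence provides a sequence of radii along which the extensions converge to \<open>f\<close> almost
  everywhere, and this identifies the limit.
\<close>

theorem radial_limits_eq_AE:
  assumes f: "integrable haar f" and spec: "spectrum_on (to_measure f) (N0 \<union> uminus ` N0)"
  shows "AE z in haar. ((\<lambda>r. radial_ext (to_measure f) (of_real r) z) \<longlongrightarrow> f z) (at_left 1)"
proof -
  let ?\<mu> = "to_measure f"
  have \<mu>: "complex_measure haar ?\<mu>" by (rule complex_measure_to_measure[OF f])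
  have "(\<lambda>n. LINT z|haar. cmod (radial_ext ?\<mu> (of_real (radii n)) z - f z)) \<longlonglongrightarrow> 0"
    by (rule filterlim_compose[OF L1_convergence[OF f] radii_at_left])
  moreover have "integrable haar (\<lambda>z. radial_ext ?\<mu> (of_real (radii n)) z - f z)" for n
    using radii_bounds[of n] by (intro Bochner_Integration.integrable_diff integrable_radial_ext \<mu> f) auto
  ultimately obtain s where s: "strict_mono s"
    "AE z in haar. (\<lambda>n. radial_ext ?\<mu> (of_real (radii (s n))) z - f z) \<longlonglongrightarrow> 0"
    using tendsto_L1_AE_subseq[of haar "\<lambda>n z. radial_ext ?\<mu> (of_real (radii n)) z - f z"] by blast
  have left: "filterlim (\<lambda>n. radii (s n)) (at_left 1) sequentially"
    by (rule filterlim_compose[OF radii_at_left filterlim_subseq[OF s(1)]])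
  from radial_limits_AE[OF \<mu> spec] s(2) show ?thesis
  proof eventually_elim
    case (elim z)
    then obtain L where L: "((\<lambda>r. radial_ext ?\<mu> (of_real r) z) \<longlongrightarrow> L) (at_left 1)" by blast
    have "(\<lambda>n. radial_ext ?\<mu> (of_real (radii (s n))) z) \<longlonglongrightarrow> L" by (rule filterlim_compose[OF L left])
    moreover have "(\<lambda>n. radial_ext ?\<mu> (of_real (radii (s n))) z) \<longlonglongrightarrow> f z"
      using elim(2) by (simp add: LIM_zero_iff)
    ultimately have "L = f z" by (rule LIMSEQ_unique)
    with L show ?case by simp
  qed
qed

theorem L1_norm_convergence:
  assumes f: "integrable haar f"
  shows "((\<lambda>r. norm_L1 (\<lambda>z. radial_ext (to_measure f) (of_real r) z - f z)) \<longlongrightarrow> 0) (at_left 1)"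
proof -
  have "((\<lambda>r. ennreal (LINT z|haar. cmod (radial_ext (to_measure f) (of_real r) z - f z))) \<longlongrightarrow> ennreal 0) (at_left 1)"
    by (intro tendsto_ennrealI L1_convergence f)
  moreover have "eventually (\<lambda>r. ennreal (LINT z|haar. cmod (radial_ext (to_measure f) (of_real r) z - f z)) =
      norm_L1 (\<lambda>z. radial_ext (to_measure f) (of_real r) z - f z)) (at_left 1)"
    using eventually_at_left_1
  proof eventually_elim
    case (elim r)
    then show ?case
      unfolding norm_L1_def
      by (intro nn_integral_eq_integral[symmetric] integrable_norm Bochner_Integration.integrable_diff f
          integrable_radial_ext complex_measure_to_measure[OF f]) auto
  qed
  ultimately show ?thesis by (simp add: Lim_transform_eventually)
qed

theorem theorem1:
  shows
    "(\<forall>\<mu>. complex_measure haar \<mu> \<longrightarrow>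
        (\<forall>\<xi>::complex. cmod \<xi> < 1 \<longrightarrow> norm_L1 (radial_ext \<mu> \<xi>) \<le> total_variation haar \<mu>) \<and>
        (\<forall>g :: (nat \<Rightarrow> complex) \<Rightarrow> complex. continuous_on torus g \<longrightarrow>
           ((\<lambda>r::real. LINT z|haar. g z * radial_ext \<mu> (of_real r) z)
              \<longlongrightarrow> complex_integral haar \<mu> g) (at_left 1)))
     \<and>
     ((\<exists>C::real. \<forall>\<mu>. complex_measure haar \<mu> \<longrightarrow> spectrum_on \<mu> (N0 \<union> uminus ` N0) \<longrightarrow>
         (\<forall>l::real. 0 < l \<longrightarrow>
            emeasure haar {z \<in> torus. radial_max \<mu> z > ennreal l}
              \<le> ennreal C * total_variation haar \<mu> / ennreal l)) \<and>
      (\<forall>\<mu>. complex_measure haar \<mu> \<longrightarrow> spectrum_on \<mu> (N0 \<union> uminus ` N0) \<longrightarrow>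
         (AE z in haar. \<exists>L::complex.
            ((\<lambda>r::real. radial_ext \<mu> (of_real r) z) \<longlongrightarrow> L) (at_left 1))))
     \<and>
     (\<forall>f. integrable haar f \<longrightarrow> spectrum_on (to_measure f) (N0 \<union> uminus ` N0) \<longrightarrow>
        (AE z in haar.
           ((\<lambda>r::real. radial_ext (to_measure f) (of_real r) z) \<longlongrightarrow> f z) (at_left 1)) \<and>
        ((\<lambda>r::real. norm_L1 (\<lambda>z. radial_ext (to_measure f) (of_real r) z - f z))
            \<longlongrightarrow> 0) (at_left 1))
     \<and>
     ((\<exists>C::real. \<forall>f\<in>H1.
         (\<integral>\<^sup>+ z. radial_max (to_measure f) z \<partial>haar) \<le> ennreal C * norm_L1 f) \<and>
      (\<exists>C::real. \<forall>\<mu>. analytic_measure \<mu> \<longrightarrow>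
         (\<integral>\<^sup>+ z. radial_max \<mu> z \<partial>haar) \<le> ennreal C * total_variation haar \<mu>))"
proof (intro conjI)
  show "\<forall>\<mu>. complex_measure haar \<mu> \<longrightarrow>
        (\<forall>\<xi>::complex. cmod \<xi> < 1 \<longrightarrow> norm_L1 (radial_ext \<mu> \<xi>) \<le> total_variation haar \<mu>) \<and>
        (\<forall>g :: (nat \<Rightarrow> complex) \<Rightarrow> complex. continuous_on torus g \<longrightarrow>
           ((\<lambda>r::real. LINT z|haar. g z * radial_ext \<mu> (of_real r) z)
              \<longlongrightarrow> complex_integral haar \<mu> g) (at_left 1))"
    by (intro allI impI conjI norm_L1_radial_ext_le weak_star_convergence)
  show "\<exists>C::real. \<forall>\<mu>. complex_measure haar \<mu> \<longrightarrow> spectrum_on \<mu> (N0 \<union> uminus ` N0) \<longrightarrow>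
         (\<forall>l::real. 0 < l \<longrightarrow>
            emeasure haar {z \<in> torus. radial_max \<mu> z > ennreal l}
              \<le> ennreal C * total_variation haar \<mu> / ennreal l)"
    by (intro exI[of _ 15] allI impI radial_max_weak_type)
  show "\<forall>\<mu>. complex_measure haar \<mu> \<longrightarrow> spectrum_on \<mu> (N0 \<union> uminus ` N0) \<longrightarrow>
         (AE z in haar. \<exists>L::complex.
            ((\<lambda>r::real. radial_ext \<mu> (of_real r) z) \<longlongrightarrow> L) (at_left 1))"
    by (intro allI impI radial_limits_AE)
  show "\<forall>f. integrable haar f \<longrightarrow> spectrum_on (to_measure f) (N0 \<union> uminus ` N0) \<longrightarrow>
        (AE z in haar.
           ((\<lambda>r::real. radial_ext (to_measure f) (of_real r) z) \<longlongrightarrow> f z) (at_left 1)) \<and>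
        ((\<lambda>r::real. norm_L1 (\<lambda>z. radial_ext (to_measure f) (of_real r) z - f z))
            \<longlongrightarrow> 0) (at_left 1)"
    by (intro allI impI conjI radial_limits_eq_AE L1_norm_convergence)
  show "\<exists>C::real. \<forall>\<mu>. analytic_measure \<mu> \<longrightarrow>
         (\<integral>\<^sup>+ z. radial_max \<mu> z \<partial>haar) \<le> ennreal C * total_variation haar \<mu>"
    by (intro exI[of _ 60] allI impI radial_max_L1) (simp_all add: analytic_measure_def)
  show "\<exists>C::real. \<forall>f\<in>H1.
         (\<integral>\<^sup>+ z. radial_max (to_measure f) z \<partial>haar) \<le> ennreal C * norm_L1 f"
  proof (intro exI[of _ 60] ballI)
    fix f assume "f \<in> H1"
    then have f: "integrable haar f" "spectrum_on (to_measure f) N0" by (auto simp: H1_def)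
    have "(\<integral>\<^sup>+ z. radial_max (to_measure f) z \<partial>haar) \<le> ennreal 60 * total_variation haar (to_measure f)"
      by (rule radial_max_L1[OF complex_measure_to_measure[OF f(1)] f(2)])
    also have "\<dots> \<le> ennreal 60 * norm_L1 f"
      by (rule mult_left_mono[OF total_variation_to_measure[OF f(1)]]) simp
    finally show "(\<integral>\<^sup>+ z. radial_max (to_measure f) z \<partial>haar) \<le> ennreal 60 * norm_L1 f" .
  qed
qed

end
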